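(* Let $d\ge 3$, $u>0$, and $\mu\in(0,1)$. There exist constants $\gamma=\gamma(d,u,\mu)>0$ and $C=C(d,u,\mu)<\infty$ such that for all $N\in\mathbb{N}$ (with $N\ge 1$), $$\mathbb{P}\left[\text{for any } A\subset\mathcal{I}^u_N \text{ with } |A|\le\mu|\mathcal{I}^u_N|,\ \ |\partial_{\mathcal{I}^u_N}A|\ge\gamma\cdot|A|^{1-\frac1d+\frac1{d^2}}\cdot N^{-\frac1d}\right]\ge 1-Ce^{-(\log N)^2}.$$
   Context: Let $\mathbb{T}^d_N=(\mathbb{Z}/N\mathbb{Z})^d$ be the $d$-dimensional discrete torus (vertices at $\ell^1$-distance $1$ on the torus are nearest neighbors), and let $(X_n)_{n\ge 0}$ be the simple random walk on $\mathbb{T}^d_N$ (the projection of the simple random walk on $\mathbb{Z}^d$), started from the uniform distribution on $\mathbb{T}^d_N$; $\mathbb{P}$ denotes its law. The range is the random set $$\mathcal{I}^u_N=\{X_0,\ldots,X_{\lfloor uN^d\rfloor}\},$$ viewed as a subgraph of $\mathbb{T}^d_N$ with edges between any two of its vertices at $\ell^1$-distance $1$ from each other. For $A\subseteq\mathcal{I}^u_N$, the edge boundary of $A$ in $\mathcal{I}^u_N$ is $$\partial_{\mathcal{I}^u_N}A=\left\{\{x,y\}:\ x\in A,\ y\in\mathcal{I}^u_N\setminus A,\ |x-y|_1=1\right\}.$$ $|\cdot|$ applied to a set denotes its cardinality. *)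

theory Defs
  imports "HOL-Probability.Probability"
begin

text \<open>
  Points of the integer lattice are functions \<open>nat \<Rightarrow> int\<close> of which only the coordinates
  \<open>i < d\<close> matter.  The discrete torus of side length \<open>N\<close> is represented by the canonical
  representatives in \<open>{0..<N}\<close> of the residue classes, as extensional functions, so that
  equality of vertices is equality of functions.
\<close>

definition torus :: "nat \<Rightarrow> nat \<Rightarrow> (nat \<Rightarrow> int) set" where
  "torus d N = ({..<d} \<rightarrow>\<^sub>E {0..<int N})"

definition torus_proj :: "nat \<Rightarrow> nat \<Rightarrow> (nat \<Rightarrow> int) \<Rightarrow> nat \<Rightarrow> int" where
  "torus_proj d N z = (\<lambda>i\<in>{..<d}. z i mod int N)"

text \<open>
  The \<open>\<ell>\<^sup>1\<close>-distance on the torus: in each coordinate the two residues below are the lengths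
  of the two arcs joining \<open>x i\<close> and \<open>y i\<close> on the cycle of length \<open>N\<close>.
\<close>

definition torus_dist :: "nat \<Rightarrow> nat \<Rightarrow> (nat \<Rightarrow> int) \<Rightarrow> (nat \<Rightarrow> int) \<Rightarrow> int" where
  "torus_dist d N x y = (\<Sum>i<d. min ((x i - y i) mod int N) ((y i - x i) mod int N))"

definition unit_steps :: "nat \<Rightarrow> (nat \<Rightarrow> int) set" where
  "unit_steps d = {(\<lambda>i. if i = j then s else 0) | j s. j < d \<and> s \<in> {1, - 1}}"

text \<open>
  An outcome \<open>(x, \<xi>)\<close> consists of a uniformly distributed starting vertex \<open>x\<close> and,
  independently of it, a sequence \<open>\<xi>\<close> of independent uniformly distributed steps.
\<close>

definition srw_space :: "nat \<Rightarrow> nat \<Rightarrow> ((nat \<Rightarrow> int) \<times> (nat \<Rightarrow> nat \<Rightarrow> int)) measure" where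
  "srw_space d N =
     measure_pmf (pmf_of_set (torus d N)) \<Otimes>\<^sub>M
     (\<Pi>\<^sub>M n\<in>UNIV. measure_pmf (pmf_of_set (unit_steps d)))"

definition srw ::
  "nat \<Rightarrow> nat \<Rightarrow> (nat \<Rightarrow> int) \<times> (nat \<Rightarrow> nat \<Rightarrow> int) \<Rightarrow> nat \<Rightarrow> nat \<Rightarrow> int" where
  "srw d N \<omega> n = torus_proj d N (\<lambda>i. fst \<omega> i + (\<Sum>k<n. snd \<omega> k i))"

definition srw_range ::
  "nat \<Rightarrow> nat \<Rightarrow> real \<Rightarrow> (nat \<Rightarrow> int) \<times> (nat \<Rightarrow> nat \<Rightarrow> int) \<Rightarrow> (nat \<Rightarrow> int) set" where
  "srw_range d N u \<omega> = srw d N \<omega> ` {..nat \<lfloor>u * real N ^ d\<rfloor>}"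

definition edge_boundary ::
  "nat \<Rightarrow> nat \<Rightarrow> (nat \<Rightarrow> int) set \<Rightarrow> (nat \<Rightarrow> int) set \<Rightarrow> (nat \<Rightarrow> int) set set" where
  "edge_boundary d N I A = {{x, y} | x y. x \<in> A \<and> y \<in> I - A \<and> torus_dist d N x y = 1}"

end

theory Submission
 imports Defs "HOL-Real_Asymp.Real_Asymp"
begin

text \<open>
 Cut the torus into cells whose side is a fixed power of a scale \<open>\<sigma>\<close>. Fourier estimates of the heat
 kernel show that the walk, seen in \<open>k\<close> well separated cells at once, fails to be dense and locally
 connected in all of them with probability at most \<open>exp (- 2 \<sigma>)^k\<close>: inside a cell the clusters of
 two visited points are grown in stages by fresh pieces of the walk until they meet.

 The cells are grouped into boxes of a hierarchy of \<open>J\<close> levels with rapidly growing ratios, and a box is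
 bad if it contains two separated bad boxes of the level below. A bad box of the top level thus
 forces \<open>2^J\<close> separated bad cells, so that with probability at least
 \<open>1 - exp (- (ln N)^2)\<close> no top box is bad.

 On this event, for \<open>A\<close> inside the range, the function that tells whether the visited points of a good cell lie
 in \<open>A\<close> has variation bounded by the boundary of \<open>A\<close>. Averaging it over the good parts of
 boxes, level after level, loses only a bounded factor, and the Poincare inequality on the top
 level bounds \<open>|A|\<close> by the boundary. Choosing \<open>\<sigma>\<close> as a small power of \<open>N^d / |A|\<close>
 turns the loss, polynomial in \<open>\<sigma>\<close>, into the factor \<open>|A|^(1/d^2) N^(-1/d)\<close>.
\<close>

section \<open>Heat kernel bounds on the torus\<close>

text \<open>No coupling with independent objects is used. Separated regions have Green function sums
  at most 1, so the expected time in a union of targets adds up over the regions while returns stay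
  bounded; the chance of progress per mixing time is then proportional to the number of regions, and
  bounds exponential in that number follow. The time is cut into thirds: the last third links what
  the first two have visited, the reversed walk links what the last two have visited, and a visit in
  the middle third belongs to both. For sets A of positive density \<sigma> stays bounded and bad
  cells do exist, so only the hierarchy reaches the required probability. In a good box the bad
  parts fit into a cube of side \<open>h\<close>; deleting \<open>h\<close> values of every
  coordinate leaves a product set, and a line with one transversal coordinate in it meets good parts
  only. Hence averages over product sets, at the cost of a factor 1 + O(d h / l) per level. The
  scale depends on |A|, so the good event is intersected over all admissible scales before A is
  chosen. Small sets are compared with windows of side about |A|^(1/d), sets with |A| of order N^d
  with the whole torus.\<close>

lemma sum_inverse_one_plus_square_le:
 fixes b :: real
 assumes "b > 0"
 shows "(\<Sum>m=1..M. 1/(1 + (b*real m)^2)) <= 2/b"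
proof -
 have step: "1/(1 + (b*real (Suc m))^2) <= arctan (b*real (Suc m))/b - arctan (b*real m)/b" for m
 proof -
  have der: "((%x. arctan (b*x)/b) has_real_derivative 1/(1 + (b*x)^2)) (at x)" for x
  proof -
   have "((%x. arctan (b*x)) has_real_derivative inverse (1 + (b*x)^2)*b) (at x)" by (auto intro!: derivative_eq_intros)
   from DERIV_cdivide[OF this, of b] show ?thesis using assms by (simp add: inverse_eq_divide)
  qed
  have "\<exists>z. real m < z & z < real (Suc m) \<and>
    arctan (b*real (Suc m))/b - arctan (b*real m)/b = (real (Suc m) - real m)*(1/(1 + (b*z)^2))"
   by (rule MVT2) (use der in auto)
  then obtain z where z: "real m < z" "z < real (Suc m)" and eq: "arctan (b*real (Suc m))/b - arctan (b*real m)/b = 1/(1 + (b*z)^2)" by auto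
  have "(b*z)^2 <= (b*real (Suc m))^2" using z assms by (intro power_mono mult_left_mono) auto
  then show ?thesis unfolding eq by (intro divide_left_mono mult_pos_pos) (auto intro: add_pos_nonneg)
 qed
 have "(\<Sum>m=1..M. 1/(1 + (b*real m)^2)) <= arctan (b*real M)/b"
 proof (induction M)
  case (Suc M)
  then show ?case using step[of M] by simp
 qed simp
 also have "... <= 2/b" using assms arctan_ubound[of "b*real M"] pi_less_4 by (intro divide_right_mono) auto
 finally show ?thesis .
qed

text \<open>Split at pi/3: below it the mean value theorem gives sin x = x cos z with cos z at least
  1/2; above it monotonicity leaves the numerical fact sqrt 3 / 2 >= pi/4.\<close>

lemma sin_ge_half:
 fixes x :: real
 assumes "0 <= x" "x <= pi/2"
 shows "x/2 <= sin x"
proof (cases "x <= pi/3")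
 case True
 show ?thesis
 proof (cases "x = 0")
  case False
  then have "x > 0" using assms by auto
  have "\<exists>z. 0 < z & z < x & sin x - sin 0 = (x - 0)*cos z" by (rule MVT2) (use \<open>x > 0\<close> in auto)
  then obtain z where z: "0 < z" "z < x" "sin x = x*cos z" by auto
  have "cos (pi/3) <= cos z" using z True by (intro cos_monotone_0_pi_le) auto
  then have "1/2 <= cos z" by (simp add: cos_60)
  then show ?thesis using z \<open>x > 0\<close> mult_left_mono[of "1/2" "cos z" x] by simp
 qed simp
next
 case False
 have "sin (pi/3) <= sin x" using False assms by (intro sin_monotone_2pi_le) auto
 moreover have "sin (pi/3) = sqrt 3/2" by (simp add: sin_60)
 moreover have "sqrt 3 >= 17/10" by (rule real_le_rsqrt) (simp add: power2_eq_square)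
 moreover have "pi < 32/10" using pi_approx by simp
 ultimately show ?thesis using assms by simp
qed

lemma exp_neg_le_inverse: "exp (- x) <= 1/(1 + x)" if "0 <= x" for x :: real using that exp_ge_add_one_self[of x] by (simp add: exp_minus field_simps)

text \<open>Up to the symmetry m -> N - m the angle is at most pi/2, where the sine is at least
  linear; the Gaussian is then dominated by 1/(1 + c m^2), whose sum is bounded through
  arctan.\<close>

lemma sum_exp_sin_le:
 fixes a :: real
 assumes "a > 0" "N >= 1"
 shows "(\<Sum>m<N. exp (- a*(sin (pi*real m/real N))^2)) <= 1 + 4*real N/sqrt a"
proof -
 define F where "F m = exp (- a*(sin (pi*real m/real N))^2)" for m
 define g where "g m = 1/(1 + (sqrt a/real N*real m)^2)" for m :: nat
 have Npos: "real N > 0" using assms by simp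
 have Fg: "F m <= g m" if "2*m <= N" for m
 proof -
  have "real m/real N <= (pi*real m/real N)/2" using pi_gt3 Npos mult_right_mono[of 2 pi "real m"] by (simp add: field_simps)
  also have "... <= sin (pi*real m/real N)" using that Npos by (intro sin_ge_half) (auto simp: field_simps)
  finally have "(real m/real N)^2 <= (sin (pi*real m/real N))^2" by (intro power_mono) auto
  then have "F m <= exp (- (a*(real m/real N)^2))" unfolding F_def using assms by simp
  also have "... <= 1/(1 + a*(real m/real N)^2)" using assms by (intro exp_neg_le_inverse) auto
  also have "... = g m" unfolding g_def using assms by (simp add: power_mult_distrib power_divide)
  finally show ?thesis .
 qed
 have Fsym: "F m = F (N - m)" if "m <= N" for m
 proof -
  have "pi*real (N - m)/real N = pi - pi*real m/real N" using that Npos by (simp add: of_nat_diff field_simps)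
  then show ?thesis unfolding F_def by simp
 qed
 have g0: "g m >= 0" for m unfolding g_def by simp
 have Fb: "F m <= g m + g (N - m)" if "m < N" for m
 proof (cases "2*m <= N")
  case True
  then show ?thesis using Fg g0[of "N - m"] by (simp add: add_increasing2)
 next
  case False
  then have "F (N - m) <= g (N - m)" using that by (intro Fg) auto
  then show ?thesis using Fsym[of m] that g0[of m] by simp
 qed
 have "(\<Sum>m=1..<N. g m) <= (\<Sum>m=1..N. g m)" by (intro sum_mono2) (auto simp: g0)
 also have "... <= 2/(sqrt a/real N)" unfolding g_def using assms Npos by (intro sum_inverse_one_plus_square_le) simp
 finally have S: "(\<Sum>m=1..<N. g m) <= 2/(sqrt a/real N)" .
 have "(\<Sum>m<N. F m) = F 0 + (\<Sum>m=1..<N. F m)" using assms by (simp add: lessThan_atLeast0 sum.atLeast_Suc_lessThan)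
 also have "(\<Sum>m=1..<N. F m) <= (\<Sum>m=1..<N. g m + g (N - m))" by (intro sum_mono Fb) auto
 also have "... = (\<Sum>m=1..<N. g m) + (\<Sum>m=1..<N. g (N - m))" by (simp add: sum.distrib)
 also have "(\<Sum>m=1..<N. g (N - m)) = (\<Sum>m=1..<N. g m)" by (rule sum.reindex_bij_witness[of _ "%m. N - m" "%m. N - m"]) auto
 also have "F 0 = 1" by (simp add: F_def)
 also have "1 + ((\<Sum>m=1..<N. g m) + (\<Sum>m=1..<N. g m)) <= 1 + 4*real N/sqrt a" using S by simp
 finally show ?thesis by (simp add: F_def)
qed

text \<open>Doubling modulo \<open>N\<close> is at most two-to-one: the fibre over \<open>m\<close>
  lies in {m/2, (m + N)/2}.\<close>

lemma sum_double_mod_le: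
 fixes F :: "nat => real"
 assumes "N >= 1" "!!m. F m >= 0"
 shows "(\<Sum>k<N. F ((2*k) mod N)) <= 2*(\<Sum>m<N. F m)"
proof -
 have "(\<Sum>k<N. F ((2*k) mod N)) = (\<Sum>m<N. (\<Sum>k | k < N & (2*k) mod N = m. F ((2*k) mod N)))"
  using assms by (subst sum.group[symmetric, of "{..<N}" "{..<N}" "%k. (2*k) mod N"]) auto
 also have "... <= (\<Sum>m<N. 2*F m)"
 proof (rule sum_mono)
  fix m assume "m \<in> {..<N}"
  have "{k. k < N & (2*k) mod N = m} \<subseteq> {m div 2, (m + N) div 2}"
  proof
   fix k assume k: "k \<in> {k. k < N & (2*k) mod N = m}"
   then have "(2*k) div N <= 1" using less_mult_imp_div_less[of "2*k" 2 N] by auto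
   moreover have "2*k = (2*k) div N*N + m" using k div_mult_mod_eq[of "2*k" N] by auto
   ultimately have "2*k = m | 2*k = m + N" by (metis One_nat_def add.commute add_0 le_Suc_eq le_zero_eq mult_1 mult_0)
   then show "k \<in> {m div 2, (m + N) div 2}" by auto
  qed
  then have "card {k. k < N & (2*k) mod N = m} <= card {m div 2, (m + N) div 2}" by (intro card_mono) auto
  also have "... <= 2" by (simp add: card_insert_if)
  finally have c: "card {k. k < N & (2*k) mod N = m} <= 2" .
  have "(\<Sum>k | k < N & (2*k) mod N = m. F ((2*k) mod N)) = (\<Sum>k | k < N & (2*k) mod N = m. F m)" by (intro sum.cong) auto
  also have "... <= 2*F m" using c assms(2)[of m] by (simp add: mult_right_mono)
  finally show "(\<Sum>k | k < N & (2*k) mod N = m. F ((2*k) mod N)) <= 2*F m" .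
 qed
 finally show ?thesis by (simp add: sum_distrib_left)
qed

text \<open>For even \<open>N\<close> the walk is periodic and its symbol has modulus one also at
  the frequency with all coordinates N/2. The sine of the double angle vanishes at both exceptional
  frequencies, so one Gaussian sum covers them.\<close>

lemma sum_exp_sin_double_le:
 fixes a :: real
 assumes "a > 0" "N >= 1"
 shows "(\<Sum>m<N. exp (- a*(sin (2*pi*real m/real N))^2)) <= 2 + 8*real N/sqrt a"
proof -
 define F where "F m = exp (- a*(sin (pi*real m/real N))^2)" for m
 have eq: "exp (- a*(sin (2*pi*real m/real N))^2) = F ((2*m) mod N)" for m
 proof -
  have "2*real m = real N*real ((2*m) div N) + real ((2*m) mod N)" by (metis mult_div_mod_eq of_nat_add of_nat_mult of_nat_numeral)
  then have "2*pi*real m/real N = pi*real ((2*m) mod N)/real N + pi*real ((2*m) div N)" using assms by (simp add: field_simps)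
  then have "(sin (2*pi*real m/real N))^2 = (sin (pi*real ((2*m) mod N)/real N))^2"
   by (simp add: sin_add power_mult_distrib flip: power_mult)
  then show ?thesis by (simp add: F_def)
 qed
 have "(\<Sum>m<N. exp (- a*(sin (2*pi*real m/real N))^2)) <= 2*(\<Sum>m<N. F m)"
  unfolding eq using assms by (intro sum_double_mod_le) (auto simp: F_def)
 also have "... <= 2*(1 + 4*real N/sqrt a)" unfolding F_def using sum_exp_sin_le[OF assms] by simp
 finally show ?thesis by simp
qed

section \<open>Fourier analysis of the walk and of the lazy walk\<close>

type_synonym pt = "nat => int"

lemma sum_int_range: "(\<Sum>k\<in>{0..<int n}. f k) = (\<Sum>k<n. f (int k))" by (rule sum.reindex_bij_witness[of _ int nat]) auto

lemma sin_abs_mult_le: "\<bar>sin (real m*x)\<bar> <= real m*\<bar>sin x\<bar>"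
proof (induction m)
 case (Suc m)
 have "\<bar>sin (real (Suc m)*x)\<bar> = \<bar>sin (real m*x)*cos x + cos (real m*x) * sin x\<bar>" by (simp add: algebra_simps sin_add)
 also have "... <= \<bar>sin (real m*x)\<bar>*\<bar>cos x\<bar> + \<bar>cos (real m*x)\<bar>*\<bar>sin x\<bar>" by (metis abs_mult abs_triangle_ineq)
 also have "... <= \<bar>sin (real m*x)\<bar>*1 + 1*\<bar>sin x\<bar>" by (intro add_mono mult_left_mono mult_right_mono) auto
 finally show ?case using Suc by (simp add: algebra_simps)
qed simp

lemma sin_abs_int_mult_le: "\<bar>sin (of_int m*x)\<bar> <= \<bar>of_int m\<bar>*\<bar>sin x\<bar>" for x :: real
proof (cases "m >= 0")
 case True
 then show ?thesis using sin_abs_mult_le[of "nat m" x] by simp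
next
 case False
 then show ?thesis using sin_abs_mult_le[of "nat (-m)" x] by simp
qed

lemma sin_abs_sum_le: "finite I ==> \<bar>sin (\<Sum>i\<in>I. b i)\<bar> <= (\<Sum>i\<in>I. \<bar>sin (b i)\<bar>)" for b :: "_ => real"
proof (induction I rule: finite_induct)
 case (insert i I)
 have "\<bar>sin (sum b (insert i I))\<bar> = \<bar>sin (b i)*cos (sum b I) + cos (b i) * sin (sum b I)\<bar>" using insert by (simp add: sin_add)
 also have "... <= \<bar>sin (b i)\<bar>*\<bar>cos (sum b I)\<bar> + \<bar>cos (b i)\<bar>*\<bar>sin (sum b I)\<bar>"
  by (metis abs_mult abs_triangle_ineq)
 also have "... <= \<bar>sin (b i)\<bar>*1 + 1*\<bar>sin (sum b I)\<bar>" by (intro add_mono mult_left_mono mult_right_mono) auto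
 finally show ?case using insert by simp
qed simp

lemma sin_sum_squared_le:
 fixes b :: "nat => real"
 shows "(sin (\<Sum>i<d. b i))^2 <= real d*(\<Sum>i<d. (sin (b i))^2)"
proof -
 have "(sin (\<Sum>i<d. b i))^2 = \<bar>sin (\<Sum>i<d. b i)\<bar>\<^sup>2" by simp
 also have "... <= (\<Sum>i<d. \<bar>sin (b i)\<bar>)^2" by (intro power_mono sin_abs_sum_le) auto
 also have "... <= (\<Sum>i<d. \<bar>sin (b i)\<bar>\<^sup>2)*(\<Sum>i<d. 1^2)"
  using Cauchy_Schwarz_ineq_sum[of "%i. \<bar>sin (b i)\<bar>" "%_. 1" "{..<d}"] by simp
 finally show ?thesis by (simp add: mult.commute)
qed

definition ustep :: "nat => int => pt" where "ustep j s = (%i. if i = j then s else 0)"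

lemma ustep_same [simp]: "ustep j s j = s" by (simp add: ustep_def)

lemma ustep_other [simp]: "i ~= j ==> ustep j s i = 0" by (simp add: ustep_def)

lemma unit_steps_eq: "unit_steps d = (%(j, s). ustep j s) ` ({..<d} \<times> {1, -1})" unfolding unit_steps_def ustep_def by auto

lemma inj_on_ustep: "inj_on (%(j, s). ustep j s) ({..<d} \<times> {1, -1})"
proof (rule inj_onI, clarify)
 fix i s j t assume s: "s \<in> {1, - 1 :: int}" and t: "t \<in> {1, - 1 :: int}" and eq: "ustep i s = ustep j t"
 have "i = j"
 proof (rule ccontr)
  assume "i ~= j"
  then have "ustep j t i = 0" by simp
  then show False using s unfolding eq[symmetric] by auto
 qed
 then show "i = j & s = t" using fun_cong[OF eq, of j] by simp
qed

lemma sum_unit_steps: "(\<Sum>e\<in>unit_steps d. f e) = (\<Sum>j<d. f (ustep j 1) + f (ustep j (-1)))" unfolding unit_steps_eq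
proof (subst sum.reindex[OF inj_on_ustep])
 have "sum (f \<circ> (%(j, s). ustep j s)) ({..<d} \<times> {1, - 1}) = (\<Sum>j<d. \<Sum>s\<in>{1,-1}. f (ustep j s))"
  by (subst sum.cartesian_product) (simp add: case_prod_unfold)
 then show "sum (f \<circ> (%(j, s). ustep j s)) ({..<d} \<times> {1, - 1}) = (\<Sum>j<d. f (ustep j 1) + f (ustep j (- 1)))" by simp
qed

lemma card_unit_steps [simp]: "card (unit_steps d) = 2*d"
 unfolding unit_steps_eq by (subst card_image[OF inj_on_ustep]) (simp add: card_cartesian_product)

lemma finite_unit_steps [simp]: "finite (unit_steps d)" unfolding unit_steps_eq by simp

lemma uminus_unit_steps: "(%e i. - e i) ` unit_steps d = unit_steps d"
proof -
 have *: "(%i. - ustep j s i) = ustep j (- s)" for j s by (auto simp: ustep_def)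
 show ?thesis
 proof (intro equalityI subsetI)
  fix e assume "e \<in> (%e i. - e i) ` unit_steps d"
  then obtain j s where "j < d" "s \<in> {1,-1}" "e = (%i. - ustep j s i)" unfolding unit_steps_eq by auto
  then show "e \<in> unit_steps d" unfolding unit_steps_eq * by force
 next
  fix e assume "e \<in> unit_steps d"
  then obtain j s where js: "j < d" "s \<in> {1,-1}" "e = ustep j s" unfolding unit_steps_eq by auto
  then have "e = (%i. - ustep j (- s) i)" by (simp add: *)
  moreover have "ustep j (- s) \<in> unit_steps d" using js unfolding unit_steps_eq by force
  ultimately show "e \<in> (%e i. - e i) ` unit_steps d" by blast
 qed
qed

lemma finite_torus [simp]: "finite (torus d n)" unfolding torus_def by (intro finite_PiE) auto

lemma card_torus: "card (torus d n) = n^d" unfolding torus_def by (subst card_PiE) auto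

lemma torusD: "x \<in> torus d n ==> k < d ==> 0 <= x k & x k < int n" unfolding torus_def by (auto simp: PiE_iff)

locale torus_walk =
 fixes d N :: nat
 assumes d3: "3 <= d" and N3: "3 <= N"
begin

abbreviation "T \<equiv> torus d N"

definition st :: "pt => pt => pt" where "st x e = torus_proj d N (%i. x i + e i)"

definition avg :: "(pt => real) => pt => real" where "avg f x = (\<Sum>e\<in>unit_steps d. f (st x e))/(2*real d)"

lemma Npos: "0 < N" and dpos: "0 < d" using N3 d3 by auto

lemma torus_proj_in [simp]: "torus_proj d N z \<in> T" unfolding torus_def torus_proj_def using Npos by auto

lemma st_in [simp]: "st x e \<in> T" by (simp add: st_def)

lemma torus_proj_nth: "i < d ==> torus_proj d N z i = z i mod int N" by (simp add: torus_proj_def)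

lemma st_nth: "i < d ==> st x e i = (x i + e i) mod int N" by (simp add: st_def torus_proj_nth)

lemma torus_eqI: assumes "x \<in> T" "y \<in> T" "!!i. i < d ==> x i mod int N = y i mod int N" shows "x = y"
proof -
 have "x i = y i" if "i < d" for i using assms(3)[OF that] torusD[OF assms(1) that] torusD[OF assms(2) that] by simp
 moreover have "x i = undefined" "y i = undefined" if "~ i < d" for i
  using assms(1,2) that unfolding torus_def by (auto simp: PiE_iff extensional_def)
 ultimately show ?thesis by (metis ext)
qed

lemma avg_mono: "(!!e. e \<in> unit_steps d ==> f (st x e) <= g (st x e)) ==> avg f x <= avg g x"
 unfolding avg_def by (intro divide_right_mono sum_mono) auto

lemma avg_add: "avg (%y. f y + g y) x = avg f x + avg g x" unfolding avg_def by (simp add: sum.distrib add_divide_distrib)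

lemma avg_cmult: "avg (%y. c*f y) x = c*avg f x" unfolding avg_def by (simp add: sum_distrib_left[symmetric])

lemma avg_sum: "avg (%y. \<Sum>i\<in>I. f i y) x = (\<Sum>i\<in>I. avg (f i) x)"
 unfolding avg_def by (subst sum.swap) (simp add: sum_divide_distrib)

lemma avg_const: "avg (%y. c) x = c" unfolding avg_def using dpos by simp

lemma avg_nonneg: "(!!y. f y >= 0) ==> avg f x >= 0" unfolding avg_def by (intro divide_nonneg_nonneg sum_nonneg) auto

primrec kern :: "nat => pt => pt => real" where "kern 0 x y = (if x = y then 1 else 0)"
| "kern (Suc t) x y = avg (%z. kern t z y) x"

text \<open>The lazy walk is introduced because its symbol \<open>lam\<close> lies in [0, 1], which
  makes its return probability decreasing in time; that of \<open>kern\<close> oscillates when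
  \<open>N\<close> is even.\<close>

primrec lazy :: "nat => pt => pt => real" where "lazy 0 x y = (if x = y then 1 else 0)"
| "lazy (Suc t) x y = lazy t x y/2 + avg (%z. lazy t z y) x/2"

definition ang :: "pt => pt => real" where "ang \<xi> z = 2*pi/real N*(\<Sum>i<d. of_int (\<xi> i) * of_int (z i))"

abbreviation "sn \<xi> i \<equiv> sin (pi * of_int ((\<xi> :: pt) i)/real N)"
abbreviation "sn2 \<xi> i \<equiv> sin (2*pi * of_int ((\<xi> :: pt) i)/real N)"
text \<open>Fourier symbol of the walk: the eigenvalue of \<open>avg\<close> at the frequency
  \<xi>.\<close>

definition phi :: "pt => real" where "phi \<xi> = (\<Sum>i<d. cos (2*pi * of_int (\<xi> i)/real N))/real d"

text \<open>Inverse Fourier transform. Cosines suffice, because all weights in use are even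
  functions of the frequency.\<close>

definition four :: "(pt => real) => pt => real" where "four w z = (\<Sum>\<xi>\<in>T. w \<xi>*cos (ang \<xi> z))/real N^d"

lemma cos_ang_cong: assumes "!!i. i < d ==> z i mod int N = z' i mod int N" shows "cos (ang \<xi> z) = cos (ang \<xi> z')"
proof -
 have "\<exists>k. z i = z' i + int N*k" if "i < d" for i
  using assms[OF that] by (metis mod_eqE add.commute diff_add_cancel mult.commute minus_diff_eq mod_eq_dvd_iff dvdE)
 then have "\<exists>k. \<forall>i<d. z i = z' i + int N*k i" by metis
 then obtain k where k: "!!i. i < d ==> z i = z' i + int N*k i" by auto
 have "(\<Sum>i<d. real_of_int (\<xi> i)*real_of_int (z i)) =
  (\<Sum>i<d. real_of_int (\<xi> i)*real_of_int (z' i)) + real N*real_of_int (\<Sum>i<d. \<xi> i*k i)"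
  using k by (simp add: sum.distrib[symmetric] sum_distrib_left algebra_simps)
 then have "ang \<xi> z = ang \<xi> z' + 2*pi*real_of_int (\<Sum>i<d. \<xi> i*k i)" unfolding ang_def using Npos by (simp add: field_simps)
 then show ?thesis by (simp only: cos_add cos_int_2pin sin_int_2pin)
qed

lemma four_cong: assumes "!!i. i < d ==> z i mod int N = z' i mod int N" shows "four w z = four w z'"
 unfolding four_def using cos_ang_cong[OF assms] by simp

lemma ang_ustep: "j < d ==> ang \<xi> (%i. z i + ustep j s i) = ang \<xi> z + 2*pi * of_int (\<xi> j)/real N * of_int s"
proof -
 assume j: "j < d"
 have "(\<Sum>i<d. real_of_int (\<xi> i)*real_of_int (ustep j s i)) = real_of_int (\<xi> j) * of_int s"
  using j by (simp add: ustep_def if_distrib sum.If_cases cong: if_cong)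
 then show ?thesis unfolding ang_def by (simp add: algebra_simps sum.distrib add_divide_distrib)
qed

text \<open>Pairing opposite steps turns cos (a + b) + cos (a - b) into a product, so averaging over
  a step multiplies the Fourier weight by \<open>phi\<close>.\<close>

lemma avg_four: "avg (%x'. four w (%i. x' i - y i)) x = four (%\<xi>. phi \<xi>*w \<xi>) (%i. x i - y i)"
proof -
 define z where "z = (%i. x i - y i)"
 have *: "four w (%i. st x e i - y i) = four w (%i. z i + e i)" for e
  by (rule four_cong) (simp add: st_nth z_def mod_diff_left_eq algebra_simps)
 have "(\<Sum>e\<in>unit_steps d. four w (%i. st x e i - y i)) = (\<Sum>e\<in>unit_steps d. four w (%i. z i + e i))" by (simp add: *)
 also have "... = (\<Sum>\<xi>\<in>T. w \<xi>*(\<Sum>e\<in>unit_steps d. cos (ang \<xi> (%i. z i + e i))))/real N^d"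
  unfolding four_def sum_divide_distrib[symmetric] by (subst sum.swap) (simp add: sum_distrib_left)
 also have "... = (\<Sum>\<xi>\<in>T. w \<xi>*(2*real d*phi \<xi>*cos (ang \<xi> z)))/real N^d"
 proof -
  have "(\<Sum>e\<in>unit_steps d. cos (ang \<xi> (%i. z i + e i))) = 2*real d*phi \<xi>*cos (ang \<xi> z)" for \<xi>
  proof -
   have "(\<Sum>e\<in>unit_steps d. cos (ang \<xi> (%i. z i + e i))) =
     (\<Sum>j<d. 2*cos (ang \<xi> z)*cos (2*pi * of_int (\<xi> j)/real N))"
    unfolding sum_unit_steps
    by (intro sum.cong refl) (simp add: ang_ustep cos_add cos_diff)
   also have "... = 2*cos (ang \<xi> z)*(\<Sum>j<d. cos (2*pi * of_int (\<xi> j)/real N))" by (simp only: sum_distrib_left)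
   also have "(\<Sum>j<d. cos (2*pi * of_int (\<xi> j)/real N)) = real d*phi \<xi>" unfolding phi_def using dpos by simp
   finally show ?thesis by simp
  qed
  then show ?thesis by simp
 qed
 also have "... = 2*real d*four (%\<xi>. phi \<xi>*w \<xi>) z" unfolding four_def by (simp add: sum_distrib_left algebra_simps)
 finally show ?thesis unfolding avg_def z_def[symmetric] using dpos by simp
qed

lemma sum_cis:
 fixes z :: int
 shows "(\<Sum>k<N. cis (2*pi * of_int (int k) * of_int z/real N)) = (if z mod int N = 0 then of_nat N else 0)"
proof -
 define w where "w = cis (2*pi * of_int z/real N)"
 have pw: "cis (2*pi * of_int (int k) * of_int z/real N) = w^k" for k unfolding w_def Complex.DeMoivre by (simp add: field_simps)
 have "w^N = cis (2*pi * of_int z)" unfolding w_def Complex.DeMoivre using Npos by simp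
 also have "... = 1" by (rule cis_multiple_2pi) simp
 finally have wN: "w^N = 1" .
 show ?thesis
 proof (cases "z mod int N = 0")
  case True
  then obtain k where "z = int N*k" by auto
  then have "2*pi * of_int z/real N = 2*pi * of_int k" using Npos by simp
  then have "w = cis (2*pi * of_int k)" unfolding w_def by (rule arg_cong)
  moreover have "cis (2*pi * of_int k) = 1" by (rule cis_multiple_2pi) simp
  ultimately have "w = 1" by simp
  then show ?thesis using True unfolding pw by simp
 next
  case False
  have "w ~= 1"
  proof
   assume "w = 1"
   then have "cos (2*pi * of_int z/real N) = 1" unfolding w_def by (simp add: complex_eq_iff)
   then obtain n :: int where "2*pi * of_int z/real N = of_int n*2*pi" using cos_one_2pi_int by blast
   then have "real_of_int z = of_int n*real N" using Npos by (simp add: field_simps)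
   then have "z = n*int N" by (metis of_int_eq_iff of_int_mult of_int_of_nat_eq)
   then show False using False by simp
  qed
  then have "(\<Sum>k<N. w^k) = 0" using wN by (simp add: sum_gp_strict geometric_sum)
  then show ?thesis using False unfolding pw by simp
 qed
qed

text \<open>Fourier inversion of the point mass: the sum over frequencies factorises into one
  geometric sum of roots of unity per coordinate.\<close>

lemma four_one: "four (%_. 1) z = (if \<forall>i<d. z i mod int N = 0 then 1 else 0)"
proof -
 have "complex_of_real (\<Sum>\<xi>\<in>T. cos (ang \<xi> z)) = complex_of_real (Re (\<Sum>\<xi>\<in>T. cis (ang \<xi> z)))" by simp
 also have "(\<Sum>\<xi>\<in>T. cis (ang \<xi> z)) = (\<Sum>\<xi>\<in>PiE {..<d} (%_. {0..<int N}). \<Prod>i\<in>{..<d}. cis (2*pi * of_int (\<xi> i) * of_int (z i)/real N))"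
 proof -
  have "cis (ang \<xi> z) = (\<Prod>i\<in>{..<d}. cis (2*pi * of_int (\<xi> i) * of_int (z i)/real N))" for \<xi>
  proof -
   have *: "cis (\<Sum>i\<in>I. f i) = (\<Prod>i\<in>I. cis (f i))" if "finite I" for I :: "nat set" and f
    using that by (induction I rule: finite_induct) (auto simp: cis_mult[symmetric])
   show ?thesis unfolding ang_def by (subst *[symmetric]) (auto simp: sum_distrib_left mult.assoc)
  qed
  then show ?thesis unfolding torus_def by simp
 qed
 also have "... = (\<Prod>i\<in>{..<d}. \<Sum>k\<in>{0..<int N}. cis (2*pi * of_int k * of_int (z i)/real N))" by (subst prod_sum_PiE) auto
 also have "... = (\<Prod>i\<in>{..<d}. (if z i mod int N = 0 then of_nat N else 0))" using sum_cis by (simp add: sum_int_range)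
 also have "... = (if \<forall>i<d. z i mod int N = 0 then of_nat N^d else 0)" by (auto simp: prod_zero_iff)
 finally have "complex_of_real (\<Sum>\<xi>\<in>T. cos (ang \<xi> z)) = complex_of_real (if \<forall>i<d. z i mod int N = 0 then real N^d else 0)"
  by (auto simp flip: of_nat_power)
 then have "(\<Sum>\<xi>\<in>T. cos (ang \<xi> z)) = (if \<forall>i<d. z i mod int N = 0 then real N^d else 0)" using of_real_eq_iff by blast
 then show ?thesis unfolding four_def using Npos by simp
qed

lemma delta_four: assumes "x \<in> T" "y \<in> T" shows "(if x = y then 1 else 0) = four (%_. 1) (%i. x i - y i)"
proof -
 have "x = y" if "\<forall>i<d. (x i - y i) mod int N = 0" using that by (intro torus_eqI assms) (simp add: mod_eq_dvd_iff mod_eq_0_iff_dvd)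
 then show ?thesis unfolding four_one by auto
qed

lemma kern_four: assumes "x \<in> T" "y \<in> T" shows "kern t x y = four (%\<xi>. phi \<xi>^t) (%i. x i - y i)" using assms
proof (induction t arbitrary: x)
 case 0
 then show ?case using delta_four by simp
next
 case (Suc t)
 have "kern (Suc t) x y = avg (%x'. four (%\<xi>. phi \<xi>^t) (%i. x' i - y i)) x"
  unfolding kern.simps avg_def using Suc by simp
 also have "... = four (%\<xi>. phi \<xi>^Suc t) (%i. x i - y i)" unfolding avg_four by simp
 finally show ?case .
qed

definition lam :: "pt => real" where "lam \<xi> = (1 + phi \<xi>)/2"

lemma four_add: "four v z + four w z = four (%\<xi>. v \<xi> + w \<xi>) z"
 unfolding four_def by (simp add: add_divide_distrib[symmetric] sum.distrib[symmetric] algebra_simps)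

lemma four_cmult: "c*four v z = four (%\<xi>. c * v \<xi>) z" unfolding four_def by (simp add: sum_distrib_left algebra_simps)

lemma lazy_four: assumes "x \<in> T" "y \<in> T" shows "lazy t x y = four (%\<xi>. lam \<xi>^t) (%i. x i - y i)" using assms
proof (induction t arbitrary: x)
 case 0
 then show ?case using delta_four by simp
next
 case (Suc t)
 define z where "z = (%i. x i - y i)"
 have "lazy (Suc t) x y = 1/2*four (%\<xi>. lam \<xi>^t) z + 1/2*avg (%x'. four (%\<xi>. lam \<xi>^t) (%i. x' i - y i)) x"
  unfolding lazy.simps avg_def using Suc by (simp add: z_def)
 also have "... = four (%\<xi>. 1/2*lam \<xi>^t + 1/2*(phi \<xi>*lam \<xi>^t)) z"
  unfolding avg_four z_def[symmetric] four_cmult four_add by simp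
 also have "(%\<xi>. 1/2*lam \<xi>^t + 1/2*(phi \<xi>*lam \<xi>^t)) = (%\<xi>. lam \<xi>^Suc t)"
  by (auto simp: lam_def algebra_simps)
 finally show ?case by (simp add: z_def)
qed

end

section \<open>Elementary inequalities, constants, and heat kernel bounds\<close>

lemma sum_UN_le:
 fixes f :: "'a => real"
 assumes "finite I" "!!i. i \<in> I ==> finite (A i)" "!!x. f x >= 0"
 shows "sum f (\<Union>i\<in>I. A i) <= (\<Sum>i\<in>I. sum f (A i))"
 using assms(1,2)
proof (induction I rule: finite_induct)
 case (insert i I)
 have "sum f (\<Union>i\<in>insert i I. A i) <= sum f (A i) + sum f (\<Union>i\<in>I. A i)" using insert assms(3) by (simp add: sum_Un sum_nonneg)
 also have "sum f (\<Union>i\<in>I. A i) <= (\<Sum>i\<in>I. sum f (A i))" using insert by simp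
 finally show ?case using insert by simp
qed simp

lemma cosh_le_exp_square: "cosh x <= exp (x^2)" for x :: real
proof -
 have *: "cosh x <= exp (x^2)" if "x >= 0" for x :: real
 proof (cases "x <= 1")
  case True
  have a: "exp x <= 1 + x + x^2" using that True by (rule exp_bound)
  have "1 + x + x^2/2 <= exp x" by (rule exp_lower_Taylor_quadratic[OF that])
  then have "exp (- x) <= 1/(1 + x + x^2/2)" using that by (simp add: exp_minus field_simps add_pos_nonneg)
  also have "... <= 1 - x + x^2"
  proof -
   have "(1 - x + x^2)*(1 + x + x^2/2) = 1 + x^2/2 + x^3/2 + x^4/2"
    by (simp add: field_simps power2_eq_square power3_eq_cube power4_eq_xxxx)
   also have "... >= 1" using that by simp
   finally show ?thesis using that by (subst divide_le_eq) (auto simp: add_pos_nonneg)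
  qed
  finally have b: "exp (- x) <= 1 - x + x^2" .
  have "cosh x <= 1 + x^2" using a b unfolding cosh_field_def by simp
  also have "... <= exp (x^2)" by (rule exp_ge_add_one_self)
  finally show ?thesis .
 next
  case False
  then have "x <= x^2" by (simp add: power2_eq_square)
  have "cosh x <= exp x" using that unfolding cosh_field_def by simp
  also have "... <= exp (x^2)" using \<open>x \<le> x\<^sup>2\<close> by simp
  finally show ?thesis .
 qed
 show ?thesis using *[of x] *[of "- x"] by (cases "x >= 0") auto
qed

lemma cube_le_exp: "x^3/27 <= exp x" if "0 <= x" for x :: real
proof -
 have "(x/3)^3 <= (1 + x/3)^3" using that by (intro power_mono) auto
 also have "... <= exp x" using exp_ge_one_plus_x_over_n_power_n[of 3 x] that by simp
 finally show ?thesis by (simp add: power_divide)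
qed

text \<open>Telescoping: consecutive square roots a, b satisfy 1/b^3 <= 2/a - 2/b.\<close>

lemma sum_inverse_sqrt_cube_le: assumes "1 <= m" "m <= n" shows "(\<Sum>s\<in>{m<..n}. 1/sqrt (real s)^3) <= 2/sqrt (real m)"
proof -
 have "(\<Sum>s\<in>{m<..n}. 1/sqrt (real s)^3) <= 2/sqrt (real m) - 2/sqrt (real n)" using assms(2)
 proof (induction n rule: dec_induct)
  case (step n)
  have n: "n >= 1" using step assms by simp
  define a b where "a = sqrt (real n)" and "b = sqrt (real (Suc n))"
  have ab: "0 < a" "a <= b" and sq: "b^2 - a^2 = 1" using n by (auto simp: a_def b_def)
  have "(b^2 - a^2)/(a*b*(a + b)) = ((b - a)*(a + b))/((a*b)*(a + b))" by (simp add: power2_eq_square algebra_simps)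
  also have "... = (b - a)/(a*b)" using ab by simp
  also have "... = 1/a - 1/b" using ab by (simp add: diff_divide_distrib)
  finally have "1/a - 1/b = (b^2 - a^2)/(a*b*(a + b))" by simp
  also have "... = 1/(a*b*(a + b))" using sq by simp
  also have "... >= 1/(b*b*(b + b))" using ab by (intro divide_left_mono mult_mono add_mono mult_pos_pos) auto
  finally have "1/b^3 <= 2/a - 2/b" by (simp add: power3_eq_cube field_simps)
  moreover have "{m<..Suc n} = insert (Suc n) {m<..n}" using step by auto
  ultimately show ?case using step.IH by (simp add: a_def b_def)
 qed simp
 then show ?thesis using order_trans by fastforce
qed

text \<open>Only the exponent 3/2 is really summed; the surplus power d - 3 is bounded by its value
  at s = w^2.\<close>

lemma sum_inverse_sqrt_power_le: assumes "1 <= w" "3 <= d" shows "(\<Sum>s\<in>{w^2<..n}. 1/sqrt (real s)^d) <= 2*real w^2/real w^d"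
proof -
 have d: "real w^d = real w^(d - 3)*real w^3" using assms by (simp flip: power_add)
 have "1/sqrt (real s)^d <= 1/real w^(d - 3)*(1/sqrt (real s)^3)" if "s \<in> {w^2<..n}" for s
 proof -
  have "real w <= sqrt (real s)" using that by (intro real_le_rsqrt) (simp flip: of_nat_power)
  then have "real w^(d - 3) * sqrt (real s)^3 <= sqrt (real s)^(d - 3) * sqrt (real s)^3" by (intro mult_right_mono power_mono) auto
  also have "... = sqrt (real s)^d" using assms by (simp flip: power_add)
  finally show ?thesis using assms that by (simp add: frac_le)
 qed
 then have "(\<Sum>s\<in>{w^2<..n}. 1/sqrt (real s)^d) <= (\<Sum>s\<in>{w^2<..n}. 1/real w^(d - 3)*(1/sqrt (real s)^3))"
  by (intro sum_mono) auto
 also have "... = 1/real w^(d - 3)*(\<Sum>s\<in>{w^2<..n}. 1/sqrt (real s)^3)" by (simp add: sum_distrib_left)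
 also have "... <= 1/real w^(d - 3)*(2/real w)"
 proof (cases "w^2 <= n")
  case True
  then have "(\<Sum>s\<in>{w^2<..n}. 1/sqrt (real s)^3) <= 2/sqrt (real (w^2))" using assms by (intro sum_inverse_sqrt_cube_le) auto
  also have "sqrt (real (w^2)) = real w" by simp
  finally show ?thesis by (intro mult_left_mono) auto
 qed simp
 also have "... = 2*real w^2/real w^d" using assms by (simp add: d power3_eq_cube power2_eq_square)
 finally show ?thesis .
qed

text \<open>Constants of the dimension alone: \<open>CU\<close> for the heat kernel from above;
  \<open>CL\<close> for the multiple of r^2 after which points at distance r have a Green function
  bounded below, so large that the main term of \<open>green_lower\<close> beats its error;
  \<open>cL\<close> for that lower bound; \<open>CG\<close> for the time spent in a set;
  \<open>CX\<close> for the Green function of far points.\<close>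

definition CU :: "nat => real" where "CU d = (16 * sqrt (2*real d))^d"
definition CL :: "nat => nat" where "CL d = nat \<lceil>8*(real d)^2*(1 + 4 * sqrt (real d))^d*(8 * sqrt 2)^d\<rceil> + 4"
definition cL :: "nat => real" where "cL d = 1/(8*(8 * sqrt 2)^d * sqrt (real (CL d))^d)"
definition CG :: "nat => real" where "CG d = 2 + 2*CU d"
definition CX :: "nat => real" where "CX d = 6912 + 2*CU d"

lemma CU_pos: "d >= 1 ==> CU d > 0" by (simp add: CU_def)
lemma cL_pos: "cL d > 0"
proof -
 have "CL d > 0" unfolding CL_def by linarith
 then have "real (CL d) > 0" by simp
 then show ?thesis unfolding cL_def by (intro divide_pos_pos mult_pos_pos zero_less_power) auto
qed

context torus_walk begin

lemma CU_gt0: "CU d > 0" using CU_pos d3 by simp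

lemma sum_T_prod:
 fixes F :: "int => real"
 shows "(\<Sum>\<xi>\<in>T. \<Prod>i<d. F (\<xi> i)) = (\<Sum>k<N. F (int k))^d"
proof -
 have "(\<Sum>\<xi>\<in>T. \<Prod>i<d. F (\<xi> i)) = (\<Prod>i\<in>{..<d}. \<Sum>k\<in>{0..<int N}. F k)"
  unfolding torus_def by (subst prod_sum_PiE) auto
 then show ?thesis by (simp add: sum_int_range)
qed

text \<open>Based on |cos a| <= 1 - (sin a)^2 / 2, which treats the frequencies near 0 and near N/2
  alike.\<close>

lemma phi_abs_le: "\<bar>phi \<xi>\<bar> <= exp (- (1/(2*real d))*(\<Sum>i<d. (sn2 \<xi> i)^2))"
proof -
 have c: "\<bar>cos a\<bar> <= 1 - (sin a)^2/2" for a :: real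
 proof -
  have "0 <= (1 - \<bar>cos a\<bar>)^2" by simp
  then have "2*\<bar>cos a\<bar> <= 1 + (cos a)^2" by (simp add: power2_diff)
  then show ?thesis using sin_cos_squared_add[of a] by linarith
 qed
 have "\<bar>phi \<xi>\<bar> <= (\<Sum>i<d. \<bar>cos (2*pi * of_int (\<xi> i)/real N)\<bar>)/real d"
  unfolding phi_def abs_divide by (simp add: divide_right_mono)
 also have "... <= (\<Sum>i<d. 1 - (sn2 \<xi> i)^2/2)/real d" by (intro divide_right_mono sum_mono c) auto
 also have "... = 1 + (- (1/(2*real d))*(\<Sum>i<d. (sn2 \<xi> i)^2))"
  using dpos by (simp add: sum_subtractf diff_divide_distrib sum_divide_distrib[symmetric])
 also have "... <= exp (- (1/(2*real d))*(\<Sum>i<d. (sn2 \<xi> i)^2))" by (rule exp_ge_add_one_self)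
 finally show ?thesis .
qed

lemma four_le: "four w z <= (\<Sum>\<xi>\<in>T. \<bar>w \<xi>\<bar>)/real N^d" unfolding four_def
proof (intro divide_right_mono sum_mono)
 fix \<xi>
 have "w \<xi>*cos (ang \<xi> z) <= \<bar>w \<xi>*cos (ang \<xi> z)\<bar>" by simp
 also have "... <= \<bar>w \<xi>\<bar>*1" unfolding abs_mult by (intro mult_left_mono) auto
 finally show "w \<xi>*cos (ang \<xi> z) <= \<bar>w \<xi>\<bar>" by simp
qed auto

text \<open>The exponential bound of the symbol is a product over coordinates, so the frequency sum
  is the d-th power of a one-dimensional Gaussian sum. Its term 1/N is the equidistributed part and
  takes over after time N^2.\<close>

lemma kern_le: assumes "x \<in> T" "y \<in> T" "t >= 1" shows "kern t x y <= CU d*(1/real N^d + 1/sqrt (real t)^d)"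
proof -
 define a where "a = real t/(2*real d)"
 have a: "a > 0" using assms dpos by (simp add: a_def)
 define F where "F k = exp (- a*(sin (2*pi * of_int k/real N))^2)" for k :: int
 have pow: "\<bar>phi \<xi>^t\<bar> <= (\<Prod>i<d. F (\<xi> i))" for \<xi>
 proof -
  have "\<bar>phi \<xi>^t\<bar> <= exp (- (1/(2*real d))*(\<Sum>i<d. (sn2 \<xi> i)^2))^t"
   unfolding power_abs by (intro power_mono phi_abs_le) auto
  also have "... = exp (\<Sum>i<d. - a*(sn2 \<xi> i)^2)"
   unfolding exp_of_nat_mult[symmetric] sum_distrib_left by (simp add: a_def)
  also have "... = (\<Prod>i<d. F (\<xi> i))" unfolding F_def by (rule exp_sum) simp
  finally show ?thesis .
 qed
 have "kern t x y <= (\<Sum>\<xi>\<in>T. \<bar>phi \<xi>^t\<bar>)/real N^d" unfolding kern_four[OF assms(1,2)] by (rule four_le)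
 also have "... <= (\<Sum>\<xi>\<in>T. \<Prod>i<d. F (\<xi> i))/real N^d" by (intro divide_right_mono sum_mono pow) auto
 also have "... = ((\<Sum>k<N. F (int k))/real N)^d" unfolding sum_T_prod by (simp add: power_divide)
 also have "... <= ((2 + 8*real N/sqrt a)/real N)^d" using sum_exp_sin_double_le[OF a, of N] Npos unfolding F_def
  by (intro power_mono divide_right_mono divide_nonneg_nonneg sum_nonneg) auto
 also have "(2 + 8*real N/sqrt a)/real N = 2/real N + 8 * sqrt (2*real d)/sqrt (real t)"
  using Npos assms by (simp add: a_def real_sqrt_divide add_divide_distrib)
 also have "(2/real N + 8 * sqrt (2*real d)/sqrt (real t))^d <= (8 * sqrt (2*real d)*(2*max (1/real N) (1/sqrt (real t))))^d"
 proof (intro power_mono)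
  have "1 <= sqrt (2*real d)" using d3 by simp
  then have "2 <= 8 * sqrt (2*real d)" by linarith
  then have "2/real N <= 8 * sqrt (2*real d)*(1/real N)" using mult_right_mono[of 2 "8 * sqrt (2*real d)" "1/real N"] by auto
  also have "... <= 8 * sqrt (2*real d)*max (1/real N) (1/sqrt (real t))" by (intro mult_left_mono) auto
  finally have 1: "2/real N <= 8 * sqrt (2*real d)*max (1/real N) (1/sqrt (real t))" .
  have "8 * sqrt (2*real d)/sqrt (real t) <= 8 * sqrt (2*real d)*max (1/real N) (1/sqrt (real t))"
   using mult_left_mono[of "1/sqrt (real t)" "max (1/real N) (1/sqrt (real t))" "8 * sqrt (2*real d)"] by simp
  with 1 show "2/real N + 8 * sqrt (2*real d)/sqrt (real t) <= 8 * sqrt (2*real d)*(2*max (1/real N) (1/sqrt (real t)))" by simp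
 qed auto
 also have "... = (16 * sqrt (2*real d)*max (1/real N) (1/sqrt (real t)))^d" by (rule arg_cong[of _ _ "%x. x^d"]) simp
 also have "... = CU d*max (1/real N) (1/sqrt (real t))^d" unfolding CU_def by (rule power_mult_distrib)
 also have "... <= CU d*(1/real N^d + 1/sqrt (real t)^d)" using CU_gt0 by (intro mult_left_mono) (auto simp: max_def power_divide)
 finally show ?thesis .
qed

lemma lam_eq: "lam \<xi> = 1 - (\<Sum>i<d. (sn \<xi> i)^2)/real d"
proof -
 have "cos (2*pi * of_int (\<xi> i)/real N) = 1 - 2*(sn \<xi> i)^2" for i
  using cos_double_sin[of "pi * of_int (\<xi> i)/real N"] by (simp add: mult.assoc)
 then have "phi \<xi> = 1 - 2*(\<Sum>i<d. (sn \<xi> i)^2)/real d"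
  unfolding phi_def using dpos by (simp add: sum_subtractf diff_divide_distrib sum_distrib_left)
 then show ?thesis by (simp add: lam_def diff_divide_distrib)
qed

lemma lam_bounds: "0 <= lam \<xi>" "lam \<xi> <= 1"
proof -
 have "(\<Sum>i<d. (sn \<xi> i)^2) <= (\<Sum>i<d. 1)" by (intro sum_mono) (simp add: abs_square_le_1)
 then show "0 <= lam \<xi>" unfolding lam_eq using dpos by simp
 show "lam \<xi> <= 1" unfolding lam_eq by (simp add: sum_nonneg)
qed

text \<open>Return probability of the lazy walk, that is \<open>four\<close> at the origin.\<close>

definition qd :: "nat => real" where "qd t = (\<Sum>\<xi>\<in>T. lam \<xi>^t)/real N^d"

lemma qd_decreasing: "s <= t ==> qd t <= qd s" unfolding qd_def by (intro divide_right_mono sum_mono power_decreasing lam_bounds) auto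

lemma qd_upper: assumes "t >= 1" shows "qd t <= (1/real N + 4 * sqrt (real d)/sqrt (real t))^d"
proof -
 define a where "a = real t/real d"
 have a: "a > 0" using assms dpos by (simp add: a_def)
 define F where "F k = exp (- a*(sin (pi * of_int k/real N))^2)" for k :: int
 have pow: "lam \<xi>^t <= (\<Prod>i<d. F (\<xi> i))" for \<xi>
 proof -
  have "lam \<xi> <= exp (- ((\<Sum>i<d. (sn \<xi> i)^2)/real d))"
   unfolding lam_eq using exp_ge_add_one_self[of "- ((\<Sum>i<d. (sn \<xi> i)^2)/real d)"] by simp
  then have "lam \<xi>^t <= exp (- ((\<Sum>i<d. (sn \<xi> i)^2)/real d))^t" by (intro power_mono lam_bounds)
  also have "... = exp (\<Sum>i<d. - a*(sn \<xi> i)^2)"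
   unfolding exp_of_nat_mult[symmetric] sum_divide_distrib sum_negf[symmetric] sum_distrib_left
   by (simp add: a_def)
  also have "... = (\<Prod>i<d. F (\<xi> i))" unfolding F_def by (rule exp_sum) simp
  finally show ?thesis .
 qed
 have "qd t <= (\<Sum>\<xi>\<in>T. \<Prod>i<d. F (\<xi> i))/real N^d" unfolding qd_def by (intro divide_right_mono sum_mono pow) auto
 also have "... = ((\<Sum>k<N. F (int k))/real N)^d" unfolding sum_T_prod by (simp add: power_divide)
 also have "... <= ((1 + 4*real N/sqrt a)/real N)^d" using sum_exp_sin_le[OF a, of N] Npos unfolding F_def
  by (intro power_mono divide_right_mono divide_nonneg_nonneg sum_nonneg) auto
 also have "(1 + 4*real N/sqrt a)/real N = 1/real N + 4 * sqrt (real d)/sqrt (real t)"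
  using Npos assms by (simp add: a_def real_sqrt_divide add_divide_distrib)
 finally show ?thesis .
qed

lemma qd_ge_unif: "1/real N^d <= qd t"
proof -
 define o0 where "o0 = torus_proj d N (%_. 0)"
 have "lam o0 = 1" unfolding lam_eq by (simp add: o0_def torus_proj_nth)
 then have "1 <= (\<Sum>\<xi>\<in>T. lam \<xi>^t)" using member_le_sum[of o0 T "%\<xi>. lam \<xi>^t"] lam_bounds by (simp add: o0_def)
 then show ?thesis unfolding qd_def by (intro divide_right_mono) auto
qed

text \<open>Frequencies in a box of side about N/(8 sqrt t) satisfy lam^t >= 1/2 by Bernoulli's
  inequality, and all other terms are nonnegative.\<close>

lemma qd_ge_sqrt: assumes "t >= 1" shows "qd t >= 1/(2*(8 * sqrt (real t))^d)"
proof -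
 define h where "h = real N/(8 * sqrt (real t))"
 have t1: "sqrt (real t) >= 1" using assms by simp
 have h0: "h > 0" using Npos assms by (simp add: h_def)
 have hN: "h <= real N/8" unfolding h_def using t1 Npos by (intro divide_left_mono) auto
 define m where "m = nat \<lfloor>h\<rfloor>"
 have mh: "real m <= h" "h < real m + 1" using h0 by (auto simp: m_def)
 have mN: "int m < int N" using mh hN Npos by linarith
 define S where "S = PiE {..<d} (%_. {0..int m})"
 have ST: "S \<subseteq> T" unfolding S_def torus_def using mN by (intro PiE_mono) auto
 have cS: "card S = (m + 1)^d" unfolding S_def by (subst card_PiE) (auto simp: nat_add_distrib)
 have half: "lam \<xi>^t >= 1/2" if "\<xi> \<in> S" for \<xi>
 proof -
  have "(sn \<xi> i)^2 <= 1/(2*real t)" if "i < d" for i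
  proof -
   have xi: "0 <= \<xi> i" "\<xi> i <= int m" using \<open>\<xi> \<in> S\<close> that unfolding S_def by (auto simp: PiE_iff)
   have "\<bar>sn \<xi> i\<bar> <= \<bar>pi * of_int (\<xi> i)/real N\<bar>" by (rule abs_sin_x_le_abs_x)
   also have "... = pi * of_int (\<xi> i)/real N" using xi by simp
   also have "... <= 4*h/real N" using xi mh pi_less_4  by (intro divide_right_mono mult_mono) auto
   also have "... = 1/(2 * sqrt (real t))" unfolding h_def using Npos by simp
   finally have "\<bar>sn \<xi> i\<bar>\<^sup>2 <= (1/(2 * sqrt (real t)))^2" by (intro power_mono) auto
   also have "... = 1/(4*real t)" by (simp add: power_divide power_mult_distrib)
   also have "... <= 1/(2*real t)" using assms by (simp add: field_simps)
   finally show ?thesis by simp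
  qed
  then have "(\<Sum>i<d. (sn \<xi> i)^2) <= (\<Sum>i<d. 1/(2*real t))" by (intro sum_mono) auto
  then have l: "lam \<xi> >= 1 + (- (1/(2*real t)))" unfolding lam_eq using dpos by (simp add: field_simps)
  have "1/2 = 1 + real t*(- (1/(2*real t)))" using assms by simp
  also have "... <= (1 + (- (1/(2*real t))))^t"  using assms by (intro Bernoulli_inequality) (simp add: field_simps)
  also have "... <= lam \<xi>^t" using l assms by (intro power_mono) (auto simp: field_simps)
  finally show ?thesis .
 qed
 have "(1/2)*h^d <= (1/2)*real (card S)" unfolding cS using mh h0 by (simp add: power_mono)
 also have "... = (\<Sum>\<xi>\<in>S. 1/2)" by simp
 also have "... <= (\<Sum>\<xi>\<in>S. lam \<xi>^t)" by (intro sum_mono half)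
 also have "... <= (\<Sum>\<xi>\<in>T. lam \<xi>^t)" using ST lam_bounds by (intro sum_mono2) auto
 finally have "(1/2)*h^d/real N^d <= qd t" unfolding qd_def by (rule divide_right_mono) simp
 then show ?thesis using Npos by (simp add: h_def power_divide)
qed

text \<open>The squared sine of a sum is controlled by the spectral gap itself, so that the decay of
 the diagonal in time controls the modulus of continuity in space.\<close>

lemma lazy_four_near_diagonal: assumes "!!i. i < d ==> \<bar>z i\<bar> <= int r"
 shows "qd s - four (%\<xi>. lam \<xi>^s) z <= 2*(real d)^2*(real r)^2*(qd s - qd (Suc s))"
proof -
 have key: "1 - cos (ang \<xi> z) <= 2*(real d)^2*(real r)^2*(1 - lam \<xi>)" for \<xi>
 proof -
  define b where "b i = of_int (z i)*(pi * of_int (\<xi> i)/real N)" for i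
  have "ang \<xi> z = 2*(\<Sum>i<d. b i)" unfolding ang_def b_def by (simp add: sum_distrib_left algebra_simps)
  then have "1 - cos (ang \<xi> z) = 2*(sin (\<Sum>i<d. b i))^2" by (simp add: cos_double_sin)
  also have "... <= 2*(real d*(\<Sum>i<d. (sin (b i))^2))" using sin_sum_squared_le[of b d] by simp
  also have "... <= 2*(real d*(\<Sum>i<d. (real r)^2*(sn \<xi> i)^2))"
  proof (intro mult_left_mono sum_mono)
   fix i assume "i \<in> {..<d}"
   then have "\<bar>real_of_int (z i)\<bar> <= real r" using assms[of i] by simp
   have "\<bar>sin (b i)\<bar> <= \<bar>real_of_int (z i)\<bar>*\<bar>sn \<xi> i\<bar>"
    unfolding b_def by (rule sin_abs_int_mult_le)
   also have "... <= real r*\<bar>sn \<xi> i\<bar>"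
    using \<open>\<bar>real_of_int (z i)\<bar> \<le> real r\<close> by (intro mult_right_mono) auto
   finally have "\<bar>sin (b i)\<bar>\<^sup>2 <= (real r*\<bar>sn \<xi> i\<bar>)^2" by (intro power_mono) auto
   then show "(sin (b i))^2 <= (real r)^2*(sn \<xi> i)^2" by (simp add: power_mult_distrib)
  qed auto
  also have "... = 2*(real d)^2*(real r)^2*(1 - lam \<xi>)"
   unfolding lam_eq using dpos by (simp add: sum_distrib_left[symmetric] power2_eq_square)
  finally show ?thesis .
 qed
 have "qd s - four (%\<xi>. lam \<xi>^s) z = (\<Sum>\<xi>\<in>T. lam \<xi>^s*(1 - cos (ang \<xi> z)))/real N^d"
  unfolding qd_def four_def by (simp add: diff_divide_distrib[symmetric] sum_subtractf[symmetric] algebra_simps)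
 also have "... <= (\<Sum>\<xi>\<in>T. lam \<xi>^s*(2*(real d)^2*(real r)^2*(1 - lam \<xi>)))/real N^d"
  by (intro divide_right_mono sum_mono mult_left_mono key zero_le_power lam_bounds) auto
 also have "... = 2*(real d)^2*(real r)^2*(qd s - qd (Suc s))"
  unfolding qd_def by (simp add: diff_divide_distrib[symmetric] sum_subtractf[symmetric] sum_distrib_left algebra_simps)
 finally show ?thesis .
qed

section \<open>Truncated Green functions, bounds from below and for sets\<close>

definition green :: "nat => pt => pt => real" where "green t x y = (\<Sum>s\<le>t. kern s x y)"

lemma kern_nonneg: "kern t x y >= 0" by (induction t arbitrary: x) (auto intro: avg_nonneg)

lemma green_nonneg: "green t x y >= 0" unfolding green_def by (intro sum_nonneg kern_nonneg)

lemma green_mono: "s <= t ==> green s x y <= green t x y" unfolding green_def by (intro sum_mono2) (auto simp: kern_nonneg)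

lemma green_0 [simp]: "green 0 x y = (if x = y then 1 else 0)" by (simp add: green_def)

lemma green_Suc: "green (Suc t) x y = (if x = y then 1 else 0) + avg (%z. green t z y) x"
proof -
 have "green (Suc t) x y = kern 0 x y + (\<Sum>s\<le>t. kern (Suc s) x y)" unfolding green_def by (rule sum.atMost_Suc_shift)
 also have "(\<Sum>s\<le>t. kern (Suc s) x y) = avg (%z. green t z y) x" unfolding green_def avg_sum by simp
 finally show ?thesis by simp
qed

text \<open>Laziness doubles the mean time spent at each visit. In the induction the two halves of
  the lazy recursion reproduce \<open>green\<close> at time t and at time t + 1.\<close>

lemma lazy_green_le: "(\<Sum>s\<le>t. lazy s x y) <= 2*green t x y"
proof (induction t arbitrary: x)
 case (Suc t)
 have "(\<Sum>s\<le>Suc t. lazy s x y) = lazy 0 x y + (\<Sum>s\<le>t. lazy (Suc s) x y)" by (rule sum.atMost_Suc_shift)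
 also have "(\<Sum>s\<le>t. lazy (Suc s) x y) = (\<Sum>s\<le>t. lazy s x y)/2 + avg (%z. \<Sum>s\<le>t. lazy s z y) x/2"
  unfolding avg_sum by (simp add: sum.distrib sum_divide_distrib)
 also have "lazy 0 x y + ... <= (if x = y then 1 else 0) + ((2*green t x y)/2 + avg (%z. 2*green t z y) x/2)"
  using Suc.IH by (intro add_mono divide_right_mono avg_mono) auto
 also have "... = (if x = y then 1 else 0) + green t x y + avg (%z. green t z y) x" unfolding avg_cmult by simp
 also have "... <= 2*green (Suc t) x y" using green_mono[of t "Suc t" x y] unfolding green_Suc by simp
 finally show ?case .
qed (simp add: green_def)

text \<open>The near-diagonal estimate is summed over the times in [t, 2t). The decrements of the
  diagonal telescope, so the total error is r^2 \<open>qd t\<close> against the main term t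
  \<open>qd (2t)\<close>; it can be beaten by taking t a large multiple of r^2. The difference of
  the points enters through any representative \<open>z\<close> modulo \<open>N\<close>.\<close>

lemma green_lower:
 assumes xy: "x \<in> T" "y \<in> T" and z: "!!i. i < d ==> \<bar>z i\<bar> <= int r & z i mod int N = (x i - y i) mod int N"
  and t: "t >= 1"
 shows "2*green (2*t) x y >= real t*qd (2*t) - 2*(real d)^2*(real r)^2*qd t"
proof -
 have lz: "lazy s x y = four (%\<xi>. lam \<xi>^s) z" for s unfolding lazy_four[OF xy] using z by (intro four_cong) auto
 have lzn: "lazy s x y >= 0" for s by (induction s arbitrary: x) (auto intro!: avg_nonneg add_nonneg_nonneg)
 define c where "c = 2*(real d)^2*(real r)^2"
 have "real t*qd (2*t) = (\<Sum>s\<in>{t..<2*t}. qd (2*t))" by simp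
 also have "... <= (\<Sum>s\<in>{t..<2*t}. qd s)" by (intro sum_mono qd_decreasing) auto
 finally have 1: "real t*qd (2*t) <= (\<Sum>s\<in>{t..<2*t}. qd s)" .
 have "c*(qd t - qd (2*t)) <= c*qd t" using order_trans[OF _ qd_ge_unif, of 0] Npos by (intro mult_left_mono) (auto simp: c_def)
 with 1 have "real t*qd (2*t) - c*qd t <= (\<Sum>s\<in>{t..<2*t}. qd s) - c*(qd t - qd (2*t))" by simp
 also have "qd t - qd (2*t) = (\<Sum>s\<in>{t..<2*t}. qd s - qd (Suc s))" by (subst sum_Suc_diff'[of t "2*t" "%s. - qd s", simplified]) auto
 also have "(\<Sum>s\<in>{t..<2*t}. qd s) - c*... = (\<Sum>s\<in>{t..<2*t}. qd s - c*(qd s - qd (Suc s)))"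
  unfolding sum_distrib_left by (simp only: sum_subtractf)
 also have "... <= (\<Sum>s\<in>{t..<2*t}. lazy s x y)"
 proof (intro sum_mono)
  fix s
  show "qd s - c*(qd s - qd (Suc s)) <= lazy s x y" using lazy_four_near_diagonal[of z r s] z unfolding lz c_def by simp
 qed
 also have "... <= (\<Sum>s\<le>2*t. lazy s x y)" using lzn by (intro sum_mono2) auto
 also have "... <= 2*green (2*t) x y" by (rule lazy_green_le)
 finally show ?thesis by (simp add: c_def)
qed

lemma CL_ge: "8*(real d)^2*(1 + 4 * sqrt (real d))^d*(8 * sqrt 2)^d <= real (CL d)"
 unfolding CL_def by (simp add: of_nat_nat le_of_int_ceiling add_increasing2)

text \<open>Radius \<open>N\<close> reaches every pair of points, and from time N^2 on the diagonal
  is of order N^(-d).\<close>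

lemma green_ge_unif: assumes xy: "x \<in> T" "y \<in> T" shows "green (2*(CL d*N^2)) x y >= real (CL d*N^2)/(4*real N^d)"
proof -
 define t where "t = CL d*N^2"
 have CL1: "CL d >= 1" by (simp add: CL_def)
 have t: "t >= 1" "t >= N^2" unfolding t_def using CL1 Npos by (auto simp: Suc_le_eq)
 have "2*green (2*t) x y >= real t*qd (2*t) - 2*(real d)^2*(real N)^2*qd t"
 proof (rule green_lower[where z = "%i. x i - y i", OF xy _ t(1)])
  fix i assume "i < d"
  then show "\<bar>x i - y i\<bar> <= int N & (x i - y i) mod int N = (x i - y i) mod int N"
   using torusD[OF xy(1), of i] torusD[OF xy(2), of i] by auto
 qed
 moreover have "real t*qd (2*t) >= real t*(1/real N^d)" by (intro mult_left_mono qd_ge_unif) auto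
 moreover have "2*(real d)^2*(real N)^2*qd t <= real t*(1/real N^d)/2"
 proof -
  have "sqrt (real t) >= real N" using t by (intro real_le_rsqrt) (simp flip: of_nat_power)
  have "qd t <= (1/real N + 4 * sqrt (real d)/sqrt (real t))^d" using t by (intro qd_upper) auto
  also have "... <= (1/real N + 4 * sqrt (real d)/real N)^d"
   using \<open>sqrt (real t) \<ge> real N\<close> Npos t by (intro power_mono add_mono divide_left_mono) auto
  also have "... = (1 + 4 * sqrt (real d))^d/real N^d" by (simp add: add_divide_distrib[symmetric] power_divide)
  finally have q: "qd t <= (1 + 4 * sqrt (real d))^d/real N^d" .
  have "4*(real d)^2*(1 + 4 * sqrt (real d))^d*1 <= 8*(real d)^2*(1 + 4 * sqrt (real d))^d*(8 * sqrt 2)^d"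
  proof (rule mult_mono)
   have "1 <= sqrt 2" by simp
   then have "1 <= 8 * sqrt 2" by linarith
   then show "1 <= (8 * sqrt 2)^d" by (rule one_le_power)
  qed (auto intro!: mult_right_mono)
  also have "... <= real (CL d)" by (rule CL_ge)
  finally have c: "4*(real d)^2*(1 + 4 * sqrt (real d))^d <= real (CL d)" by simp
  have "2*(real d)^2*(real N)^2*qd t <= 2*(real d)^2*(real N)^2*((1 + 4 * sqrt (real d))^d/real N^d)"
   using q by (intro mult_left_mono) auto
  also have "... = (4*(real d)^2*(1 + 4 * sqrt (real d))^d)*(real N)^2/(2*real N^d)" by simp
  also have "... <= real (CL d)*(real N)^2/(2*real N^d)" using c by (intro divide_right_mono mult_right_mono) auto
  finally show ?thesis unfolding t_def by simp
 qed
 ultimately have "2*green (2*t) x y >= real t*(1/real N^d)/2" by linarith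
 then show ?thesis unfolding t_def[symmetric] by simp
qed

text \<open>Up to time N^2 the diagonal is of order t^(-d/2) from both sides; at t =
  \<open>CL d\<close> r^2 this yields the order r^(2 - d).\<close>

lemma green_ge_local:
 assumes xy: "x \<in> T" "y \<in> T" and z: "!!i. i < d ==> \<bar>z i\<bar> <= int r & z i mod int N = (x i - y i) mod int N"
  and r: "r >= 1" "CL d*r^2 <= N^2"
 shows "green (2*(CL d*r^2)) x y >= cL d*(real r)^2/real r^d"
proof -
 define t where "t = CL d*r^2"
 have CL1: "CL d >= 1" by (simp add: CL_def)
 have t: "t >= 1" "t <= N^2" unfolding t_def using CL1 r by (auto simp: Suc_le_eq)
 have lower: "2*green (2*t) x y >= real t*qd (2*t) - 2*(real d)^2*(real r)^2*qd t" using xy z t(1) by (rule green_lower)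
 define D where "D = 1/sqrt (real t)^d"
 have D0: "D > 0" using t by (simp add: D_def)
 have q2: "qd (2*t) >= 1/(2*(8 * sqrt 2)^d)*D" using qd_ge_sqrt[of "2*t"] t by (simp add: D_def real_sqrt_mult power_mult_distrib)
 have "qd t <= (1/real N + 4 * sqrt (real d)/sqrt (real t))^d" using t by (intro qd_upper) auto
 also have "... <= (1/sqrt (real t) + 4 * sqrt (real d)/sqrt (real t))^d"
 proof -
  have "sqrt (real t) <= real N" using t by (intro real_le_lsqrt) (auto simp flip: of_nat_power)
  then show ?thesis using t Npos by (intro power_mono add_mono divide_left_mono) auto
 qed
 also have "... = (1 + 4 * sqrt (real d))^d*D" by (simp add: add_divide_distrib[symmetric] power_divide D_def)
 finally have q1: "qd t <= (1 + 4 * sqrt (real d))^d*D" .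
 define e where "e = (8 * sqrt 2 :: real)^d"
 have e0: "e > 0" by (simp add: e_def)
 have "2*(real d)^2*(real r)^2*qd t <= 2*(real d)^2*(real r)^2*((1 + 4 * sqrt (real d))^d*D)"
  using q1 by (intro mult_left_mono) auto
 also have "... = (8*(real d)^2*(1 + 4 * sqrt (real d))^d*e)*((real r)^2*D/(4*e))" using e0 by simp
 also have "... <= real (CL d)*((real r)^2*D/(4*e))"
 proof -
  have "(real r)^2*D/(4*e) >= 0" using D0 e0 by simp
  then show ?thesis using CL_ge unfolding e_def by (intro mult_right_mono) auto
 qed
 finally have c1: "2*(real d)^2*(real r)^2*qd t <= real t*D/(4*e)" by (simp add: t_def)
 have c2: "real t*qd (2*t) >= real t*D/(2*e)" using q2 mult_left_mono[of "1/(2*e)*D" "qd (2*t)" "real t"] unfolding e_def by simp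
 have "real t*D/(2*e) - real t*D/(4*e) = real t*D/(4*e)" by (simp add: field_simps)
 with lower c1 c2 have g: "green (2*t) x y >= real t*D/(8*e)" by (simp add: field_simps)
 have "sqrt (real t) = sqrt (real (CL d))*real r" by (simp add: t_def real_sqrt_mult)
 then have D: "D = 1/(sqrt (real (CL d))^d*real r^d)" by (simp add: D_def power_mult_distrib)
 have "cL d*(real r)^2/real r^d = (real r)^2*D/(8*e)" unfolding cL_def D e_def by (simp add: field_simps)
 also have "... <= real t*D/(8*e)"
 proof -
  have "(real r)^2 <= real t" unfolding t_def using CL1 mult_right_mono[of 1 "real (CL d)" "(real r)^2"] by simp
  then show ?thesis using D0 e0 by (intro divide_right_mono mult_right_mono) auto
 qed
 finally show ?thesis using g unfolding t_def by simp
qed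

lemma sum_kern: "x \<in> T ==> (\<Sum>y\<in>T. kern t x y) = 1"
proof (induction t arbitrary: x)
 case (Suc t)
 have "(\<Sum>y\<in>T. kern (Suc t) x y) = avg (%z. \<Sum>y\<in>T. kern t z y) x" unfolding avg_sum by simp
 also have "... = avg (%z. 1) x" unfolding avg_def using Suc.IH by simp
 finally show ?case by (simp add: avg_const)
qed auto

lemma sum_kern_le: "x \<in> T ==> C \<subseteq> T ==> (\<Sum>y\<in>C. kern t x y) <= 1"
 using sum_kern[of x t] sum_mono2[of T C "kern t x"] kern_nonneg by simp

definition greenS :: "nat => pt => pt set => real" where "greenS t x C = (\<Sum>y\<in>C. green t x y)"

lemma greenS_eq: "greenS t x C = (\<Sum>s\<le>t. \<Sum>y\<in>C. kern s x y)" unfolding greenS_def green_def by (rule sum.swap)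

lemma greenS_nonneg: "greenS t x C >= 0" unfolding greenS_def by (intro sum_nonneg green_nonneg)

lemma greenS_mono_t: "s <= t ==> greenS s x C <= greenS t x C" unfolding greenS_def by (intro sum_mono green_mono)

lemma greenS_mono: "C \<subseteq> D ==> finite D ==> greenS t x C <= greenS t x D" unfolding greenS_def by (intro sum_mono2) (auto simp: green_nonneg)

lemma greenS_0: "finite C ==> greenS 0 x C = (if x \<in> C then 1 else 0)" unfolding greenS_def by simp

lemma greenS_Suc: "finite C ==> greenS (Suc t) x C = (if x \<in> C then 1 else 0) + avg (%z. greenS t z C) x"
 unfolding greenS_def green_Suc avg_sum by (simp add: sum.distrib)

lemma greenS_T: "x \<in> T ==> greenS t x T = real t + 1" unfolding greenS_eq by (simp add: sum_kern)

lemma CG_ge1: "CG d >= 1" using CU_gt0 by (simp add: CG_def)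

text \<open>Up to time w^2 a step contributes at most 1; later the heat kernel is summed over at
  most w^d points. Both parts are of order w^2, apart from the equidistributed term.\<close>

lemma greenS_le: assumes "x \<in> T" "C \<subseteq> T" "card C <= w^d" "w >= 1"
 shows "greenS t x C <= CG d*((real w)^2 + real t*real w^d/real N^d)"
proof -
 have late: "(\<Sum>y\<in>C. kern s x y) <= real w^d*(CU d*(1/real N^d + 1/sqrt (real s)^d))" if "s >= 1" for s
 proof -
  have "(\<Sum>y\<in>C. kern s x y) <= (\<Sum>y\<in>C. CU d*(1/real N^d + 1/sqrt (real s)^d))" using assms that by (intro sum_mono kern_le) auto
  also have "... = real (card C)*(CU d*(1/real N^d + 1/sqrt (real s)^d))" by simp
  also have "... <= real w^d*(CU d*(1/real N^d + 1/sqrt (real s)^d))"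
   using assms(3) CU_gt0 by (intro mult_right_mono) (auto simp flip: of_nat_power)
  finally show ?thesis .
 qed
 have "greenS t x C <= (\<Sum>s\<in>{..w^2} \<union> {w^2<..t}. \<Sum>y\<in>C. kern s x y)"
  unfolding greenS_eq by (intro sum_mono2) (auto intro: sum_nonneg kern_nonneg)
 also have "... = (\<Sum>s\<in>{..w^2}. \<Sum>y\<in>C. kern s x y) + (\<Sum>s\<in>{w^2<..t}. \<Sum>y\<in>C. kern s x y)"
  by (rule sum.union_disjoint) auto
 also have "(\<Sum>s\<in>{..w^2}. \<Sum>y\<in>C. kern s x y) <= (\<Sum>s\<in>{..w^2}. 1)"
  using assms by (intro sum_mono sum_kern_le) auto
 also have "(\<Sum>s\<in>{w^2<..t}. \<Sum>y\<in>C. kern s x y) <= (\<Sum>s\<in>{w^2<..t}. real w^d*(CU d*(1/real N^d + 1/sqrt (real s)^d)))"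
  by (intro sum_mono late) auto
 also have "... = real w^d*CU d*(\<Sum>s\<in>{w^2<..t}. 1/real N^d) + real w^d*CU d*(\<Sum>s\<in>{w^2<..t}. 1/sqrt (real s)^d)"
  by (simp only: distrib_left sum.distrib sum_distrib_left mult.assoc)
 also have "real w^d*CU d*(\<Sum>s\<in>{w^2<..t}. 1/sqrt (real s)^d) <= real w^d*CU d*(2*real w^2/real w^d)"
  using CU_gt0 assms d3 by (intro mult_left_mono sum_inverse_sqrt_power_le) auto
 also have "... = 2*CU d*(real w)^2" using assms by simp
 also have "real w^d*CU d*(\<Sum>s\<in>{w^2<..t}. 1/real N^d) <= real w^d*CU d*(real t*(1/real N^d))"
  using CU_gt0 by (intro mult_left_mono) (auto intro!: mult_right_mono divide_right_mono)
 finally have "greenS t x C <= ((real w)^2 + 1) + (real w^d*CU d*(real t*(1/real N^d)) + 2*CU d*(real w)^2)" by simp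
 also have "... <= CG d*(real w)^2 + CG d*(real t*real w^d/real N^d)"
 proof -
  have "1 <= (real w)^2" using assms by simp
  then have "(real w)^2 + 1 + 2*CU d*(real w)^2 <= CG d*(real w)^2" unfolding CG_def by (simp add: algebra_simps)
  moreover have "CU d*(real t*real w^d/real N^d) <= CG d*(real t*real w^d/real N^d)" unfolding CG_def using CU_gt0 by (intro mult_right_mono) auto
  ultimately show ?thesis by (simp add: algebra_simps)
 qed
 finally show ?thesis by (simp add: algebra_simps)
qed

section \<open>Distance on the cycle, Gaussian tails, and Green functions of far points\<close>

definition cd :: "int => int => int" where "cd a b = min ((a - b) mod int N) ((b - a) mod int N)"

lemma cd_nonneg: "cd a b >= 0" unfolding cd_def using Npos by simp

lemma cd_commute: "cd a b = cd b a" by (simp add: cd_def min.commute)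

lemma cd_self [simp]: "cd a a = 0" by (simp add: cd_def)

lemma cd_mod [simp]: "cd (a mod int N) b = cd a b" "cd a (b mod int N) = cd a b" unfolding cd_def by (simp_all add: mod_simps)

lemma cd_witness: "\<exists>z. \<bar>z\<bar> = cd a b & z mod int N = (a - b) mod int N"
proof (cases "(a - b) mod int N <= (b - a) mod int N")
 case True
 then show ?thesis using Npos by (intro exI[of _ "(a - b) mod int N"]) (auto simp: cd_def min_def)
next
 case False
 then have "cd a b = (b - a) mod int N" by (simp add: cd_def min_def)
 moreover have "(- ((b - a) mod int N)) mod int N = (a - b) mod int N" by (metis minus_diff_eq mod_minus_eq)
 ultimately show ?thesis using Npos by (intro exI[of _ "- ((b - a) mod int N)"]) auto
qed

lemma cd_le_abs: assumes "z mod int N = (a - b) mod int N" shows "cd a b <= \<bar>z\<bar>"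
proof -
 have "(b - a) mod int N = (- z) mod int N" by (metis assms minus_diff_eq mod_minus_eq)
 moreover have "z >= 0 ==> z mod int N <= z" using zmod_le_nonneg_dividend by blast
 moreover have "z <= 0 ==> (- z) mod int N <= - z" using zmod_le_nonneg_dividend[of "- z"] by simp
 ultimately show ?thesis using assms unfolding cd_def by linarith
qed

lemma cd_triangle: "cd a c <= cd a b + cd b c"
proof -
 obtain z where z: "\<bar>z\<bar> = cd a b" "z mod int N = (a - b) mod int N" using cd_witness by blast
 obtain w where w: "\<bar>w\<bar> = cd b c" "w mod int N = (b - c) mod int N" using cd_witness by blast
 have "(z + w) mod int N = (a - c) mod int N" using z(2) w(2) mod_add_cong[of z "int N" "a - b" w "b - c"] by simp
 then have "cd a c <= \<bar>z + w\<bar>" by (rule cd_le_abs)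
 then show ?thesis using z w by linarith
qed

text \<open>Formulated by upper bounds, so that distance 0 (through the absolute value) and points
  near the antipode need no separate treatment. This is what an increasing convex function of the
  distance requires.\<close>

lemma cd_neighbours: "(cd a (b + 1) <= cd a b + 1 & cd a (b - 1) <= \<bar>cd a b - 1\<bar>) \<or>
  (cd a (b - 1) <= cd a b + 1 & cd a (b + 1) <= \<bar>cd a b - 1\<bar>)"
proof -
 obtain z where z: "\<bar>z\<bar> = cd a b" "z mod int N = (a - b) mod int N" using cd_witness by blast
 have 1: "(z - 1) mod int N = (a - (b + 1)) mod int N" using mod_diff_cong[OF z(2) refl, of 1] by (simp add: algebra_simps)
 have 2: "(z + 1) mod int N = (a - (b - 1)) mod int N" using mod_add_cong[OF z(2) refl, of 1] by (simp add: algebra_simps)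
 from cd_le_abs[OF 1] cd_le_abs[OF 2] z(1) show ?thesis by linarith
qed

text \<open>On the integers cosh (b x) is an eigenfunction of the walk with eigenvalue cosh b.
  Wrapping around the cycle only decreases it, and steps in other directions leave it
  unchanged.\<close>

lemma avg_cosh_le: assumes "i < d" "0 <= b" shows "avg (%y. cosh (b * of_int (cd a (y i)))) x <= cosh b*cosh (b * of_int (cd a (x i)))"
proof -
 define g where "g y = cosh (b * of_int (cd a (y i)))" for y :: pt
 define c where "c = cd a (x i)"
 have gst: "g (st x e) = cosh (b * of_int (cd a (x i + e i)))" for e unfolding g_def st_nth[OF assms(1)] by simp
 have mono: "cosh (b * of_int k) <= cosh (b * of_int l)" if "0 <= k" "k <= l" for k l :: int
 proof -
  have "b * of_int k <= b * of_int l" "0 <= b * of_int k" using that assms by (auto intro: mult_left_mono)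
  then show ?thesis by (subst cosh_real_nonneg_le_iff) auto
 qed
 have pair: "g (st x (ustep j 1)) + g (st x (ustep j (-1))) <= 2*(cosh b*g x)" if "j < d" for j
 proof (cases "j = i")
  case False
  then have "g (st x (ustep j 1)) = g x" "g (st x (ustep j (-1))) = g x" by (auto simp: gst) (auto simp: g_def)
  moreover have "g x <= cosh b*g x" using mult_right_mono[OF cosh_real_ge_1[of b], of "g x"] by (simp add: g_def)
  ultimately show ?thesis by simp
 next
  case True
  have "cosh (b * of_int (cd a (x i + 1))) + cosh (b * of_int (cd a (x i - 1))) \<le>
   cosh (b * of_int (c + 1)) + cosh (b * of_int \<bar>c - 1\<bar>)"
   using cd_neighbours[of a "x i"]
  proof
   assume "cd a (x i + 1) <= cd a (x i) + 1 & cd a (x i - 1) <= \<bar>cd a (x i) - 1\<bar>"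
   then show ?thesis unfolding c_def by (intro add_mono mono) (auto simp: cd_nonneg)
  next
   assume "cd a (x i - 1) <= cd a (x i) + 1 & cd a (x i + 1) <= \<bar>cd a (x i) - 1\<bar>"
   then have "cosh (b * of_int (cd a (x i - 1))) + cosh (b * of_int (cd a (x i + 1))) \<le>
    cosh (b * of_int (c + 1)) + cosh (b * of_int \<bar>c - 1\<bar>)"
    unfolding c_def by (intro add_mono mono) (auto simp: cd_nonneg)
   then show ?thesis by simp
  qed
  also have "cosh (b * of_int \<bar>c - 1\<bar>) = cosh (b * of_int (c - 1))"
   using cosh_real_abs[of "b * of_int (c - 1)"] assms by (simp add: abs_mult)
  also have "cosh (b * of_int (c + 1)) + cosh (b * of_int (c - 1)) = 2*(cosh b*cosh (b * of_int c))" by (simp add: algebra_simps cosh_add cosh_diff)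
  finally show ?thesis using True assms by (simp add: gst) (simp add: g_def c_def)
 qed
 have "avg g x <= (\<Sum>j<d. 2*(cosh b*g x))/(2*real d)" unfolding avg_def sum_unit_steps by (intro divide_right_mono sum_mono pair) auto
 also have "... = cosh b*g x" using dpos by simp
 finally have "avg g x <= cosh b*g x" .
 moreover have "g = (%y. cosh (b * of_int (cd a (y i))))" by (simp add: g_def fun_eq_iff)
 ultimately show ?thesis by simp
qed

text \<open>Exponential Chebyshev inequality for the cosh of the distance; the choice of
  \<open>b\<close> minimises the exponent t b^2 - b r.\<close>

lemma far_kern_le: assumes "x \<in> T" "i < d" "t >= 1"
 shows "(\<Sum>y | y \<in> T & int r <= cd (x i) (y i). kern t x y) <= 2*exp (- (real r)\<^sup>2/(4*real t))"
proof -
 define b where "b = real r/(2*real t)"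
 have l0: "0 <= b" by (simp add: b_def)
 define g where "g y = cosh (b * of_int (cd (x i) (y i)))" for y :: pt
 have step: "(\<Sum>y\<in>T. kern s z y*g y) <= cosh b^s*g z" if "z \<in> T" for s z using that
 proof (induction s arbitrary: z)
  case 0
  then show ?case by (simp add: if_distrib if_distribR cong: if_cong)
 next
  case (Suc s)
  have "(\<Sum>y\<in>T. kern (Suc s) z y*g y) = avg (%z'. \<Sum>y\<in>T. kern s z' y*g y) z"
   unfolding avg_sum kern.simps by (simp add: avg_cmult[symmetric] mult.commute)
  also have "... <= avg (%z'. cosh b^s*g z') z" using Suc.IH by (intro avg_mono) auto
  also have "... = cosh b^s*avg g z" by (rule avg_cmult)
  also have "... <= cosh b^s*(cosh b*g z)" unfolding g_def using assms l0 by (intro mult_left_mono avg_cosh_le) auto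
  finally show ?case by (simp add: mult_ac)
 qed
 define F where "F = {y. y \<in> T & int r <= cd (x i) (y i)}"
 have "exp (b*real r)/2*(\<Sum>y\<in>F. kern t x y) = (\<Sum>y\<in>F. kern t x y*(exp (b*real r)/2))" by (simp add: sum_distrib_left mult.commute)
 also have "... <= (\<Sum>y\<in>F. kern t x y*g y)"
 proof (intro sum_mono mult_left_mono kern_nonneg)
  fix y assume "y \<in> F"
  then have "real r <= of_int (cd (x i) (y i))" unfolding F_def by simp
  then have "b*real r <= b * of_int (cd (x i) (y i))" using l0 by (rule mult_left_mono)
  then have "exp (b*real r) <= exp (b * of_int (cd (x i) (y i)))" by simp
  also have "... <= 2*g y" unfolding g_def cosh_field_def by simp
  finally show "exp (b*real r)/2 <= g y" by simp
 qed
 also have "... <= (\<Sum>y\<in>T. kern t x y*g y)" by (intro sum_mono2) (auto simp: F_def g_def kern_nonneg)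
 also have "... <= cosh b^t*g x" using assms by (intro step)
 also have "... <= exp (b^2)^t*1" by (intro mult_mono power_mono cosh_le_exp_square) (auto simp: g_def)
 also have "... = exp (real t*b^2)" by (simp add: exp_of_nat_mult)
 finally have "(\<Sum>y\<in>F. kern t x y) <= 2*(exp (real t*b^2)/exp (b*real r))" by (simp add: field_simps)
 also have "exp (real t*b^2)/exp (b*real r) = exp (- (real r)\<^sup>2/(4*real t))"
  unfolding exp_diff[symmetric] using assms by (simp add: b_def power2_eq_square field_simps)
 finally show ?thesis by (simp add: F_def)
qed

definition ball :: "pt => nat => pt set" where "ball x r = {y \<in> T. \<forall>i<d. cd (x i) (y i) <= int r}"

lemma ball_subset [simp]: "ball x r \<subseteq> T" and finite_ball [simp]: "finite (ball x r)" by (auto simp: ball_def)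

lemma ball_mono: "r <= s ==> ball x r \<subseteq> ball x s" by (force simp: ball_def)

lemma ball_self [simp]: "x \<in> T ==> x \<in> ball x r" by (simp add: ball_def)

lemma ball_commute: "x \<in> T ==> y \<in> ball x r ==> x \<in> ball y r" by (simp add: ball_def cd_commute)

lemma ball_trans: "y \<in> ball x r ==> z \<in> ball y s ==> z \<in> ball x (r + s)"
proof -
 assume y: "y \<in> ball x r" and z: "z \<in> ball y s"
 have "cd (x i) (z i) <= int (r + s)" if "i < d" for i using cd_triangle[of "x i" "z i" "y i"] y z that unfolding ball_def by fastforce
 then show ?thesis using z unfolding ball_def by blast
qed

lemma card_ball_le: "card (ball x r) <= (2*r + 1)^d"
proof -
 define B where "B = PiE {..<d} (%_. {- int r..int r})"
 have "ball x r \<subseteq> (%z. torus_proj d N (%i. x i + z i)) ` B"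
 proof
  fix y assume y: "y \<in> ball x r"
  have "\<exists>z. \<bar>z\<bar> <= int r & z mod int N = (y i - x i) mod int N" if "i < d" for i
  proof -
   obtain z where z: "\<bar>z\<bar> = cd (y i) (x i)" "z mod int N = (y i - x i) mod int N" using cd_witness by blast
   moreover have "cd (y i) (x i) <= int r" using y that unfolding ball_def cd_commute[of "y i"] by blast
   ultimately show ?thesis by (intro exI[of _ z]) simp
  qed
  then obtain z where z: "!!i. i < d ==> \<bar>z i\<bar> <= int r & z i mod int N = (y i - x i) mod int N" by metis
  have "y = torus_proj d N (%i. x i + restrict z {..<d} i)"
  proof (rule torus_eqI)
   fix i assume i: "i < d"
   have "(x i + z i) mod int N = (x i + (y i - x i)) mod int N" using z[OF i] mod_add_cong[of "x i" "int N" "x i" "z i" "y i - x i"] by simp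
   then show "y i mod int N = torus_proj d N (%i. x i + restrict z {..<d} i) i mod int N" using i by (simp add: torus_proj_nth)
  qed (use y in \<open>auto simp: ball_def\<close>)
  moreover have "restrict z {..<d} \<in> B" unfolding B_def using z by (auto simp: abs_le_iff) force
  ultimately show "y \<in> (%z. torus_proj d N (%i. x i + z i)) ` B" by blast
 qed
 then have "card (ball x r) <= card ((%z. torus_proj d N (%i. x i + z i)) ` B)"
  unfolding B_def by (intro card_mono finite_imageI finite_PiE) auto
 also have "... <= card B" unfolding B_def by (intro card_image_le finite_PiE) auto
 also have "card B = (2*r + 1)^d" unfolding B_def by (subst card_PiE) (auto simp: nat_add_distrib nat_mult_distrib)
 finally show ?thesis .
qed

lemma greenS_exit_le: assumes "x \<in> T" "t >= 1" "r >= 1"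
 shows "greenS t x (T - ball x r) <= 2*real d*real t*exp (- (real r)\<^sup>2/(4*real t))"
proof -
 have one: "(\<Sum>y\<in>T - ball x r. kern s x y) <= 2*real d*exp (- (real r)\<^sup>2/(4*real t))" if "s \<in> {1..t}" for s
 proof -
  have "(\<Sum>y\<in>T - ball x r. kern s x y) <= (\<Sum>y\<in>(\<Union>i<d. {y. y \<in> T & int r <= cd (x i) (y i)}). kern s x y)"
   by (intro sum_mono2) (auto simp: ball_def kern_nonneg)
  also have "... <= (\<Sum>i<d. \<Sum>y | y \<in> T & int r <= cd (x i) (y i). kern s x y)" by (intro sum_UN_le kern_nonneg) auto
  also have "... <= (\<Sum>i<d. 2*exp (- (real r)\<^sup>2/(4*real s)))" using assms that by (intro sum_mono far_kern_le) auto
  also have "... <= (\<Sum>i<d. 2*exp (- (real r)\<^sup>2/(4*real t)))"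
  proof (intro sum_mono mult_left_mono)
   have "(real r)^2/(4*real t) <= (real r)^2/(4*real s)" using that by (intro divide_left_mono) auto
   then show "exp (- (real r)\<^sup>2/(4*real s)) <= exp (- (real r)\<^sup>2/(4*real t))"
    by (simp only: exp_le_cancel_iff minus_divide_left[symmetric] neg_le_iff_le)
  qed auto
  finally show ?thesis by simp
 qed
 have z: "(\<Sum>y\<in>T - ball x r. kern 0 x y) = 0" using assms by auto
 have "greenS t x (T - ball x r) = (\<Sum>s\<in>insert 0 {1..t}. \<Sum>y\<in>T - ball x r. kern s x y)" unfolding greenS_eq by (rule sum.cong) auto
 also have "... = (\<Sum>s\<in>{1..t}. \<Sum>y\<in>T - ball x r. kern s x y)" using z by simp
 also have "... <= (\<Sum>s\<in>{1..t}. 2*real d*exp (- (real r)\<^sup>2/(4*real t)))" by (intro sum_mono one)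
 finally show ?thesis by (simp add: mult_ac)
qed

text \<open>For times up to r a displacement of more than r is a large deviation; later times are
  summed with the exponent 3/2 of the heat kernel. The decay r^(-1/2) is weaker than the true r^(2 -
  d) but suffices, since the separations used later are high powers of the scale.\<close>

lemma green_far_le: assumes "x \<in> T" "y \<in> T" "y ~: ball x r" "r >= 1"
 shows "green t x y <= CX d*(1/sqrt (real r) + real t/real N^d)"
proof -
 have "x ~= y" using assms by auto
 from assms(2,3) obtain i where i: "i < d" "int r < cd (x i) (y i)" unfolding ball_def by force
 \<comment> \<open>3456 = 2 * 27 * 4^3 comes from \<open>cube_le_exp\<close> at r/4; a factor 2 is
   spare.\<close>
 have early: "kern s x y <= 3456*2/(real r^3)" if "s <= r" for s
 proof (cases "s = 0")
  case False
  then have s: "s >= 1" by simp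
  have "kern s x y <= (\<Sum>y | y \<in> T & int r <= cd (x i) (y i). kern s x y)"
   using assms i by (intro member_le_sum) (auto simp: kern_nonneg)
  also have "... <= 2*exp (- (real r)\<^sup>2/(4*real s))" using assms i s by (intro far_kern_le) auto
  also have "... <= 2*exp (- (real r/4))"
  proof -
   have "real r/4 = (real r)^2/(4*real r)" using assms by (simp add: power2_eq_square)
   also have "... <= (real r)^2/(4*real s)" using s that by (intro divide_left_mono) auto
   finally have "exp (- (real r)\<^sup>2/(4*real s)) <= exp (- (real r/4))"
    by (simp only: exp_le_cancel_iff minus_divide_left[symmetric] neg_le_iff_le)
   then show ?thesis by (rule mult_left_mono) simp
  qed
  also have "... = 2/exp (real r/4)" by (simp only: exp_minus divide_inverse)
  also have "... <= 2/((real r/4)^3/27)" by (rule divide_left_mono[OF cube_le_exp]) (use assms in auto)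
  also have "... = 3456/real r^3" by (simp add: power_divide)
  also have "... <= 3456*2/real r^3" by (simp add: divide_right_mono)
  finally show ?thesis .
 next
  case True
  then show ?thesis using \<open>x \<noteq> y\<close> by simp
 qed
 have "green t x y <= (\<Sum>s\<in>insert 0 {1..r} \<union> {r<..t}. kern s x y)" unfolding green_def by (intro sum_mono2) (auto simp: kern_nonneg)
 also have "... = (\<Sum>s\<in>{1..r}. kern s x y) + (\<Sum>s\<in>{r<..t}. kern s x y)"
  using \<open>x \<noteq> y\<close> by (subst sum.union_disjoint) auto
 also have "(\<Sum>s\<in>{1..r}. kern s x y) <= (\<Sum>s\<in>{1..r}. 3456*2/(real r^3))" by (intro sum_mono early) auto
 also have "... = 6912/(real r)^2" using assms by (simp add: power3_eq_cube power2_eq_square)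
 also have "... <= 6912/sqrt (real r)"
 proof -
  have "sqrt (real r) <= real r" using assms by (intro real_le_lsqrt) (auto simp: power2_eq_square)
  also have "... <= (real r)^2" using assms by (simp add: power2_eq_square)
  finally have "sqrt (real r) <= (real r)^2" .
  then show ?thesis using assms by (intro divide_left_mono) auto
 qed
 also have "(\<Sum>s\<in>{r<..t}. kern s x y) <= (\<Sum>s\<in>{r<..t}. CU d*(1/real N^d + 1/sqrt (real s)^3))"
 proof (intro sum_mono)
  fix s assume s: "s \<in> {r<..t}"
  then have "sqrt (real s)^3 <= sqrt (real s)^d" using d3 by (intro power_increasing) auto
  then have "1/sqrt (real s)^d <= 1/sqrt (real s)^3" using s by (intro divide_left_mono) auto
  then have "CU d*(1/real N^d + 1/sqrt (real s)^d) <= CU d*(1/real N^d + 1/sqrt (real s)^3)" using CU_gt0 by (intro mult_left_mono) auto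
  then show "kern s x y <= CU d*(1/real N^d + 1/sqrt (real s)^3)" using kern_le[OF assms(1,2), of s] s by force
 qed
 also have "... = CU d*(\<Sum>s\<in>{r<..t}. 1/real N^d) + CU d*(\<Sum>s\<in>{r<..t}. 1/sqrt (real s)^3)"
  by (simp only: distrib_left sum.distrib sum_distrib_left)
 also have "... <= CU d*(real t/real N^d) + CU d*(2/sqrt (real r))"
 proof (intro add_mono mult_left_mono)
  show "(\<Sum>s\<in>{r<..t}. 1/real N^d) <= real t/real N^d" by (simp add: divide_right_mono)
  show "(\<Sum>s\<in>{r<..t}. 1/sqrt (real s)^3) <= 2/sqrt (real r)" using sum_inverse_sqrt_cube_le[of r t] assms by (cases "r <= t") auto
 qed (use CU_gt0 in auto)
 finally have "green t x y <= 6912/sqrt (real r) + (CU d*(real t/real N^d) + CU d*(2/sqrt (real r)))" by simp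
 also have "... <= CX d*(1/sqrt (real r)) + CX d*(real t/real N^d)"
 proof -
  have "CU d*(real t/real N^d) <= CX d*(real t/real N^d)" unfolding CX_def using CU_gt0 by (intro mult_right_mono) auto
  moreover have "6912/sqrt (real r) + CU d*(2/sqrt (real r)) = CX d*(1/sqrt (real r))"
   unfolding CX_def by (simp add: algebra_simps add_divide_distrib)
  ultimately show ?thesis by simp
 qed
 finally show ?thesis by (simp add: algebra_simps)
qed

lemma green_ge_ball: assumes "x \<in> T" "y \<in> ball x r" "r >= 1" "CL d*r^2 <= N^2"
 shows "green (2*(CL d*r^2)) x y >= cL d*(real r)^2/real r^d"
proof -
 have "\<exists>z. \<bar>z\<bar> <= int r & z mod int N = (x i - y i) mod int N" if "i < d" for i
  using assms(2) that cd_witness[of "x i" "y i"] unfolding ball_def by force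
 then have "\<exists>z. \<forall>i<d. \<bar>z i\<bar> <= int r & z i mod int N = (x i - y i) mod int N" by metis
 then obtain z where z: "\<forall>i<d. \<bar>z i\<bar> <= int r & z i mod int N = (x i - y i) mod int N" by blast
 show ?thesis using assms z by (intro green_ge_local[of x y z r]) (auto simp: ball_def)
qed

end

section \<open>Expectations over finite walks\<close>

context torus_walk begin

text \<open>Expectation over the list of the n + 1 positions of a walk of n steps. As a finite
  average it keeps measure theory out of the argument until the very end.\<close>

primrec E :: "nat => pt => (pt list => real) => real" where "E 0 x f = f [x]"
| "E (Suc n) x f = avg (%y. E n y (%p. f (x # p))) x"

primrec walks :: "nat => pt => pt list set" where "walks 0 x = {[x]}"
| "walks (Suc n) x = (\<Union>e\<in>unit_steps d. (#) x ` walks n (st x e))"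

lemma walksD: "p \<in> walks n x ==> length p = Suc n & hd p = x & p ~= []" by (induction n arbitrary: x p) auto

lemma walks_set: "p \<in> walks n x ==> x \<in> T ==> set p \<subseteq> T"
proof (induction n arbitrary: x p)
 case (Suc n)
 then obtain e q where q: "q \<in> walks n (st x e)" "p = x # q" by auto
 then show ?case using Suc.IH[OF q(1)] Suc.prems by simp
qed auto

lemma walks_last: "p \<in> walks n x ==> x \<in> T ==> last p \<in> T" using walksD walks_set by (metis last_in_set subsetD)

lemma walks_hd: "p \<in> walks n x ==> x \<in> set p" using walksD by (metis list.set_sel(1))

lemma E_mono: "(!!p. p \<in> walks n x ==> f p <= g p) ==> E n x f <= E n x g"
proof (induction n arbitrary: x f g)
 case (Suc n)
 show ?case unfolding E.simps by (intro avg_mono Suc) auto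
qed auto

lemma E_cong: "(!!p. p \<in> walks n x ==> f p = g p) ==> E n x f = E n x g" by (intro antisym E_mono) auto

lemma E_const [simp]: "E n x (%_. c) = c" by (induction n arbitrary: x) (auto simp: avg_const)

lemma E_add: "E n x (%p. f p + g p) = E n x f + E n x g" by (induction n arbitrary: x f g) (auto simp: avg_add)

lemma E_cmult: "E n x (%p. c*f p) = c*E n x f" by (induction n arbitrary: x f) (auto simp: avg_cmult)

lemma E_sum: "E n x (%p. \<Sum>i\<in>I. f i p) = (\<Sum>i\<in>I. E n x (f i))" by (induction n arbitrary: x f) (auto simp: avg_sum)

lemma E_nonneg: "(!!p. f p >= 0) ==> E n x f >= 0" using E_mono[of n x "%_. 0" f] by simp

lemma E_le_const: "(!!p. p \<in> walks n x ==> f p <= c) ==> E n x f <= c" using E_mono[of n x f "%_. c"] by simp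

text \<open>Markov property. The second piece begins at the last point of the first one, which
  \<open>tl\<close> removes.\<close>

lemma E_append: "E (m + n) x f = E m x (%p. E n (last p) (%q. f (p @ tl q)))"
proof (induction m arbitrary: x f)
 case 0
 have "E n x f = E n x (%q. f ([x] @ tl q))" using walksD by (intro E_cong) (metis append_Cons append_Nil list.collapse)
 then show ?case by simp
next
 case (Suc m)
 have "E (Suc m + n) x f = avg (%y. E m y (%p. E n (last p) (%q. f (x # (p @ tl q))))) x" by (simp add: Suc)
 also have "... = avg (%y. E m y (%p. E n (last (x # p)) (%q. f ((x # p) @ tl q)))) x"
 proof -
  have "E m y (%p. E n (last p) (%q. f (x # (p @ tl q)))) = E m y (%p. E n (last (x # p)) (%q. f ((x # p) @ tl q)))" for y
   using walksD by (intro E_cong) auto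
  then show ?thesis by simp
 qed
 finally show ?case by simp
qed

text \<open>Most later functionals depend on the visited set only. Then the shared point is
  harmless, and the past is carried along in \<open>W\<close>.\<close>

lemma E_append_set:
 "E (m + n) x (%p. f (W \<union> set p)) = E m x (%p. E n (last p) (%q. f ((W \<union> set p) \<union> set q)))"
 unfolding E_append
proof (intro E_cong)
 fix p q assume p: "p \<in> walks m x" and q: "q \<in> walks n (last p)"
 have "set q = insert (last p) (set (tl q))" using walksD[OF q] by (metis list.collapse list.simps(15))
 then have "set (p @ tl q) = set p \<union> set q" using walksD[OF p] last_in_set[of p] by auto
 then show "f (W \<union> set (p @ tl q)) = f ((W \<union> set p) \<union> set q)" by (simp add: Un_assoc)
qed

lemma E_snoc: "E (Suc n) x f = E n x (%p. avg (%y. f (p @ [y])) (last p))" using E_append[of n 1 x f] by simp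

lemma st_inverse: "x \<in> T ==> st (st x e) (%i. - e i) = x" by (rule torus_eqI) (auto simp: st_nth mod_simps)

lemma sum_st: "(\<Sum>x\<in>T. F x (st x e)) = (\<Sum>y\<in>T. F (st y (%i. - e i)) y)"
proof (rule sum.reindex_bij_witness[of _ "%y. st y (%i. - e i)" "%x. st x e"])
 fix y assume "y \<in> T"
 then show "st (st y (%i. - e i)) e = y" using st_inverse[of y "%i. - e i"] by simp
qed (auto simp: st_inverse)

text \<open>Reversibility: translation by a step is a bijection of the torus and the set of steps is
  symmetric.\<close>

lemma sum_avg_swap: "(\<Sum>x\<in>T. avg (F x) x) = (\<Sum>y\<in>T. avg (%z. F z y) y)"
proof -
 have "(\<Sum>x\<in>T. \<Sum>e\<in>unit_steps d. F x (st x e)) = (\<Sum>e\<in>unit_steps d. \<Sum>y\<in>T. F (st y (%i. - e i)) y)"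
  by (subst sum.swap) (simp add: sum_st)
 also have "... = (\<Sum>e\<in>(%e i. - e i) ` unit_steps d. \<Sum>y\<in>T. F (st y e) y)"
  by (subst sum.reindex) (auto simp: inj_on_def fun_eq_iff)
 also have "... = (\<Sum>y\<in>T. \<Sum>e\<in>unit_steps d. F (st y e) y)" unfolding uminus_unit_steps by (rule sum.swap)
 finally show ?thesis unfolding avg_def sum_divide_distrib[symmetric] by simp
qed

text \<open>Makes estimates for the end of a walk from the uniform distribution available for its
  beginning. The induction moves the first position to the other end of the list.\<close>

lemma sum_E_rev: "(\<Sum>x\<in>T. E n x f) = (\<Sum>x\<in>T. E n x (%p. f (rev p)))"
proof (induction n arbitrary: f)
 case (Suc n)
 have "(\<Sum>x\<in>T. E (Suc n) x f) = (\<Sum>y\<in>T. avg (%z. E n y (%p. f (z # p))) y)" unfolding E.simps by (rule sum_avg_swap)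
 also have "... = (\<Sum>y\<in>T. E n y (%p. avg (%z. f (z # p)) (hd p)))"
 proof (intro sum.cong refl)
  fix y
  have "avg (%z. E n y (%p. f (z # p))) y = E n y (%p. avg (%z. f (z # p)) y)"
   unfolding avg_def divide_inverse by (simp add: E_sum[symmetric] E_cmult[symmetric] mult.commute)
  also have "... = E n y (%p. avg (%z. f (z # p)) (hd p))" using walksD by (intro E_cong) auto
  finally show "avg (%z. E n y (%p. f (z # p))) y = E n y (%p. avg (%z. f (z # p)) (hd p))" .
 qed
 also have "... = (\<Sum>y\<in>T. E n y (%p. avg (%z. f (z # rev p)) (hd (rev p))))" by (rule Suc.IH)
 also have "... = (\<Sum>y\<in>T. E (Suc n) y (%p. f (rev p)))" unfolding E_snoc by (simp add: hd_rev)
 finally show ?case .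
qed simp

text \<open>Iterates a contraction that is uniform in the starting point and in the visited set
  \<open>W\<close>. The base case needs monotonicity, because a walk of length 0 still visits its
  starting point.\<close>

lemma E_blocks: assumes step: "!!x W. x \<in> T ==> E n x (%p. F (W \<union> set p)) <= c*F W"
  and anti: "!!W W'. W \<subseteq> W' ==> F W' <= F W" and c: "c >= 0" and x: "x \<in> T"
 shows "E (m*n) x (%p. F (W \<union> set p)) <= c^m*F W"
 using x
proof (induction m arbitrary: x W)
 case 0
 then show ?case using anti[of W "insert x W"] by auto
next
 case (Suc m)
 have "E (Suc m*n) x (%p. F (W \<union> set p)) = E (n + m*n) x (%p. F (W \<union> set p))" by simp
 also have "... = E n x (%p. E (m*n) (last p) (%q. F ((W \<union> set p) \<union> set q)))" by (rule E_append_set)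
 also have "... <= E n x (%p. c^m*F (W \<union> set p))" using Suc by (intro E_mono Suc.IH walks_last) auto
 also have "... = c^m*E n x (%p. F (W \<union> set p))" by (rule E_cmult)
 also have "... <= c^m*(c*F W)" using step[of x W] Suc c by (intro mult_left_mono) auto
 finally show ?case by (simp add: mult_ac)
qed

lemma E_shorter: assumes "!!W W'. W \<subseteq> W' ==> F W' <= F W" "m <= n" "x \<in> T"
 shows "E n x (%p. F (W \<union> set p)) <= E m x (%p. F (W \<union> set p))"
proof -
 have "E n x (%p. F (W \<union> set p)) = E (m + (n - m)) x (%p. F (W \<union> set p))" using assms by simp
 also have "... <= E m x (%p. F (W \<union> set p))" unfolding E_append_set by (intro E_mono E_le_const assms(1)) auto
 finally show ?thesis .
qed

text \<open>First-entrance decomposition of the Green function, in the form of an induction over time.\<close>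

lemma hit_lower: assumes "finite C" and h0: "!!t x. h t x >= 0" and hC: "!!t x. x \<in> C ==> s <= h t x"
  and hstep: "!!t x. x \<in> T ==> x ~: C ==> avg (h t) x <= h (Suc t) x"
  and B: "!!y. y \<in> C ==> greenS t0 y C <= B" "B >= 0" and s: "s >= 0" and "t <= t0" "x \<in> T"
 shows "s*greenS t x C <= B*h t x"
 using \<open>t \<le> t0\<close> \<open>x \<in> T\<close>
proof (induction t arbitrary: x)
 case 0
 show ?case
 proof (cases "x \<in> C")
  case True
  have "s*greenS 0 x C <= s*B" using B(1)[OF True] greenS_mono_t[of 0 t0 x C] s by (intro mult_left_mono) auto
  also have "... <= B*h 0 x" using hC[OF True] B(2) by (simp add: mult.commute mult_left_mono)
  finally show ?thesis .
 next
  case False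
  then show ?thesis using greenS_0[OF assms(1)] h0 B(2) by simp
 qed
next
 case (Suc t)
 show ?case
 proof (cases "x \<in> C")
  case True
  have "s*greenS (Suc t) x C <= s*B" using B(1)[OF True] greenS_mono_t[of "Suc t" t0 x C] s Suc.prems by (intro mult_left_mono) auto
  also have "... <= B*h (Suc t) x" using hC[OF True] B(2) by (simp add: mult.commute mult_left_mono)
  finally show ?thesis .
 next
  case False
  have "s*greenS (Suc t) x C = avg (%y. s*greenS t y C) x" using False by (simp add: greenS_Suc[OF assms(1)] avg_cmult)
  also have "... <= avg (%y. B*h t y) x" using Suc by (intro avg_mono) auto
  also have "... = B*avg (h t) x" by (rule avg_cmult)
  also have "... <= B*h (Suc t) x" using hstep[OF Suc.prems(2) False] B(2) by (intro mult_left_mono) auto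
  finally show ?thesis .
 qed
qed

text \<open>First moment bound by first-step analysis.\<close>

lemma hit_upper: assumes "finite F" shows "E t x (%p. of_bool (set p \<inter> F ~= {})) <= greenS t x F"
proof (induction t arbitrary: x)
 case 0
 then show ?case using assms by (auto simp: greenS_0)
next
 case (Suc t)
 show ?case
 proof (cases "x \<in> F")
  case True
  have "E (Suc t) x (%p. of_bool (set p \<inter> F ~= {})) <= 1" by (intro E_le_const) simp
  also have "... <= greenS (Suc t) x F" using True by (simp add: greenS_Suc[OF assms] avg_nonneg greenS_nonneg)
  finally show ?thesis .
 next
  case False
  have "E (Suc t) x (%p. of_bool (set p \<inter> F ~= {})) = avg (%y. E t y (%p. of_bool (set p \<inter> F ~= {}))) x"
   using False by simp
  also have "... <= avg (%y. greenS t y F) x" using Suc by (intro avg_mono) auto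
  also have "... = greenS (Suc t) x F" using False by (simp add: greenS_Suc[OF assms])
  finally show ?thesis .
 qed
qed

text \<open>The k steps after an entrance are part of the event; so a hitting estimate and an
  estimate for fresh walks started in \<open>C\<close> combine by the Markov property.\<close>

definition entersGood :: "pt set => nat => (pt list => bool) => pt list => bool" where "entersGood C k good p \<longleftrightarrow>
  (\<exists>ys zs. p = ys @ zs & Suc k <= length zs & hd zs \<in> C & good (take (Suc k) zs))"

lemma entersGood_Cons: "entersGood C k good p ==> entersGood C k good (x # p)" unfolding entersGood_def by (metis append_Cons)

text \<open>\<open>hit_lower\<close> with the horizon prolonged by k, so that a good piece fits even
  after an entrance at time t.\<close>

lemma entersGood_lower: assumes "C \<subseteq> T" and s: "s >= 0" "!!y. y \<in> C ==> s <= E k y (%p. of_bool (good p))"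
  and B: "!!y. y \<in> C ==> greenS t y C <= B" "B >= 0" and "x \<in> T"
 shows "s*greenS t x C <= B*E (t + k) x (%p. of_bool (entersGood C k good p))"
proof (rule hit_lower[where h = "%t x. E (t + k) x (%p. of_bool (entersGood C k good p))"])
 show "finite C" using assms(1) finite_torus finite_subset by blast
 show "0 <= E (t + k) x (%p. of_bool (entersGood C k good p))" for t x by (rule E_nonneg) simp
 show "s <= E (t + k) y (%p. of_bool (entersGood C k good p))" if "y \<in> C" for t y
 proof -
  have "s <= E k y (%p. of_bool (good p))" by (rule s(2)[OF that])
  also have "... <= E k y (%p. E t (last p) (%q. of_bool (entersGood C k good (p @ tl q))))"
  proof (rule E_mono)
   fix p assume p: "p \<in> walks k y"
   show "of_bool (good p) <= E t (last p) (%q. of_bool (entersGood C k good (p @ tl q)))"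
   proof (cases "good p")
    case True
    have "entersGood C k good (p @ r)" for r unfolding entersGood_def using walksD[OF p] True that
     by (intro exI[of _ "[]"] exI[of _ "p @ r"]) auto
    then show ?thesis by simp
   qed (auto intro: E_nonneg)
  qed
  also have "... = E (t + k) y (%p. of_bool (entersGood C k good p))" using E_append[of k t y] by (simp add: add.commute)
  finally show ?thesis .
 qed
 show "avg (%x. E (t + k) x (%p. of_bool (entersGood C k good p))) z
   <= E (Suc t + k) z (%p. of_bool (entersGood C k good p))" for t z
  using entersGood_Cons by (auto intro!: avg_mono E_mono)
qed (use assms in auto)

text \<open>From \<open>z\<close> itself the expected number of visits to \<open>z\<close> up to
  time N^d is bounded, so the Green function is bounded by a multiple of the hitting
  probability.\<close>

lemma visit_lower: assumes "z \<in> T" "x \<in> T" "t <= N^d" shows "green t x z <= 2*CG d*E t x (%p. of_bool (z \<in> set p))"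
proof -
 have "1*greenS t x {z} <= (2*CG d)*E t x (%p. of_bool (z \<in> set p))"
 proof (rule hit_lower[where h = "%t x. E t x (%p. of_bool (z \<in> set p))" and ?t0.0 = t])
  show "0 <= E t x (%p. of_bool (z \<in> set p))" for t x by (rule E_nonneg) simp
  show "1 <= E t y (%p. of_bool (z \<in> set p))" if "y \<in> {z}" for t y
  proof -
   have "E t y (%_. 1) <= E t y (%p. of_bool (z \<in> set p))" using that by (intro E_mono) (auto dest: walks_hd)
   then show ?thesis by (simp only: E_const)
  qed
  show "avg (%x. E t x (%p. of_bool (z \<in> set p))) y <= E (Suc t) y (%p. of_bool (z \<in> set p))" for t y
   unfolding E.simps by (intro avg_mono E_mono) auto
  show "greenS t y {z} <= 2*CG d" if "y \<in> {z}" for y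
  proof -
   have "greenS t y {z} <= CG d*((real 1)^2 + real t*real 1^d/real N^d)" using assms that by (intro greenS_le) auto
   also have "... <= CG d*(1 + 1)" using assms CG_ge1 Npos by (intro mult_left_mono) (auto simp: divide_le_eq simp flip: of_nat_power)
   finally show ?thesis by simp
  qed
 qed (use assms CG_ge1 in auto)
 then show ?thesis by (simp add: greenS_def)
qed

text \<open>At least half of the time is spent outside \<open>A\<close> on average, and by
  \<open>visit_lower\<close> the expected number of distinct points is comparable with that time.
  Since it never exceeds t + 1, it is of order t with probability bounded below.\<close>

lemma new_points: assumes "x \<in> T" "A \<subseteq> T" "1 <= t" "t <= N^d" and A: "greenS t x A <= real t/2"
 shows "1/(16*CG d) <= E t x (%p. of_bool (real t/(8*CG d) <= real (card (set p - A))))"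
proof -
 define m where "m = real t/(8*CG d)"
 define pr where "pr = E t x (%p. of_bool (m <= real (card (set p - A))))"
 have C1: "CG d >= 1" by (rule CG_ge1)
 have fA: "finite A" using assms(2) finite_torus finite_subset by blast
 have card: "real (card (set p - A)) = (\<Sum>z\<in>T - A. of_bool (z \<in> set p))" if "p \<in> walks t x" for p
 proof -
  have "set p - A = {z \<in> T - A. z \<in> set p}" using walks_set[OF that assms(1)] by auto
  then show ?thesis by (simp add: Int_def)
 qed
 have "real t/2 <= greenS t x T - greenS t x A" using greenS_T[OF assms(1), of t] A by simp
 also have "... = greenS t x (T - A)" unfolding greenS_def using assms(2) fA by (simp add: sum_diff)
 also have "... <= (\<Sum>z\<in>T - A. 2*CG d*E t x (%p. of_bool (z \<in> set p)))"
  unfolding greenS_def using assms by (intro sum_mono visit_lower) auto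
 also have "... = 2*CG d*E t x (%p. real (card (set p - A)))"
 proof -
  have "E t x (%p. real (card (set p - A))) = (\<Sum>z\<in>T - A. E t x (%p. of_bool (z \<in> set p)))"
   unfolding E_sum[symmetric] by (rule E_cong) (rule card)
  then show ?thesis by (simp only: sum_distrib_left)
 qed
 also have "... <= 2*CG d*E t x (%p. (real t + 1) * of_bool (m <= real (card (set p - A))) + m)"
 proof (intro mult_left_mono E_mono)
  fix p assume p: "p \<in> walks t x"
  have "card (set p - A) <= card (set p)" by (intro card_mono) auto
  also have "... <= length p" by (rule card_length)
  also have "... = t + 1" using walksD[OF p] by simp
  finally have "real (card (set p - A)) <= real t + 1" by simp
  moreover have "m >= 0" using C1 by (simp add: m_def)
  ultimately show "real (card (set p - A)) <= (real t + 1) * of_bool (m <= real (card (set p - A))) + m"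
   by (cases "m <= real (card (set p - A))") auto
 qed (use C1 in auto)
 also have "... = 2*CG d*((real t + 1)*pr + m)" unfolding E_add E_cmult pr_def by simp
 also have "2*CG d*m = real t/4" unfolding m_def using C1 by simp
 then have "2*CG d*((real t + 1)*pr + m) = 2*CG d*((real t + 1)*pr) + real t/4" by (simp add: distrib_left)
 finally have 1: "real t/4 <= 2*CG d*((real t + 1)*pr)" by simp
 also have "... <= 2*CG d*((2*real t)*pr)" using assms(3) C1 by (intro mult_left_mono mult_right_mono) (auto simp: pr_def intro!: E_nonneg)
 finally have "1/16 <= CG d*pr" using assms(3) by (simp add: field_simps)
 then have "1/(16*CG d) <= pr" using C1 by (simp add: field_simps)
 then show ?thesis by (simp add: pr_def m_def)
qed

lemma new_points_local: assumes "x \<in> T" "A \<subseteq> T" "1 <= t" "t <= N^d" "r >= 1" and A: "greenS t x A <= real t/2"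
  and r: "2*real d*real t*exp (- (real r)\<^sup>2/(4*real t)) <= 1/(32*CG d)"
 shows "1/(32*CG d) \<le> E t x (%p. of_bool (set p \<subseteq> ball x r & real t/(8*CG d) <= real (card (set p - A))))"
proof -
 have "1/(16*CG d) <= E t x (%p. of_bool (real t/(8*CG d) <= real (card (set p - A))))" using assms by (intro new_points) auto
 also have "... <= E t x (%p. of_bool (set p \<subseteq> ball x r & real t/(8*CG d) <= real (card (set p - A)))
   + of_bool (set p \<inter> (T - ball x r) ~= {}))"
  using walks_set[OF _ assms(1)] by (intro E_mono) auto
 also have "... = E t x (%p. of_bool (set p \<subseteq> ball x r & real t/(8*CG d) <= real (card (set p - A))))
   + E t x (%p. of_bool (set p \<inter> (T - ball x r) ~= {}))" by (rule E_add)
 also have "E t x (%p. of_bool (set p \<inter> (T - ball x r) ~= {})) <= greenS t x (T - ball x r)" by (rule hit_upper) simp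
 also have "... <= 1/(32*CG d)" using greenS_exit_le[of x t r] assms by simp
 finally show ?thesis by (simp add: field_simps)
qed

end

section \<open>Growing connected clusters simultaneously in several regions\<close>

context torus_walk begin

section \<open>Connectivity inside a set and pieces of a walk as connected sets\<close>

definition adj :: "pt => pt => bool" where "adj x y \<longleftrightarrow> torus_dist d N x y = 1"

definition conn :: "pt set => pt => pt => bool" where
 "conn S x y \<longleftrightarrow> x \<in> S & (x, y) \<in> {(a, b). a \<in> S & b \<in> S & adj a b}\<^sup>*"

lemma adj_sym: "adj x y ==> adj y x" by (simp add: adj_def torus_dist_def min.commute)

lemma adj_st: "e \<in> unit_steps d ==> adj x (st x e)"
proof -
 assume "e \<in> unit_steps d"
 then obtain j s where js: "j < d" "s \<in> {1, -1}" "e = ustep j s" unfolding unit_steps_eq by auto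
 have "(\<Sum>i<d. min ((x i - st x e i) mod int N) ((st x e i - x i) mod int N)) = (\<Sum>i<d. if i = j then 1 else 0)"
 proof (intro sum.cong refl)
  fix i assume i: "i \<in> {..<d}"
  have "(x i - st x e i) mod int N = (- e i) mod int N" "(st x e i - x i) mod int N = e i mod int N" using i by (simp_all add: st_nth mod_simps)
  moreover have "1 mod int N = 1" "(-1) mod int N = int N - 1" using N3 by (auto simp: zmod_minus1)
  ultimately show "min ((x i - st x e i) mod int N) ((st x e i - x i) mod int N) = (if i = j then 1 else 0)" using js N3 by auto
 qed
 also have "... = 1" using js by simp
 finally show ?thesis by (simp add: adj_def torus_dist_def)
qed

lemma walks_successively: "p \<in> walks n x ==> successively adj p"
proof (induction n arbitrary: x p)
 case (Suc n)
 then obtain e q where q: "e \<in> unit_steps d" "q \<in> walks n (st x e)" "p = x # q" by auto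
 then show ?case using Suc.IH[OF q(2)] walksD[OF q(2)] adj_st[OF q(1)] by (simp add: successively_Cons)
qed auto

lemma power_split_d: "real w^d = real w^(d - 2)*(real w)^2"
proof -
 have "d = (d - 2) + 2" using d3 by simp
 then show ?thesis by (metis power_add)
qed

lemma conn_refl: "x \<in> S ==> conn S x x" by (simp add: conn_def)

lemma conn_mem: "conn S x y ==> x \<in> S & y \<in> S" unfolding conn_def by (auto elim: rtranclE)

lemma conn_mono: "conn S x y ==> S \<subseteq> S' ==> conn S' x y" unfolding conn_def by (auto elim!: rtrancl_mono[THEN subsetD, rotated])

lemma conn_trans: "conn S x y ==> conn S y z ==> conn S x z" unfolding conn_def by auto

lemma conn_sym: "conn S x y ==> conn S y x"
proof -
 assume c: "conn S x y"
 have "sym {(a, b). a \<in> S & b \<in> S & adj a b}" using adj_sym by (auto simp: sym_def)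
 then have "sym ({(a, b). a \<in> S & b \<in> S & adj a b}\<^sup>*)" by (rule sym_rtrancl)
 then show ?thesis using c conn_mem[OF c] unfolding conn_def by (auto dest: symD)
qed

lemma conn_list: assumes "successively adj p" "set p \<subseteq> S" "y \<in> set p" shows "conn S (hd p) y" using assms
proof (induction p)
 case (Cons a p)
 show ?case
 proof (cases "y = a")
  case True
  then show ?thesis using Cons.prems by (auto intro: conn_refl)
 next
  case False
  then have y: "y \<in> set p" using Cons by auto
  then have "p ~= []" by auto
  then have "adj a (hd p)" "successively adj p" using Cons.prems by (auto simp: successively_Cons)
  moreover have "hd p \<in> S" "a \<in> S" using \<open>p \<noteq> []\<close> Cons.prems by auto
  ultimately have "conn S a (hd p)" unfolding conn_def by auto
  moreover have "conn S (hd p) y" using Cons y \<open>successively adj p\<close> by auto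
  ultimately show ?thesis by (auto intro: conn_trans)
 qed
qed auto

definition comp :: "pt set => pt => pt set" where "comp S x = {y. conn S x y}"

lemma comp_subset: "comp S x \<subseteq> S" using conn_mem by (auto simp: comp_def)

lemma comp_mono: "S \<subseteq> S' ==> comp S x \<subseteq> comp S' x" using conn_mono by (auto simp: comp_def)

text \<open>Turns the event into geometry: the good piece becomes a connected list of visited points
  that starts in \<open>C\<close>.\<close>

lemma entersGood_conn: assumes p: "p \<in> walks n x" and e: "entersGood C k good p"
 obtains zs where "hd zs \<in> C" "good zs" "set zs \<subseteq> set p" "zs ~= []" "length zs = Suc k"
  "!!S y. set zs \<subseteq> S ==> y \<in> set zs ==> conn S (hd zs) y"
proof -
 from e obtain ys qs where q: "p = ys @ qs" "Suc k <= length qs" "hd qs \<in> C" "good (take (Suc k) qs)" unfolding entersGood_def by blast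
 define zs where "zs = take (Suc k) qs"
 have succ: "successively adj p" by (rule walks_successively[OF p])
 then have "successively adj qs" using q by (simp add: successively_append_iff)
 then have "successively adj (zs @ drop (Suc k) qs)" by (simp add: zs_def)
 then have "successively adj zs" by (simp add: successively_append_iff)
 moreover have "zs ~= []" using q by (auto simp: zs_def)
 moreover have "hd zs = hd qs" using q by (cases qs) (auto simp: zs_def)
 moreover have "set zs \<subseteq> set p" using q set_take_subset[of "Suc k" qs] by (auto simp: zs_def)
 moreover have "length zs = Suc k" using q by (simp add: zs_def)
 ultimately show ?thesis using q conn_list[of zs] by (intro that[of zs]) (auto simp: zs_def)
qed

text \<open>The horizon of \<open>green_ge_unif\<close>: by then every point has received a fixed
  fraction of its uniform share of the time.\<close>

definition tmix :: nat where "tmix = 2*(CL d*N^2)"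

lemma tmix_pos: "tmix >= 1" using Npos by (simp add: tmix_def CL_def Suc_le_eq)

lemma greenS_tmix_ge: assumes "x \<in> T" "C \<subseteq> T" shows "real (card C)*(real tmix/(8*real N^d)) <= greenS tmix x C"
proof -
 have "(\<Sum>y\<in>C. real tmix/(8*real N^d)) <= (\<Sum>y\<in>C. green tmix x y)"
  using green_ge_unif[OF assms(1)] assms(2) unfolding tmix_def by (intro sum_mono) auto
 then show ?thesis by (simp add: greenS_def)
qed

text \<open>Substitute for independence: from a point of one region, the expected time in all the
  other regions together is at most 1.\<close>

definition sep :: "'j set => ('j => pt set) => bool" where
 "sep J reg \<longleftrightarrow> finite J & (\<forall>j\<in>J. reg j \<subseteq> T) & disjoint_family_on reg J \<and>
  (\<forall>j\<in>J. \<forall>y\<in>reg j. (\<Sum>i\<in>J - {j}. greenS tmix y (reg i)) <= 1)"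

lemma sep_subset: assumes "sep J reg" "I \<subseteq> J" shows "sep I reg" unfolding sep_def
proof (intro conjI ballI)
 show "finite I" using assms finite_subset by (auto simp: sep_def)
 show "disjoint_family_on reg I" using assms disjoint_family_on_mono by (auto simp: sep_def)
 fix j assume j: "j \<in> I"
 show "reg j \<subseteq> T" using assms j by (auto simp: sep_def)
 fix y assume y: "y \<in> reg j"
 have "(\<Sum>i\<in>I - {j}. greenS tmix y (reg i)) <= (\<Sum>i\<in>J - {j}. greenS tmix y (reg i))"
  using assms by (intro sum_mono2) (auto simp: sep_def greenS_nonneg)
 also have "... <= 1" using assms j y by (auto simp: sep_def)
 finally show "(\<Sum>i\<in>I - {j}. greenS tmix y (reg i)) <= 1" .
qed

definition kap :: real where "kap = 1/(8*(2*CG d + 1))"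

lemma kap_pos: "kap > 0" using CG_ge1 by (simp add: kap_def)

text \<open>The expected time in the union of the targets is proportional to \<open>card J\<close>.
  From a point of a target, the time in all targets is of order w^2: its own by
  \<open>greenS_le\<close>, the others by separation. The quotient of the two bounds the entrance
  probability from below, and it is additive in the regions.\<close>

lemma multi_hit: assumes sep: "sep J reg" and C: "!!j. j \<in> J ==> C j \<subseteq> reg j & card (C j) = w^d" and w: "w >= 1"
  and wN: "real tmix*real w^d <= (real w)^2*real N^d"
  and s: "s >= 0" "!!j y. j \<in> J ==> y \<in> C j ==> s <= E k y (%p. of_bool (good p))" and x: "x \<in> T"
 shows "s*kap*real (card J)*(real tmix*real w^(d - 2)/real N^d)
  <= E (tmix + k) x (%p. of_bool (entersGood (\<Union>j\<in>J. C j) k good p))" (is "_ <= ?P")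
proof -
 have fJ: "finite J" and regT: "!!j. j \<in> J ==> reg j \<subseteq> T" and disj: "disjoint_family_on reg J"
  and cross: "!!j y. j \<in> J ==> y \<in> reg j ==> (\<Sum>i\<in>J - {j}. greenS tmix y (reg i)) <= 1"
  using sep by (auto simp: sep_def)
 have CT: "C j \<subseteq> T" if "j \<in> J" for j using C regT that by blast
 have finC: "finite (C j)" if "j \<in> J" for j using CT[OF that] finite_torus finite_subset by blast
 have finreg: "finite (reg j)" if "j \<in> J" for j using regT[OF that] finite_torus finite_subset by blast
 define U where "U = (\<Union>j\<in>J. C j)"
 have "disjoint_family_on C J" using disj C unfolding disjoint_family_on_def by blast
 then have cU: "card U = card J*w^d" unfolding U_def using fJ finC C by (subst card_UN_disjoint) (auto simp: disjoint_family_on_def)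
 have UT: "U \<subseteq> T" using CT by (auto simp: U_def)
 have Bb: "greenS tmix y U <= (2*CG d + 1)*(real w)^2" if "y \<in> U" for y
 proof -
  from that obtain j where j: "j \<in> J" "y \<in> C j" by (auto simp: U_def)
  have "greenS tmix y U <= (\<Sum>i\<in>J. greenS tmix y (C i))"
   unfolding greenS_def U_def using fJ finC by (intro sum_UN_le) (auto simp: green_nonneg)
  also have "... = greenS tmix y (C j) + (\<Sum>i\<in>J - {j}. greenS tmix y (C i))" using fJ j by (simp add: sum.remove)
  also have "(\<Sum>i\<in>J - {j}. greenS tmix y (C i)) <= (\<Sum>i\<in>J - {j}. greenS tmix y (reg i))"
   using C finreg by (intro sum_mono greenS_mono) auto
  also have "... <= 1" using cross j C by blast
  also have "greenS tmix y (C j) <= CG d*((real w)^2 + real tmix*real w^d/real N^d)" using j CT C w by (intro greenS_le) auto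
  also have "... <= CG d*((real w)^2 + (real w)^2)"
   using wN CG_ge1 Npos by (intro mult_left_mono add_left_mono) (auto simp: divide_le_eq)
  also have "CG d*((real w)^2 + (real w)^2) + 1 <= CG d*((real w)^2 + (real w)^2) + (real w)^2" using w by simp
  finally show ?thesis by (simp add: algebra_simps)
 qed
 have "s*greenS tmix x U <= ((2*CG d + 1)*(real w)^2)*?P" unfolding U_def[symmetric]
  by (rule entersGood_lower[OF UT s(1) _ Bb _ x]) (use s(2) CG_ge1 in \<open>auto simp: U_def\<close>)
 moreover have "s*(real (card J*w^d)*(real tmix/(8*real N^d))) <= s*greenS tmix x U"
  using greenS_tmix_ge[OF x UT] cU s(1) by (intro mult_left_mono) auto
 ultimately have "s*(real (card J*w^d)*(real tmix/(8*real N^d))) <= ((2*CG d + 1)*(real w)^2)*?P" by simp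
 moreover have "real w^d = real w^(d - 2)*(real w)^2" by (rule power_split_d)
 ultimately have "(s*kap*real (card J)*(real tmix*real w^(d - 2)/real N^d))*((2*CG d + 1)*(real w)^2) <= ?P*((2*CG d + 1)*(real w)^2)"
 proof -
  have kapeq: "kap*(2*CG d + 1) = 1/8" unfolding kap_def using CG_ge1 by simp
  have "(s*kap*real (card J)*(real tmix*real w^(d - 2)/real N^d))*((2*CG d + 1)*(real w)^2)
    = (kap*(2*CG d + 1))*(s*(real (card J)*(real w^(d - 2)*(real w)^2)*(real tmix/real N^d)))"
   by (simp only: mult_ac times_divide_eq_left times_divide_eq_right)
  also have "... = s*(real (card J*w^d)*(real tmix/(8*real N^d)))"
   unfolding kapeq using \<open>real w ^ d = real w ^ (d - 2) * (real w)\<^sup>2\<close> by simp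
  finally show ?thesis
   using \<open>s * (real (card J * w ^ d) * (real tmix / (8 * real N ^ d))) \<le> ((2 * CG d + 1) * (real w)\<^sup>2) * ?P\<close>
   by (simp only: mult.commute)
 qed
 moreover have "0 < (2*CG d + 1)*(real w)^2" using CG_ge1 w by (intro mult_pos_pos) auto
 ultimately show ?thesis by (rule mult_right_le_imp_le)
qed

lemma blocks_exp: assumes F: "!!x W. x \<in> T ==> E n x (%p. F (W \<union> set p)) <= (1 - q)*F W"
  and anti: "!!W W'. W \<subseteq> W' ==> F W' <= F W" and F01: "!!W. 0 <= F W" "!!W. F W <= 1"
  and q: "0 <= q" "q <= 1" and x: "x \<in> T"
 shows "E (m*n) x (%p. F (W \<union> set p)) <= exp (- (real m*q))"
proof -
 have "E (m*n) x (%p. F (W \<union> set p)) <= (1 - q)^m*F W" using assms by (intro E_blocks) auto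
 also have "... <= exp (- q)^m*1" using q F01 exp_ge_add_one_self[of "- q"] by (intro mult_mono power_mono) auto
 also have "... = exp (- (real m*q))" by (simp add: exp_of_nat_mult[symmetric])
 finally show ?thesis .
qed

text \<open>\<open>multi_hit\<close> with pieces of length 0 in each of the m blocks.\<close>

lemma multi_visit: assumes sep: "sep J reg" and C: "!!j. j \<in> J ==> C j \<subseteq> reg j & card (C j) = w^d" and w: "w >= 1"
  and wN: "real tmix*real w^d <= (real w)^2*real N^d"
  and m: "v * real N^d <= real m*real tmix" and x: "x \<in> T"
 shows "E (m*tmix) x (%p. of_bool (\<forall>j\<in>J. set p \<inter> C j = {})) <= exp (- (real (card J)*(kap * v * real w^(d - 2))))"
proof -
 define q where "q = kap*real (card J)*(real tmix*real w^(d - 2)/real N^d)"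
 have q0: "q >= 0" using kap_pos by (simp add: q_def)
 define F :: "pt set => real" where "F W = of_bool (\<forall>j\<in>J. W \<inter> C j = {})" for W
 have hit: "q <= E tmix y (%p. of_bool (entersGood (\<Union>j\<in>J. C j) 0 (%_. True) p))" if "y \<in> T" for y
  using multi_hit[of J reg C w 1 0 "%_. True", OF sep C w wN _ _ that] by (simp add: q_def)
 have hit2: "E tmix y (%p. of_bool (\<forall>j\<in>J. set p \<inter> C j = {})) <= 1 - q" if "y \<in> T" for y
 proof -
  have "E tmix y (%p. of_bool (\<forall>j\<in>J. set p \<inter> C j = {})) \<le>
   E tmix y (%p. 1 + (-1) * of_bool (entersGood (\<Union>j\<in>J. C j) 0 (%_. True) p))"
  proof (rule E_mono)
   fix p assume p: "p \<in> walks tmix y"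
   have "~ (\<forall>j\<in>J. set p \<inter> C j = {})" if "entersGood (\<Union>j\<in>J. C j) 0 (%_. True) p"
    using entersGood_conn[OF p that] by (metis (no_types, lifting) UN_E disjoint_iff hd_in_set subsetD)
   then show "of_bool (\<forall>j\<in>J. set p \<inter> C j = {}) <= 1 + (-1)*(of_bool (entersGood (\<Union>j\<in>J. C j) 0 (%_. True) p) :: real)"
    by (auto simp: of_bool_def)
  qed
  also have "... = 1 - E tmix y (%p. of_bool (entersGood (\<Union>j\<in>J. C j) 0 (%_. True) p))" unfolding E_add E_cmult by simp
  finally show ?thesis using hit[OF that] by simp
 qed
 \<comment> \<open>No condition on the parameters: q bounds a probability from below.\<close>
 have q1: "q <= 1" using hit2[OF x] E_nonneg[of "%p. of_bool (\<forall>j\<in>J. set p \<inter> C j = {})" tmix x] by simp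
 have "E (m*tmix) x (%p. F ({} \<union> set p)) <= exp (- (real m*q))"
 proof (rule blocks_exp)
  fix y W assume y: "y \<in> T"
  have "E tmix y (%p. F (W \<union> set p)) = E tmix y (%p. F W * of_bool (\<forall>j\<in>J. set p \<inter> C j = {}))"
   by (intro E_cong) (auto simp: F_def)
  also have "... <= F W*(1 - q)" unfolding E_cmult using hit2[OF y] by (intro mult_left_mono) (auto simp: F_def)
  finally show "E tmix y (%p. F (W \<union> set p)) <= (1 - q)*F W" by (simp add: mult.commute)
 qed (use q0 q1 x in \<open>auto simp: F_def\<close>)
 also have "... <= exp (- (real (card J)*(kap * v * real w^(d - 2))))"
 proof -
  have "(v * real N^d)*(kap*real (card J)*real w^(d - 2)) <= (real m*real tmix)*(kap*real (card J)*real w^(d - 2))"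
   using m kap_pos by (intro mult_right_mono) auto
  then have "real (card J)*(kap * v * real w^(d - 2)) <= real m*q" using Npos by (simp add: q_def field_simps)
  then show ?thesis by simp
 qed
 finally show ?thesis by (simp add: F_def)
qed

text \<open>Potential argument. While all clusters are small, a block enters one of them and adds
  \<open>m0\<close> points to it with a probability q proportional to \<open>card J\<close>; this at
  least halves exp (- S / m0), where S is the total size. If all clusters stay small, S is at most
  card J * V, so undoing the weight costs the factor exp (card J * V / m0).\<close>

lemma cluster_growth:
 fixes c root :: "'j => pt"
 assumes sep: "sep J reg" and w: "w >= 1" and wN: "real tmix*real w^d <= (real w)^2*real N^d"
  and big: "!!j. j \<in> J ==> w^d <= card (comp (W0 \<inter> ball (c j) rho) (root j))"
  and reg: "!!j. j \<in> J ==> ball (c j) (rho + K) \<subseteq> reg j"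
  and tau: "1 <= tau" "tau <= N^d" and K: "K >= 1"
  and exit: "2*real d*real tau*exp (- (real K)\<^sup>2/(4*real tau)) <= 1/(32*CG d)"
  and V: "!!y A. y \<in> T ==> A \<subseteq> T ==> real (card A) < V ==> greenS tau y A <= real tau/2"
  and m: "v * real N^d <= real m*real tmix" and x: "x \<in> T"
 shows "E (m*(tmix + tau)) x (%p. of_bool (\<forall>j\<in>J. real (card (comp ((W0 \<union> set p) \<inter> ball (c j) (rho + K)) (root j))) < V))
  <= exp (real (card J)*(8*CG d*V/real tau - kap/(64*CG d) * v * real w^(d - 2)))"
proof -
 have C1: "CG d >= 1" by (rule CG_ge1)
 have fJ: "finite J" and regT: "!!j. j \<in> J ==> reg j \<subseteq> T" using sep by (auto simp: sep_def)
 \<comment> \<open>Exactly w^d points of each initial cluster serve as targets throughout, so the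
   hitting rate is the same in every block.\<close>
 have "\<exists>C. \<forall>j\<in>J. C j \<subseteq> comp (W0 \<inter> ball (c j) rho) (root j) & card (C j) = w^d"
  using big by (intro bchoice) (meson obtain_subset_with_card_n)
 then obtain C where C: "!!j. j \<in> J ==> C j \<subseteq> comp (W0 \<inter> ball (c j) rho) (root j)"
  "!!j. j \<in> J ==> card (C j) = w^d" by blast
 have Cball: "C j \<subseteq> ball (c j) rho" if "j \<in> J" for j using C(1)[OF that] comp_subset by blast
 have Creg: "C j \<subseteq> reg j" if "j \<in> J" for j using Cball[OF that] reg[OF that] ball_mono[of rho "rho + K" "c j"] by auto
 define A where "A W j = comp ((W0 \<union> W) \<inter> ball (c j) (rho + K)) (root j)" for W j
 have finA: "finite (A W j)" for W j unfolding A_def by (rule finite_subset[OF comp_subset]) auto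
 have A_T: "A W j \<subseteq> T" for W j unfolding A_def using comp_subset ball_subset by blast
 have A_mono: "A W j \<subseteq> A W' j" if "W \<subseteq> W'" for W W' j unfolding A_def using that by (intro comp_mono) auto
 have CA: "C j \<subseteq> A W j" if "j \<in> J" for W j
 proof -
  have "comp (W0 \<inter> ball (c j) rho) (root j) \<subseteq> A W j"
   unfolding A_def using ball_mono[of rho "rho + K" "c j"] by (intro comp_mono) auto
  then show ?thesis using C(1)[OF that] by blast
 qed
 define m0 where "m0 = real tau/(8*CG d)"
 have m0: "m0 > 0" using tau C1 by (simp add: m0_def)
 define S where "S W = (\<Sum>j\<in>J. real (card (A W j)))" for W
 have S_mono: "S W <= S W'" if "W \<subseteq> W'" for W W' unfolding S_def
 proof (intro sum_mono)
  fix j show "real (card (A W j)) <= real (card (A W' j))" using card_mono[OF finA A_mono[OF that]] of_nat_le_iff by blast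
 qed
 define small where "small W \<longleftrightarrow> (\<forall>j\<in>J. real (card (A W j)) < V)" for W
 have small_mono: "small W" if "W \<subseteq> W'" "small W'" for W W'
 proof -
  have "card (A W j) <= card (A W' j)" for j by (rule card_mono[OF finA A_mono[OF that(1)]])
  then show ?thesis using that(2) unfolding small_def by (metis of_nat_le_iff order_le_less_trans)
 qed
 define F where "F W = of_bool (small W)*exp (- S W/m0)" for W
 have anti: "F W' <= F W" if "W \<subseteq> W'" for W W'
 proof -
  have "- S W'/m0 <= - S W/m0" using S_mono[OF that] m0 by (intro divide_right_mono) auto
  then show ?thesis using small_mono[OF that] unfolding F_def by (auto simp: of_bool_def)
 qed
 have S0: "S W >= 0" for W by (simp add: S_def sum_nonneg)
 have F01: "0 <= F W" "F W <= 1" for W unfolding F_def using S0[of W] m0 by (auto simp: of_bool_def)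
 define s where "s = 1/(32*CG d)"
 define q where "q = s*kap*real (card J)*(real tmix*real w^(d - 2)/real N^d)"
 have q0: "q >= 0" unfolding q_def s_def using kap_pos C1 by simp
 have hit: "q <= E (tmix + tau) y (%p. of_bool (entersGood (\<Union>j\<in>J. C j) tau
   (%zs. \<exists>j\<in>J. hd zs \<in> C j & set zs \<subseteq> ball (hd zs) K & m0 <= real (card (set zs - A W j))) p))"
  if y: "y \<in> T" and sm: "small W" for y W
  unfolding q_def
 proof (rule multi_hit[OF sep _ w wN _ _ y])
  show "C j \<subseteq> reg j & card (C j) = w^d" if "j \<in> J" for j using Creg C that by auto
  show "s >= 0" using C1 by (simp add: s_def)
  fix j z assume j: "j \<in> J" and z: "z \<in> C j"
  have zT: "z \<in> T" using z Cball[OF j] ball_subset by blast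
  have "s <= E tau z (%p. of_bool (set p \<subseteq> ball z K & m0 <= real (card (set p - A W j))))"
   unfolding s_def m0_def using zT A_T tau K exit sm j
   by (intro new_points_local V) (auto simp: small_def)
  also have "... <= E tau z (%p. of_bool (\<exists>j\<in>J. hd p \<in> C j & set p \<subseteq> ball (hd p) K & m0 <= real (card (set p - A W j))))"
  proof (rule E_mono)
   fix p assume "p \<in> walks tau z"
   then have "hd p = z" using walksD by blast
   then show "of_bool (set p \<subseteq> ball z K & m0 <= real (card (set p - A W j)))
    <= (of_bool (\<exists>j\<in>J. hd p \<in> C j & set p \<subseteq> ball (hd p) K & m0 <= real (card (set p - A W j))) :: real)"
    using j z by (auto simp: of_bool_def)
  qed
  finally show "s <= ..." .
 qed
 have main: "E (tmix + tau) y (%p. F (W \<union> set p)) <= (1 - q/2)*F W" if y: "y \<in> T" for y W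
 proof (cases "small W")
  case False
  then have "F (W \<union> set p) = 0" "F W = 0" for p using small_mono[of W "W \<union> set p"] by (auto simp: F_def)
  then show ?thesis by simp
 next
  case True
  define ev where "ev = entersGood (\<Union>j\<in>J. C j) tau
   (%zs. \<exists>j\<in>J. hd zs \<in> C j & set zs \<subseteq> ball (hd zs) K & m0 <= real (card (set zs - A W j)))"
  have "E (tmix + tau) y (%p. F (W \<union> set p)) <= E (tmix + tau) y (%p. F W*(1 + (- 1/2) * of_bool (ev p)))"
  proof (rule E_mono)
   fix p assume p: "p \<in> walks (tmix + tau) y"
   show "F (W \<union> set p) <= F W*(1 + (- 1/2) * of_bool (ev p))"
   proof (cases "ev p")
    case False
    then show ?thesis using anti[of W "W \<union> set p"] by simp
   next
    case ev: True
    from entersGood_conn[OF p ev[unfolded ev_def]] obtain zs j where zs: "set zs \<subseteq> set p" "zs ~= []"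
     and cn: "!!S y. set zs \<subseteq> S ==> y \<in> set zs ==> conn S (hd zs) y"
     and j: "j \<in> J" "hd zs \<in> C j" "set zs \<subseteq> ball (hd zs) K" "m0 <= real (card (set zs - A W j))"
     by metis
    have sub: "set zs \<subseteq> (W0 \<union> (W \<union> set p)) \<inter> ball (c j) (rho + K)" using zs j Cball[OF j(1)] ball_trans by blast
    have "conn ((W0 \<union> (W \<union> set p)) \<inter> ball (c j) (rho + K)) (root j) (hd zs)"
     using CA[OF j(1), of "W \<union> set p"] j(2) unfolding A_def comp_def by blast
    then have "set zs \<subseteq> A (W \<union> set p) j" using cn[OF sub] conn_trans unfolding A_def comp_def by blast
    then have "A W j \<union> (set zs - A W j) \<subseteq> A (W \<union> set p) j" using A_mono[of W "W \<union> set p" j] by auto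
    then have "card (A W j \<union> (set zs - A W j)) <= card (A (W \<union> set p) j)" using finA by (intro card_mono)
    moreover have "card (A W j \<union> (set zs - A W j)) = card (A W j) + card (set zs - A W j)" using finA by (intro card_Un_disjoint) auto
    ultimately have gain: "real (card (A W j)) + m0 <= real (card (A (W \<union> set p) j))" using j(4) by linarith
    have "(\<Sum>i\<in>J - {j}. real (card (A W i))) <= (\<Sum>i\<in>J - {j}. real (card (A (W \<union> set p) i)))"
    proof (intro sum_mono)
     fix i show "real (card (A W i)) <= real (card (A (W \<union> set p) i))"
      using card_mono[OF finA A_mono[of W "W \<union> set p"]] of_nat_le_iff by blast
    qed
    then have "S W + m0 <= S (W \<union> set p)" unfolding S_def using gain fJ j(1) by (simp add: sum.remove[of J j])
    then have "- S (W \<union> set p)/m0 <= - S W/m0 + (- 1)" using m0 by (simp add: field_simps)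
    then have "exp (- S (W \<union> set p)/m0) <= exp (- S W/m0 + (- 1))" by simp
    also have "... = exp (- S W/m0)*exp (- 1)" by (rule exp_add)
    also have "... <= exp (- S W/m0)*(1/2)"
    proof (intro mult_left_mono)
     have "2 <= exp (1 :: real)" using exp_ge_add_one_self[of 1] by simp
     then show "exp (- 1) <= (1/2 :: real)" by (simp add: exp_minus field_simps)
    qed simp
    finally have "exp (- S (W \<union> set p)/m0) <= F W*(1/2)" using True by (simp add: F_def)
    moreover have "F (W \<union> set p) <= exp (- S (W \<union> set p)/m0)" by (simp add: F_def of_bool_def)
    ultimately show ?thesis using ev by simp
   qed
  qed
  also have "... = F W*(1 + (- 1/2)*E (tmix + tau) y (%p. of_bool (ev p)))" unfolding E_cmult E_add by simp
  also have "... <= F W*(1 + (- 1/2)*q)" using hit[OF y True] F01 unfolding ev_def by (intro mult_left_mono) auto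
  finally show ?thesis by (simp add: algebra_simps)
 qed
 \<comment> \<open>If no set is small, the potential vanishes identically and no bound on q is
   available; otherwise q bounds a probability.\<close>
 have q1: "q <= 2 | (\<forall>W. ~ small W)"
 proof (rule disjCI)
  assume "~ (\<forall>W. ~ small W)"
  then obtain W where "small W" by blast
  have "q <= E (tmix + tau) x (%_. 1)" by (rule order_trans[OF hit[OF x \<open>small W\<close>]], intro E_mono, simp)
  then show "q <= 2" by simp
 qed
 have P: "of_bool (small (set p)) <= exp (real (card J)*V/m0)*F ({} \<union> set p)" for p
 proof (cases "small (set p)")
  case True
  then have "S (set p) <= (\<Sum>j\<in>J. V)" unfolding S_def small_def by (intro sum_mono) (auto intro: less_imp_le)
  then have "real (card J)*V/m0 >= S (set p)/m0" using m0 by (intro divide_right_mono) auto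
  then have "1 <= exp (real (card J)*V/m0 - S (set p)/m0)" by simp
  also have "... = exp (real (card J)*V/m0)*exp (- S (set p)/m0)" unfolding exp_add[symmetric] by simp
  finally show ?thesis using True by (simp add: F_def)
 qed (auto simp: F_def)
 have "E (m*(tmix + tau)) x (%p. of_bool (small (set p)))
   <= exp (real (card J)*V/m0)*E (m*(tmix + tau)) x (%p. F ({} \<union> set p))"
  unfolding E_cmult[symmetric] by (intro E_mono P)
 also have "... <= exp (real (card J)*V/m0)*exp (- (real m*(q/2)))"
 proof (cases "q <= 2")
  case True
  show ?thesis by (intro mult_left_mono blocks_exp[OF main anti F01]) (use q0 True x in auto)
 next
  case False
  then have "F W = 0" for W using q1 by (simp add: F_def)
  then show ?thesis by simp
 qed
 also have "... = exp (real (card J)*V/m0 - real m*(q/2))" by (simp add: exp_add[symmetric])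
 also have "... <= exp (real (card J)*(8*CG d*V/real tau - kap/(64*CG d) * v * real w^(d - 2)))"
 proof -
  have "(v * real N^d)*(kap*real (card J)*real w^(d - 2)) <= (real m*real tmix)*(kap*real (card J)*real w^(d - 2))"
   using m kap_pos by (intro mult_right_mono) auto
  then have "real (card J)*(kap/(64*CG d) * v * real w^(d - 2)) <= real m*(q/2)" using Npos C1 by (simp add: q_def s_def field_simps)
  moreover have "real (card J)*V/m0 = real (card J)*(8*CG d*V/real tau)" by (simp add: m0_def)
  ultimately show ?thesis by (simp add: right_diff_distrib)
 qed
 finally show ?thesis unfolding small_def A_def .
qed

text \<open>From a point of the first cluster, the Green function at distance 2 rho summed over w^d
  points of the second, divided by the time O(w^2) spent there, gives a hitting probability of at
  least 2 s within k steps. Subtracting the probability s of moving farther than \<open>Q\<close>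
  leaves s for a connection inside the region.\<close>

lemma cluster_merge:
 fixes c :: "'j => pt"
 assumes sep: "sep J reg" and w: "w >= 1" and wN: "real tmix*real w^d <= (real w)^2*real N^d"
  and bigx: "!!j. j \<in> J ==> w^d <= card (comp (W0 \<inter> ball (c j) rho) (rx j))"
  and bigy: "!!j. j \<in> J ==> w^d <= card (comp (W0 \<inter> ball (c j) rho) (ry j))"
  and reg: "!!j. j \<in> J ==> ball (c j) (rho + Q) \<subseteq> reg j" and Q: "Q >= 1" and rho: "rho >= 1"
  and rN: "CL d*(2*rho)^2 <= N^2" and k: "k = 2*(CL d*(2*rho)^2)" "k <= tmix"
  and s: "s = cL d*real w^(d - 2)*(real (2*rho))^2/(4*CG d*real (2*rho)^d)"
  and exit: "2*real d*real k*exp (- (real Q)\<^sup>2/(4*real k)) <= s"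
  and m: "v * real N^d <= real m*real tmix" and x: "x \<in> T"
 shows "E (m*(tmix + k)) x (%p. of_bool (\<forall>j\<in>J. ~ conn ((W0 \<union> set p) \<inter> reg j) (rx j) (ry j)))
  <= exp (- (real (card J)*(s*kap * v * real w^(d - 2))))"
proof -
 have C1: "CG d >= 1" by (rule CG_ge1)
 have fJ: "finite J" and regT: "!!j. j \<in> J ==> reg j \<subseteq> T" using sep by (auto simp: sep_def)
 have "\<exists>C. \<forall>j\<in>J. C j \<subseteq> comp (W0 \<inter> ball (c j) rho) (rx j) & card (C j) = w^d"
  using bigx by (intro bchoice) (meson obtain_subset_with_card_n)
 then obtain C where C: "!!j. j \<in> J ==> C j \<subseteq> comp (W0 \<inter> ball (c j) rho) (rx j)"
  "!!j. j \<in> J ==> card (C j) = w^d" by blast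
 have "\<exists>D. \<forall>j\<in>J. D j \<subseteq> comp (W0 \<inter> ball (c j) rho) (ry j) & card (D j) = w^d"
  using bigy by (intro bchoice) (meson obtain_subset_with_card_n)
 then obtain D where D: "!!j. j \<in> J ==> D j \<subseteq> comp (W0 \<inter> ball (c j) rho) (ry j)"
  "!!j. j \<in> J ==> card (D j) = w^d" by blast
 have Cball: "C j \<subseteq> ball (c j) rho" if "j \<in> J" for j using C(1)[OF that] comp_subset by blast
 have Dball: "D j \<subseteq> ball (c j) rho" if "j \<in> J" for j using D(1)[OF that] comp_subset by blast
 have sub: "W0 \<inter> ball (c j) rho \<subseteq> (W0 \<union> W) \<inter> reg j" if "j \<in> J" for W j
  using reg[OF that] ball_mono[of rho "rho + Q" "c j"] by auto
 have Creg: "C j \<subseteq> reg j" if "j \<in> J" for j using Cball[OF that] reg[OF that] ball_mono[of rho "rho + Q" "c j"] by auto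
 have s0: "s >= 0" unfolding s using cL_pos[of d] C1 by simp
 define q where "q = s*kap*real (card J)*(real tmix*real w^(d - 2)/real N^d)"
 have q0: "q >= 0" unfolding q_def using kap_pos s0 by simp
 define good where "good zs \<longleftrightarrow> (\<exists>j\<in>J. hd zs \<in> C j & set zs \<subseteq> ball (hd zs) Q & set zs \<inter> D j ~= {})" for zs
 have hit: "q <= E (tmix + k) y (%p. of_bool (entersGood (\<Union>j\<in>J. C j) k good p))" if y: "y \<in> T" for y unfolding q_def
 proof (rule multi_hit[OF sep _ w wN s0 _ y])
  show "C j \<subseteq> reg j & card (C j) = w^d" if "j \<in> J" for j using Creg C that by auto
  fix j z assume j: "j \<in> J" and z: "z \<in> C j"
  have zT: "z \<in> T" using z Cball[OF j] ball_subset by blast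
  have DT: "D j \<subseteq> T" using Dball[OF j] ball_subset by blast
  have "(\<Sum>y\<in>D j. cL d*(real (2*rho))^2/real (2*rho)^d) <= (\<Sum>y\<in>D j. green k z y)"
  proof (intro sum_mono)
   fix y assume "y \<in> D j"
   moreover have "c j \<in> ball z rho" if "c j \<in> T" using z Cball[OF j] ball_commute[OF that] by blast
   ultimately have "y \<in> ball z (2*rho)"
   proof -
    have yb: "y \<in> ball (c j) rho" using \<open>y \<in> D j\<close> Dball[OF j] by blast
    have zb: "z \<in> ball (c j) rho" using z Cball[OF j] by blast
    have "cd (z i) (y i) <= int (2*rho)" if "i < d" for i using cd_triangle[of "z i" "y i" "c j i"] yb zb that cd_commute[of "z i" "c j i"]
     unfolding ball_def by fastforce
    then show ?thesis using yb unfolding ball_def by auto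
   qed
   then show "cL d*(real (2*rho))^2/real (2*rho)^d <= green k z y" unfolding k(1) using zT rho rN by (intro green_ge_ball) auto
  qed
  then have gr: "real w^d*(cL d*(real (2*rho))^2/real (2*rho)^d) <= greenS k z (D j)" using D(2)[OF j] by (simp add: greenS_def)
  have "1*greenS k z (D j) <= (2*CG d*(real w)^2)*E (k + 0) z (%p. of_bool (entersGood (D j) 0 (%_. True) p))"
  proof (rule entersGood_lower[OF DT _ _ _ _ zT])
   show "greenS k y (D j) <= 2*CG d*(real w)^2" if "y \<in> D j" for y
   proof -
    have "greenS k y (D j) <= CG d*((real w)^2 + real k*real w^d/real N^d)" using that DT D(2)[OF j] w by (intro greenS_le) auto
    also have "real k*real w^d/real N^d <= real tmix*real w^d/real N^d" using k(2) by (intro divide_right_mono mult_right_mono) auto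
    also have "... <= (real w)^2" using wN Npos by (simp add: divide_le_eq)
    finally show ?thesis using C1 by (simp add: algebra_simps)
   qed
  qed (use C1 in auto)
  also have "E (k + 0) z (%p. of_bool (entersGood (D j) 0 (%_. True) p)) <= E k z (%p. of_bool (set p \<inter> D j ~= {}))"
   unfolding add_0_right
  proof (rule E_mono)
   fix p assume p: "p \<in> walks k z"
   have "set p \<inter> D j ~= {}" if "entersGood (D j) 0 (%_. True) p"
    using entersGood_conn[OF p that] by (metis disjoint_iff hd_in_set subsetD)
   then show "of_bool (entersGood (D j) 0 (%_. True) p) <= (of_bool (set p \<inter> D j ~= {}) :: real)" by (auto simp: of_bool_def)
  qed
  finally have "real w^d*(cL d*(real (2*rho))^2/real (2*rho)^d)
    <= 2*CG d*(real w)^2*E k z (%p. of_bool (set p \<inter> D j ~= {}))"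
   using gr C1 by (simp add: mult_left_mono)
  moreover have "real w^d = real w^(d - 2)*(real w)^2" by (rule power_split_d)
  ultimately have "(2*CG d*(real w)^2)*(2 * s) <= (2*CG d*(real w)^2)*E k z (%p. of_bool (set p \<inter> D j ~= {}))"
   unfolding s using C1 by (simp add: mult_ac)
  moreover have "0 < 2*CG d*(real w)^2" using C1 w by (intro mult_pos_pos) auto
  ultimately have "2 * s <= E k z (%p. of_bool (set p \<inter> D j ~= {}))" by (rule mult_left_le_imp_le)
  also have "... <= E k z (%p. of_bool (good p) + of_bool (set p \<inter> (T - ball z Q) ~= {}))"
  proof (rule E_mono)
   fix p assume p: "p \<in> walks k z"
   have "hd p = z" "set p \<subseteq> T" using walksD[OF p] walks_set[OF p zT] by auto
   then show "of_bool (set p \<inter> D j ~= {}) <= (of_bool (good p) + of_bool (set p \<inter> (T - ball z Q) ~= {}) :: real)"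
    using j z by (auto simp: of_bool_def good_def)
  qed
  also have "... = E k z (%p. of_bool (good p)) + E k z (%p. of_bool (set p \<inter> (T - ball z Q) ~= {}))" by (rule E_add)
  also have "E k z (%p. of_bool (set p \<inter> (T - ball z Q) ~= {})) <= greenS k z (T - ball z Q)" by (rule hit_upper) simp
  also have "... <= 2*real d*real k*exp (- (real Q)\<^sup>2/(4*real k))"
  proof (rule greenS_exit_le[OF zT _ Q])
   show "1 <= k" using rho unfolding k(1) CL_def by (simp add: Suc_le_eq)
  qed
  also have "... <= s" by (rule exit)
  finally show "s <= E k z (%p. of_bool (good p))" by simp
 qed
 define F :: "pt set => real" where "F W = of_bool (\<forall>j\<in>J. ~ conn ((W0 \<union> W) \<inter> reg j) (rx j) (ry j))" for W
 have anti: "F W' <= F W" if "W \<subseteq> W'" for W W'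
 proof -
  have "conn ((W0 \<union> W) \<inter> R) a b ==> conn ((W0 \<union> W') \<inter> R) a b" for R a b by (erule conn_mono) (use that in blast)
  then show ?thesis unfolding F_def of_bool_def by auto
 qed
 have hit2: "E (tmix + k) y (%p. F (W \<union> set p)) <= (1 - q)*F W" if y: "y \<in> T" for y W
 proof -
  have "E (tmix + k) y (%p. F (W \<union> set p)) \<le>
   E (tmix + k) y (%p. F W*(1 + (-1) * of_bool (entersGood (\<Union>j\<in>J. C j) k good p)))"
  proof (rule E_mono)
   fix p assume p: "p \<in> walks (tmix + k) y"
   show "F (W \<union> set p) <= F W*(1 + (-1) * of_bool (entersGood (\<Union>j\<in>J. C j) k good p))"
   proof (cases "entersGood (\<Union>j\<in>J. C j) k good p")
    case False
    then show ?thesis using anti[of W "W \<union> set p"] by simp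
   next
    case True
    from entersGood_conn[OF p True] obtain zs j where zs: "set zs \<subseteq> set p" "zs ~= []"
     and cn: "!!S y. set zs \<subseteq> S ==> y \<in> set zs ==> conn S (hd zs) y"
     and j: "j \<in> J" "hd zs \<in> C j" "set zs \<subseteq> ball (hd zs) Q" "set zs \<inter> D j ~= {}"
     unfolding good_def by metis
    obtain z where z: "z \<in> set zs" "z \<in> D j" using j by blast
    define S where "S = (W0 \<union> (W \<union> set p)) \<inter> reg j"
    have "set zs \<subseteq> ball (c j) (rho + Q)" using j Cball[OF j(1)] ball_trans by blast
    then have "set zs \<subseteq> S" using zs reg[OF j(1)] unfolding S_def by blast
    then have "conn S (hd zs) z" using cn z by blast
    moreover have "conn (W0 \<inter> ball (c j) rho) (rx j) (hd zs)" "conn (W0 \<inter> ball (c j) rho) (ry j) z"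
     using C(1)[OF j(1)] D(1)[OF j(1)] j(2) z(2) unfolding comp_def by auto
    then have "conn S (rx j) (hd zs)" "conn S (ry j) z" using conn_mono sub[OF j(1), of "W \<union> set p"] unfolding S_def by auto
    ultimately have "conn S (rx j) (ry j)" by (meson conn_trans conn_sym)
    then have "F (W \<union> set p) = 0" unfolding F_def S_def using j by auto
    then show ?thesis using True by simp
   qed
  qed
  also have "... = F W*(1 + (- 1)*E (tmix + k) y (%p. of_bool (entersGood (\<Union>j\<in>J. C j) k good p)))"
   unfolding E_cmult E_add by simp
  also have "... <= F W*(1 + (- 1)*q)" using hit[OF y] by (intro mult_left_mono) (auto simp: F_def)
  finally show ?thesis by (simp add: algebra_simps)
 qed
 have "q <= E (tmix + k) x (%_. 1)" using hit[OF x] by (rule order_trans) (intro E_mono, simp)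
 then have q1: "q <= 1" by simp
 have "E (m*(tmix + k)) x (%p. F ({} \<union> set p)) <= exp (- (real m*q))"
  by (intro blocks_exp[OF hit2 anti]) (use q0 q1 x in \<open>auto simp: F_def\<close>)
 also have "... <= exp (- (real (card J)*(s*kap * v * real w^(d - 2))))"
 proof -
  have "(v * real N^d)*(s*kap*real (card J)*real w^(d - 2)) <= (real m*real tmix)*(s*kap*real (card J)*real w^(d - 2))"
   using m kap_pos s0 by (intro mult_right_mono) auto
  then have "real (card J)*(s*kap * v * real w^(d - 2)) <= real m*q" using Npos by (simp add: q_def field_simps)
  then show ?thesis by simp
 qed
 finally show ?thesis by (simp add: F_def)
qed

end

section \<open>Conditions on the base scale and the stages of growth\<close>

definition kp :: "nat => real" where "kp d = 1/(8*(2*CG d + 1))"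

text \<open>In each condition a further power of \<sigma>, or an exponential in \<sigma>, absorbs a
  constant or a polynomial; so all of them hold for large \<sigma>.\<close>

definition ok_sigma :: "nat => real => nat => bool" where "ok_sigma d v \<sigma> \<longleftrightarrow>
   8*CL d <= \<sigma> & 8*d + 24 <= \<sigma> & 4*CG d <= real \<sigma> & 16*CG d*(64*CG d) <= kp d * v * real \<sigma> \<and>
   2*(64*CG d) <= kp d * v * real \<sigma> & 2*real d*real \<sigma>^(6*d + 7)*exp (- real \<sigma>/4) <= 1/(32*CG d) \<and>
   2*real d*(2*real (CL d)*real \<sigma>^(6*d + 10))*exp (- real \<sigma>) <= cL d/(4*CG d*real \<sigma>^((d + 1)*(d - 2))) \<and>
   1 <= kp d * v * (cL d/(4*CG d))*real \<sigma>"

lemma eventually_poly_exp: assumes "c > 0" and that: "e > 0"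
 shows "\<forall>\<^sub>F \<sigma> in sequentially. C*real \<sigma>^k*exp (- c*real \<sigma>) <= e"
proof -
 have "((%x::real. x^k/exp x) \<longlongrightarrow> 0) at_top" by (rule tendsto_power_div_exp_0)
 moreover have "filterlim (%\<sigma>. c*real \<sigma>) at_top sequentially"
  using assms by (intro filterlim_tendsto_pos_mult_at_top[OF tendsto_const]) (auto intro: filterlim_real_sequentially)
 ultimately have "((%\<sigma>. (c*real \<sigma>)^k/exp (c*real \<sigma>)) \<longlonglongrightarrow> 0)" by (rule filterlim_compose)
 then have "((%\<sigma>. C/c^k*((c*real \<sigma>)^k/exp (c*real \<sigma>))) \<longlonglongrightarrow> C/c^k*0)"
  by (intro tendsto_mult tendsto_const)
 moreover have "C/c^k*((c*real \<sigma>)^k/exp (c*real \<sigma>)) = C*real \<sigma>^k*exp (- c*real \<sigma>)" for \<sigma>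
  using assms by (simp add: power_mult_distrib exp_minus field_simps)
 ultimately have "((%\<sigma>. C*real \<sigma>^k*exp (- c*real \<sigma>)) \<longlonglongrightarrow> 0)" by simp
 then have "\<forall>\<^sub>F \<sigma> in sequentially. C*real \<sigma>^k*exp (- c*real \<sigma>) < e" using that by (rule order_tendstoD)
 then show ?thesis by eventually_elim simp
qed

lemma eventually_linear_ge: assumes "c > 0" shows "\<forall>\<^sub>F \<sigma> in sequentially. C <= c*real \<sigma>"
proof -
 have "filterlim (%\<sigma>. c*real \<sigma>) at_top sequentially"
  using assms by (intro filterlim_tendsto_pos_mult_at_top[OF tendsto_const]) (auto intro: filterlim_real_sequentially)
 then show ?thesis by (simp add: filterlim_at_top)
qed

lemma eventually_ok_sigma: assumes d: "3 <= d" and v: "v > 0" shows "\<forall>\<^sub>F \<sigma> in sequentially. ok_sigma d v \<sigma>"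
proof -
 have C: "CG d > 0" using CU_pos[of d] d by (simp add: CG_def)
 have kpp: "kp d * v > 0" using C v by (simp add: kp_def)
 have cLp: "cL d/(4*CG d) > 0" using C cL_pos[of d] by simp
 have e1: "\<forall>\<^sub>F \<sigma> in sequentially. 2*real d*real \<sigma>^(6*d + 7)*exp (- real \<sigma>/4) <= 1/(32*CG d)"
  using eventually_poly_exp[of "1/4" "1/(32*CG d)" "2*real d" "6*d + 7"] C by simp
 have A: "\<forall>\<^sub>F \<sigma> in sequentially. (2*real d*2*real (CL d))*real \<sigma>^(6*d + 10 + (d + 1)*(d - 2))*exp (- 1*real \<sigma>)
   <= cL d/(4*CG d)"
  using cLp by (intro eventually_poly_exp) auto
 have e2: "\<forall>\<^sub>F \<sigma> in sequentially. 2*real d*(2*real (CL d)*real \<sigma>^(6*d + 10))*exp (- real \<sigma>) <= cL d/(4*CG d*real \<sigma>^((d + 1)*(d - 2)))" using A eventually_gt_at_top[of "0::nat"]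
 proof eventually_elim
  case (elim \<sigma>)
  define Y where "Y = real \<sigma>^((d + 1)*(d - 2))"
  have Y: "Y > 0" using elim by (simp add: Y_def)
  have "(2*real d*(2*real (CL d)*real \<sigma>^(6*d + 10))*exp (- real \<sigma>))*Y <= cL d/(4*CG d)"
   using elim(1) unfolding power_add[of _ "6*d + 10"] Y_def[symmetric] by (simp add: mult_ac)
  then have "2*real d*(2*real (CL d)*real \<sigma>^(6*d + 10))*exp (- real \<sigma>) <= cL d/(4*CG d)/Y"
   using Y by (simp only: le_divide_eq if_True)
  then show ?case by (simp add: Y_def)
 qed
 show ?thesis unfolding ok_sigma_def using eventually_ge_at_top[of "8*CL d"] eventually_ge_at_top[of "8*d + 24"]
   eventually_linear_ge[of 1 "4*CG d"] eventually_linear_ge[OF kpp, of "16*CG d*(64*CG d)"]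
   eventually_linear_ge[OF kpp, of "2*(64*CG d)"] e1 e2 eventually_linear_ge[OF mult_pos_pos[OF kpp cLp], of 1]
  by (simp add: eventually_conj_iff)
qed

context torus_walk begin

lemma power_split_nat: "(a::nat)^d = a^(d - 2)*a^2"
proof -
 have "d = (d - 2) + 2" using d3 by simp
 then show ?thesis by (metis power_add)
qed

lemma kap_kp: "kap = kp d" by (simp add: kap_def kp_def)

text \<open>Expansion over the set I of regions where the first stage succeeds: each region outside
  I costs a, each region in I must fail in the second stage and costs b. The sum over I is the
  binomial expansion of (a + b)^card J.\<close>

lemma combine_stages: assumes fJ: "finite J" and x: "x \<in> T" and ab: "0 <= a" "0 <= b"
  and st1: "!!I. I \<subseteq> J ==> E n1 x (%p. of_bool (\<forall>j\<in>I. ~ Q (W0 \<union> set p) j)) <= a^card I"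
  and st2: "!!I W y. I \<subseteq> J ==> y \<in> T ==> W0 \<subseteq> W ==> (!!j. j \<in> I ==> Q W j)
   ==> E n2 y (%p. of_bool (\<forall>j\<in>I. ~ R (W \<union> set p) j)) <= b^card I"
 shows "E (n1 + n2) x (%p. of_bool (\<forall>j\<in>J. ~ R (W0 \<union> set p) j)) <= (a + b)^card J"
proof -
 define S where "S W = {j \<in> J. Q W j}" for W
 have "E (n1 + n2) x (%p. of_bool (\<forall>j\<in>J. ~ R (W0 \<union> set p) j)) =
   E n1 x (%p. E n2 (last p) (%q. of_bool (\<forall>j\<in>J. ~ R ((W0 \<union> set p) \<union> set q) j)))"
  by (rule E_append_set)
 also have "... <= E n1 x (%p. b^card (S (W0 \<union> set p)))"
 proof (rule E_mono)
  fix p assume p: "p \<in> walks n1 x"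
  have "E n2 (last p) (%q. of_bool (\<forall>j\<in>J. ~ R ((W0 \<union> set p) \<union> set q) j))
    <= E n2 (last p) (%q. of_bool (\<forall>j\<in>S (W0 \<union> set p). ~ R ((W0 \<union> set p) \<union> set q) j))"
   by (intro E_mono) (auto simp: S_def of_bool_def)
  also have "... <= b^card (S (W0 \<union> set p))" using walks_last[OF p x] by (intro st2) (auto simp: S_def)
  finally show "E n2 (last p) (%q. of_bool (\<forall>j\<in>J. ~ R ((W0 \<union> set p) \<union> set q) j)) <= b^card (S (W0 \<union> set p))" .
 qed
 also have "... <= E n1 x (%p. \<Sum>I\<in>Pow J. b^card I * of_bool (\<forall>j\<in>J - I. ~ Q (W0 \<union> set p) j))"
 proof (rule E_mono)
  fix p
  define I where "I = S (W0 \<union> set p)"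
  have "b^card I = b^card I * of_bool (\<forall>j\<in>J - I. ~ Q (W0 \<union> set p) j)" by (auto simp: I_def S_def)
  also have "... <= (\<Sum>I\<in>Pow J. b^card I * of_bool (\<forall>j\<in>J - I. ~ Q (W0 \<union> set p) j))"
   using fJ ab by (intro member_le_sum[of I]) (auto simp: I_def S_def)
  finally show "b^card (S (W0 \<union> set p)) <= (\<Sum>I\<in>Pow J. b^card I * of_bool (\<forall>j\<in>J - I. ~ Q (W0 \<union> set p) j))"
   by (simp add: I_def)
 qed
 also have "... = (\<Sum>I\<in>Pow J. b^card I*E n1 x (%p. of_bool (\<forall>j\<in>J - I. ~ Q (W0 \<union> set p) j)))"
  unfolding E_sum E_cmult ..
 also have "... <= (\<Sum>I\<in>Pow J. b^card I*a^card (J - I))" using ab by (intro sum_mono mult_left_mono st1) auto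
 also have "... = (\<Prod>j\<in>J. b + a)" by (subst prod_add[OF fJ]) simp
 finally show ?thesis by (simp add: add.commute)
qed

end

text \<open>The base scale is an integer \<open>\<sigma>\<close>; cells have side \<open>\<sigma> ^ (3 d + 4)\<close>, the growing clusters have
 size \<open>\<sigma> ^ (r d)\<close> for \<open>r = 3, \<dots>, 2 d + 4\<close>, and a piece of a walk has length \<open>\<sigma> ^ (6 d + 7)\<close>, slightly less
 than the square of the side of a cell.\<close>

locale torus_scale = torus_walk +
 fixes v :: real and \<sigma> :: nat
 assumes v0: "v > 0" and ok: "ok_sigma d v \<sigma>" and Nbig: "\<sigma>^(3*d + 8) <= N" and vN: "real tmix <= v * real N^d"
begin

definition side :: nat where "side = \<sigma>^(3*d + 4)"
definition tau :: nat where "tau = \<sigma>^(6*d + 7)"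
text \<open>Final radius of the clusters: 9 * \<open>side\<close> at the start and one
  \<open>side\<close> for each of the 4 d + 2 growth stages.\<close>

definition rho_f :: nat where "rho_f = (4*d + 11) * side"
text \<open>Distance granted to a merging piece, one power of \<sigma> above the bound for 2 *
  \<open>rho_f\<close>; one further power gives the radius \<open>Rr\<close> of a region.\<close>

definition Qr :: nat where "Qr = \<sigma>^(3*d + 6)"
definition Rr :: nat where "Rr = \<sigma>^(3*d + 7)"
definition kf :: nat where "kf = 2*(CL d*(2*rho_f)^2)"
text \<open>Number of mixing times that make up time v N^d, the budget of every single
  stage.\<close>

definition mst :: nat where "mst = nat \<lceil>v * real N^d/real tmix\<rceil>"
definition nst :: nat where "nst = mst*(tmix + tau)"
definition nfin :: nat where "nfin = mst*(tmix + kf)"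

lemma okD: "8*CL d <= \<sigma>" "8*d + 24 <= \<sigma>" "4*CG d <= real \<sigma>"
 "16*CG d*(64*CG d) <= kap * v * real \<sigma>" "2*(64*CG d) <= kap * v * real \<sigma>"
 "2*real d*real \<sigma>^(6*d + 7)*exp (- real \<sigma>/4) <= 1/(32*CG d)"
 "2*real d*(2*real (CL d)*real \<sigma>^(6*d + 10))*exp (- real \<sigma>) <= cL d/(4*CG d*real \<sigma>^((d + 1)*(d - 2)))"
 "1 <= kap * v * (cL d/(4*CG d))*real \<sigma>"
 using ok unfolding ok_sigma_def kap_kp by auto

lemma sigma_ge: "48 <= \<sigma>" using okD(2) d3 by linarith

lemma sigma1: "1 <= \<sigma>" "1 <= real \<sigma>" "0 < \<sigma>" using sigma_ge by auto

lemma pow_mono: "a <= b ==> \<sigma>^a <= \<sigma>^b" using sigma1 by (intro power_increasing) auto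

lemma pow_N: "a <= 3*d + 8 ==> \<sigma>^a <= N" using pow_mono[of a "3*d + 8"] Nbig by linarith

lemma side_pos: "1 <= side" and tau_pos: "1 <= tau" and Qr_pos: "1 <= Qr" using sigma1 by (auto simp: side_def tau_def Qr_def Suc_le_eq)

lemma rho_f_le: "2*rho_f <= \<sigma>^(3*d + 5)"
proof -
 have "2*(4*d + 11) <= \<sigma>" using okD(2) by simp
 then have "2*(4*d + 11)*\<sigma>^(3*d + 4) <= \<sigma>*\<sigma>^(3*d + 4)" by (rule mult_right_mono) simp
 moreover have "3*d + 5 = Suc (3*d + 4)" by simp
 ultimately show ?thesis unfolding rho_f_def side_def by (simp only: power_Suc mult.assoc)
qed

lemma rho_f_Qr: "rho_f + Qr <= Rr"
proof -
 have "rho_f <= \<sigma>^(3*d + 6)" using rho_f_le pow_mono[of "3*d+5" "3*d+6"] by linarith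
 moreover have "2*\<sigma>^(3*d + 6) <= \<sigma>*\<sigma>^(3*d + 6)" using sigma_ge by (intro mult_right_mono) auto
 ultimately show ?thesis unfolding Qr_def Rr_def by (simp add: eval_nat_numeral)
qed

lemma mst_ge: "v * real N^d <= real mst*real tmix"
proof -
 have "v * real N^d/real tmix <= real mst" unfolding mst_def by linarith
 then show ?thesis using tmix_pos by (simp add: divide_le_eq)
qed

lemma mst_le: "real mst*real tmix <= 2 * v * real N^d"
proof -
 have "0 <= v * real N^d/real tmix" using v0 by simp
 then have "real mst <= v * real N^d/real tmix + 1" unfolding mst_def by linarith
 then have "real mst*real tmix <= (v * real N^d/real tmix + 1)*real tmix" by (intro mult_right_mono) auto
 also have "... = v * real N^d + real tmix" using tmix_pos by (simp add: distrib_right)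
 finally show ?thesis using vN by simp
qed

lemma tau_le_N2: "tau <= N^2"
proof -
 have "tau <= (\<sigma>^(3*d + 4))^2" unfolding tau_def power_mult[symmetric] by (rule pow_mono) simp
 also have "... <= N^2" by (intro power_mono pow_N) auto
 finally show ?thesis .
qed

lemma N2_le_tmix: "N^2 <= tmix" unfolding tmix_def CL_def by simp

lemma kf_le_tmix: "kf <= tmix" and CL_rho: "CL d*(2*rho_f)^2 <= N^2"
proof -
 have "CL d*(2*rho_f)^2 <= \<sigma>*(\<sigma>^(3*d + 5))^2" using okD(1) rho_f_le by (intro mult_mono power_mono) auto
 also have "... = \<sigma>^(1 + 2*(3*d + 5))"
 proof -
  have "(\<sigma>^(3*d + 5))^2 = \<sigma>^(2*(3*d + 5))" by (metis power_mult mult.commute)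
  then show ?thesis by (simp only: power_add power_one_right)
 qed
 also have "... <= (\<sigma>^(3*d + 6))^2" unfolding power_mult[symmetric] by (rule pow_mono) simp
 also have "... <= N^2" by (intro power_mono pow_N) auto
 finally show *: "CL d*(2*rho_f)^2 <= N^2" .
 have "N^2 <= CL d*N^2" unfolding CL_def by simp
 then show "kf <= tmix" unfolding kf_def tmix_def using * by linarith
qed

text \<open>The equidistributed part of the time spent in w^d points up to \<open>tmix\<close> does
  not exceed the local part w^2; this holds because \<open>N\<close> exceeds w = \<sigma>^r by more
  than a factor \<sigma>.\<close>

lemma wN: assumes "r <= 2*d + 4" shows "real tmix*real (\<sigma>^r)^d <= (real (\<sigma>^r))^2*real N^d"
proof -
 have "2*CL d <= \<sigma>" using okD(1) by simp
 also have "\<sigma> <= \<sigma>^(d - 2)" using pow_mono[of 1 "d - 2"] d3 by simp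
 finally have "2*CL d*(\<sigma>^r)^(d - 2) <= \<sigma>^(d - 2)*(\<sigma>^r)^(d - 2)" by (rule mult_right_mono) simp
 also have "... = (\<sigma>^(r + 1))^(d - 2)" by (simp add: power_mult_distrib)
 also have "... <= N^(d - 2)" using assms d3 by (intro power_mono pow_N) auto
 finally have "2*CL d*(\<sigma>^r)^(d - 2) <= N^(d - 2)" .
 then have "N^2*(2*CL d*(\<sigma>^r)^(d - 2))*(\<sigma>^r)^2 <= N^2*N^(d - 2)*(\<sigma>^r)^2"
  by (intro mult_right_mono mult_left_mono) auto
 also have "N^2*(2*CL d*(\<sigma>^r)^(d - 2))*(\<sigma>^r)^2 = tmix*((\<sigma>^r)^(d - 2)*(\<sigma>^r)^2)" by (simp add: tmix_def)
 also have "(\<sigma>^r)^(d - 2)*(\<sigma>^r)^2 = (\<sigma>^r)^d" by (rule power_split_nat[symmetric])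
 also have "N^2*N^(d - 2) = N^d" by (simp only: power_split_nat[of N] mult.commute)
 finally have "tmix*(\<sigma>^r)^d <= (\<sigma>^r)^2*N^d" by (simp add: mult.commute)
 then have "real (tmix*(\<sigma>^r)^d) <= real ((\<sigma>^r)^2*N^d)" by (rule of_nat_mono)
 then show ?thesis by simp
qed

lemma exit_growth: "2*real d*real tau*exp (- (real side)\<^sup>2/(4*real tau)) <= 1/(32*CG d)"
proof -
 have "(3*d + 4)*2 = Suc (6*d + 7)" by simp
 then have "(real \<sigma>^(3*d + 4))^2 = real \<sigma>*real \<sigma>^(6*d + 7)" by (metis power_mult power_Suc)
 then have "(real side)^2 = real \<sigma>*real tau" by (simp add: side_def tau_def)
 then have "(real side)^2/(4*real tau) = real \<sigma>/4" using tau_pos by simp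
 then have eq: "- (real side)\<^sup>2/(4*real tau) = - real \<sigma>/4" by (simp only: minus_divide_left[symmetric])
 show ?thesis unfolding eq using okD(6) by (simp only: tau_def of_nat_power)
qed

text \<open>Both parts of \<open>greenS_le\<close> are at most tau/4, since tau exceeds \<sigma>^(2
  r) and N^d exceeds \<sigma>^(r d) by a factor of at least \<sigma>. A walk of length
  \<open>tau\<close> thus spends half of its time outside the cluster.\<close>

lemma half_time: assumes "r <= 2*d + 4" "y \<in> T" "A \<subseteq> T" "real (card A) < real (\<sigma>^r)^d" shows "greenS tau y A <= real tau/2"
proof -
 have "real (card A) < real ((\<sigma>^r)^d)" using assms(4) by simp
 then have cA: "card A <= (\<sigma>^r)^d" by linarith
 have "greenS tau y A <= CG d*((real (\<sigma>^r))^2 + real tau*real (\<sigma>^r)^d/real N^d)" using assms cA sigma1 by (intro greenS_le) auto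
 also have "... = CG d*(real (\<sigma>^r))^2 + real tau*(CG d*real (\<sigma>^r)^d/real N^d)" by (simp add: algebra_simps)
 also have "CG d*(real (\<sigma>^r))^2 <= real tau/4"
 proof -
  have "4*CG d*(real (\<sigma>^r))^2 <= real \<sigma>*real (\<sigma>^(2*r))"
   using okD(3) by (intro mult_mono) (auto simp: power_mult[symmetric] mult.commute)
  also have "... = real (\<sigma>^Suc (2*r))" by simp
  also have "... <= real tau" unfolding tau_def using assms d3 by (intro of_nat_mono pow_mono) auto
  finally show ?thesis by simp
 qed
 also have "CG d*real (\<sigma>^r)^d/real N^d <= 1/4"
 proof -
  have "real \<sigma> <= real \<sigma>^d" using sigma1 d3 power_increasing[of 1 d "real \<sigma>"] by simp
  then have "4*CG d*real (\<sigma>^r)^d <= real \<sigma>^d*real (\<sigma>^r)^d"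
   by (intro mult_right_mono order_trans[OF okD(3) \<open>real \<sigma> \<le> real \<sigma> ^ d\<close>]) simp
  also have "... = real (\<sigma>^(r + 1))^d" by (simp add: power_mult_distrib)
  also have "... <= real N^d" using assms d3 pow_N[of "r + 1"] by (intro power_mono of_nat_mono) auto
  finally show ?thesis using Npos by (simp add: divide_le_eq)
 qed
 then have "real tau*(CG d*real (\<sigma>^r)^d/real N^d) <= real tau*(1/4)" by (intro mult_left_mono) auto
 finally show ?thesis by simp
qed

definition reg :: "pt => pt set" where "reg c = ball c Rr"

definition big :: "nat => nat => pt set => pt => pt => bool" where
 "big r rho W c z \<longleftrightarrow> (\<sigma>^r)^d <= card (comp (W \<inter> ball c rho) z)"

lemma big_mono: "big r rho W c z ==> rho <= rho' ==> W \<subseteq> W' ==> big r rho' W' c z"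
proof -
 assume b: "big r rho W c z" and le: "rho <= rho'" "W \<subseteq> W'"
 have "comp (W \<inter> ball c rho) z \<subseteq> comp (W' \<inter> ball c rho') z" using le ball_mono[of rho rho' c] by (intro comp_mono) auto
 then have "card (comp (W \<inter> ball c rho) z) <= card (comp (W' \<inter> ball c rho') z)"
  by (rule card_mono[rotated]) (rule finite_subset[OF comp_subset], simp)
 then show ?thesis using b unfolding big_def by simp
qed

text \<open>Rate against cost: the hitting rate carries w^(d - 2) >= \<sigma>^3, while the cost
  V/tau of the potential is smaller than w^(d - 2) by a factor \<sigma>. What remains of the rate is
  at least \<sigma>^2 per region.\<close>

lemma growth_stage: assumes sep: "sep J (%j. reg (c j))" and r: "3 <= r" "r < 2*d + 4"
  and b: "!!j. j \<in> J ==> big r rho W0 (c j) (z j)" and rho: "rho + side <= rho_f" and x: "x \<in> T"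
 shows "E nst x (%p. of_bool (\<forall>j\<in>J. ~ big (Suc r) (rho + side) (W0 \<union> set p) (c j) (z j)))
  <= exp (- (real \<sigma>)\<^sup>2)^card J"
proof -
 define w where "w = \<sigma>^r"
 define V where "V = real (\<sigma>^Suc r)^d"
 have C1: "CG d >= 1" by (rule CG_ge1)
 have w1: "w >= 1" using sigma1 by (simp add: w_def Suc_le_eq)
 have rr: "rho + side <= Rr" using rho rho_f_Qr by simp
 have "N^2 <= N^d" using d3 Npos by (intro power_increasing) auto
 then have tauN: "tau <= N^d" using tau_le_N2 by simp
 have "E nst x (%p. of_bool (\<forall>j\<in>J. real (card (comp ((W0 \<union> set p) \<inter> ball (c j) (rho + side)) (z j))) < V))
  <= exp (real (card J)*(8*CG d*V/real tau - kap/(64*CG d) * v * real w^(d - 2)))"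
  unfolding nst_def
 proof (rule cluster_growth[OF sep w1 _ _ _ tau_pos tauN side_pos exit_growth _ mst_ge x])
  show "real tmix*real w^d <= (real w)^2*real N^d" unfolding w_def using r by (intro wN) auto
  show "w^d <= card (comp (W0 \<inter> ball (c j) rho) (z j))" if "j \<in> J" for j using b[OF that] by (simp add: big_def w_def)
  show "ball (c j) (rho + side) \<subseteq> reg (c j)" for j unfolding reg_def using rr by (rule ball_mono)
  show "greenS tau y A <= real tau/2" if "y \<in> T" "A \<subseteq> T" "real (card A) < V" for y A
   using that r unfolding V_def by (intro half_time[of "Suc r"]) auto
 qed
 also have "... <= exp (real (card J)*(- (real \<sigma>)\<^sup>2))"
 proof -
  define X where "X = real w^(d - 2)"
  define k where "k = kap * v/(64*CG d)"
  have k0: "k > 0" using kap_pos v0 C1 by (simp add: k_def)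
  have X0: "X > 0" using w1 by (simp add: X_def)
  have "3*1 <= r*(d - 2)" using r d3 by (intro mult_mono) auto
  then have "\<sigma>^3 <= \<sigma>^(r*(d - 2))" by (intro pow_mono) simp
  then have "real (\<sigma>^3) <= real (\<sigma>^(r*(d - 2)))" by (rule of_nat_mono)
  then have X3: "real \<sigma>^3 <= X" unfolding X_def w_def by (simp add: power_mult)
  have "d = (d - 2) + 2" using d3 by simp
  then have "r*d = r*(d - 2) + r*2" by (metis distrib_left)
  \<comment> \<open>Amounts to 2 r <= 5 d + 6; with r < 2 d + 4 this is where the exponent 6 d + 7
    of \<open>tau\<close> enters.\<close>
  then have "Suc (Suc r*d) <= r*(d - 2) + (6*d + 7)" using r by simp
  then have "\<sigma>^Suc (Suc r*d) <= \<sigma>^(r*(d - 2) + (6*d + 7))" by (rule pow_mono)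
  then have "real (\<sigma>^Suc (Suc r*d)) <= real (\<sigma>^(r*(d - 2) + (6*d + 7)))" by (rule of_nat_mono)
  moreover have "real (\<sigma>^Suc (Suc r*d)) = real \<sigma>*V" unfolding V_def by (simp only: power_Suc power_mult of_nat_mult of_nat_power)
  moreover have "real (\<sigma>^(r*(d - 2) + (6*d + 7))) = X*real tau"
   unfolding X_def w_def tau_def by (simp only: power_add power_mult of_nat_mult of_nat_power)
  ultimately have VX: "real \<sigma>*V <= X*real tau" by metis
  have "V/real tau <= X/real \<sigma>" using VX tau_pos sigma1 by (simp add: field_simps)
  then have "8*CG d*(V/real tau) <= 8*CG d*(X/real \<sigma>)" using C1 by (intro mult_left_mono) auto
  then have "8*CG d*V/real tau <= 8*CG d*X/real \<sigma>" by simp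
  also have "... <= k/2*X"
  proof -
   have "16*CG d <= k*real \<sigma>" using okD(4) C1 unfolding k_def by (simp add: field_simps)
   then have "8*CG d/real \<sigma> <= k/2" using sigma1 by (simp add: field_simps)
   then have "8*CG d/real \<sigma>*X <= k/2*X" using X0 by (intro mult_right_mono) auto
   then show ?thesis by simp
  qed
  finally have 1: "8*CG d*V/real tau - k*X <= - (k/2*X)" by simp
  have "2 <= k*real \<sigma>" using okD(5) C1 unfolding k_def by (simp add: field_simps)
  then have "1*(real \<sigma>)^2 <= (k/2*real \<sigma>)*(real \<sigma>)^2" by (intro mult_right_mono) auto
  also have "... = k/2*real \<sigma>^3" by (simp add: power2_eq_square power3_eq_cube)
  also have "... <= k/2*X" using X3 k0 by (intro mult_left_mono) auto
  finally have "8*CG d*V/real tau - k*X <= - (real \<sigma>)\<^sup>2" using 1 by simp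
  then have "real (card J)*(8*CG d*V/real tau - k*X) <= real (card J)*(- (real \<sigma>)\<^sup>2)" by (rule mult_left_mono) simp
  moreover have "k*X = kap/(64*CG d) * v * real w^(d - 2)" by (simp add: k_def X_def)
  ultimately show ?thesis by simp
 qed
 also have "... = exp (- (real \<sigma>)\<^sup>2)^card J" by (rule exp_of_nat_mult)
 also have "E nst x (%p. of_bool (\<forall>j\<in>J. real (card (comp ((W0 \<union> set p) \<inter> ball (c j) (rho + side)) (z j))) < V))
   = E nst x (%p. of_bool (\<forall>j\<in>J. ~ big (Suc r) (rho + side) (W0 \<union> set p) (c j) (z j)))"
 proof -
  have "(real n < V) = (~ (\<sigma>^Suc r)^d <= n)" for n unfolding V_def of_nat_power[symmetric] of_nat_less_iff by (simp only: not_le)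
  then show ?thesis unfolding big_def by simp
 qed
 finally show ?thesis .
qed

text \<open>The distance of the clusters costs \<sigma>^((d + 1) (d - 2)) in the merging
  probability, and the rate gains w^(d - 2) = \<sigma>^((2 d + 4) (d - 2)). The growth is carried up
  to r = 2 d + 4 so that the gain prevails by at least \<sigma>^3.\<close>

lemma merge_stage: assumes sep: "sep J (%j. reg (c j))"
  and b: "!!j. j \<in> J ==> big (2*d + 4) rho_f W0 (c j) (y j)" "!!j. j \<in> J ==> big (2*d + 4) rho_f W0 (c j) (z j)"
  and x: "x \<in> T"
 shows "E nfin x (%p. of_bool (\<forall>j\<in>J. ~ conn ((W0 \<union> set p) \<inter> reg (c j)) (y j) (z j)))
  <= exp (- (real \<sigma>)\<^sup>2)^card J"
proof -
 define w where "w = \<sigma>^(2*d + 4)"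
 define rf where "rf = 2*rho_f"
 define s where "s = cL d*real w^(d - 2)*(real rf)^2/(4*CG d*real rf^d)"
 have C1: "CG d >= 1" by (rule CG_ge1)
 have w1: "w >= 1" using sigma1 by (simp add: w_def Suc_le_eq)
 have rho1: "rho_f >= 1" using side_pos by (simp add: rho_f_def)
 have rf1: "rf >= 1" using rho1 by (simp add: rf_def)
 have rf_le: "rf <= \<sigma>^(3*d + 5)" unfolding rf_def by (rule rho_f_le)
 define Y where "Y = real \<sigma>^((d + 1)*(d - 2))"
 have Y0: "Y > 0" using sigma1 by (simp add: Y_def)
 have "rf^(d - 2) <= (\<sigma>^(3*d + 5))^(d - 2)" using rf_le by (intro power_mono) auto
 also have "... = \<sigma>^((d + 1)*(d - 2))*w^(d - 2)"
 proof -
  have "3*d + 5 = (d + 1) + (2*d + 4)" by simp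
  then have "(3*d + 5)*(d - 2) = (d + 1)*(d - 2) + (2*d + 4)*(d - 2)" by (metis distrib_right)
  then show ?thesis unfolding w_def power_mult[symmetric] power_add[symmetric] by simp
 qed
 finally have "real (rf^(d - 2)) <= real (\<sigma>^((d + 1)*(d - 2))*w^(d - 2))" by (rule of_nat_mono)
 then have le: "real rf^(d - 2) <= Y*real w^(d - 2)" by (simp add: Y_def)
 have pos: "real rf^(d - 2) > 0" using rf1 by simp
 have "s = cL d*real w^(d - 2)/(4*CG d*real rf^(d - 2))" unfolding s_def power_split_d[of rf] using rf1 C1 by simp
 moreover have "cL d/(4*CG d*Y) <= cL d*real w^(d - 2)/(4*CG d*real rf^(d - 2))"
 proof -
  have "1/Y <= real w^(d - 2)/real rf^(d - 2)" using le Y0 pos by (simp add: field_simps)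
  then have "cL d/(4*CG d)*(1/Y) <= cL d/(4*CG d)*(real w^(d - 2)/real rf^(d - 2))" using cL_pos[of d] C1 by (intro mult_left_mono) auto
  then show ?thesis by simp
 qed
 ultimately have s_ge: "cL d/(4*CG d*Y) <= s" by simp
 have kf1: "kf >= 1" unfolding kf_def CL_def using rho1 by (simp add: Suc_le_eq)
 have "kf <= 2*(CL d*(\<sigma>^(3*d + 5))^2)" unfolding kf_def using rho_f_le by (intro mult_left_mono power_mono) auto
 also have "(\<sigma>^(3*d + 5))^2 = \<sigma>^(6*d + 10)" unfolding power_mult[symmetric] by (simp add: algebra_simps)
 finally have "real kf <= real (2*(CL d*\<sigma>^(6*d + 10)))" by (rule of_nat_mono)
 then have kf_le: "real kf <= 2*real (CL d)*real \<sigma>^(6*d + 10)" by simp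
 have "8*real (CL d) <= real \<sigma>" using okD(1) of_nat_mono[of "8*CL d" \<sigma>] by simp
 have "real \<sigma>*(4*real kf) <= real \<sigma>*(8*real (CL d)*real \<sigma>^(6*d + 10))" using kf_le by (intro mult_left_mono) auto
 also have "... <= real \<sigma>*(real \<sigma>*real \<sigma>^(6*d + 10))"
  using \<open>8 * real (CL d) \<le> real \<sigma>\<close> by (intro mult_left_mono mult_right_mono) auto
 also have "... = real \<sigma>^(6*d + 12)" by (simp add: eval_nat_numeral)
 also have "... = (real Qr)^2" unfolding Qr_def by (simp add: power_mult[symmetric] algebra_simps)
 finally have "real \<sigma>*(4*real kf) <= (real Qr)^2" .
 then have "real \<sigma> <= (real Qr)^2/(4*real kf)" using kf1 by (simp add: le_divide_eq)
 then have "exp (- (real Qr)\<^sup>2/(4*real kf)) <= exp (- real \<sigma>)"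
  by (simp only: exp_le_cancel_iff minus_divide_left[symmetric] neg_le_iff_le)
 then have "2*real d*real kf*exp (- (real Qr)\<^sup>2/(4*real kf)) <= 2*real d*(2*real (CL d)*real \<sigma>^(6*d + 10))*exp (- real \<sigma>)"
  using kf_le by (intro mult_mono) auto
 also have "... <= cL d/(4*CG d*Y)" unfolding Y_def by (rule okD(7))
 also have "... <= s" by (rule s_ge)
 finally have exit: "2*real d*real kf*exp (- (real Qr)\<^sup>2/(4*real kf)) <= s" .
 have "E nfin x (%p. of_bool (\<forall>j\<in>J. ~ conn ((W0 \<union> set p) \<inter> reg (c j)) (y j) (z j)))
  <= exp (- (real (card J)*(s*kap * v * real w^(d - 2))))"
  unfolding nfin_def
 proof (rule cluster_merge[OF sep w1 _ _ _ _ Qr_pos rho1 CL_rho kf_def kf_le_tmix _ exit mst_ge x])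
  show "real tmix*real w^d <= (real w)^2*real N^d" unfolding w_def by (intro wN) auto
  show "w^d <= card (comp (W0 \<inter> ball (c j) rho_f) (y j))" if "j \<in> J" for j using b(1)[OF that] by (simp add: big_def w_def)
  show "w^d <= card (comp (W0 \<inter> ball (c j) rho_f) (z j))" if "j \<in> J" for j using b(2)[OF that] by (simp add: big_def w_def)
  show "ball (c j) (rho_f + Qr) \<subseteq> reg (c j)" for j unfolding reg_def using rho_f_Qr by (rule ball_mono)
  show "s = cL d*real w^(d - 2)*(real (2*rho_f))^2/(4*CG d*real (2*rho_f)^d)" by (simp only: s_def rf_def)
 qed
 also have "... <= exp (real (card J)*(- (real \<sigma>)\<^sup>2))"
 proof -
  have "2*d + 4 = (d + 1) + (d + 3)" by simp
  then have ex: "(2*d + 4)*(d - 2) = (d + 1)*(d - 2) + (d + 3)*(d - 2)" by (metis distrib_right)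
  have "3*1 <= (d + 3)*(d - 2)" using d3 by (intro mult_mono) auto
  then have "real \<sigma>^3 <= real \<sigma>^((d + 3)*(d - 2))" using sigma1 by (intro power_increasing) auto
  then have "Y*real \<sigma>^3 <= Y*real \<sigma>^((d + 3)*(d - 2))" using Y0 by (intro mult_left_mono) auto
  also have "... = real w^(d - 2)" unfolding Y_def w_def by (simp add: power_mult[symmetric] power_add[symmetric] ex)
  finally have W: "Y*real \<sigma>^3 <= real w^(d - 2)" .
  have "(real \<sigma>)^2*1 <= (real \<sigma>)^2*(kap * v * (cL d/(4*CG d))*real \<sigma>)" using okD(8) by (intro mult_left_mono) auto
  also have "... = (cL d/(4*CG d*Y)*(kap * v))*(Y*real \<sigma>^3)" using Y0 C1 by (simp add: power2_eq_square power3_eq_cube field_simps)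
  also have "... <= (s*(kap * v))*real w^(d - 2)"
  proof (rule mult_mono)
   have "0 <= cL d/(4*CG d*Y)" using cL_pos[of d] C1 Y0 by simp
   then have "0 <= s" using s_ge by linarith
   then show "0 <= s*(kap * v)" using kap_pos v0 by simp
   show "cL d/(4*CG d*Y)*(kap * v) <= s*(kap * v)" using s_ge by (rule mult_right_mono) (use kap_pos v0 in simp)
   show "0 <= Y*real \<sigma>^3" using Y0 by simp
  qed (rule W)
  finally have "(real \<sigma>)^2 <= s*kap * v * real w^(d - 2)" by (simp add: mult.assoc)
  then have "real (card J)*(real \<sigma>)^2 <= real (card J)*(s*kap * v * real w^(d - 2))" by (rule mult_left_mono) simp
  then show ?thesis by simp
 qed
 also have "... = exp (- (real \<sigma>)\<^sup>2)^card J" by (rule exp_of_nat_mult)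
 finally show ?thesis .
qed

text \<open>Both clusters are grown one after the other; \<open>k\<close> counts the remaining growth stages.\<close>

lemma connect_chain: assumes "sep J (%j. reg (c j))" and "3 <= ry" "ry <= 2*d + 4" "3 <= rz" "rz <= 2*d + 4"
  and "k = (2*d + 4 - ry) + (2*d + 4 - rz)" and "rho + k * side = rho_f"
  and "!!j. j \<in> J ==> big ry rho W0 (c j) (y j)" "!!j. j \<in> J ==> big rz rho W0 (c j) (z j)"
  and "x \<in> T"
 shows "E (k*nst + nfin) x (%p. of_bool (\<forall>j\<in>J. ~ conn ((W0 \<union> set p) \<inter> reg (c j)) (y j) (z j)))
  <= (real (Suc k)*exp (- (real \<sigma>)\<^sup>2))^card J"
 using assms
proof (induction k arbitrary: J ry rz rho W0 x)
 case 0
 then have "ry = 2*d + 4" "rz = 2*d + 4" "rho = rho_f" by auto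
 then show ?case using merge_stage[OF 0(1), of W0 y z x] 0 by simp
next
 case (Suc k)
 have fJ: "finite J" using Suc.prems(1) by (simp add: sep_def)
 have sub: "sep I (%j. reg (c j))" if "I \<subseteq> J" for I using Suc.prems(1) that by (rule sep_subset)
 define a b where "a = exp (- (real \<sigma>)\<^sup>2)" and "b = real (Suc k)*exp (- (real \<sigma>)\<^sup>2)"
 have rho: "rho + side + k * side = rho_f" using Suc.prems(7) by simp
 then have rho': "rho + side <= rho_f" by simp
 have "E (nst + (k*nst + nfin)) x (%p. of_bool (\<forall>j\<in>J. ~ conn ((W0 \<union> set p) \<inter> reg (c j)) (y j) (z j))) <= (a + b)^card J"
 proof (cases "ry < 2*d + 4")
  case True
  show ?thesis
  proof (rule combine_stages[where Q = "%W j. big (Suc ry) (rho + side) W (c j) (y j)" and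
     R = "%W j. conn (W \<inter> reg (c j)) (y j) (z j)", OF fJ Suc.prems(10)])
   show "E nst x (%p. of_bool (\<forall>j\<in>I. ~ big (Suc ry) (rho + side) (W0 \<union> set p) (c j) (y j))) <= a^card I"
    if "I \<subseteq> J" for I
    unfolding a_def using that Suc.prems(2,8,10) True rho' by (intro growth_stage sub) auto
   show "E (k*nst + nfin) x' (%p. of_bool (\<forall>j\<in>I. ~ conn ((W \<union> set p) \<inter> reg (c j)) (y j) (z j))) <= b^card I"
    if I: "I \<subseteq> J" and x': "x' \<in> T" and W: "W0 \<subseteq> W" and Q: "!!j. j \<in> I ==> big (Suc ry) (rho + side) W (c j) (y j)"
    for I W x'
    unfolding b_def
   proof (rule Suc.IH[of I "Suc ry" rz "rho + side" W x'])
    show "big rz (rho + side) W (c j) (z j)" if "j \<in> I" for j by (rule big_mono[OF Suc.prems(9)[OF subsetD[OF I that]] _ W]) simp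
    show "sep I (%j. reg (c j))" by (rule sub[OF I])
    show "3 <= Suc ry" "Suc ry <= 2*d + 4" "3 <= rz" "rz <= 2*d + 4" "k = 2*d + 4 - Suc ry + (2*d + 4 - rz)"
     using Suc.prems(2-6) True by linarith+
    show "rho + side + k * side = rho_f" by (rule rho)
    show "x' \<in> T" by (rule x')
    show "big (Suc ry) (rho + side) W (c j) (y j)" if "j \<in> I" for j by (rule Q[OF that])
   qed
  qed (auto simp: a_def b_def)
 next
  case False
  then have ry: "ry = 2*d + 4" using Suc.prems by simp
  then have rz: "rz < 2*d + 4" using Suc.prems by simp
  show ?thesis
  proof (rule combine_stages[where Q = "%W j. big (Suc rz) (rho + side) W (c j) (z j)" and
     R = "%W j. conn (W \<inter> reg (c j)) (y j) (z j)", OF fJ Suc.prems(10)])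
   show "E nst x (%p. of_bool (\<forall>j\<in>I. ~ big (Suc rz) (rho + side) (W0 \<union> set p) (c j) (z j))) <= a^card I"
    if "I \<subseteq> J" for I
    unfolding a_def using that Suc.prems(4,9,10) rz rho' by (intro growth_stage sub) auto
   show "E (k*nst + nfin) x' (%p. of_bool (\<forall>j\<in>I. ~ conn ((W \<union> set p) \<inter> reg (c j)) (y j) (z j))) <= b^card I"
    if I: "I \<subseteq> J" and x': "x' \<in> T" and W: "W0 \<subseteq> W" and Q: "!!j. j \<in> I ==> big (Suc rz) (rho + side) W (c j) (z j)"
    for I W x'
    unfolding b_def
   proof (rule Suc.IH[of I ry "Suc rz" "rho + side" W x'])
    show "big ry (rho + side) W (c j) (y j)" if "j \<in> I" for j by (rule big_mono[OF Suc.prems(8)[OF subsetD[OF I that]] _ W]) simp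
    show "sep I (%j. reg (c j))" by (rule sub[OF I])
    show "3 <= ry" "ry <= 2*d + 4" "3 <= Suc rz" "Suc rz <= 2*d + 4" "k = 2*d + 4 - ry + (2*d + 4 - Suc rz)" using Suc.prems(2-6) rz by linarith+
    show "rho + side + k * side = rho_f" by (rule rho)
    show "x' \<in> T" by (rule x')
    show "big (Suc rz) (rho + side) W (c j) (z j)" if "j \<in> I" for j by (rule Q[OF that])
   qed
  qed (auto simp: a_def b_def)
 qed
 moreover have "a + b = real (Suc (Suc k))*exp (- (real \<sigma>)\<^sup>2)" by (simp add: a_def b_def algebra_simps)
 ultimately show ?case by (simp add: add.assoc)
qed

end

section \<open>Connections leaving a set, initial clusters, and the uniform starting point\<close>

context torus_walk begin

text \<open>Induction along the connection: the edge by which it first leaves \<open>B\<close>.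
  Later also used with \<open>B\<close> the set A of the theorem, where the edge is a boundary
  edge.\<close>

lemma conn_exit: assumes "conn S r z" "r \<in> B" "z ~: B"
 obtains w y where "conn (S \<inter> B) r w" "adj w y" "y \<in> S" "y ~: B"
proof -
 have "(r, z) \<in> {(a, b). a \<in> S & b \<in> S & adj a b}\<^sup>*" "r \<in> S" using assms(1) by (auto simp: conn_def)
 then have "conn (S \<inter> B) r z | (\<exists>w y. conn (S \<inter> B) r w & adj w y & y \<in> S & y ~: B)"
 proof (induction rule: rtrancl_induct)
  case base
  then show ?case using assms(2) conn_refl by auto
 next
  case (step y z)
  then show ?case
  proof (cases "conn (S \<inter> B) r y & z \<in> B")
   case True
   then have "y \<in> S \<inter> B" using conn_mem by blast
   then have "conn (S \<inter> B) y z" using step True unfolding conn_def by auto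
   then show ?thesis using True conn_trans by blast
  qed (use step in auto)
 qed
 then show ?thesis using that assms(3) conn_mem by blast
qed

lemma adj_cd: "adj a b ==> i < d ==> cd (a i) (b i) <= 1"
proof -
 assume ab: "adj a b" and i: "i < d"
 have "cd (a i) (b i) <= (\<Sum>i<d. cd (a i) (b i))" using i by (intro member_le_sum) (auto simp: cd_nonneg)
 also have "... = 1" using ab by (simp add: adj_def torus_dist_def cd_def)
 finally show ?thesis .
qed

lemma adj_ball: "adj w y ==> y \<in> T ==> w \<in> ball r k ==> y \<in> ball r (Suc k)"
proof -
 assume a: "adj w y" "y \<in> T" "w \<in> ball r k"
 then have "y \<in> ball w 1" unfolding ball_def using adj_cd by auto
 then show ?thesis using ball_trans[OF a(3), of y 1] by simp
qed

text \<open>Either the path stays in the ball and its whole range is connected there, or it leaves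
  the ball and the component has a point in each of K shells. This provides the cluster with which
  the growth around a visited point starts.\<close>

lemma card_comp_path: assumes p: "p \<in> walks n x" "x \<in> T" "r \<in> set p" and m: "m <= K" "m <= card (set p)"
 shows "m <= card (comp (set p \<inter> ball r K) r)"
proof -
 have pT: "set p \<subseteq> T" using walks_set p by blast
 then have rT: "r \<in> T" using p by blast
 have hd: "conn (set p) (hd p) y" if "y \<in> set p" for y using conn_list[OF walks_successively[OF p(1)] _ that] by simp
 have all: "conn (set p) r y" if "y \<in> set p" for y by (rule conn_trans[OF conn_sym[OF hd[OF p(3)]] hd[OF that]])
 have fin: "finite (comp (set p \<inter> ball r K) r)" by (rule finite_subset[OF comp_subset]) simp
 show ?thesis
 proof (cases "set p \<subseteq> ball r K")
  case True
  then have "set p \<inter> ball r K = set p" by auto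
  then have "set p \<subseteq> comp (set p \<inter> ball r K) r" using all by (auto simp: comp_def)
  then have "card (set p) <= card (comp (set p \<inter> ball r K) r)" using fin by (rule card_mono[rotated])
  then show ?thesis using m by simp
 next
  case False
  then obtain z where z: "z \<in> set p" "z ~: ball r K" by auto
  have "\<exists>y. y \<in> comp (set p \<inter> ball r K) r & y \<in> ball r (Suc k) & y ~: ball r k" if "k < K" for k
  proof -
   have "z ~: ball r k" using z(2) ball_mono[of k K r] that by auto
   with all[OF z(1)] rT obtain w y where wy: "conn (set p \<inter> ball r k) r w" "adj w y" "y \<in> set p" "y ~: ball r k"
    by (elim conn_exit[of "set p" r z "ball r k"]) auto
   have wk: "w \<in> set p \<inter> ball r k" using conn_mem[OF wy(1)] by simp
   then have yk: "y \<in> ball r (Suc k)" using adj_ball[OF wy(2)] wy(3) pT by blast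
   have sub: "ball r k \<subseteq> ball r K" "ball r (Suc k) \<subseteq> ball r K" using that by (auto intro!: ball_mono)
   have "conn (set p \<inter> ball r K) r w" using wy(1) by (rule conn_mono) (use sub in auto)
   moreover have "conn (set p \<inter> ball r K) w y" using wk wy yk sub unfolding conn_def by auto
   ultimately have "y \<in> comp (set p \<inter> ball r K) r" unfolding comp_def using conn_trans by blast
   then show ?thesis using yk wy by blast
  qed
  then obtain y where y: "!!k. k < K ==> y k \<in> comp (set p \<inter> ball r K) r & y k \<in> ball r (Suc k) & y k ~: ball r k"
   by metis
  have "inj_on y {..<K}"
  proof (rule linorder_inj_onI)
   fix j k assume jk: "j < k" "j \<in> {..<K}" "k \<in> {..<K}"
   then have "y j \<in> ball r k" using y[of j] ball_mono[of "Suc j" k r] by auto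
   then show "y j ~= y k" using y[of k] jk by auto
  qed auto
  then have "K = card (y ` {..<K})" by (simp add: card_image)
  also have "... <= card (comp (set p \<inter> ball r K) r)" using y by (intro card_mono fin) auto
  finally show ?thesis using m by simp
 qed
qed

definition avgT :: "nat => (pt list => real) => real" where "avgT n f = (\<Sum>x\<in>T. E n x f)/real N^d"

lemma avgT_mono: "(!!x p. x \<in> T ==> p \<in> walks n x ==> f p <= g p) ==> avgT n f <= avgT n g"
 unfolding avgT_def by (intro divide_right_mono sum_mono E_mono) auto

lemma avgT_le: "(!!x. x \<in> T ==> E n x f <= c) ==> avgT n f <= c"
proof -
 assume "!!x. x \<in> T ==> E n x f <= c"
 then have "(\<Sum>x\<in>T. E n x f) <= (\<Sum>x\<in>T. c)" by (intro sum_mono)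
 also have "... = c*real N^d" by (simp add: card_torus)
 finally show ?thesis unfolding avgT_def using Npos by (simp add: divide_le_eq)
qed

lemma avgT_sum: "avgT n (%p. \<Sum>i\<in>I. f i p) = (\<Sum>i\<in>I. avgT n (f i))"
 unfolding avgT_def E_sum by (subst sum.swap) (simp add: sum_divide_distrib)

lemma avgT_rev: "avgT n (%p. f (rev p)) = avgT n f" unfolding avgT_def using sum_E_rev[of n f] by simp

end

text \<open>\<open>nbig\<close> makes a third of the time long enough for all 4 d + 3 stages, each
  lasting at most 4 v N^d; \<open>ok2\<close> pays for the pairs of points in a ball of radius 8 *
  \<open>side\<close>, at most (17 * \<open>side\<close>)^(2 d) many.\<close>

locale torus_run = torus_scale +
 fixes n :: nat
 assumes nbig: "12*real (4*d + 3) * v * real N^d + 3 <= real n"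
  and ok2: "real (17*\<sigma>^(3*d + 4))^(2*d)*real (4*d + 3)*exp (- real \<sigma>) <= 1"
begin

definition n1 :: nat where "n1 = n div 3"

definition ncon :: nat where "ncon = (4*d + 2)*nst + nfin"

lemma ncon_le: "ncon <= n1" and visit_le: "mst*tmix <= n - n1 - n1"
proof -
 have t: "tau <= tmix" "kf <= tmix" using tau_le_N2 N2_le_tmix kf_le_tmix by auto
 have "ncon <= (4*d + 2)*(mst*(tmix + tmix)) + mst*(tmix + tmix)" unfolding ncon_def nst_def nfin_def using t by (intro add_mono mult_left_mono) auto
 also have "... = (4*d + 3)*2*(mst*tmix)" by (simp add: algebra_simps)
 finally have "real ncon <= real ((4*d + 3)*2*(mst*tmix))" by (rule of_nat_mono)
 also have "... = real (4*d + 3)*2*(real mst*real tmix)" by simp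
 also have "... <= real (4*d + 3)*2*(2 * v * real N^d)" by (intro mult_left_mono mst_le) auto
 also have "... = 4*(real (4*d + 3) * v * real N^d)" by simp
 finally have "3*real ncon <= 12*(real (4*d + 3) * v * real N^d)" by linarith
 also have "... = 12*real (4*d + 3) * v * real N^d" by (simp only: mult.assoc)
 finally have "3*real ncon + 3 <= real n" using nbig by linarith
 then have "3*ncon + 3 <= n" by linarith
 then show *: "ncon <= n1" unfolding n1_def by simp
 have "mst*tmix <= ncon" unfolding ncon_def nst_def nfin_def by (simp add: distrib_left)
 also note *
 finally show "mst*tmix <= n - n1 - n1" unfolding n1_def by simp
qed

lemma ok2_le: "real (17*\<sigma>^(3*d + 4))^(2*d)*(real (4*d + 3)*exp (- (real \<sigma>)\<^sup>2)) <= exp (- (9*real \<sigma>))"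
proof -
 have "real \<sigma>*10 <= real \<sigma>*real \<sigma>" using sigma_ge by (intro mult_left_mono) auto
 then have "exp (- (real \<sigma>)\<^sup>2) <= exp (- real \<sigma> + - (9*real \<sigma>))" by (simp add: power2_eq_square)
 also have "... = exp (- real \<sigma>)*exp (- (9*real \<sigma>))" by (rule exp_add)
 finally have "real (17*\<sigma>^(3*d + 4))^(2*d)*(real (4*d + 3)*exp (- (real \<sigma>)\<^sup>2))
   <= real (17*\<sigma>^(3*d + 4))^(2*d)*(real (4*d + 3)*(exp (- real \<sigma>)*exp (- (9*real \<sigma>))))"
  by (intro mult_left_mono) auto
 also have "... = (real (17*\<sigma>^(3*d + 4))^(2*d)*real (4*d + 3)*exp (- real \<sigma>))*exp (- (9*real \<sigma>))" by (simp only: mult_ac)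
 also have "... <= 1*exp (- (9*real \<sigma>))" using ok2 by (rule mult_right_mono) simp
 finally show ?thesis by simp
qed

lemma sigma3_side: "(\<sigma>^3)^d <= side" unfolding side_def power_mult[symmetric] by (rule pow_mono) simp

abbreviation "dis p q z x y \<equiv> ~ conn ((set p \<union> set q) \<inter> reg z) x y"

text \<open>Given the earlier path the pairs to be connected are fixed, so a union bound over one
  pair per region is possible. Both clusters start from \<open>card_comp_path\<close> with index
  3.\<close>

lemma forward: assumes sep: "sep J (%j. reg (c j))" and p: "p \<in> walks m x" "x \<in> T" and W: "(\<sigma>^3)^d <= card (set p)"
  and k: "ncon <= k" and y: "y \<in> T"
 shows "E k y (%q. of_bool (\<forall>j\<in>J. \<exists>a\<in>set p \<inter> ball (c j) (8 * side). \<exists>b\<in>set p \<inter> ball (c j) (8 * side).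
   dis p q (c j) a b)) <= exp (- (9*real \<sigma>))^card J"
proof -
 have fJ: "finite J" using sep by (simp add: sep_def)
 define B where "B j = set p \<inter> ball (c j) (8 * side)" for j
 define P where "P = (\<Pi>\<^sub>E j\<in>J. B j \<times> B j)"
 have finB: "finite (B j)" for j by (simp add: B_def)
 have finP: "finite P" unfolding P_def using fJ finB by (intro finite_PiE) auto
 have cB: "card (B j) <= (17 * side)^d" for j
 proof -
  have "card (B j) <= card (ball (c j) (8 * side))" unfolding B_def by (intro card_mono) auto
  also have "... <= (2*(8 * side) + 1)^d" by (rule card_ball_le)
  also have "... <= (17 * side)^d" using side_pos by (intro power_mono) auto
  finally show ?thesis .
 qed
 have "card P = (\<Prod>j\<in>J. card (B j)*card (B j))" unfolding P_def using fJ by (simp add: card_PiE card_cartesian_product)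
 also have "... <= (\<Prod>j\<in>J. (17 * side)^d*(17 * side)^d)" using cB by (intro prod_mono) (auto intro: mult_mono)
 also have "... = ((17 * side)^(2*d))^card J" by (simp only: prod_constant power_add[symmetric] mult_2)
 finally have "real (card P) <= real (((17 * side)^(2*d))^card J)" by (rule of_nat_mono)
 then have cP: "real (card P) <= (real (17 * side)^(2*d))^card J" by simp
 have one: "E k y (%q. of_bool (\<forall>j\<in>J. dis p q (c j) (fst (f j)) (snd (f j))))
   <= (real (4*d + 3)*exp (- (real \<sigma>)\<^sup>2))^card J" if f: "f \<in> P" for f
 proof -
  have fB: "fst (f j) \<in> B j" "snd (f j) \<in> B j" if "j \<in> J" for j using f that unfolding P_def by (auto simp: PiE_iff mem_Times_iff)
  have bg: "big 3 (9 * side) (set p) (c j) r" if r: "r \<in> B j" for j r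
  proof -
   have rB: "r \<in> set p" "r \<in> ball (c j) (8 * side)" using r by (auto simp: B_def)
   have "ball r side \<subseteq> ball (c j) (8 * side + side)" using ball_trans[OF rB(2)] by blast
   then have "ball r side \<subseteq> ball (c j) (9 * side)" by simp
   then have sub: "comp (set p \<inter> ball r side) r \<subseteq> comp (set p \<inter> ball (c j) (9 * side)) r" by (intro comp_mono) auto
   have "(\<sigma>^3)^d <= card (comp (set p \<inter> ball r side) r)" using card_comp_path[OF p rB(1) sigma3_side W] .
   also have "... <= card (comp (set p \<inter> ball (c j) (9 * side)) r)" by (rule card_mono[OF _ sub]) (rule finite_subset[OF comp_subset], simp)
   finally show ?thesis unfolding big_def .
  qed
  have "E k y (%q. of_bool (\<forall>j\<in>J. dis p q (c j) (fst (f j)) (snd (f j))))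
   <= E ncon y (%q. of_bool (\<forall>j\<in>J. dis p q (c j) (fst (f j)) (snd (f j))))"
  proof (rule E_shorter[where F = "%W. of_bool (\<forall>j\<in>J. ~ conn (W \<inter> reg (c j)) (fst (f j)) (snd (f j)))", OF _ k y])
   fix W W' :: "pt set" assume sub: "W \<subseteq> W'"
   have "conn (W \<inter> R) a b ==> conn (W' \<inter> R) a b" for R a b by (erule conn_mono) (use sub in blast)
   then show "of_bool (\<forall>j\<in>J. ~ conn (W' \<inter> reg (c j)) (fst (f j)) (snd (f j)))
    <= (of_bool (\<forall>j\<in>J. ~ conn (W \<inter> reg (c j)) (fst (f j)) (snd (f j))) :: real)"
    unfolding of_bool_def by auto
  qed
  also have "... <= (real (Suc (4*d + 2))*exp (- (real \<sigma>)\<^sup>2))^card J" unfolding ncon_def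
  proof (rule connect_chain[OF sep, where ry = 3 and rz = 3 and rho = "9 * side"])
   show "4*d + 2 = 2*d + 4 - 3 + (2*d + 4 - 3)" using d3 by simp
   show "9 * side + (4*d + 2) * side = rho_f" unfolding rho_f_def by (simp add: algebra_simps)
  qed (use bg fB y d3 in auto)
  also have "Suc (4*d + 2) = 4*d + 3" by simp
  finally show ?thesis .
 qed
 have "E k y (%q. of_bool (\<forall>j\<in>J. \<exists>a\<in>B j. \<exists>b\<in>B j. dis p q (c j) a b))
  <= E k y (%q. \<Sum>f\<in>P. of_bool (\<forall>j\<in>J. dis p q (c j) (fst (f j)) (snd (f j))))"
 proof (rule E_mono)
  fix q
  show "of_bool (\<forall>j\<in>J. \<exists>a\<in>B j. \<exists>b\<in>B j. dis p q (c j) a b)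
   <= (\<Sum>f\<in>P. of_bool (\<forall>j\<in>J. dis p q (c j) (fst (f j)) (snd (f j))) :: real)"
  proof (cases "\<forall>j\<in>J. \<exists>a\<in>B j. \<exists>b\<in>B j. dis p q (c j) a b")
   case True
   then have "\<forall>j\<in>J. \<exists>ab. ab \<in> B j \<times> B j & dis p q (c j) (fst ab) (snd ab)" by fastforce
   then obtain g where g: "\<forall>j\<in>J. g j \<in> B j \<times> B j & dis p q (c j) (fst (g j)) (snd (g j))"
    by metis
   define h where "h = restrict g J"
   have "h \<in> P" unfolding P_def h_def using g by auto
   then have "(\<Sum>f\<in>P. of_bool (\<forall>j\<in>J. dis p q (c j) (fst (f j)) (snd (f j))) :: real)
     >= of_bool (\<forall>j\<in>J. dis p q (c j) (fst (h j)) (snd (h j)))"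
    using finP by (intro member_le_sum) auto
   moreover have "\<forall>j\<in>J. dis p q (c j) (fst (h j)) (snd (h j))" using g by (simp add: h_def)
   ultimately show ?thesis by simp
  next
   case False
   show ?thesis unfolding of_bool_def if_not_P[OF False] by (intro sum_nonneg) simp
  qed
 qed
 also have "... <= (\<Sum>f\<in>P. (real (4*d + 3)*exp (- (real \<sigma>)\<^sup>2))^card J)" unfolding E_sum by (intro sum_mono one)
 also have "... = real (card P)*(real (4*d + 3)*exp (- (real \<sigma>)\<^sup>2))^card J" by simp
 also have "... <= (real (17 * side)^(2*d))^card J*(real (4*d + 3)*exp (- (real \<sigma>)\<^sup>2))^card J" using cP by (intro mult_right_mono) auto
 also have "... = (real (17 * side)^(2*d)*(real (4*d + 3)*exp (- (real \<sigma>)\<^sup>2)))^card J" by (rule power_mult_distrib[symmetric])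
 also have "... <= exp (- (9*real \<sigma>))^card J" using ok2_le unfolding side_def by (intro power_mono) auto
 finally show ?thesis by (simp add: B_def)
qed

text \<open>The first two thirds of the time. On the reversed list these are the last two thirds,
  and \<open>middle\<close> is contained in both.\<close>

definition past :: "pt list => pt set" where "past p = set (take (Suc (n - n1)) p)"
definition middle :: "pt list => pt set" where "middle p = set (drop n1 (take (Suc (n - n1)) p))"

text \<open>The growth needs an initial cluster, so a small past does not count as bad; on the good
  event \<open>card_pasts\<close> shows that the past is large.\<close>

definition badf :: "pt => pt list => bool" where "badf c p \<longleftrightarrow> (\<sigma>^3)^d <= card (past p) \<and>
  (\<exists>a\<in>past p \<inter> ball c (8 * side). \<exists>b\<in>past p \<inter> ball c (8 * side). ~ conn (set p \<inter> reg c) a b)"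

text \<open>Every visited point lies in the first or in the last two thirds, and a visit in the
  middle third lies in both. If none of the three failures occurs, all visited points nearby can be
  joined through such a visit.\<close>

definition bad :: "pt => pt set => pt list => bool" where
 "bad c C p \<longleftrightarrow> badf c p | badf c (rev p) | middle p \<inter> C = {}"

lemma badf_joint: assumes sep: "sep J (%j. reg (c j))"
 shows "avgT n (%p. of_bool (\<forall>j\<in>J. badf (c j) p)) <= exp (- (9*real \<sigma>))^card J"
proof (rule avgT_le)
 fix x assume x: "x \<in> T"
 have nn: "n = (n - n1) + n1" unfolding n1_def by simp
 have "E n x (%p. of_bool (\<forall>j\<in>J. badf (c j) p)) =
  E (n - n1) x (%p. E n1 (last p) (%q. of_bool (\<forall>j\<in>J. badf (c j) (p @ tl q))))"
  by (subst nn) (rule E_append)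
 also have "... <= exp (- (9*real \<sigma>))^card J"
 proof (rule E_le_const)
  fix p assume p: "p \<in> walks (n - n1) x"
  have past: "past (p @ tl q) = set p" for q using walksD[OF p] by (simp add: past_def)
  have all: "set (p @ tl q) = set p \<union> set q" if q: "q \<in> walks n1 (last p)" for q
  proof -
   have "set q = insert (last p) (set (tl q))" using walksD[OF q] by (metis list.collapse list.simps(15))
   then show ?thesis using walksD[OF p] last_in_set[of p] by auto
  qed
  show "E n1 (last p) (%q. of_bool (\<forall>j\<in>J. badf (c j) (p @ tl q))) <= exp (- (9*real \<sigma>))^card J"
  proof (cases "J = {} | (\<sigma>^3)^d <= card (set p)")
   case False
   then show ?thesis by (simp add: badf_def past)
  next
   case True
   show ?thesis
   proof (cases "J = {}")
    case False
    have "E n1 (last p) (%q. of_bool (\<forall>j\<in>J. badf (c j) (p @ tl q))) \<le>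
     E n1 (last p) (%q. of_bool (\<forall>j\<in>J. \<exists>a\<in>set p \<inter> ball (c j) (8 * side). \<exists>b\<in>set p \<inter> ball (c j) (8 * side).
       dis p q (c j) a b))"
    proof (rule E_mono)
     fix q assume q: "q \<in> walks n1 (last p)"
     show "of_bool (\<forall>j\<in>J. badf (c j) (p @ tl q)) \<le>
      (of_bool (\<forall>j\<in>J. \<exists>a\<in>set p \<inter> ball (c j) (8 * side). \<exists>b\<in>set p \<inter> ball (c j) (8 * side).
       dis p q (c j) a b) :: real)"
      unfolding badf_def past all[OF q] by (auto simp: of_bool_def)
    qed
    also have "... <= exp (- (9*real \<sigma>))^card J" using True False walks_last[OF p x] by (intro forward[OF sep p x _ ncon_le]) auto
    finally show ?thesis .
   qed simp
  qed
 qed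
 finally show "E n x (%p. of_bool (\<forall>j\<in>J. badf (c j) p)) <= exp (- (9*real \<sigma>))^card J" .
qed

lemma miss_joint:
 assumes sep: "sep J (%j. reg (c j))" and C: "!!j. j \<in> J ==> C j \<subseteq> reg (c j) & card (C j) = (\<sigma>^3)^d"
 shows "avgT n (%p. of_bool (\<forall>j\<in>J. middle p \<inter> C j = {})) <= exp (- (9*real \<sigma>))^card J"
proof (rule avgT_le)
 fix x assume x: "x \<in> T"
 define n2 where "n2 = n - n1 - n1"
 have nn: "n = n1 + (n2 + n1)" unfolding n1_def n2_def by simp
 have n2: "n - n1 = n1 + n2" unfolding n2_def n1_def by simp
 define F where "F W = (of_bool (\<forall>j\<in>J. W \<inter> C j = {}) :: real)" for W
 have "E n x (%p. of_bool (\<forall>j\<in>J. middle p \<inter> C j = {})) =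
  E n1 x (%p. E (n2 + n1) (last p) (%q. F (middle (p @ tl q))))"
  unfolding F_def by (subst nn) (rule E_append)
 also have "... = E n1 x (%p. E n2 (last p) (%q. E n1 (last q) (%r. F (middle (p @ tl (q @ tl r))))))"
  unfolding E_append[of n2 n1] ..
 also have "... <= exp (- (9*real \<sigma>))^card J"
 proof (rule E_le_const)
  fix p assume p: "p \<in> walks n1 x"
  have lp: "last p \<in> T" by (rule walks_last[OF p x])
  have "E n2 (last p) (%q. E n1 (last q) (%r. F (middle (p @ tl (q @ tl r))))) = E n2 (last p) (%q. F ({} \<union> set q))"
  proof (rule E_cong)
   fix q assume q: "q \<in> walks n2 (last p)"
   have "middle (p @ tl (q @ tl r)) = set q" for r
   proof -
    have lenp: "length p = Suc n1" "p ~= []" and lenq: "length q = Suc n2" "q ~= []" "hd q = last p"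
     using walksD[OF p] walksD[OF q] by auto
    then have pq: "p @ tl (q @ tl r) = butlast p @ q @ tl r"
     by (metis append.assoc append_butlast_last_id append_Cons append_Nil list.collapse tl_append2)
    have "take (Suc (n - n1)) (butlast p @ q @ tl r) = butlast p @ q" using lenp lenq n2 by simp
    then show ?thesis unfolding middle_def pq using lenp by simp
   qed
   then show "E n1 (last q) (%r. F (middle (p @ tl (q @ tl r)))) = F ({} \<union> set q)" by simp
  qed
  also have "... <= E (mst*tmix) (last p) (%q. F ({} \<union> set q))"
   using visit_le lp unfolding n2_def by (intro E_shorter) (auto simp: F_def of_bool_def)
  also have "... <= exp (- (real (card J)*(kap * v * real (\<sigma>^3)^(d - 2))))" unfolding F_def Un_empty_left
   using sigma1 d3 by (intro multi_visit[OF sep C _ _ mst_ge lp] wN) auto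
  also have "... <= exp (real (card J)*(- (9*real \<sigma>)))"
  proof -
   have "9 <= kap * v * real \<sigma>" using okD(5) CG_ge1 by simp
   then have "9*real \<sigma> <= (kap * v * real \<sigma>)*(real \<sigma>)^2" using sigma1 by (intro mult_mono) (auto simp: power2_eq_square)
   also have "... = kap * v * real \<sigma>^3" by (simp add: power2_eq_square power3_eq_cube)
   also have "... <= kap * v * real (\<sigma>^3)^(d - 2)"
   proof (rule mult_left_mono)
    have "real \<sigma>^3 <= real \<sigma>^(3*(d - 2))" using sigma1 d3 by (intro power_increasing) auto
    then show "real \<sigma>^3 <= real (\<sigma>^3)^(d - 2)" by (simp add: power_mult)
   qed (use kap_pos v0 in simp)
   finally have "real (card J)*(9*real \<sigma>) <= real (card J)*(kap * v * real (\<sigma>^3)^(d - 2))" by (rule mult_left_mono) simp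
   then show ?thesis by simp
  qed
  also have "... = exp (- (9*real \<sigma>))^card J" by (rule exp_of_nat_mult)
  finally show "E n2 (last p) (%q. E n1 (last q) (%r. F (middle (p @ tl (q @ tl r))))) <= exp (- (9*real \<sigma>))^card J" .
 qed
 finally show "E n x (%p. of_bool (\<forall>j\<in>J. middle p \<inter> C j = {})) <= exp (- (9*real \<sigma>))^card J" .
qed

text \<open>By pigeonhole a third of the regions fail for the same reason, which reduces the
  exponent 9 to 3; the 3^card J assignments of reasons reduce it further to 2.\<close>

lemma bad_joint:
 assumes sep: "sep J (%j. reg (c j))" and C: "!!j. j \<in> J ==> C j \<subseteq> reg (c j) & card (C j) = (\<sigma>^3)^d"
 shows "avgT n (%p. of_bool (\<forall>j\<in>J. bad (c j) (C j) p)) <= exp (- (2*real \<sigma>))^card J"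
proof -
 have fJ: "finite J" using sep by (simp add: sep_def)
 define B where "B i j p = (if i = (0::nat) then badf (c j) p else if i = 1 then badf (c j) (rev p) else middle p \<inter> C j = {})" for i j p
 define eta where "eta = exp (- (3*real \<sigma>))"
 have eta01: "0 <= eta" "eta <= 1" by (auto simp: eta_def)
 have eta3: "exp (- (9*real \<sigma>)) = eta^3" by (simp add: eta_def exp_of_nat_mult[symmetric])
 have one: "avgT n (%p. of_bool (\<forall>j\<in>I. B i j p)) <= eta^(3*card I)" if I: "I \<subseteq> J" for I i
 proof -
  have s: "sep I (%j. reg (c j))" using sep I by (rule sep_subset)
  have "avgT n (%p. of_bool (\<forall>j\<in>I. badf (c j) (rev p))) = avgT n (%p. of_bool (\<forall>j\<in>I. badf (c j) p))"
   by (rule avgT_rev)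
  moreover have "avgT n (%p. of_bool (\<forall>j\<in>I. middle p \<inter> C j = {})) <= exp (- (9*real \<sigma>))^card I"
   using C I by (intro miss_joint[OF s]) auto
  ultimately show ?thesis using badf_joint[OF s] unfolding B_def power_mult eta3[symmetric] by (cases "i = 0"; cases "i = 1") simp_all
 qed
 define P where "P = (\<Pi>\<^sub>E j\<in>J. {0, 1, 2 :: nat})"
 have finP: "finite P" unfolding P_def using fJ by (intro finite_PiE) auto
 have "avgT n (%p. of_bool (\<forall>j\<in>J. bad (c j) (C j) p)) <= avgT n (%p. \<Sum>g\<in>P. of_bool (\<forall>j\<in>J. B (g j) j p))"
 proof (rule avgT_mono)
  fix p
  show "of_bool (\<forall>j\<in>J. bad (c j) (C j) p) <= (\<Sum>g\<in>P. of_bool (\<forall>j\<in>J. B (g j) j p) :: real)"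
  proof (cases "\<forall>j\<in>J. bad (c j) (C j) p")
   case True
   define g where "g = (\<lambda>j\<in>J. if badf (c j) p then 0 else if badf (c j) (rev p) then 1 else 2 :: nat)"
   have "g \<in> P" unfolding P_def g_def by auto
   then have "of_bool (\<forall>j\<in>J. B (g j) j p) <= (\<Sum>g\<in>P. of_bool (\<forall>j\<in>J. B (g j) j p) :: real)"
    using finP by (intro member_le_sum) auto
   moreover have "\<forall>j\<in>J. B (g j) j p" using True by (auto simp: g_def B_def bad_def)
   ultimately show ?thesis by simp
  next
   case False
   show ?thesis unfolding of_bool_def if_not_P[OF False] by (intro sum_nonneg) simp
  qed
 qed
 also have "... = (\<Sum>g\<in>P. avgT n (%p. of_bool (\<forall>j\<in>J. B (g j) j p)))" by (rule avgT_sum)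
 also have "... <= (\<Sum>g\<in>P. eta^card J)"
 proof (rule sum_mono)
  fix g assume g: "g \<in> P"
  define S where "S i = {j \<in> J. g j = i}" for i
  have "J = S 0 \<union> S 1 \<union> S 2" using g unfolding P_def S_def by (auto simp: PiE_iff)
  then have "card J <= card (S 0) + card (S 1) + card (S 2)" by (metis add_le_mono1 card_Un_le order_trans)
  then have "card J <= 3*card (S 0) | card J <= 3*card (S 1) | card J <= 3*card (S 2)" by linarith
  then obtain i where i: "card J <= 3*card (S i)" by blast
  have "avgT n (%p. of_bool (\<forall>j\<in>J. B (g j) j p)) <= avgT n (%p. of_bool (\<forall>j\<in>S i. B i j p))"
   by (intro avgT_mono) (auto simp: S_def of_bool_def)
  also have "... <= eta^(3*card (S i))" by (intro one) (auto simp: S_def)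
  also have "... <= eta^card J" using i eta01 by (intro power_decreasing) auto
  finally show "avgT n (%p. of_bool (\<forall>j\<in>J. B (g j) j p)) <= eta^card J" .
 qed
 also have "... = (3*eta)^card J" unfolding P_def using fJ by (simp add: card_PiE power_mult_distrib)
 also have "... <= exp (- (2*real \<sigma>))^card J"
 proof (rule power_mono)
  have "3 <= 1 + real \<sigma>" using sigma_ge by simp
  also have "... <= exp (real \<sigma>)" by (rule exp_ge_add_one_self)
  finally have "3 <= exp (real \<sigma>)" .
  then have "3*eta <= exp (real \<sigma>)*eta" using eta01 by (intro mult_right_mono) auto
  also have "... = exp (- (2*real \<sigma>))" by (simp add: eta_def exp_add[symmetric])
  finally show "3*eta <= exp (- (2*real \<sigma>))" .
 qed (use eta01 in simp)
 finally show ?thesis .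
qed

end

section \<open>Total variation of averaged functions on coarser and coarser grids\<close>

lemma sum_PiE_split: assumes "k < d" and fin: "!!j. j < d ==> finite (S j)"
 shows "(\<Sum>x\<in>PiE {..<d::nat} S. g x) = (\<Sum>y\<in>PiE ({..<d} - {k}) S. \<Sum>t\<in>S k. g (y(k := t)))"
proof -
 have ins: "{..<d} = insert k ({..<d} - {k})" using assms by auto
 have "PiE {..<d} S = (%(t, y). y(k := t)) ` (S k \<times> PiE ({..<d} - {k}) S)" by (subst ins) (rule PiE_insert_eq)
 moreover have "inj_on (%(t, y). y(k := t)) (S k \<times> PiE ({..<d} - {k}) S)"
 proof (rule inj_onI, clarsimp)
  fix t s y z assume y: "y \<in> PiE ({..<d} - {k}) S" and z: "z \<in> PiE ({..<d} - {k}) S" and eq: "y(k := t) = z(k := s)"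
  have "y k = z k" using y z by (auto simp: PiE_iff extensional_def)
  then show "t = s & y = z" using eq by (metis fun_upd_eqD fun_upd_triv fun_upd_upd)
 qed
 ultimately have "(\<Sum>x\<in>PiE {..<d} S. g x) = (\<Sum>(t, y)\<in>S k \<times> PiE ({..<d} - {k}) S. g (y(k := t)))"
  by (simp add: sum.reindex case_prod_unfold)
 also have "... = (\<Sum>t\<in>S k. \<Sum>y\<in>PiE ({..<d} - {k}) S. g (y(k := t)))" by (rule sum.cartesian_product[symmetric])
 also have "... = (\<Sum>y\<in>PiE ({..<d} - {k}) S. \<Sum>t\<in>S k. g (y(k := t)))" by (rule sum.swap)
 finally show ?thesis .
qed

lemma line_variation:
 fixes a b :: "int => real"
 assumes step: "!!u. 0 <= u ==> u < l - 1 ==> \<bar>a (u + 1) - a u\<bar> <= b u" and s: "0 <= s" "s < l" and t: "0 <= t" "t < l"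
 shows "\<bar>a s - a t\<bar> <= (\<Sum>u\<in>{0..<l - 1}. b u)"
proof -
 have b0: "0 <= b u" if "0 <= u" "u < l - 1" for u using step[OF that] by linarith
 have *: "\<bar>a t - a s\<bar> <= (\<Sum>u\<in>{s..<t}. b u)" if "0 <= s" "s <= t" "t < l" for s t using that(2,3)
 proof (induction t rule: int_ge_induct)
  case (step t)
  have "\<bar>a (t + 1) - a s\<bar> <= \<bar>a t - a s\<bar> + \<bar>a (t + 1) - a t\<bar>" by linarith
  also have "... <= (\<Sum>u\<in>{s..<t}. b u) + b t" using step assms(1)[of t] that(1) by (intro add_mono) auto
  also have "... = (\<Sum>u\<in>{s..<t + 1}. b u)"
  proof -
   have "{s..<t + 1} = insert t {s..<t}" using step by auto
   then show ?thesis by simp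
  qed
  finally show ?case .
 qed simp
 have sub: "(\<Sum>u\<in>{s..<t}. b u) <= (\<Sum>u\<in>{0..<l - 1}. b u)" if "0 <= s" "t < l" for s t using that b0 by (intro sum_mono2) auto
 show ?thesis
 proof (cases "s <= t")
  case True
  then show ?thesis using *[of s t] sub[of s t] s t by (simp add: abs_minus_commute)
 next
  case False
  then show ?thesis using *[of t s] sub[of t s] s t by simp
 qed
qed

text \<open>A box of side \<open>l\<close> in dimension \<open>d\<close>: a function \<open>g\<close> on the box whose increments along the
 lines through the product set \<open>Y\<close> are controlled by \<open>w\<close>; nothing is known about lines that
 avoid \<open>Y\<close> in all of their transversal coordinates.\<close>

locale grid_box =
 fixes d l :: nat and g :: "pt => real" and w :: "nat => pt => real" and Y :: "nat => int set"
 assumes d2: "2 <= d" and Yl: "!!k. k < d ==> Y k \<subseteq> {0..<int l}" and Yne: "!!k. k < d ==> Y k ~= {}"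
  and w0: "!!k x. 0 <= w k x"
  and line: "!!k x j. k < d ==> j < d ==> j ~= k ==> x \<in> torus d l ==> x k + 1 < int l ==> x j \<in> Y j ==>
   \<bar>g (x(k := x k + 1)) - g x\<bar> <= w k x"
begin

lemma finite_Y: "k < d ==> finite (Y k)" using Yl finite_subset by blast

lemma line_le: assumes k: "k < d" and S: "!!j. j < d ==> S j \<subseteq> {0..<int l}" and j: "j < d" "j ~= k" "S j \<subseteq> Y j"
  and y: "y \<in> PiE ({..<d} - {k}) S" and st: "s \<in> {0..<int l}" "t \<in> {0..<int l}"
 shows "\<bar>g (y(k := s)) - g (y(k := t))\<bar> <= (\<Sum>u\<in>{0..<int l - 1}. w k (y(k := u)))"
proof (rule line_variation[where a = "%u. g (y(k := u))"])
 fix u :: int assume u: "0 <= u" "u < int l - 1"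
 define x where "x = y(k := u)"
 have "x \<in> torus d l"
  unfolding x_def torus_def using y S u k by (auto simp: PiE_iff extensional_def) (metis Diff_iff atLeastLessThan_iff lessThan_iff singletonD subsetD)+
 moreover have "x j \<in> Y j" using y j by (auto simp: x_def PiE_iff)
 ultimately have "\<bar>g (x(k := x k + 1)) - g x\<bar> <= w k x" using k j u by (intro line) (auto simp: x_def)
 then show "\<bar>g (y(k := u + 1)) - g (y(k := u))\<bar> <= w k (y(k := u))" by (simp add: x_def)
qed (use st in auto)

lemma lines_sum_le: assumes k: "k < d" and S: "!!j. j < d ==> S j \<subseteq> {0..<int l}"
 shows "(\<Sum>y\<in>PiE ({..<d} - {k}) S. \<Sum>u\<in>{0..<int l - 1}. w k (y(k := u))) <= (\<Sum>x\<in>torus d l. w k x)"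
proof -
 define S' where "S' = S(k := {0..<int l - 1})"
 have fin: "finite (S' j)" if "j < d" for j using S that finite_subset[of "S j" "{0..<int l}"] by (auto simp: S'_def)
 have "PiE ({..<d} - {k}) S = PiE ({..<d} - {k}) S'" by (intro PiE_cong) (auto simp: S'_def)
 then have "(\<Sum>y\<in>PiE ({..<d} - {k}) S. \<Sum>u\<in>{0..<int l - 1}. w k (y(k := u))) = (\<Sum>y\<in>PiE ({..<d} - {k}) S'. \<Sum>u\<in>S' k. w k (y(k := u)))" by (simp add: S'_def)
 also have "... = (\<Sum>x\<in>PiE {..<d} S'. w k x)" using fin k by (intro sum_PiE_split[symmetric]) auto
 also have "... <= (\<Sum>x\<in>torus d l. w k x)"
 proof (rule sum_mono2)
  show "finite (torus d l)" unfolding torus_def by (intro finite_PiE) auto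
  show "PiE {..<d} S' \<subseteq> torus d l" unfolding torus_def
  proof (rule PiE_mono)
   fix j assume "j \<in> {..<d}"
   then show "S' j \<subseteq> {0..<int l}" using S[of j] by (auto simp: S'_def)
  qed
 qed (use w0 in auto)
 finally show ?thesis .
qed

definition mean :: "(nat => int set) => real" where "mean S = (\<Sum>x\<in>PiE {..<d} S. g x)/(\<Prod>j<d. real (card (S j)))"

text \<open>On one line the two averages differ by at most the removed fraction times the variation
  of the line. The coordinate \<open>j\<close>, restricted to \<open>Y j\<close>, ensures that every
  line involved is controlled.\<close>

lemma mean_swap: assumes k: "k < d" and S: "!!j. j < d ==> S j \<subseteq> {0..<int l}" and Sne: "!!j. j < d ==> S j ~= {}"
  and j: "j < d" "j ~= k" "S j \<subseteq> Y j" and Z: "Z \<subseteq> S k" "Z ~= {}"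
 shows "\<bar>mean S - mean (S(k := Z))\<bar> \<le>
  (real (card (S k)) - real (card Z))/real (card (S k))/(\<Prod>j\<in>{..<d} - {k}. real (card (S j)))*(\<Sum>x\<in>torus d l. w k x)"
proof -
 have finS: "finite (S j)" if "j < d" for j using S[OF that] finite_subset by blast
 have finZ: "finite Z" using Z(1) finS[OF k] finite_subset by blast
 define Ot where "Ot = PiE ({..<d} - {k}) S"
 define p where "p = (\<Prod>j\<in>{..<d} - {k}. real (card (S j)))"
 define a where "a = real (card (S k))"
 define b where "b = real (card Z)"
 have a0: "a > 0" using Sne[OF k] finS[OF k] by (simp add: a_def card_gt_0_iff)
 have b0: "b > 0" using Z finZ by (simp add: b_def card_gt_0_iff)
 have ba: "b <= a" unfolding a_def b_def using Z finS[OF k] by (simp add: card_mono)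
 have p0: "p > 0" unfolding p_def using Sne finS by (intro prod_pos) (auto simp: card_gt_0_iff)
 define V where "V y = (\<Sum>u\<in>{0..<int l - 1}. w k (y(k := u)))" for y :: pt
 have pa: "(\<Prod>j<d. real (card (S j))) = a*p" unfolding a_def p_def using k by (subst prod.remove[of _ k]) auto
 have pb: "(\<Prod>j<d. real (card ((S(k := Z)) j))) = b*p" unfolding b_def p_def using k by (subst prod.remove[of _ k]) auto
 have "(\<Sum>x\<in>PiE {..<d} S. g x) = (\<Sum>y\<in>Ot. \<Sum>t\<in>S k. g (y(k := t)))"
  unfolding Ot_def using finS k by (intro sum_PiE_split) auto
 then have mS: "mean S = (\<Sum>y\<in>Ot. (\<Sum>t\<in>S k. g (y(k := t)))/a)/p" unfolding mean_def pa by (simp add: sum_divide_distrib[symmetric])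
 have "(\<Sum>x\<in>PiE {..<d} (S(k := Z)). g x) = (\<Sum>y\<in>PiE ({..<d} - {k}) (S(k := Z)). \<Sum>t\<in>Z. g (y(k := t)))"
  using finS finZ k by (subst sum_PiE_split[of k]) auto
 also have "PiE ({..<d} - {k}) (S(k := Z)) = Ot" unfolding Ot_def by (intro PiE_cong) auto
 finally have eq: "(\<Sum>x\<in>PiE {..<d} (S(k := Z)). g x) = (\<Sum>y\<in>Ot. \<Sum>t\<in>Z. g (y(k := t)))" .
 have mZ: "mean (S(k := Z)) = (\<Sum>y\<in>Ot. (\<Sum>t\<in>Z. g (y(k := t)))/b)/p" unfolding mean_def pb eq by (simp add: sum_divide_distrib[symmetric])
 have one: "\<bar>(\<Sum>t\<in>S k. g (y(k := t)))/a - (\<Sum>t\<in>Z. g (y(k := t)))/b\<bar> <= (a - b)/a*V y" if y: "y \<in> Ot" for y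
 proof -
  define r where "r t = g (y(k := t))" for t
  have rr: "\<bar>r s - r t\<bar> <= V y" if "s \<in> S k" "t \<in> S k" for s t unfolding r_def V_def using y that S[OF k] unfolding Ot_def
   by (intro line_le[where S = S and j = j, OF k S j]) auto
  have split: "(\<Sum>t\<in>S k. r t) = (\<Sum>t\<in>Z. r t) + (\<Sum>t\<in>S k - Z. r t)" using Z finS[OF k] by (subst sum.subset_diff[of Z]) auto
  have cd: "real (card (S k - Z)) = a - b"
   unfolding a_def b_def using Z finZ finS[OF k] by (subst card_Diff_subset) (auto simp: card_mono of_nat_diff)
  \<comment> \<open>The difference of the averages becomes a double sum over a removed and a kept
    point, each term of which is at most the variation.\<close>
  have "(\<Sum>t\<in>S k - Z. \<Sum>s\<in>Z. r t - r s) = b*(\<Sum>t\<in>S k - Z. r t) - (a - b)*(\<Sum>s\<in>Z. r s)"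
   by (simp add: sum_subtractf sum_distrib_left[symmetric] cd b_def[symmetric])
  then have "(\<Sum>t\<in>S k. r t)/a - (\<Sum>t\<in>Z. r t)/b = (\<Sum>t\<in>S k - Z. \<Sum>s\<in>Z. r t - r s)/(a*b)" unfolding split using a0 b0 by (simp add: field_simps)
  also have "\<bar>...\<bar> <= (\<Sum>t\<in>S k - Z. \<Sum>s\<in>Z. \<bar>r t - r s\<bar>)/(a*b)"
   using a0 b0 unfolding abs_divide by (simp add: divide_right_mono order_trans[OF sum_abs sum_mono[OF sum_abs]])
  also have "... <= (\<Sum>t\<in>S k - Z. \<Sum>s\<in>Z. V y)/(a*b)" using a0 b0 Z rr by (intro divide_right_mono sum_mono) auto
  also have "... = (a - b)/a*V y" using a0 b0 by (simp add: cd b_def[symmetric])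
  finally show ?thesis by (simp add: r_def)
 qed
 have "\<bar>mean S - mean (S(k := Z))\<bar> = \<bar>\<Sum>y\<in>Ot. (\<Sum>t\<in>S k. g (y(k := t)))/a - (\<Sum>t\<in>Z. g (y(k := t)))/b\<bar>/p"
  unfolding mS mZ using p0 by (simp add: sum_subtractf diff_divide_distrib[symmetric] abs_divide)
 also have "... <= (\<Sum>y\<in>Ot. (a - b)/a*V y)/p" using p0 one by (intro divide_right_mono order_trans[OF sum_abs] sum_mono) auto
 also have "... = (a - b)/a/p*(\<Sum>y\<in>Ot. V y)" unfolding sum_distrib_left[symmetric] by simp
 also have "... <= (a - b)/a/p*(\<Sum>x\<in>torus d l. w k x)"
  unfolding Ot_def V_def using a0 ba p0 by (intro mult_left_mono lines_sum_le[OF k S]) auto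
 finally show ?thesis by (simp add: a_def b_def p_def)
qed

text \<open>Exchanging the first \<open>m\<close> coordinates of a pair of points is an involution of the pairs, which
 turns a step of the path that changes the coordinates one at a time into a step along one line.\<close>

lemma poincare: assumes q: "!!k. k < d ==> card (Y k) = q"
 shows "(\<Sum>x\<in>PiE {..<d} Y. \<Sum>y\<in>PiE {..<d} Y. \<bar>g x - g y\<bar>) <= real q^(d + 1)*(\<Sum>k<d. \<Sum>x\<in>torus d l. w k x)"
proof -
 define P where "P = PiE {..<d} Y"
 define H where "H m x y = (%k. if k < m then (y :: pt) k else (x :: pt) k)" for m x y
 have HP: "H m x y \<in> P" if "x \<in> P" "y \<in> P" for m x y using that unfolding P_def H_def by (auto simp: PiE_iff extensional_def)
 have Hd: "H d x y = y" if "x \<in> P" "y \<in> P" for x y using that unfolding P_def H_def by (auto simp: PiE_iff extensional_def fun_eq_iff)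
 have H0: "H 0 x y = x" for x y by (simp add: H_def)
 have "(\<Sum>x\<in>P. \<Sum>y\<in>P. \<bar>g x - g y\<bar>) <= (\<Sum>x\<in>P. \<Sum>y\<in>P. \<Sum>m<d. \<bar>g (H m x y) - g (H (Suc m) x y)\<bar>)"
 proof (intro sum_mono)
  fix x y assume xy: "x \<in> P" "y \<in> P"
  have "g x - g y = (\<Sum>m<d. g (H m x y) - g (H (Suc m) x y))" using sum_lessThan_telescope'[of "%m. g (H m x y)" d] H0 Hd[OF xy] by simp
  also have "\<bar>...\<bar> <= (\<Sum>m<d. \<bar>g (H m x y) - g (H (Suc m) x y)\<bar>)" by (rule sum_abs)
  finally show "\<bar>g x - g y\<bar> <= (\<Sum>m<d. \<bar>g (H m x y) - g (H (Suc m) x y)\<bar>)" .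
 qed
 also have "... = (\<Sum>x\<in>P. \<Sum>m<d. \<Sum>y\<in>P. \<bar>g (H m x y) - g (H (Suc m) x y)\<bar>)" by (intro sum.cong refl sum.swap)
 also have "... = (\<Sum>m<d. \<Sum>x\<in>P. \<Sum>y\<in>P. \<bar>g (H m x y) - g (H (Suc m) x y)\<bar>)" by (rule sum.swap)
 also have "... <= (\<Sum>m<d. real q^(d + 1)*(\<Sum>x\<in>torus d l. w m x))"
 proof (rule sum_mono)
  fix m assume "m \<in> {..<d}"
  then have m: "m < d" by simp
  obtain j where j: "j < d" "j ~= m" using d2 m by (metis One_nat_def less_2_cases_iff less_le_trans nat_neq_iff zero_less_Suc lessI numeral_2_eq_2)
  define Ot where "Ot = PiE ({..<d} - {m}) Y"
  define V where "V y = (\<Sum>u\<in>{0..<int l - 1}. w m (y(m := u)))" for y :: pt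
  have "H (Suc m) x y = (H m x y)(m := H m y x m)" for x y by (auto simp: H_def fun_eq_iff)
  then have "(\<Sum>x\<in>P. \<Sum>y\<in>P. \<bar>g (H m x y) - g (H (Suc m) x y)\<bar>) = (\<Sum>(x, y)\<in>P \<times> P. \<bar>g (H m x y) - g ((H m x y)(m := H m y x m))\<bar>)" by (simp add: sum.cartesian_product)
  also have "... = (\<Sum>(x, y)\<in>P \<times> P. \<bar>g x - g (x(m := y m))\<bar>)"
   by (rule sum.reindex_bij_witness[of _ "%(x, y). (H m x y, H m y x)" "%(x, y). (H m x y, H m y x)"])
     (use HP in \<open>auto simp: H_def fun_eq_iff\<close>)
  also have "... = (\<Sum>x\<in>P. \<Sum>y\<in>P. \<bar>g x - g (x(m := y m))\<bar>)" by (rule sum.cartesian_product[symmetric])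
  also have "... = (\<Sum>x\<in>P. real (card Ot)*(\<Sum>t\<in>Y m. \<bar>g x - g (x(m := t))\<bar>))"
  proof (intro sum.cong refl)
   fix x
   have "(\<Sum>y\<in>P. \<bar>g x - g (x(m := y m))\<bar>) = (\<Sum>z\<in>Ot. \<Sum>t\<in>Y m. \<bar>g x - g (x(m := (z(m := t)) m))\<bar>)"
    unfolding P_def Ot_def using finite_Y m by (intro sum_PiE_split) auto
   then show "(\<Sum>y\<in>P. \<bar>g x - g (x(m := y m))\<bar>) = real (card Ot)*(\<Sum>t\<in>Y m. \<bar>g x - g (x(m := t))\<bar>)" by simp
  qed
  also have "... = real (card Ot)*(\<Sum>x\<in>P. \<Sum>t\<in>Y m. \<bar>g x - g (x(m := t))\<bar>)" by (simp add: sum_distrib_left)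
  also have "(\<Sum>x\<in>P. \<Sum>t\<in>Y m. \<bar>g x - g (x(m := t))\<bar>) = (\<Sum>z\<in>Ot. \<Sum>s\<in>Y m. \<Sum>t\<in>Y m. \<bar>g (z(m := s)) - g ((z(m := s))(m := t))\<bar>)"
   unfolding P_def Ot_def using finite_Y m by (intro sum_PiE_split) auto
  also have "... <= (\<Sum>z\<in>Ot. \<Sum>s\<in>Y m. \<Sum>t\<in>Y m. V z)"
  proof (intro sum_mono)
   fix z s t assume z: "z \<in> Ot" and st: "s \<in> Y m" "t \<in> Y m"
   have "\<bar>g (z(m := s)) - g (z(m := t))\<bar> <= V z"
    unfolding V_def using z st Yl[OF m] j unfolding Ot_def by (intro line_le[where S = Y and j = j, OF m Yl]) auto
   then show "\<bar>g (z(m := s)) - g ((z(m := s))(m := t))\<bar> <= V z" by simp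
  qed
  also have "... = (real q*real q)*(\<Sum>z\<in>Ot. V z)" using q[OF m] by (simp add: sum_distrib_left mult.assoc)
  also have "... <= (real q*real q)*(\<Sum>x\<in>torus d l. w m x)" unfolding Ot_def V_def using Yl m by (intro mult_left_mono lines_sum_le) auto
  also have "real (card Ot) = real q^(d - 1)" unfolding Ot_def using q m by (subst card_PiE) auto
  also have "real q^(d - 1)*((real q*real q)*(\<Sum>x\<in>torus d l. w m x)) = real q^(d + 1)*(\<Sum>x\<in>torus d l. w m x)"
  proof -
   have "real q^(d + 1) = real q^((d - 1) + 2)" using d2 by simp
   then show ?thesis by (simp only: power_add power2_eq_square mult.assoc)
  qed
  finally show "(\<Sum>x\<in>P. \<Sum>y\<in>P. \<bar>g (H m x y) - g (H (Suc m) x y)\<bar>) <= real q^(d + 1)*(\<Sum>x\<in>torus d l. w m x)"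
   by (simp add: mult_left_mono)
 qed
 finally show ?thesis by (simp add: P_def sum_distrib_left)
qed

end

section \<open>Periodic functions and their sums over boxes\<close>

definition per :: "nat => nat => (pt => 'a) => bool" where
 "per d n f \<longleftrightarrow> (\<forall>c c'. (\<forall>i<d. c i mod int n = c' i mod int n) --> f c = f c')"

lemma perD: "per d n f ==> (!!i. i < d ==> c i mod int n = c' i mod int n) ==> f c = f c'" by (auto simp: per_def)

lemma sum_per_shift:
 fixes f :: "pt => real"
 assumes f: "per d n f" and n: "n > 0"
 shows "(\<Sum>c\<in>torus d n. f (%i. c i + z i)) = (\<Sum>c\<in>torus d n. f c)"
proof (rule sum.reindex_bij_witness[of _ "%c. restrict (%i. (c i - z i) mod int n) {..<d}" "%c. restrict (%i. (c i + z i) mod int n) {..<d}"])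
 fix c assume c: "c \<in> torus d n"
 have "(\<lambda>i\<in>{..<d}. ((\<lambda>i\<in>{..<d}. (c i + z i) mod int n) i - z i) mod int n) i = c i" for i
  using c unfolding torus_def by (cases "i < d") (auto simp: PiE_iff extensional_def mod_simps)
 then show "(\<lambda>i\<in>{..<d}. ((\<lambda>i\<in>{..<d}. (c i + z i) mod int n) i - z i) mod int n) = c" by (rule ext)
 show "(\<lambda>i\<in>{..<d}. (c i + z i) mod int n) \<in> torus d n" unfolding torus_def using n by auto
 show "f (\<lambda>i\<in>{..<d}. (c i + z i) mod int n) = f (%i. c i + z i)" using f by (rule perD) simp
next
 fix c assume c: "c \<in> torus d n"
 have "(\<lambda>i\<in>{..<d}. ((\<lambda>i\<in>{..<d}. (c i - z i) mod int n) i + z i) mod int n) i = c i" for i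
  using c unfolding torus_def by (cases "i < d") (auto simp: PiE_iff extensional_def mod_simps)
 then show "(\<lambda>i\<in>{..<d}. ((\<lambda>i\<in>{..<d}. (c i - z i) mod int n) i + z i) mod int n) = c" by (rule ext)
 show "(\<lambda>i\<in>{..<d}. (c i - z i) mod int n) \<in> torus d n" unfolding torus_def using n by auto
qed

text \<open>Position of the part \<open>x\<close> of the box \<open>B\<close> on the finer grid. No
  reduction modulo the size is made, as all functions evaluated there are periodic.\<close>

definition sub :: "nat => pt => pt => pt" where "sub l B x = (%i. int l*B i + x i)"

lemma per_comp: "per d n f ==> (!!c c'. f c = f c' ==> g c = g c') ==> per d n g" unfolding per_def by metis

lemma per_comp2: "per d n f ==> per d n g ==> per d n (%c. k (f c) (g c))" unfolding per_def by metis

lemma per_all: "(!!x. per d n (F x)) ==> per d n (%c x. F x c)" unfolding per_def fun_eq_iff by blast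

lemma per_upd: "per d n f ==> per d n (%c. f (c(k := c k + 1)))" unfolding per_def by (smt (verit) fun_upd_apply mod_add_cong)

lemma per_sub: "per d (l*m) f ==> per d m (%B x. f (sub l B x))" unfolding per_def
proof (intro allI impI)
 fix c c' :: pt assume f: "\<forall>c c'. (\<forall>i<d. c i mod int (l*m) = c' i mod int (l*m)) --> f c = f c'"
  and eq: "\<forall>i<d. c i mod int m = c' i mod int m"
 have "sub l c x i mod int (l*m) = sub l c' x i mod int (l*m)" if "i < d" for i x
 proof -
  have "(int l*c i) mod (int l*int m) = (int l*c' i) mod (int l*int m)" using eq that by (simp add: mult_mod_right[symmetric])
  then show ?thesis unfolding sub_def using mod_add_cong[of "int l*c i" "int l*int m" "int l*c' i" "x i" "x i"] by simp
 qed
 then show "(%x. f (sub l c x)) = (%x. f (sub l c' x))" by (intro ext f[rule_format]) simp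
qed

lemma sum_blocks:
 fixes f :: "pt => real"
 assumes f: "per d (l*m) f" and l: "l > 0"
 shows "(\<Sum>c\<in>torus d (l*m). f c) = (\<Sum>B\<in>torus d m. \<Sum>x\<in>torus d l. f (sub l B x))"
proof -
 have "(\<Sum>B\<in>torus d m. \<Sum>x\<in>torus d l. f (sub l B x)) = (\<Sum>(B, x)\<in>torus d m \<times> torus d l. f (sub l B x))"
  by (rule sum.cartesian_product)
 also have "... = (\<Sum>c\<in>torus d (l*m). f c)"
 proof -
  define D where "D c = restrict (%i. c i div int l) {..<d}" for c
  define M where "M c = restrict (%i. c i mod int l) {..<d}" for c
  define R where "R B x = restrict (sub l B x) {..<d}" for B x
  have bij1: "R B x \<in> torus d (l*m) & D (R B x) = B & M (R B x) = x & f (R B x) = f (sub l B x)"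
   if B: "B \<in> torus d m" and x: "x \<in> torus d l" for B x
  proof -
   have Bx: "0 <= B i" "B i < int m" "0 <= x i" "x i < int l" if "i < d" for i using B x that unfolding torus_def by (auto simp: PiE_iff)
   have ext: "B i = undefined" "x i = undefined" if "~ i < d" for i using B x that unfolding torus_def by (auto simp: PiE_iff extensional_def)
   have "sub l B x i \<in> {0..<int (l*m)}" if "i < d" for i
   proof -
    have "int l*B i + x i < int l*(B i + 1)" using Bx[OF that] by (simp add: distrib_left)
    also have "... <= int l*int m" using Bx[OF that] by (intro mult_left_mono) auto
    finally show ?thesis using Bx[OF that] by (simp add: sub_def)
   qed
   then have "R B x \<in> torus d (l*m)" unfolding torus_def R_def by auto
   moreover have "D (R B x) i = B i" "M (R B x) i = x i" for i using Bx[of i] ext[of i] l by (cases "i < d"; auto simp: sub_def D_def R_def M_def)+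
   moreover have "f (R B x) = f (sub l B x)" by (rule perD[OF f]) (simp add: R_def)
   ultimately show ?thesis by (simp add: fun_eq_iff)
  qed
  have bij2: "D c \<in> torus d m & M c \<in> torus d l & R (D c) (M c) = c" if c: "c \<in> torus d (l*m)" for c
  proof -
   have ci: "0 <= c i" "c i < int l*int m" if "i < d" for i using c that unfolding torus_def by (auto simp: PiE_iff)
   have ext: "c i = undefined" if "~ i < d" for i using c that unfolding torus_def by (auto simp: PiE_iff extensional_def)
   have "M c \<in> torus d l" unfolding torus_def M_def using l by auto
   moreover have "c i div int l < int m" if "i < d" for i
   proof (rule ccontr)
    assume "~ c i div int l < int m"
    then have "int m*int l <= c i div int l*int l" by (intro mult_right_mono) auto
    also have "... <= c i" using div_mult_mod_eq[of "c i" "int l"] pos_mod_sign[of "int l" "c i"] l by linarith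
    finally show False using ci[OF that] by (simp add: mult.commute)
   qed
   then have "D c \<in> torus d m" unfolding torus_def D_def using ci l by (auto simp: pos_imp_zdiv_nonneg_iff)
   moreover have "R (D c) (M c) i = c i" for i using ext[of i] by (cases "i < d") (auto simp: sub_def R_def D_def M_def)
   ultimately show ?thesis by (simp add: fun_eq_iff)
  qed
  show ?thesis by (rule sum.reindex_bij_witness[of _ "%c. (D c, M c)" "%(B, x). R B x"]) (use bij1 bij2 in auto)
 qed
 finally show ?thesis by simp
qed

text \<open>Comparing points at distance l along two adjacent segments of length l: the edge with
  offset u is crossed u + 1 times in the first and l - 1 - u times in the second segment, together l
  times for every offset.\<close>

lemma sum_double_window:
 fixes b :: "int => real"
 shows "(\<Sum>t\<in>{0..<int l}. \<Sum>u\<in>{t..<t + int l}. b u) =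
  (\<Sum>u\<in>{0..<int l}. of_int (u + 1)*b u + of_int (int l - 1 - u)*b (u + int l))"
proof -
 have one: "(\<Sum>u\<in>{t..<t + int l}. b u) = (\<Sum>u\<in>{0..<int l}. of_bool (t <= u)*b u + of_bool (u < t)*b (u + int l))"
  if t: "t \<in> {0..<int l}" for t
 proof -
  have "{t..<t + int l} = {t..<int l} \<union> {int l..<t + int l}" using t by auto
  then have "(\<Sum>u\<in>{t..<t + int l}. b u) = (\<Sum>u\<in>{t..<int l}. b u) + (\<Sum>u\<in>{int l..<t + int l}. b u)"
   by (simp add: sum.union_disjoint)
  also have "(\<Sum>u\<in>{int l..<t + int l}. b u) = (\<Sum>u\<in>{0..<t}. b (u + int l))"
   by (rule sum.reindex_bij_witness[of _ "%u. u + int l" "%u. u - int l"]) auto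
  also have "(\<Sum>u\<in>{t..<int l}. b u) = (\<Sum>u\<in>{0..<int l}. of_bool (t <= u)*b u)" using t by (intro sum.mono_neutral_cong_left) auto
  also have "(\<Sum>u\<in>{0..<t}. b (u + int l)) = (\<Sum>u\<in>{0..<int l}. of_bool (u < t)*b (u + int l))"
   using t by (intro sum.mono_neutral_cong_left) auto
  finally show ?thesis by (simp add: sum.distrib)
 qed
 have "(\<Sum>t\<in>{0..<int l}. \<Sum>u\<in>{t..<t + int l}. b u) =
  (\<Sum>t\<in>{0..<int l}. \<Sum>u\<in>{0..<int l}. of_bool (t <= u)*b u + of_bool (u < t)*b (u + int l))"
  by (intro sum.cong refl one)
 also have "... = (\<Sum>u\<in>{0..<int l}. \<Sum>t\<in>{0..<int l}. of_bool (t <= u)*b u + of_bool (u < t)*b (u + int l))" by (rule sum.swap)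
 also have "... = (\<Sum>u\<in>{0..<int l}. of_int (u + 1)*b u + of_int (int l - 1 - u)*b (u + int l))"
 proof (intro sum.cong refl)
  fix u assume u: "u \<in> {0..<int l}"
  have "{0..<int l} \<inter> {t. t <= u} = {0..u}" using u by auto
  then have "(\<Sum>t\<in>{0..<int l}. of_bool (t <= u) :: real) = of_int (u + 1)" using u by (simp add: sum.If_cases of_bool_def)
  moreover have "(\<Sum>t\<in>{0..<int l}. of_bool (u < t) :: real) = of_int (int l - 1 - u)"
  proof -
   have "{0..<int l} \<inter> {t. u < t} = {u + 1..<int l}" using u by auto
   then show ?thesis using u by (simp add: sum.If_cases of_bool_def)
  qed
  ultimately show "(\<Sum>t\<in>{0..<int l}. of_bool (t <= u)*b u + of_bool (u < t)*b (u + int l))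
    = of_int (u + 1)*b u + of_int (int l - 1 - u)*b (u + int l)"
   by (simp only: sum.distrib sum_distrib_right[symmetric])
 qed
 finally show ?thesis .
qed

context grid_box begin

lemma mean_cong: "(!!k. k < d ==> S k = S' k) ==> mean S = mean S'"
proof -
 assume eq: "!!k. k < d ==> S k = S' k"
 have "PiE {..<d} S = PiE {..<d} S'" by (intro PiE_cong) (auto simp: eq)
 moreover have "(\<Prod>j<d. real (card (S j))) = (\<Prod>j<d. real (card (S' j)))" by (intro prod.cong) (auto simp: eq)
 ultimately show ?thesis by (simp add: mean_def)
qed

text \<open>The factors are exchanged one at a time. While the transversal ones shrink to
  \<open>Z\<close>, factor \<open>i\<close> is still \<open>Y i\<close> and controls the lines; when
  factor \<open>i\<close> is finally enlarged to the full range, the others lie in \<open>Z\<close>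
  and take over this task.\<close>

lemma mean_shrink: assumes i: "i < d" and q: "!!k. k < d ==> card (Y k) = l - h" and lh: "2*h < l"
  and Z: "!!k. k < d ==> Z k \<subseteq> Y k" "!!k. k < d ==> l - 2*h <= card (Z k)"
 shows "\<bar>mean Y - mean (%k. if k = i then {0..<int l} else Z k)\<bar> \<le>
  real h/real (l - h)/real (l - 2*h)^(d - 1)*(\<Sum>k<d. \<Sum>x\<in>torus d l. w k x)"
proof -
 define c where "c = real h/real (l - h)/real (l - 2*h)^(d - 1)"
 define W where "W k = (\<Sum>x\<in>torus d l. w k x)" for k
 have W0: "W k >= 0" for k unfolding W_def by (intro sum_nonneg w0)
 have Zne: "Z k ~= {}" if "k < d" for k using Z(2)[OF that] lh by auto
 have Zl: "Z k \<subseteq> {0..<int l}" if "k < d" for k using Z(1)[OF that] Yl[OF that] by auto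
 define S where "S j k = (if k = i then Y i else if k < j then Z k else Y k)" for j k
 have SY: "S j k \<subseteq> Y k" if "k < d" for j k using Z(1)[OF that] by (auto simp: S_def)
 have Sl: "S j k \<subseteq> {0..<int l}" if "k < d" for j k using SY[OF that] Yl[OF that] by (rule order_trans)
 have Sne: "S j k ~= {}" if "k < d" for j k using Zne[OF that] Yne[OF that] Yne[OF i] by (auto simp: S_def)
 have Sz: "l - 2*h <= card (S j k)" if "k < d" for j k using Z(2)[OF that] q[OF that] q[OF i] by (auto simp: S_def)
 have prodge: "real (l - 2*h)^(d - 1) <= (\<Prod>j\<in>{..<d} - {k}. real (card (R j)))"
  if "k < d" "!!j. j < d ==> l - 2*h <= card (R j)" for k and R :: "nat => int set"
 proof -
  have "(\<Prod>j\<in>{..<d} - {k}. real (l - 2*h)) <= (\<Prod>j\<in>{..<d} - {k}. real (card (R j)))" using that(2) by (intro prod_mono) auto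
  then show ?thesis using that(1) by simp
 qed
 have frac: "(a - b)/a/p <= c" if "a - b <= real h" "0 <= a - b" "real (l - h) <= a" "real (l - 2*h)^(d - 1) <= p" for a b p :: real
  unfolding c_def using that lh by (intro frac_le) (auto intro: divide_nonneg_nonneg)
 have step: "\<bar>mean (S j) - mean (S (Suc j))\<bar> <= (if j = i then 0 else c*W j)" if j: "j < d" for j
 proof (cases "j = i")
  case True
  then have "S (Suc j) = S j" by (auto simp: S_def fun_eq_iff)
  then show ?thesis using True by simp
 next
  case False
  have upd: "S (Suc j) = (S j)(j := Z j)" using False by (auto simp: S_def fun_eq_iff)
  have SjY: "S j j = Y j" using False by (simp add: S_def)
  have "\<bar>mean (S j) - mean ((S j)(j := Z j))\<bar> \<le>
   (real (card (S j j)) - real (card (Z j)))/real (card (S j j))/(\<Prod>k\<in>{..<d} - {j}. real (card (S j k)))*W j"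
   unfolding W_def using Sl Sne SY i False Z(1) Zne j SjY by (intro mean_swap[of j "S j" i]) auto
  also have "... <= c*W j"
  proof (intro mult_right_mono frac W0)
   have "card (Z j) <= card (Y j)" using Z(1)[OF j] finite_Y[OF j] by (rule card_mono[rotated])
   then show "0 <= real (card (S j j)) - real (card (Z j))" unfolding SjY by simp
   show "real (card (S j j)) - real (card (Z j)) <= real h" unfolding SjY using q[OF j] Z(2)[OF j] lh by linarith
   show "real (l - h) <= real (card (S j j))" unfolding SjY using q[OF j] by simp
  qed (use prodge[OF j Sz] in auto)
  finally show ?thesis using False upd by simp
 qed
 define U where "U = (%k. if k = i then {0..<int l} else Z k)"
 have last: "\<bar>mean U - mean (S d)\<bar> <= c*W i"
 proof -
  obtain j where j: "j < d" "j ~= i" using d2 i by (metis One_nat_def less_2_cases_iff less_le_trans nat_neq_iff zero_less_Suc lessI numeral_2_eq_2)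
  have "mean (S d) = mean (U(i := Y i))" by (rule mean_cong) (auto simp: S_def U_def)
  moreover have "\<bar>mean U - mean (U(i := Y i))\<bar> \<le>
   (real (card (U i)) - real (card (Y i)))/real (card (U i))/(\<Prod>k\<in>{..<d} - {i}. real (card (U k)))*W i"
   unfolding W_def
   by (rule mean_swap[OF i _ _ j]) (use Zl Zne Z(1) Yl[OF i] Yne[OF i] i j lh in \<open>auto simp: U_def split: if_splits\<close>)
  moreover have "(real (card (U i)) - real (card (Y i)))/real (card (U i))/(\<Prod>k\<in>{..<d} - {i}. real (card (U k)))*W i <= c*W i"
  proof (intro mult_right_mono frac W0 prodge i)
   show "l - 2*h <= card (U j)" if "j < d" for j using Z(2)[OF that] by (auto simp: U_def)
  qed (use q[OF i] lh in \<open>auto simp: U_def\<close>)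
  ultimately show ?thesis by simp
 qed
 have "mean Y = mean (S 0)" by (rule mean_cong) (auto simp: S_def)
 then have "\<bar>mean Y - mean U\<bar> <= \<bar>mean (S 0) - mean (S d)\<bar> + \<bar>mean U - mean (S d)\<bar>" by linarith
 also have "\<bar>mean (S 0) - mean (S d)\<bar> <= (\<Sum>j<d. \<bar>mean (S j) - mean (S (Suc j))\<bar>)"
 proof -
  have "mean (S 0) - mean (S d) = (\<Sum>j<d. mean (S j) - mean (S (Suc j)))" using sum_lessThan_telescope'[of "%j. mean (S j)" d] by simp
  then show ?thesis by (simp add: sum_abs)
 qed
 also have "... <= (\<Sum>j<d. if j = i then 0 else c*W j)" by (intro sum_mono step) auto
 also have "... = (\<Sum>j\<in>{..<d} - {i}. c*W j)" using i by (subst sum.remove[of _ i]) auto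
 also note last
 also have "(\<Sum>j\<in>{..<d} - {i}. c*W j) + c*W i = (\<Sum>j<d. c*W j)" using i by (subst (2) sum.remove[of _ i]) auto
 finally show ?thesis unfolding U_def c_def W_def by (simp add: sum_distrib_left)
qed

end

section \<open>One level: averages over the good parts of boxes\<close>

locale level =
 fixes d l m h :: nat and f :: "pt => real" and good :: "pt => bool"
 assumes d2: "2 <= d" and lh: "2*h < l" and m0: "0 < m" and perf: "per d (l*m) f" and perg: "per d (l*m) good"
begin

definition edge :: "nat => pt => real" where "edge k c = (if good c & good (c(k := c k + 1)) then \<bar>f c - f (c(k := c k + 1))\<bar> else 0)"

text \<open>The bad parts of a good box fit into a cube of side \<open>h\<close>, at an arbitrary
  place; a bad box offers the two separated bad parts from which \<open>leafsets\<close>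
  branches.\<close>

definition goodB :: "pt => bool" where
 "goodB B \<longleftrightarrow> (\<forall>x\<in>torus d l. \<forall>y\<in>torus d l. ~ good (sub l B x) --> ~ good (sub l B y) \<longrightarrow>
   (\<forall>k<d. \<bar>x k - y k\<bar> < int h))"

text \<open>One coordinate in \<open>Y\<close> makes the part good, whatever the others are. The
  first condition ranges over all k, which spares later statements the side condition k < d.\<close>

definition okY :: "(pt => bool) => (nat => int set) => bool" where
 "okY gx Y \<longleftrightarrow> (\<forall>k. Y k \<subseteq> {0..<int l} & card (Y k) = l - h) & (\<forall>x\<in>torus d l. \<forall>k<d. x k \<in> Y k --> gx x)"

text \<open>The choice depends only on the pattern of good parts in the box, so it inherits the
  periodicity of \<open>good\<close>.\<close>

definition Yc :: "pt => nat => int set" where "Yc B = (SOME Y. okY (%x. good (sub l B x)) Y)"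

definition fB :: "pt => real" where "fB B = (\<Sum>x\<in>PiE {..<d} (Yc B). f (sub l B x))/real (l - h)^d"

definition edgeB :: "nat => pt => real" where
 "edgeB k B = (if goodB B & goodB (B(k := B k + 1)) then \<bar>fB B - fB (B(k := B k + 1))\<bar> else 0)"

lemma l0: "0 < l" and lh': "h < l" using lh by auto

lemma edge_nonneg: "0 <= edge k c" by (simp add: edge_def)

lemma Yc_ok: assumes "goodB B" shows "okY (%x. good (sub l B x)) (Yc B)"
proof -
 define Bad where "Bad = {x \<in> torus d l. ~ good (sub l B x)}"
 have near: "\<bar>x k - y k\<bar> < int h" if "x \<in> Bad" "y \<in> Bad" "k < d" for x y k using assms that by (auto simp: goodB_def Bad_def)
 have "\<exists>a. 0 <= a & a <= int (l - h) & (\<forall>x\<in>Bad. a <= x k & x k < a + int h)" if k: "k < d" for k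
 proof (cases "Bad = {}")
  case True
  then show ?thesis by (intro exI[of _ 0]) auto
 next
  case False
  have finB: "finite Bad" unfolding Bad_def using finite_torus by auto
  define mn where "mn = Min ((%x. x k) ` Bad)"
  have mn_le: "mn <= x k" if "x \<in> Bad" for x unfolding mn_def using finB that by auto
  have "mn \<in> (%x. x k) ` Bad" unfolding mn_def using finB False by (intro Min_in) auto
  then obtain x0 where x0: "x0 \<in> Bad" "mn = x0 k" by auto
  have inl: "0 <= x k & x k < int l" if "x \<in> Bad" for x using that k unfolding Bad_def torus_def by (auto simp: PiE_iff)
  \<comment> \<open>The deleted interval begins at the least bad value but is pushed back if it
    would stick out of the box.\<close>
  define a where "a = min mn (int (l - h))"
  have "a <= x k & x k < a + int h" if "x \<in> Bad" for x
   using mn_le[OF that] near[OF that x0(1) k] inl[OF that] x0 lh' by (auto simp: a_def min_def)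
  moreover have "0 <= a" using inl[OF x0(1)] x0 by (simp add: a_def)
  ultimately show ?thesis by (intro exI[of _ a]) (auto simp: a_def)
 qed
 then obtain a where a: "!!k. k < d ==> 0 <= a k & a k <= int (l - h) & (\<forall>x\<in>Bad. a k <= x k & x k < a k + int h)"
  by metis
 define Y where "Y k = (if k < d then {0..<int l} - {a k..<a k + int h} else {0..<int (l - h)})" for k
 have "Y k \<subseteq> {0..<int l} & card (Y k) = l - h" for k
 proof (cases "k < d")
  case True
  have "{a k..<a k + int h} \<subseteq> {0..<int l}" using a[OF True] lh' by auto
  then show ?thesis using True by (simp add: Y_def card_Diff_subset)
 next
  case False
  then show ?thesis using lh' by (auto simp: Y_def)
 qed
 moreover have "good (sub l B x)" if "x \<in> torus d l" "k < d" "x k \<in> Y k" for x k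
 proof (rule ccontr)
  assume "~ good (sub l B x)"
  then have "x \<in> Bad" using that by (simp add: Bad_def)
  then show False using a[OF that(2)] that by (auto simp: Y_def)
 qed
 ultimately have ex: "\<exists>Y. okY (%x. good (sub l B x)) Y" unfolding okY_def by (intro exI[of _ Y]) auto
 show ?thesis unfolding Yc_def by (rule someI_ex[OF ex])
qed

lemma sub_upd: "sub l B (x(k := x k + 1)) = (sub l B x)(k := sub l B x k + 1)" by (auto simp: sub_def fun_eq_iff)

lemma sub_next: "sub l (B(i := B i + 1)) x = sub l B (x(i := x i + int l))" by (auto simp: sub_def fun_eq_iff algebra_simps)

lemma torus_upd: "x \<in> torus d l ==> k < d ==> 0 <= u ==> u < int l ==> x(k := u) \<in> torus d l"
 unfolding torus_def by (auto simp: PiE_iff extensional_def)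

lemma box: "goodB B ==> grid_box d l (%x. f (sub l B x)) (%k x. edge k (sub l B x)) (Yc B)"
proof -
 assume B: "goodB B"
 have Y: "Yc B k \<subseteq> {0..<int l}" "card (Yc B k) = l - h" for k using Yc_ok[OF B] by (auto simp: okY_def)
 have good: "good (sub l B x)" if "x \<in> torus d l" "k < d" "x k \<in> Yc B k" for x k using Yc_ok[OF B] that by (auto simp: okY_def)
 show ?thesis
 proof
  show "Yc B k ~= {}" for k using Y(2)[of k] lh' by auto
  fix k x j assume a: "k < d" "j < d" "j ~= k" "x \<in> torus d l" "x k + 1 < int l" "x j \<in> Yc B j"
  have "0 <= x k" using a unfolding torus_def by (auto simp: PiE_iff)
  then have "x(k := x k + 1) \<in> torus d l" using a by (intro torus_upd) auto
  then have "good (sub l B (x(k := x k + 1)))" using a by (intro good[of _ j]) auto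
  moreover have "good (sub l B x)" using a by (intro good[of _ j]) auto
  ultimately show "\<bar>f (sub l B (x(k := x k + 1))) - f (sub l B x)\<bar> <= edge k (sub l B x)"
   unfolding edge_def sub_upd by (simp add: abs_minus_commute)
 qed (use d2 Y edge_nonneg in auto)
qed

definition Wt :: "pt => real" where "Wt B = (\<Sum>k<d. \<Sum>x\<in>torus d l. edge k (sub l B x))"

lemma per_edge: "per d (l*m) (edge k)"
 using perf perg per_upd[OF perf, of k] per_upd[OF perg, of k] unfolding per_def edge_def by metis

lemma fB_eq: assumes "goodB B" shows "fB B = grid_box.mean d (%x. f (sub l B x)) (Yc B)"
proof -
 interpret b: grid_box d l "%x. f (sub l B x)" "%k x. edge k (sub l B x)" "Yc B" by (rule box[OF assms])
 have "card (Yc B k) = l - h" for k using Yc_ok[OF assms] by (auto simp: okY_def)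
 then show ?thesis unfolding fB_def b.mean_def by simp
qed

text \<open>Both averages are moved to the common transversal set \<open>Z\<close> and to the full
  range in direction \<open>i\<close> by \<open>mean_shrink\<close>. The lines of the two boxes then
  join to lines of length 2 l consisting of good parts, on which points at distance l are
  compared.\<close>

lemma two_boxes: assumes B: "goodB B" and B': "goodB (B(i := B i + 1))" and i: "i < d" shows "\<bar>fB B - fB (B(i := B i + 1))\<bar> \<le>
  real h/real (l - h)/real (l - 2*h)^(d - 1)*(Wt B + Wt (B(i := B i + 1))) + 1/(real l*real (l - 2*h)^(d - 1)) *
   (\<Sum>x\<in>torus d l. of_int (x i + 1)*edge i (sub l B x) + of_int (int l - 1 - x i)*edge i (sub l (B(i := B i + 1)) x))"
proof -
 define B1 where "B1 = B(i := B i + 1)"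
 interpret b0: grid_box d l "%x. f (sub l B x)" "%k x. edge k (sub l B x)" "Yc B" by (rule box[OF B])
 interpret b1: grid_box d l "%x. f (sub l B1 x)" "%k x. edge k (sub l B1 x)" "Yc B1" unfolding B1_def by (rule box[OF B'])
 have Y0: "Yc B k \<subseteq> {0..<int l}" "card (Yc B k) = l - h" for k using Yc_ok[OF B] by (auto simp: okY_def)
 have Y1: "Yc B1 k \<subseteq> {0..<int l}" "card (Yc B1 k) = l - h" for k using Yc_ok[OF B'] by (auto simp: okY_def B1_def)
 define Z where "Z k = Yc B k \<inter> Yc B1 k" for k
 have cZ: "l - 2*h <= card (Z k)" for k
 proof -
  have fin: "finite (Yc B k)" "finite (Yc B1 k)" by (rule finite_subset[OF Y0(1)], simp) (rule finite_subset[OF Y1(1)], simp)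
  have "card (Yc B k) + card (Yc B1 k) = card (Yc B k \<union> Yc B1 k) + card (Z k)" unfolding Z_def by (rule card_Un_Int[OF fin])
  moreover have "card (Yc B k \<union> Yc B1 k) <= card {0..<int l}" using Y0 Y1 by (intro card_mono) auto
  ultimately show ?thesis using Y0(2)[of k] Y1(2)[of k] by simp
 qed
 define U where "U = (%k. if k = i then {0..<int l} else Z k)"
 define c where "c = real h/real (l - h)/real (l - 2*h)^(d - 1)"
 have 0: "\<bar>fB B - b0.mean U\<bar> <= c*Wt B" unfolding fB_eq[OF B] U_def c_def Wt_def
  using cZ Y0 lh i by (intro b0.mean_shrink) (auto simp: Z_def)
 have 1: "\<bar>fB B1 - b1.mean U\<bar> <= c*Wt B1" unfolding fB_eq[OF B', folded B1_def] U_def c_def Wt_def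
  using cZ Y1 lh i by (intro b1.mean_shrink) (auto simp: Z_def)
 have Zl: "Z k \<subseteq> {0..<int l}" for k using Y0[of k] by (auto simp: Z_def)
 have Ul: "U k \<subseteq> {0..<int l}" and finU: "finite (U k)" for k using Zl[of k] finite_subset[of "Z k" "{0..<int l}"] by (auto simp: U_def)
 define pU where "pU = (\<Prod>k<d. real (card (U k)))"
 have "pU = real (card (U i))*(\<Prod>k\<in>{..<d} - {i}. real (card (U k)))" unfolding pU_def using i by (subst prod.remove[of _ i]) auto
 moreover have "(\<Prod>k\<in>{..<d} - {i}. real (l - 2*h)) <= (\<Prod>k\<in>{..<d} - {i}. real (card (U k)))"
  using cZ by (intro prod_mono) (auto simp: U_def)
 ultimately have pU: "pU >= real l*real (l - 2*h)^(d - 1)" using i by (simp add: U_def mult_left_mono)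
 have lz: "real l*real (l - 2*h)^(d - 1) > 0" using lh l0 by simp
 define M where "M = (\<Sum>x\<in>torus d l. of_int (x i + 1)*edge i (sub l B x) + of_int (int l - 1 - x i)*edge i (sub l B1 x))"
 have M0: "M >= 0" unfolding M_def
 proof (intro sum_nonneg add_nonneg_nonneg mult_nonneg_nonneg edge_nonneg)
  fix x assume "x \<in> torus d l"
  then have "0 <= x i" "x i < int l" using i unfolding torus_def by (auto simp: PiE_iff)
  then show "0 <= (of_int (x i + 1) :: real)" "0 <= (of_int (int l - 1 - x i) :: real)" by simp_all
 qed
 define Ot where "Ot = PiE ({..<d} - {i}) U"
 obtain j where j: "j < d" "j ~= i" using d2 i by (metis One_nat_def less_2_cases_iff less_le_trans nat_neq_iff zero_less_Suc lessI numeral_2_eq_2)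
 have line: "\<bar>(\<Sum>t\<in>{0..<int l}. f (sub l B (z(i := t)))) - (\<Sum>t\<in>{0..<int l}. f (sub l B1 (z(i := t))))\<bar>
   <= (\<Sum>t\<in>{0..<int l}. of_int (t + 1)*edge i (sub l B (z(i := t))) + of_int (int l - 1 - t)*edge i (sub l B1 (z(i := t))))"
  if z: "z \<in> Ot" for z
 proof -
  define a where "a u = f (sub l B (z(i := u)))" for u
  define b where "b u = edge i (sub l B (z(i := u)))" for u
  have shift: "sub l B1 (z(i := t)) = sub l B (z(i := t + int l))" for t unfolding B1_def sub_next by simp
  have zT: "z(i := u) \<in> torus d l" if "0 <= u" "u < int l" for u
  proof -
   have "z k \<in> {0..<int l}" if "k < d" "k ~= i" for k using z that Ul[of k] unfolding Ot_def by (auto simp: PiE_iff)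
   moreover have "z k = undefined" if "~ k < d" for k using z that unfolding Ot_def by (auto simp: PiE_iff extensional_def)
   ultimately show ?thesis using that i unfolding torus_def by (auto simp: PiE_iff extensional_def)
  qed
  have zj: "z j \<in> Yc B j" "z j \<in> Yc B1 j" using z j unfolding Ot_def by (auto simp: PiE_iff U_def Z_def)
  have good: "good (sub l B (z(i := u)))" if u: "0 <= u" "u < 2*int l" for u
  proof (cases "u < int l")
   case True
   then show ?thesis using Yc_ok[OF B] zT[OF u(1) True] j zj unfolding okY_def by (metis fun_upd_other)
  next
   case False
   have "good (sub l B1 (z(i := u - int l)))"
    using Yc_ok[OF B'] zT[of "u - int l"] False u j zj unfolding okY_def B1_def[symmetric] by (metis diff_ge_0_iff_ge diff_less_eq fun_upd_other leI mult_2)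
   then show ?thesis unfolding shift by simp
  qed
  have inc: "\<bar>a u - a (u + 1)\<bar> = b u" if "0 <= u" "u < 2*int l - 1" for u
  proof -
   have eq: "sub l B (z(i := u + 1)) = (sub l B (z(i := u)))(i := sub l B (z(i := u)) i + 1)" using sub_upd[of B "z(i := u)" i] by simp
   have "good (sub l B (z(i := u)))" "good (sub l B (z(i := u + 1)))" using that by (auto intro!: good)
   then show ?thesis unfolding a_def b_def edge_def eq by simp
  qed
  have tel: "\<bar>a t - a (t + int l)\<bar> <= (\<Sum>u\<in>{t..<t + int l}. b u)" if t: "t \<in> {0..<int l}" for t
  proof -
   have "\<bar>a t - a (t + int n)\<bar> <= (\<Sum>u\<in>{t..<t + int n}. b u)" if "n <= l" for n using that
   proof (induction n)
    case (Suc n)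
    have "{t..<t + int (Suc n)} = insert (t + int n) {t..<t + int n}" by auto
    then show ?case using Suc inc[of "t + int n"] t by (simp add: algebra_simps)
   qed simp
   then show ?thesis by simp
  qed
  have "\<bar>(\<Sum>t\<in>{0..<int l}. f (sub l B (z(i := t)))) - (\<Sum>t\<in>{0..<int l}. f (sub l B1 (z(i := t))))\<bar>
    = \<bar>\<Sum>t\<in>{0..<int l}. a t - a (t + int l)\<bar>"
   unfolding shift a_def by (simp add: sum_subtractf)
  also have "... <= (\<Sum>t\<in>{0..<int l}. \<Sum>u\<in>{t..<t + int l}. b u)" by (intro order_trans[OF sum_abs] sum_mono tel)
  also have "... = (\<Sum>u\<in>{0..<int l}. of_int (u + 1)*b u + of_int (int l - 1 - u)*b (u + int l))" by (rule sum_double_window)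
  finally show ?thesis unfolding b_def shift .
 qed
 have split: "(\<Sum>x\<in>PiE {..<d} U. G x) = (\<Sum>z\<in>Ot. \<Sum>t\<in>{0..<int l}. G (z(i := t)))" for G :: "pt => real"
  unfolding Ot_def using sum_PiE_split[of i d U G] i finU by (simp add: U_def)
 have e1: "b0.mean U - b1.mean U = ((\<Sum>x\<in>PiE {..<d} U. f (sub l B x)) - (\<Sum>x\<in>PiE {..<d} U. f (sub l B1 x)))/pU"
  unfolding b0.mean_def b1.mean_def pU_def by (simp add: diff_divide_distrib)
 have "\<bar>b0.mean U - b1.mean U\<bar> = \<bar>\<Sum>z\<in>Ot. (\<Sum>t\<in>{0..<int l}. f (sub l B (z(i := t)))) - (\<Sum>t\<in>{0..<int l}. f (sub l B1 (z(i := t))))\<bar>/pU"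
  unfolding e1 split using pU lz by (simp add: abs_divide sum_subtractf)
 also have "... <= (\<Sum>z\<in>Ot. \<Sum>t\<in>{0..<int l}. of_int (t + 1)*edge i (sub l B (z(i := t))) + of_int (int l - 1 - t)*edge i (sub l B1 (z(i := t))))/pU"
  using pU lz by (intro divide_right_mono order_trans[OF sum_abs] sum_mono line) auto
 also have "... = (\<Sum>x\<in>PiE {..<d} U. of_int (x i + 1)*edge i (sub l B x) + of_int (int l - 1 - x i)*edge i (sub l B1 x))/pU"
  unfolding split by simp
 also have "... <= M/pU"
 proof (rule divide_right_mono)
  show "(\<Sum>x\<in>PiE {..<d} U. of_int (x i + 1)*edge i (sub l B x) + of_int (int l - 1 - x i)*edge i (sub l B1 x)) <= M" unfolding M_def
  proof (rule sum_mono2)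
   show "PiE {..<d} U \<subseteq> torus d l" unfolding torus_def using Ul by (intro PiE_mono) auto
   fix x assume "x \<in> torus d l - PiE {..<d} U"
   then have "0 <= x i" "x i < int l" using i unfolding torus_def by (auto simp: PiE_iff)
   then show "0 <= of_int (x i + 1)*edge i (sub l B x) + of_int (int l - 1 - x i)*edge i (sub l B1 x)"
    using edge_nonneg by (intro add_nonneg_nonneg mult_nonneg_nonneg) auto
  qed (rule finite_torus)
 qed (use pU lz in simp)
 also have "... <= M/(real l*real (l - 2*h)^(d - 1))"
 proof (rule divide_left_mono[OF pU M0])
  show "0 < pU*(real l*real (l - 2*h)^(d - 1))" using less_le_trans[OF lz pU] lz by (rule mult_pos_pos)
 qed
 finally have 2: "\<bar>b0.mean U - b1.mean U\<bar> <= 1/(real l*real (l - 2*h)^(d - 1))*M" by simp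
 have "\<bar>fB B - fB B1\<bar> <= c*(Wt B + Wt B1) + 1/(real l*real (l - 2*h)^(d - 1))*M" using 0 1 2 by (simp add: distrib_left)
 then show ?thesis by (simp add: c_def M_def B1_def)
qed

lemma sum_next: assumes "per d m G" shows "(\<Sum>B\<in>torus d m. G (B(i := B i + 1))) = (\<Sum>B\<in>torus d m. (G B :: real))"
proof -
 have "(%j. B j + (if j = i then 1 else 0)) = B(i := B i + 1)" for B :: pt by (auto simp: fun_eq_iff)
 then show ?thesis using sum_per_shift[OF assms m0, of "%j. if j = i then 1 else 0"] by simp
qed

definition tv :: real where "tv = (\<Sum>k<d. \<Sum>c\<in>torus d (l*m). edge k c)"
definition tvB :: real where "tvB = (\<Sum>k<d. \<Sum>B\<in>torus d m. edgeB k B)"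

lemma sum_Wt: "(\<Sum>B\<in>torus d m. Wt B) = tv" unfolding Wt_def tv_def by (subst sum.swap) (simp add: sum_blocks[OF per_edge l0])

lemma per_Wt: "per d m Wt" by (rule per_comp[OF per_all[of d m "%k B x. edge k (sub l B x)", OF per_sub[OF per_edge]]]) (simp add: Wt_def fun_eq_iff)

text \<open>Summed over all boxes, the two weights of an edge from \<open>sum_double_window\<close>
  add up to l and cancel the 1/l of the average. The leading factor 1/(l - 2 h)^(d - 1) is nearly
  the scaling of total variation; the change of the averaging sets only adds a relative error d h /
  l.\<close>

lemma tv_step: "tvB <= (1 + 2*real d*real h/real (l - h))/real (l - 2*h)^(d - 1)*tv"
proof -
 define c where "c = real h/real (l - h)/real (l - 2*h)^(d - 1)"
 define z where "z = real (l - 2*h)^(d - 1)"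
 have z0: "z > 0" using lh by (simp add: z_def)
 have c0: "c >= 0" by (simp add: c_def)
 have W0: "Wt B >= 0" for B unfolding Wt_def by (intro sum_nonneg edge_nonneg)
 have dir: "(\<Sum>B\<in>torus d m. edgeB i B) <= 2*c*tv + 1/z*(\<Sum>c\<in>torus d (l*m). edge i c)" if i: "i < d" for i
 proof -
  define p q where "p B = (\<Sum>x\<in>torus d l. of_int (x i + 1)*edge i (sub l B x))"
   and "q B = (\<Sum>x\<in>torus d l. of_int (int l - 1 - x i)*edge i (sub l B x))" for B
  have xi: "0 <= x i & x i < int l" if "x \<in> torus d l" for x using that i unfolding torus_def by (auto simp: PiE_iff)
  have p0: "p B >= 0" "q B >= 0" for B
  proof -
   have x0: "0 <= (of_int (x i + 1) :: real)" "0 <= (of_int (int l - 1 - x i) :: real)" if "x \<in> torus d l" for x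
    unfolding of_int_0_le_iff using xi[OF that] by auto
   show "p B >= 0" unfolding p_def using x0(1) edge_nonneg by (intro sum_nonneg mult_nonneg_nonneg)
   show "q B >= 0" unfolding q_def using x0(2) edge_nonneg by (intro sum_nonneg mult_nonneg_nonneg)
  qed
  have "(\<Sum>B\<in>torus d m. edgeB i B) <= (\<Sum>B\<in>torus d m. c*(Wt B + Wt (B(i := B i + 1))) + 1/(real l*z)*(p B + q (B(i := B i + 1))))"
  proof (rule sum_mono)
   fix B
   show "edgeB i B <= c*(Wt B + Wt (B(i := B i + 1))) + 1/(real l*z)*(p B + q (B(i := B i + 1)))"
   proof (cases "goodB B & goodB (B(i := B i + 1))")
    case True
    then show ?thesis using two_boxes[of B i] i unfolding edgeB_def c_def z_def p_def q_def by (simp add: sum.distrib)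
   next
    case False
    then have "edgeB i B = 0" by (auto simp: edgeB_def)
    then show ?thesis using c0 W0 z0 p0 l0 by (simp add: add_nonneg_nonneg)
   qed
  qed
  also have "... = c*((\<Sum>B\<in>torus d m. Wt B) + (\<Sum>B\<in>torus d m. Wt (B(i := B i + 1)))) + 1/(real l*z)*((\<Sum>B\<in>torus d m. p B) + (\<Sum>B\<in>torus d m. q (B(i := B i + 1))))"
   by (simp only: sum.distrib sum_distrib_left distrib_left)
  also have "(\<Sum>B\<in>torus d m. Wt (B(i := B i + 1))) = tv" using sum_next[OF per_Wt] sum_Wt by simp
  also have "(\<Sum>B\<in>torus d m. q (B(i := B i + 1))) = (\<Sum>B\<in>torus d m. q B)"
   by (rule sum_next) (rule per_comp[OF per_sub[OF per_edge[of i]]], simp add: q_def fun_eq_iff)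
  also have "(\<Sum>B\<in>torus d m. p B) + (\<Sum>B\<in>torus d m. q B) = real l*(\<Sum>c\<in>torus d (l*m). edge i c)"
  proof -
   have "p B + q B = real l*(\<Sum>x\<in>torus d l. edge i (sub l B x))" for B
    unfolding p_def q_def by (simp add: sum.distrib[symmetric] sum_distrib_left algebra_simps)
   then show ?thesis unfolding sum_blocks[OF per_edge l0] sum.distrib[symmetric] by (simp add: sum_distrib_left)
  qed
  finally show ?thesis using sum_Wt l0 by simp
 qed
 have "tvB <= (\<Sum>i<d. 2*c*tv + 1/z*(\<Sum>c\<in>torus d (l*m). edge i c))" unfolding tvB_def by (intro sum_mono dir) auto
 also have "... = real d*(2*c*tv) + 1/z*tv" unfolding tv_def by (simp add: sum.distrib sum_distrib_left)
 also have "... = (1 + 2*real d*real h/real (l - h))/z*tv" unfolding c_def z_def[symmetric] by (simp add: field_simps add_divide_distrib)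
 finally show ?thesis by (simp add: z_def)
qed

lemma l1_box: assumes B: "goodB B" shows "(\<Sum>x\<in>PiE {..<d} (Yc B). \<bar>f (sub l B x) - fB B\<bar>) <= real l*Wt B"
proof -
 interpret b0: grid_box d l "%x. f (sub l B x)" "%k x. edge k (sub l B x)" "Yc B" by (rule box[OF B])
 have Y: "card (Yc B k) = l - h" for k using Yc_ok[OF B] by (auto simp: okY_def)
 define P where "P = PiE {..<d} (Yc B)"
 define q where "q = real (l - h)"
 have q0: "q > 0" using lh' by (simp add: q_def)
 have cP: "real (card P) = q^d" unfolding P_def using Y by (subst card_PiE) (auto simp: q_def)
 have "(\<Sum>x\<in>P. \<bar>f (sub l B x) - fB B\<bar>) <= (\<Sum>x\<in>P. (\<Sum>y\<in>P. \<bar>f (sub l B x) - f (sub l B y)\<bar>)/q^d)"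
 proof (rule sum_mono)
  fix x
  have "f (sub l B x) - fB B = (\<Sum>y\<in>P. f (sub l B x) - f (sub l B y))/q^d" unfolding fB_def P_def[symmetric] q_def[symmetric] using q0 cP
   by (simp add: sum_subtractf diff_divide_distrib)
  then show "\<bar>f (sub l B x) - fB B\<bar> <= (\<Sum>y\<in>P. \<bar>f (sub l B x) - f (sub l B y)\<bar>)/q^d"
   using q0 by (simp add: abs_divide divide_right_mono sum_abs)
 qed
 also have "... = (\<Sum>x\<in>P. \<Sum>y\<in>P. \<bar>f (sub l B x) - f (sub l B y)\<bar>)/q^d" by (simp add: sum_divide_distrib)
 also have "... <= (q^(d + 1)*Wt B)/q^d" unfolding P_def Wt_def q_def using Y q0 by (intro divide_right_mono b0.poincare) (auto simp: q_def)
 also have "... = q*Wt B" using q0 by simp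
 also have "... <= real l*Wt B" unfolding Wt_def q_def by (intro mult_right_mono sum_nonneg edge_nonneg) auto
 finally show ?thesis by (simp add: P_def)
qed

lemma per_goodB: "per d m goodB" by (rule per_comp[OF per_sub[OF perg]]) (simp add: goodB_def fun_eq_iff)

lemma per_Yc: "per d m Yc" using per_sub[OF perg] unfolding per_def Yc_def by metis

lemma per_fB: "per d m fB" 
 using per_comp2[OF per_sub[OF perf] per_Yc, of "%F Y. sum F (PiE {..<d} Y)/real (l - h)^d"] unfolding per_def fB_def .

end

context level begin

text \<open>Mass on the retained part of a box; the mass of a bad box is given up.\<close>

definition lift :: "(pt => real) => pt => real" where "lift a B = (if goodB B then \<Sum>x\<in>PiE {..<d} (Yc B). a (sub l B x) else 0)"

lemma PiE_Yc: assumes "goodB B" shows "PiE {..<d} (Yc B) \<subseteq> torus d l" "finite (PiE {..<d} (Yc B))" "card (PiE {..<d} (Yc B)) = (l - h)^d"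
  and "x \<in> PiE {..<d} (Yc B) ==> good (sub l B x)"
proof -
 have Y: "Yc B k \<subseteq> {0..<int l}" "card (Yc B k) = l - h" for k using Yc_ok[OF assms] by (auto simp: okY_def)
 show T: "PiE {..<d} (Yc B) \<subseteq> torus d l" unfolding torus_def by (intro PiE_mono Y)
 show "finite (PiE {..<d} (Yc B))" by (rule finite_subset[OF T finite_torus])
 show "card (PiE {..<d} (Yc B)) = (l - h)^d" using Y by (subst card_PiE) auto
 have d0: "0 < d" using d2 by simp
 assume x: "x \<in> PiE {..<d} (Yc B)"
 then have "x 0 \<in> Yc B 0" using d0 by auto
 moreover have "x \<in> torus d l" using x T by blast
 ultimately show "good (sub l B x)" using Yc_ok[OF assms] d0 unfolding okY_def by blast
qed

lemma lift_nonneg: "(!!c. 0 <= a c) ==> 0 <= lift a B" unfolding lift_def by (auto intro: sum_nonneg)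

lemma per_lift: assumes "per d (l*m) a" shows "per d m (lift a)"
 using per_comp2[OF per_comp2[OF per_sub[OF assms] per_Yc, of "%F Y. sum F (PiE {..<d} Y)"] per_goodB, of "%s g. if g then s else 0"]
 unfolding per_def lift_def .

lemma sum_lift_le: assumes a: "per d (l*m) a" and a0: "!!c. 0 <= a c"
 shows "(\<Sum>B\<in>torus d m. lift a B) <= (\<Sum>c\<in>torus d (l*m). a c)"
 unfolding sum_blocks[OF a l0]
proof (rule sum_mono)
 fix B
 show "lift a B <= (\<Sum>x\<in>torus d l. a (sub l B x))"
  unfolding lift_def using PiE_Yc(1)[of B] a0 finite_torus by (auto intro!: sum_mono2 sum_nonneg)
qed

lemma lift_add: assumes "goodB B" and M: "!!c. good c ==> a c + b c = M" shows "lift a B + lift b B = M*real (l - h)^d"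
proof -
 have "lift a B + lift b B = (\<Sum>x\<in>PiE {..<d} (Yc B). M)"
  unfolding lift_def using assms(1) PiE_Yc(4)[OF assms(1)] M by (simp add: sum.distrib[symmetric])
 then show ?thesis using PiE_Yc(3)[OF assms(1)] by simp
qed

lemma fB_range: assumes B: "goodB B" and f: "!!c. 0 <= f c" "!!c. f c <= 1" shows "0 <= fB B" "fB B <= 1"
proof -
 show "0 <= fB B" unfolding fB_def using f by (intro divide_nonneg_nonneg sum_nonneg) auto
 have "(\<Sum>x\<in>PiE {..<d} (Yc B). f (sub l B x)) <= (\<Sum>x\<in>PiE {..<d} (Yc B). 1)" by (intro sum_mono f)
 also have "... = real (l - h)^d" using PiE_Yc(3)[OF B] by simp
 finally show "fB B <= 1" unfolding fB_def using lh' by simp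
qed

text \<open>\<open>a\<close> and \<open>b\<close> are the masses of a set and of its complement, and
  \<open>f\<close> should be 1 where the first sits and 0 where the second does; the sum is the
  misfit. Replacing \<open>f\<close> by its averages changes it by at most M times an L1 distance,
  controlled by \<open>l1_box\<close>.\<close>

lemma deviation_step: assumes a: "per d (l*m) a" "per d (l*m) b" and nn: "!!c. 0 <= a c" "!!c. 0 <= b c"
  and M: "!!c. good c ==> a c + b c = M" and M0: "0 <= M" and f: "!!c. 0 <= f c" "!!c. f c <= 1"
 shows "(\<Sum>B\<in>torus d m. lift a B*(1 - fB B) + lift b B*fB B) \<le> (\<Sum>c\<in>torus d (l*m). a c*(1 - f c) + b c*f c) + M*real l*tv"
proof -
 define D where "D c = a c*(1 - f c) + b c*f c" for c
 have D0: "D c >= 0" for c unfolding D_def using nn f by (intro add_nonneg_nonneg mult_nonneg_nonneg) auto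
 have perD': "per d (l*m) D" using a perf unfolding per_def D_def by metis
 have "lift a B*(1 - fB B) + lift b B*fB B <= (\<Sum>x\<in>torus d l. D (sub l B x)) + M*real l*Wt B" for B
 proof (cases "goodB B")
  case True
  define P where "P = PiE {..<d} (Yc B)"
  have la: "lift a B = (\<Sum>x\<in>P. a (sub l B x))" "lift b B = (\<Sum>x\<in>P. b (sub l B x))" using True by (simp_all add: lift_def P_def)
  have "lift a B*(1 - fB B) + lift b B*fB B = (\<Sum>x\<in>P. a (sub l B x)*(1 - fB B) + b (sub l B x)*fB B)"
   unfolding la by (simp only: sum_distrib_right sum.distrib)
  also have "... <= (\<Sum>x\<in>P. D (sub l B x) + M*\<bar>f (sub l B x) - fB B\<bar>)"
  proof (rule sum_mono)
   fix x assume x: "x \<in> P"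
   define c where "c = sub l B x"
   have ab: "a c + b c = M" using M PiE_Yc(4)[OF True] x unfolding c_def P_def by blast
   have "a c*(1 - fB B) + b c*fB B = D c + (a c - b c)*(f c - fB B)" unfolding D_def by (simp add: algebra_simps)
   moreover have "(a c - b c)*(f c - fB B) <= \<bar>a c - b c\<bar>*\<bar>f c - fB B\<bar>" by (metis abs_ge_self abs_mult)
   moreover have "\<bar>a c - b c\<bar>*\<bar>f c - fB B\<bar> <= M*\<bar>f c - fB B\<bar>" using ab nn[of c] by (intro mult_right_mono) auto
   ultimately show "a (sub l B x)*(1 - fB B) + b (sub l B x)*fB B <= D (sub l B x) + M*\<bar>f (sub l B x) - fB B\<bar>"
    unfolding c_def by linarith
  qed
  also have "... = (\<Sum>x\<in>P. D (sub l B x)) + M*(\<Sum>x\<in>P. \<bar>f (sub l B x) - fB B\<bar>)" by (simp add: sum.distrib sum_distrib_left)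
  also have "... <= (\<Sum>x\<in>torus d l. D (sub l B x)) + M*(real l*Wt B)" unfolding P_def using PiE_Yc(1)[OF True] D0 M0 finite_torus
   by (intro add_mono sum_mono2 mult_left_mono l1_box[OF True]) auto
  finally show ?thesis by simp
 next
  case False
  have "0 <= Wt B" unfolding Wt_def by (intro sum_nonneg edge_nonneg)
  then show ?thesis using False D0 M0 unfolding lift_def by (auto intro!: add_nonneg_nonneg sum_nonneg)
 qed
 then have "(\<Sum>B\<in>torus d m. lift a B*(1 - fB B) + lift b B*fB B) \<le>
   (\<Sum>B\<in>torus d m. (\<Sum>x\<in>torus d l. D (sub l B x)) + M*real l*Wt B)" by (rule sum_mono)
 also have "... = (\<Sum>c\<in>torus d (l*m). D c) + M*real l*tv"
  unfolding sum_blocks[OF perD' l0] sum_Wt[symmetric] by (simp add: sum.distrib sum_distrib_left)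
 finally show ?thesis unfolding D_def .
qed

end

section \<open>The tower of levels and the isoperimetric inequality on top\<close>

definition etv :: "nat => nat => (pt => real) => (pt => bool) => real" where
 "etv d n f good = (\<Sum>k<d. \<Sum>c\<in>torus d n. if good c & good (c(k := c k + 1)) then \<bar>f c - f (c(k := c k + 1))\<bar> else 0)"

primrec tower_good :: "nat => nat => (nat => nat) => (pt => bool) => nat => pt => bool" where "tower_good d h l good 0 = good"
| "tower_good d h l good (Suc j) = level.goodB d (l j) h (tower_good d h l good j)"

lemma etv_nonneg: "0 <= etv d n f good" unfolding etv_def by (intro sum_nonneg) auto

lemma exp_half_le_2: "exp (1/2 :: real) <= 2"
proof (rule power2_le_imp_le)
 have "exp (1/2 :: real)^2 = exp 1" by (simp add: exp_of_nat_mult[symmetric])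
 also note exp_le
 finally show "exp (1/2 :: real)^2 <= 2^2" by simp
qed simp

text \<open>\<open>slow\<close> bounds the product of the loss factors of all levels by exp (1/2),
  hence by 2.\<close>

locale tower =
 fixes d h :: nat and l nn :: "nat => nat" and f :: "pt => real" and good :: "pt => bool" and J :: nat
 assumes d2: "2 <= d" and h0: "0 < h" and lh: "!!j. 4*h <= l j" and nn: "!!j. j < J ==> nn j = l j*nn (Suc j)"
  and nn0: "!!j. j <= J ==> 0 < nn j"
  and perf: "per d (nn 0) f" and perg: "per d (nn 0) good" and f01: "!!c. f c = 0 | f c = 1"
  and slow: "(\<Sum>i<J. 8*real d*real h/real (l i)) <= 1/2"
begin

abbreviation "gd \<equiv> tower_good d h l good"

text \<open>\<open>LL j\<close> is the side of a box of level j in cells, \<open>MM j\<close> the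
  number of its cells that survive in the nested good parts.\<close>

definition LL :: "nat => nat" where "LL j = (\<Prod>i<j. l i)"
definition MM :: "nat => nat" where "MM j = (\<Prod>i<j. l i - h)^d"
definition V :: real where "V = etv d (nn 0) f good"

lemma V0: "0 <= V" unfolding V_def by (rule etv_nonneg)

lemma LL_pos: "0 < LL j" 
proof -
 have "0 < l i" for i using lh[of i] h0 by linarith
 then show ?thesis unfolding LL_def by (simp add: prod_pos)
qed

lemma MM_le: "MM j <= LL j^d" unfolding MM_def LL_def by (intro power_mono prod_mono) auto

text \<open>Measured against l^(1 - d), the scaling of total variation, a level loses 1 + O(d h /
  l).\<close>

lemma level_factor: "(1 + 2*real d*real h/real (l j - h))/real (l j - 2*h)^(d - 1)*real (l j)^(d - 1) <= exp (8*real d*real h/real (l j))"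
proof -
 have lj: "4*real h <= real (l j)" using lh[of j] by (metis of_nat_le_iff of_nat_mult of_nat_numeral)
 have hp: "0 < real h" using h0 by simp
 have lp: "0 < real (l j)" using lj hp by linarith
 have r1: "real (l j - h) = real (l j) - real h" "real (l j - 2*h) = real (l j) - 2*real h" using lh[of j] by (simp_all add: of_nat_diff)
 have "2*real d*real h/(real (l j) - real h) <= 2*real d*real h/(real (l j)/2)" using lj hp lp by (intro divide_left_mono) (auto intro: mult_pos_pos)
 then have "1 + 2*real d*real h/real (l j - h) <= 1 + 4*real d*real h/real (l j)" unfolding r1 by simp
 also have "... <= exp (4*real d*real h/real (l j))" by (rule exp_ge_add_one_self)
 finally have A: "1 + 2*real d*real h/real (l j - h) <= exp (4*real d*real h/real (l j))" .
 define a where "a = real h"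
 define b where "b = real (l j)"
 have ab: "4*a <= b" "0 < a" "0 < b" using lj hp lp by (auto simp: a_def b_def)
 have "b*b <= (b + 4*a)*(b - 2*a)" using mult_mono[of "4*a" b a a] ab by (simp add: algebra_simps)
 then have "b <= (1 + 4*a/b)*(b - 2*a)" using ab by (simp add: field_simps)
 then have "real (l j)/(real (l j) - 2*real h) <= 1 + 4*real h/real (l j)" unfolding a_def[symmetric] b_def[symmetric] using ab by (simp add: pos_divide_le_eq)
 also have "... <= exp (4*real h/real (l j))" by (rule exp_ge_add_one_self)
 finally have B: "real (l j)/(real (l j) - 2*real h) <= exp (4*real h/real (l j))" .
 have pos: "0 < real (l j) - 2*real h" using lj hp by linarith
 have "(1 + 2*real d*real h/real (l j - h))/real (l j - 2*h)^(d - 1)*real (l j)^(d - 1)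
  = (1 + 2*real d*real h/real (l j - h))*(real (l j)/(real (l j) - 2*real h))^(d - 1)"
  unfolding r1 by (simp add: power_divide)
 also have "... <= exp (4*real d*real h/real (l j))*exp (4*real h/real (l j))^(d - 1)" using A B pos lp by (intro mult_mono power_mono) auto
 also have "... = exp (4*real d*real h/real (l j) + real (d - 1)*(4*real h/real (l j)))" by (simp only: exp_add exp_of_nat_mult)
 also have "... <= exp (8*real d*real h/real (l j))"
 proof -
  have "real (d - 1)*(4*real h/real (l j)) <= real d*(4*real h/real (l j))" using lp hp by (intro mult_right_mono) auto
  then show ?thesis by simp
 qed
 finally show ?thesis .
qed

text \<open>\<open>F\<close> is the averaged function at level j, \<open>a\<close> and
  \<open>b\<close> are the surviving masses of the cells with value 1 and 0. The misfit bound in the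
  last line reproduces itself because \<open>LL\<close> grows at least fourfold, so the newest level
  dominates.\<close>

definition inv :: "nat => (pt => real) => (pt => real) => (pt => real) => bool" where
 "inv j F a b \<longleftrightarrow> per d (nn j) (gd j) & per d (nn j) F & per d (nn j) a & per d (nn j) b \<and>
   (\<forall>c. 0 <= F c & F c <= (1::real) & 0 <= a c & 0 <= b c) \<and>
   (\<forall>c. gd j c --> a c + b c = real (MM j)) \<and>
   (\<Sum>c\<in>torus d (nn j). a c) <= (\<Sum>c\<in>torus d (nn 0). f c) \<and>
   (\<Sum>c\<in>torus d (nn j). b c) <= (\<Sum>c\<in>torus d (nn 0). of_bool (good c)*(1 - f c)) \<and>
   etv d (nn j) F (gd j)*real (LL j)^(d - 1) <= exp (\<Sum>i<j. 8*real d*real h/real (l i))*V \<and>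
   (\<Sum>c\<in>torus d (nn j). a c*(1 - F c) + b c*F c) <= 4*real (LL j)*V"

lemma tower_exists: "j <= J ==> \<exists>F a b. inv j F a b"
proof (induction j)
 case 0
 have f: "0 <= f c" "f c <= 1" for c using f01[of c] by auto
 define a b where "a = f" and "b = (%c. of_bool (good c)*(1 - f c))"
 have "per d (nn 0) b" using per_comp2[OF perg perf, of "%g x. of_bool g*(1 - x)"] unfolding b_def .
 moreover have z: "a c*(1 - f c) + b c*f c = 0" for c using f01[of c] by (auto simp: a_def b_def)
 ultimately have "inv 0 f a b" unfolding inv_def z using perf perg f V0 by (simp add: a_def b_def V_def MM_def LL_def)
 then show ?case by blast
next
 case (Suc j)
 then obtain F a b where "inv j F a b" by (meson Suc_leD)
 then have IH: "per d (nn j) (gd j)" "per d (nn j) F" "per d (nn j) a" "per d (nn j) b"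
  "!!c. 0 <= F c" "!!c. F c <= 1" "!!c. 0 <= a c" "!!c. 0 <= b c"
  "!!c. gd j c ==> a c + b c = real (MM j)"
  "(\<Sum>c\<in>torus d (nn j). a c) <= (\<Sum>c\<in>torus d (nn 0). f c)"
  "(\<Sum>c\<in>torus d (nn j). b c) <= (\<Sum>c\<in>torus d (nn 0). of_bool (good c)*(1 - f c))"
  "etv d (nn j) F (gd j)*real (LL j)^(d - 1) <= exp (\<Sum>i<j. 8*real d*real h/real (l i))*V"
  "(\<Sum>c\<in>torus d (nn j). a c*(1 - F c) + b c*F c) <= 4*real (LL j)*V"
  unfolding inv_def by blast+
 define m where "m = nn (Suc j)"
 have nj: "nn j = l j*m" using Suc.prems nn unfolding m_def by simp
 interpret lv: level d "l j" m h F "gd j" by unfold_locales (use d2 h0 lh[of j] nn0 Suc.prems IH(1,2) nj in \<open>auto simp: m_def\<close>)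
 have gS: "gd (Suc j) = lv.goodB" by simp
 \<comment> \<open>The value 0 on bad boxes keeps \<open>F'\<close> in [0, 1]; edges at bad boxes do
   not count in \<open>etv\<close>.\<close>
 define F' where "F' B = (if lv.goodB B then lv.fB B else 0)" for B
 define a' b' where "a' = lv.lift a" and "b' = lv.lift b"
 have tvj: "lv.tv = etv d (nn j) F (gd j)" unfolding lv.tv_def etv_def lv.edge_def nj ..
 have tvS: "etv d m F' (gd (Suc j)) = lv.tvB" unfolding lv.tvB_def etv_def lv.edgeB_def gS F'_def by (intro sum.cong refl) auto
 have L4: "4 <= real (l j)" using lh[of j] h0 by linarith
 have LS: "real (LL (Suc j)) = real (LL j)*real (l j)" by (simp add: LL_def)
 have MS: "real (MM (Suc j)) = real (MM j)*real (l j - h)^d" by (simp add: MM_def power_mult_distrib)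
 have perF': "per d m F'" using lv.per_goodB lv.per_fB unfolding per_def F'_def by metis
 have pa: "per d (l j*m) a" "per d (l j*m) b" using IH(3,4) nj by simp_all
 define q where "q = (1 + 2*real d*real h/real (l j - h))/real (l j - 2*h)^(d - 1)"
 have "lv.tvB <= q*etv d (nn j) F (gd j)" using lv.tv_step unfolding tvj q_def .
 then have "lv.tvB*real (LL (Suc j))^(d - 1) <= (q*etv d (nn j) F (gd j))*real (LL (Suc j))^(d - 1)" by (rule mult_right_mono) simp
 also have "... = (q*real (l j)^(d - 1))*(etv d (nn j) F (gd j)*real (LL j)^(d - 1))" unfolding LS by (simp only: power_mult_distrib ac_simps)
 also have "... <= exp (8*real d*real h/real (l j))*(exp (\<Sum>i<j. 8*real d*real h/real (l i))*V)"
  by (rule mult_mono[OF level_factor[of j, folded q_def] IH(12)]) (simp_all add: etv_nonneg)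
 finally have E: "etv d m F' (gd (Suc j))*real (LL (Suc j))^(d - 1) <= exp (\<Sum>i<Suc j. 8*real d*real h/real (l i))*V" unfolding tvS by (simp add: exp_add mult.commute mult.left_commute)
 have "(\<Sum>c\<in>torus d m. a' c*(1 - F' c) + b' c*F' c) = (\<Sum>c\<in>torus d m. lv.lift a c*(1 - lv.fB c) + lv.lift b c*lv.fB c)"
  unfolding a'_def b'_def F'_def by (intro sum.cong refl) (auto simp: lv.lift_def)
 also have "... <= (\<Sum>c\<in>torus d (l j*m). a c*(1 - F c) + b c*F c) + real (MM j)*real (l j)*lv.tv"
  by (rule lv.deviation_step[OF pa IH(7,8,9) _ IH(5,6)]) simp_all
 also have "... <= 4*real (LL j)*V + 2*real (LL (Suc j))*V"
 proof (rule add_mono)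
  show "(\<Sum>c\<in>torus d (l j*m). a c*(1 - F c) + b c*F c) <= 4*real (LL j)*V" using IH(13) unfolding nj .
  have e0: "0 <= etv d (nn j) F (gd j)" by (rule etv_nonneg)
  have "(\<Sum>i<j. 8*real d*real h/real (l i)) <= (\<Sum>i<J. 8*real d*real h/real (l i))" using Suc.prems by (intro sum_mono2) auto
  also note slow
  finally have "exp (\<Sum>i<j. 8*real d*real h/real (l i)) <= exp (1/2)" by simp
  also note exp_half_le_2
  finally have e2: "exp (\<Sum>i<j. 8*real d*real h/real (l i))*V <= 2*V" using V0 by (rule mult_right_mono)
  have "real (MM j)*real (l j)*lv.tv <= real (LL j)^d*real (l j)*lv.tv"
   using of_nat_mono[OF MM_le[of j], where ?'a = real] e0 unfolding tvj by (intro mult_right_mono) auto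
  also have "... = real (LL (Suc j))*(etv d (nn j) F (gd j)*real (LL j)^(d - 1))"
  proof -
   have "real (LL j)^d = real (LL j)*real (LL j)^(d - 1)" using d2 by (simp add: power_eq_if)
   then show ?thesis unfolding tvj LS by (simp only: ac_simps)
  qed
  also have "... <= real (LL (Suc j))*(2*V)" by (intro mult_left_mono order_trans[OF IH(12) e2]) simp
  finally show "real (MM j)*real (l j)*lv.tv <= 2*real (LL (Suc j))*V" by simp
 qed
 also have "... <= 4*real (LL (Suc j))*V"
 proof -
  have "real (LL j)*4 <= real (LL (Suc j))" unfolding LS by (intro mult_left_mono L4) simp
  then have "(real (LL j)*4)*V <= real (LL (Suc j))*V" by (rule mult_right_mono[OF _ V0])
  moreover have "0 <= real (LL (Suc j))*V" using V0 by simp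
  ultimately show ?thesis by linarith
 qed
 finally have Dv: "(\<Sum>c\<in>torus d m. a' c*(1 - F' c) + b' c*F' c) <= 4*real (LL (Suc j))*V" .
 have A: "(\<Sum>c\<in>torus d m. a' c) <= (\<Sum>c\<in>torus d (nn 0). f c)" "(\<Sum>c\<in>torus d m. b' c) <= (\<Sum>c\<in>torus d (nn 0). of_bool (good c)*(1 - f c))"
  using lv.sum_lift_le[OF pa(1) IH(7)] lv.sum_lift_le[OF pa(2) IH(8)] IH(10,11) unfolding nj a'_def b'_def by linarith+
 have R: "0 <= F' c & F' c <= 1 & 0 <= a' c & 0 <= b' c" for c
  unfolding F'_def a'_def b'_def using lv.fB_range[OF _ IH(5,6)] lv.lift_nonneg IH(7,8) by auto
 have Ms: "a' c + b' c = real (MM (Suc j))" if "gd (Suc j) c" for c unfolding MS a'_def b'_def using that gS by (intro lv.lift_add IH(9)) auto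
 have "inv (Suc j) F' a' b'" unfolding inv_def m_def[symmetric]
 proof (intro conjI allI impI)
  show "per d m (gd (Suc j))" unfolding gS by (rule lv.per_goodB)
  show "per d m a'" "per d m b'" unfolding a'_def b'_def by (rule lv.per_lift[OF pa(1)], rule lv.per_lift[OF pa(2)])
  show "0 <= F' c" "F' c <= 1" "0 <= a' c" "0 <= b' c" for c using R by blast+
 qed (fact perF' A Ms E Dv)+
 then show ?case by blast
qed

text \<open>With all top boxes good, \<open>F\<close> lives on a full torus. Products of masses of
  two boxes are bounded by misfit and by differences of \<open>F\<close>, and the latter are summed
  over windows of side r by the Poincare inequality. If \<alpha> can fill at most half of a window,
  the complement fills the other half, which gives the linear bound; the window of side
  \<open>nn J\<close> gives the product bound.\<close>

lemma tower_isoperimetry: assumes top: "!!B. gd J B"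
 obtains \<alpha> \<beta> :: real where "0 <= \<alpha>" "0 <= \<beta>" "\<alpha> <= (\<Sum>c\<in>torus d (nn 0). f c)" "\<beta> <= (\<Sum>c\<in>torus d (nn 0). of_bool (good c)*(1 - f c))"
  "\<alpha> + \<beta> = real (MM J)*real (nn J)^d"
  "!!r. 0 < r ==> r <= nn J ==> 2*\<alpha> <= real r^d*real (MM J) ==> \<alpha> <= 20*real r*real (LL J)*V"
  "\<alpha>*\<beta> <= 10*real (MM J)*real (nn J)^(d + 1)*real (LL J)*V"
proof -
 define m M L where "m = nn J" and "M = real (MM J)" and "L = real (LL J)"
 have m0: "0 < m" using nn0 unfolding m_def by simp
 have "0 < l i - h" for i using lh[of i] h0 by linarith
 then have M0: "0 < M" unfolding M_def MM_def by (simp add: prod_pos)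
 have L1: "0 < L" using LL_pos by (simp add: L_def)
 obtain F a b where i: "inv J F a b" using tower_exists[OF order.refl] by blast
 have H1: "per d m F" "per d m a" "per d m b" "!!c. 0 <= F c" "!!c. F c <= 1" "!!c. 0 <= a c" "!!c. 0 <= b c"
  using i unfolding inv_def m_def by blast+
 have H8: "a c + b c = M" for c using i top[of c] unfolding inv_def M_def by blast
 have H2: "(\<Sum>c\<in>torus d m. a c) <= (\<Sum>c\<in>torus d (nn 0). f c)"
  "(\<Sum>c\<in>torus d m. b c) <= (\<Sum>c\<in>torus d (nn 0). of_bool (good c)*(1 - f c))"
  "etv d m F (gd J)*L^(d - 1) <= exp (\<Sum>i<J. 8*real d*real h/real (l i))*V"
  "(\<Sum>c\<in>torus d m. a c*(1 - F c) + b c*F c) <= 4*L*V"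
  using i unfolding inv_def m_def L_def by blast+
 note H = H1 H8 H2
 define \<alpha> \<beta> where "\<alpha> = (\<Sum>c\<in>torus d m. a c)" and "\<beta> = (\<Sum>c\<in>torus d m. b c)"
 define D where "D c = a c*(1 - F c) + b c*F c" for c
 define e where "e k c = \<bar>F c - F (c(k := c k + 1))\<bar>" for k and c :: pt
 define tvF where "tvF = etv d m F (gd J)"
 have \<alpha>\<beta>: "0 <= \<alpha>" "0 <= \<beta>" unfolding \<alpha>_def \<beta>_def using H(6,7) by (auto intro: sum_nonneg)
 have sumM: "\<alpha> + \<beta> = M*real m^d" unfolding \<alpha>_def \<beta>_def sum.distrib[symmetric] H(8) by (simp add: card_torus)
 have tvF_le: "tvF*L^(d - 1) <= 2*V"
 proof -
  have "exp (\<Sum>i<J. 8*real d*real h/real (l i)) <= 2" using slow exp_half_le_2 by (metis exp_le_cancel_iff order_trans)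
  from mult_right_mono[OF this V0] H(11) show ?thesis unfolding tvF_def by linarith
 qed
 have tvF_eq: "tvF = (\<Sum>k<d. \<Sum>c\<in>torus d m. e k c)" unfolding tvF_def etv_def e_def using top by simp
 have tvF0: "0 <= tvF" unfolding tvF_def by (rule etv_nonneg)
 have pD: "per d m D" and pe: "per d m (e k)" for k
  using H(1,2,3) per_upd[OF H(1), of k] unfolding per_def D_def e_def by metis+
 have sh: "(\<Sum>w\<in>torus d m. \<Sum>x\<in>torus d r. G (%i. w i + x i)) = real r^d*(\<Sum>c\<in>torus d m. G c)"
  if "per d m G" for G :: "pt => real" and r
  by (subst sum.swap) (simp add: sum_per_shift[OF that m0] card_torus)
 define aw bw where "aw r w = (\<Sum>x\<in>torus d r. a (%i. w i + x i))" and "bw r w = (\<Sum>x\<in>torus d r. b (%i. w i + x i))" for r and w :: pt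
 have awbw: "aw r w + bw r w = M*real r^d" for r w unfolding aw_def bw_def sum.distrib[symmetric] H(8) by (simp add: card_torus)
 have pair: "a c*b c' <= M*(D c + D c') + M^2*\<bar>F c - F c'\<bar>" for c c'
 proof -
  have ab: "a c <= M" "b c' <= M" using H(6,7,8)[of c] H(6,7,8)[of c'] by linarith+
  \<comment> \<open>1 <= (1 - F c) + F c' + |F c - F c'|: a misfit at c, a misfit at c', or a
    difference of \<open>F\<close>.\<close>
  have "a c*b c'*1 <= a c*b c'*((1 - F c) + F c' + \<bar>F c - F c'\<bar>)" using H(6,7) by (intro mult_left_mono) auto
  also have "... = b c'*(a c*(1 - F c)) + a c*(b c'*F c') + a c*b c'*\<bar>F c - F c'\<bar>" by (simp add: algebra_simps)
  also have "... <= M*D c + M*D c' + M*M*\<bar>F c - F c'\<bar>"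
  proof (intro add_mono)
   have "a c*(1 - F c) <= D c" "b c'*F c' <= D c'" unfolding D_def using H(4,6,7) H(5)[of c'] by (simp_all)
   moreover have "0 <= a c*(1 - F c)" "0 <= b c'*F c'" using H(4,5,6,7) by simp_all
   ultimately show "b c'*(a c*(1 - F c)) <= M*D c" "a c*(b c'*F c') <= M*D c'" using ab M0 H(6,7) by (auto intro!: mult_mono)
   show "a c*b c'*\<bar>F c - F c'\<bar> <= M*M*\<bar>F c - F c'\<bar>" using ab M0 H(6,7) by (intro mult_right_mono mult_mono) auto
  qed
  finally show ?thesis by (simp add: distrib_left power2_eq_square)
 qed
 have win: "aw r w*bw r w <= 2*M*real r^d*(\<Sum>x\<in>torus d r. D (%i. w i + x i))
   + M^2*(real r^(d + 1)*(\<Sum>k<d. \<Sum>x\<in>torus d r. e k (%i. w i + x i)))" if r: "0 < r" for r and w :: pt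
 proof -
  define T where "T = torus d r"
  have cT: "real (card T) = real r^d" by (simp add: T_def card_torus)
  interpret gb: grid_box d r "%x. F (%i. w i + x i)" "%k x. e k (%i. w i + x i)" "%k. {0..<int r}"
  proof (unfold_locales, goal_cases)
   case (5 k x j)
   have "(%i. w i + (x(k := x k + 1)) i) = (%i. w i + x i)(k := w k + x k + 1)" by (auto simp: fun_eq_iff)
   then show ?case by (simp add: e_def abs_minus_commute)
  qed (use d2 r in \<open>auto simp: e_def\<close>)
  have "aw r w*bw r w = (\<Sum>x\<in>T. \<Sum>y\<in>T. a (%i. w i + x i)*b (%i. w i + y i))"
   unfolding aw_def bw_def T_def by (rule sum_product)
  also have "... <= (\<Sum>x\<in>T. \<Sum>y\<in>T. M*(D (%i. w i + x i) + D (%i. w i + y i)) + M^2*\<bar>F (%i. w i + x i) - F (%i. w i + y i)\<bar>)"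
   by (intro sum_mono pair)
  also have "... = 2*M*real r^d*(\<Sum>x\<in>T. D (%i. w i + x i)) + M^2*(\<Sum>x\<in>T. \<Sum>y\<in>T. \<bar>F (%i. w i + x i) - F (%i. w i + y i)\<bar>)"
   by (simp add: sum.distrib distrib_left sum_distrib_left[symmetric] cT algebra_simps)
  also have "(\<Sum>x\<in>T. \<Sum>y\<in>T. \<bar>F (%i. w i + x i) - F (%i. w i + y i)\<bar>) <= real r^(d + 1)*(\<Sum>k<d. \<Sum>x\<in>T. e k (%i. w i + x i))"
   using gb.poincare[of r] unfolding T_def torus_def by simp
  finally show ?thesis unfolding T_def using M0 by (simp add: mult_left_mono)
 qed
 have main: "(\<Sum>w\<in>torus d m. aw r w*bw r w) <= 10*M*real r^(2*d + 1)*L*V" if r: "0 < r" for r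
 proof -
  have "(\<Sum>w\<in>torus d m. aw r w*bw r w) <= (\<Sum>w\<in>torus d m. 2*M*real r^d*(\<Sum>x\<in>torus d r. D (%i. w i + x i))
   + M^2*(real r^(d + 1)*(\<Sum>k<d. \<Sum>x\<in>torus d r. e k (%i. w i + x i))))"
   by (intro sum_mono win r)
  also have "... = 2*M*real r^d*(\<Sum>w\<in>torus d m. \<Sum>x\<in>torus d r. D (%i. w i + x i))
   + M^2*(real r^(d + 1)*(\<Sum>k<d. \<Sum>w\<in>torus d m. \<Sum>x\<in>torus d r. e k (%i. w i + x i)))"
   by (subst (4) sum.swap) (simp add: sum.distrib sum_distrib_left)
  also have "... = 2*M*real r^d*(real r^d*(\<Sum>c\<in>torus d m. D c)) + M^2*(real r^(d + 1)*(real r^d*tvF))"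
   unfolding sh[OF pD] sh[OF pe] tvF_eq by (simp add: sum_distrib_left)
  also have "... <= 2*M*real r^d*(real r^d*(4*L*V)) + M*(real r^(d + 1)*(real r^d*(L*(2*V))))"
  proof (intro add_mono mult_left_mono)
   show "(\<Sum>c\<in>torus d m. D c) <= 4*L*V" using H(12) unfolding D_def .
   have "M*tvF <= L^d*tvF" using of_nat_mono[OF MM_le[of J], where ?'a = real] tvF0 unfolding M_def L_def by (intro mult_right_mono) auto
   also have "... = L*(tvF*L^(d - 1))" using d2 by (simp add: power_eq_if)
   also have "... <= L*(2*V)" using tvF_le L1 by (intro mult_left_mono) auto
   finally have "M*tvF <= L*(2*V)" .
   then have "M*(real r^(d + 1)*real r^d)*(M*tvF) <= M*(real r^(d + 1)*real r^d)*(L*(2*V))" using M0 by (intro mult_left_mono) auto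
   then show "M^2*(real r^(d + 1)*(real r^d*tvF)) <= M*(real r^(d + 1)*(real r^d*(L*(2*V))))" by (simp only: power2_eq_square ac_simps)
  qed (use M0 in auto)
  also have "... = (8*(M*L*V)*real r^(2*d)) + 2*(M*L*V)*real r^(2*d + 1)"
  proof -
   define R where "R = real r^d"
   have pw: "real r^(2*d) = R*R" "real r^(2*d + 1) = R*R*real r" "real r^(d + 1) = R*real r"
    unfolding R_def by (simp_all add: power_add mult_2)
   show ?thesis unfolding pw R_def[symmetric] by algebra
  qed
  also have "... <= 8*(M*L*V)*real r^(2*d + 1) + 2*(M*L*V)*real r^(2*d + 1)"
  proof -
   have "real r^(2*d) <= real r^(2*d + 1)" using r by (intro power_increasing) auto
   moreover have "0 <= 8*(M*L*V)" using M0 L1 V0 by simp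
   ultimately show ?thesis by (intro add_right_mono mult_left_mono)
  qed
  also have "... = 10*M*real r^(2*d + 1)*L*V" by algebra
  finally show ?thesis .
 qed
 show thesis
 proof (rule that[OF \<alpha>\<beta>])
  show "\<alpha> <= (\<Sum>c\<in>torus d (nn 0). f c)" "\<beta> <= (\<Sum>c\<in>torus d (nn 0). of_bool (good c)*(1 - f c))" "\<alpha> + \<beta> = real (MM J)*real (nn J)^d"
   using H(9,10) sumM unfolding \<alpha>_def \<beta>_def M_def m_def by simp_all
  fix r assume r: "0 < r" "r <= nn J" and small: "2*\<alpha> <= real r^d*real (MM J)"
  define R where "R = real r^d"
  have R0: "0 < R" using r by (simp add: R_def)
  have aw_le: "aw r w <= \<alpha>" for w
  proof -
   have "torus d r \<subseteq> torus d m" unfolding torus_def using r m_def by (intro PiE_mono) auto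
   then have "aw r w <= (\<Sum>x\<in>torus d m. a (%i. w i + x i))" unfolding aw_def using H(6) finite_torus by (intro sum_mono2) auto
   also have "... = (\<Sum>x\<in>torus d m. a (%i. x i + w i))" by (simp add: add.commute)
   also have "... = \<alpha>" unfolding \<alpha>_def by (rule sum_per_shift[OF H(2) m0])
   finally show ?thesis .
  qed
  have aw0: "0 <= aw r w" for w unfolding aw_def by (intro sum_nonneg H(6))
  have "R*M/2*(R*\<alpha>) = (\<Sum>w\<in>torus d m. aw r w*(R*M/2))"
   using sh[OF H(2), of r] unfolding aw_def R_def[symmetric] \<alpha>_def sum_distrib_right[symmetric] by (simp only: mult.commute)
  also have "... <= (\<Sum>w\<in>torus d m. aw r w*bw r w)"
  proof (intro sum_mono mult_left_mono aw0)
   fix w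
   show "R*M/2 <= bw r w" using awbw[of r w] aw_le[of w] small unfolding R_def M_def by (simp add: mult.commute)
  qed
  also have "... <= 10*M*real r^(2*d + 1)*L*V" by (rule main[OF r(1)])
  also have "... = R*M/2*(R*(20*real r*L*V))"
  proof -
   have pw: "real r^(2*d + 1) = R*R*real r" unfolding R_def by (simp add: power_add mult_2)
   show ?thesis unfolding pw by simp
  qed
  finally have "R*M/2*(R*\<alpha>) <= R*M/2*(R*(20*real r*L*V))" .
  then have "\<alpha> <= 20*real r*L*V" using R0 M0 by (simp add: ac_simps)
  then show "\<alpha> <= 20*real r*real (LL J)*V" unfolding L_def .
 next
  define R where "R = real m^d"
  have R0: "0 < R" using m0 by (simp add: R_def)
  have full: "aw m w = \<alpha>" "bw m w = \<beta>" for w using sum_per_shift[OF H(2) m0, of w] sum_per_shift[OF H(3) m0, of w]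
   unfolding aw_def bw_def \<alpha>_def \<beta>_def by (simp_all add: add.commute)
  have "(\<Sum>w\<in>torus d m. aw m w*bw m w) = R*(\<alpha>*\<beta>)" unfolding full R_def by (simp add: card_torus)
  then have "R*(\<alpha>*\<beta>) <= 10*M*real m^(2*d + 1)*L*V" using main[OF m0] by simp
  also have "... = R*(10*M*real m^(d + 1)*L*V)"
  proof -
   have pw: "real m^(2*d + 1) = R*real m^(d + 1)" unfolding R_def by (simp add: power_add mult_2)
   show ?thesis unfolding pw by (simp only: ac_simps)
  qed
  finally have "\<alpha>*\<beta> <= 10*M*real m^(d + 1)*L*V" using R0 by simp
  then show "\<alpha>*\<beta> <= 10*real (MM J)*real (nn J)^(d + 1)*real (LL J)*V" unfolding M_def m_def L_def .
 qed
qed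

end

section \<open>Witnesses of a bad top box: the leaves of binary trees of bad boxes\<close>

primrec leafsets :: "nat => nat => (nat => nat) => nat => pt => pt set set" where "leafsets d h l 0 B = {{B}}"
| "leafsets d h l (Suc j) B = (\<Union>(x, y)\<in>{(x, y). x \<in> torus d (l j) & y \<in> torus d (l j) & (\<exists>k<d. int h <= \<bar>x k - y k\<bar>)}.
   (%(Q1, Q2). Q1 \<union> Q2) ` (leafsets d h l j (sub (l j) B x) \<times> leafsets d h l j (sub (l j) B y)))"

lemma leafsets_SucE: assumes "Q \<in> leafsets d h l (Suc j) B"
 obtains x y Q1 Q2 k where "x \<in> torus d (l j)" "y \<in> torus d (l j)" "k < d" "int h <= \<bar>x k - y k\<bar>"
  "Q1 \<in> leafsets d h l j (sub (l j) B x)" "Q2 \<in> leafsets d h l j (sub (l j) B y)" "Q = Q1 \<union> Q2"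
 using assms by auto

lemma leafsets_range: assumes "Q \<in> leafsets d h l j B" "q \<in> Q" "k < d"
 shows "int (\<Prod>i<j. l i)*B k <= q k & q k < int (\<Prod>i<j. l i)*(B k + 1)"
 using assms
proof (induction j arbitrary: B Q)
 case (Suc j)
 define L where "L = int (\<Prod>i<j. l i)"
 obtain x y Q1 Q2 k' where xy: "x \<in> torus d (l j)" "y \<in> torus d (l j)"
  "Q1 \<in> leafsets d h l j (sub (l j) B x)" "Q2 \<in> leafsets d h l j (sub (l j) B y)" "Q = Q1 \<union> Q2"
  using leafsets_SucE[OF Suc.prems(1)] by metis
 have "\<exists>x. x \<in> torus d (l j) & L * sub (l j) B x k <= q k & q k < L*(sub (l j) B x k + 1)"
  using Suc.IH[OF xy(3) _ Suc.prems(3)] Suc.IH[OF xy(4) _ Suc.prems(3)] xy Suc.prems(2) unfolding L_def by blast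
 then obtain x where x: "x \<in> torus d (l j)" and q: "L * sub (l j) B x k <= q k" "q k < L*(sub (l j) B x k + 1)" by blast
 have xk: "0 <= x k" "x k + 1 <= int (l j)" using torusD[OF x Suc.prems(3)] by auto
 have L0: "0 <= L" unfolding L_def by (rule of_nat_0_le_iff)
 have A: "L*(int (l j)*B k) <= L * sub (l j) B x k" unfolding sub_def using xk L0 by (intro mult_left_mono) auto
 have A': "L*(sub (l j) B x k + 1) <= L*(int (l j)*B k + int (l j))" unfolding sub_def using xk L0 by (intro mult_left_mono) auto
 have e: "int (\<Prod>i<Suc j. l i)*B k = L*(int (l j)*B k)" "int (\<Prod>i<Suc j. l i)*(B k + 1) = L*(int (l j)*B k + int (l j))"
  by (simp_all add: L_def algebra_simps)
 show ?case unfolding e using A A' q by linarith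
qed simp

lemma leafsets_nonempty_finite: "Q \<in> leafsets d h l j B ==> finite Q" by (induction j arbitrary: B Q) auto

lemma finite_leafsets: "finite (leafsets d h l j B)"
proof (induction j arbitrary: B)
 case (Suc j)
 have "finite {(x, y). x \<in> torus d (l j) & y \<in> torus d (l j) & (\<exists>k<d. int h <= \<bar>x k - y k\<bar>)}"
  by (rule finite_subset[of _ "torus d (l j) \<times> torus d (l j)"]) (auto simp: finite_torus)
 then show ?case using Suc.IH by auto
qed simp

text \<open>The numbers satisfy c(j+1) <= (l0 4^j)^(2 d) c(j)^2. Carrying the factor (l0 4^(j+1))^(2
  d) turns this into pure squaring, because l0 4^j times l0 4^(j+2) is the square of l0
  4^(j+1).\<close>

lemma card_leafsets:
 fixes l0 d :: nat
 defines "Y \<equiv> (4*real l0)^(2*d)"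
 assumes l0: "0 < l0"
 shows "real (card (leafsets d h (%i. l0*4^i) j B))*(real l0*4^Suc j)^(2*d) <= Y^(2^j)"
proof (induction j arbitrary: B)
 case 0
 then show ?case by (simp add: Y_def mult.commute)
next
 case (Suc j)
 define l where "l = (%i. l0*4^i :: nat)"
 define W where "W = {(x, y). x \<in> torus d (l j) & y \<in> torus d (l j) & (\<exists>k<d. int h <= \<bar>x k - y k\<bar>)}"
 define z where "z = (real l0*4^Suc j)^(2*d)"
 define S where "S p = (%(Q1, Q2). Q1 \<union> Q2) ` (leafsets d h l j (sub (l j) B (fst p)) \<times> leafsets d h l j (sub (l j) B (snd p)))" for p
 have z0: "0 < z" using l0 by (simp add: z_def)
 have fW: "finite W" unfolding W_def by (rule finite_subset[of _ "torus d (l j) \<times> torus d (l j)"]) (auto simp: finite_torus)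
 have "card W <= card (torus d (l j) \<times> torus d (l j))" unfolding W_def by (rule card_mono) (auto simp: finite_torus)
 then have cW: "real (card W) <= real (l j)^(2*d)"
  by (metis (no_types) card_cartesian_product card_torus mult_2 of_nat_le_iff of_nat_power power_add)
 have cj: "real (card (leafsets d h l j B')) <= Y^(2^j)/z" for B'
  using Suc.IH[of B'] z0 unfolding l_def[symmetric] z_def[symmetric] by (simp add: pos_le_divide_eq)
 have "leafsets d h l (Suc j) B = (\<Union>p\<in>W. S p)" unfolding leafsets.simps W_def S_def by force
 then have "real (card (leafsets d h l (Suc j) B)) <= (\<Sum>p\<in>W. real (card (S p)))"
  using card_UN_le[OF fW, of S] by (metis of_nat_le_iff of_nat_sum)
 also have "... <= (\<Sum>p\<in>W. (Y^(2^j)/z)*(Y^(2^j)/z))"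
 proof (rule sum_mono)
  fix p
  have "card (S p) <= card (leafsets d h l j (sub (l j) B (fst p)))*card (leafsets d h l j (sub (l j) B (snd p)))"
   unfolding S_def by (intro order_trans[OF card_image_le]) (auto simp: finite_leafsets card_cartesian_product)
  then have "real (card (S p)) <= real (card (leafsets d h l j (sub (l j) B (fst p))))*real (card (leafsets d h l j (sub (l j) B (snd p))))"
   by (metis of_nat_le_iff of_nat_mult)
  also have "... <= (Y^(2^j)/z)*(Y^(2^j)/z)" using cj z0 by (intro mult_mono) (auto simp: Y_def)
  finally show "real (card (S p)) <= (Y^(2^j)/z)*(Y^(2^j)/z)" .
 qed
 also have "... = real (card W)*(Y^(2^Suc j)/z^2)" by (simp add: power2_eq_square power_add[symmetric] mult_2)
 also have "... <= real (l j)^(2*d)*(Y^(2^Suc j)/z^2)" using cW by (rule mult_right_mono) (simp add: Y_def)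
 finally have "real (card (leafsets d h l (Suc j) B))*(real l0*4^Suc (Suc j))^(2*d)
  <= real (l j)^(2*d)*(Y^(2^Suc j)/z^2)*(real l0*4^Suc (Suc j))^(2*d)"
  by (rule mult_right_mono) simp
 also have "... = Y^(2^Suc j)*((real (l j)*(real l0*4^Suc (Suc j)))^(2*d)/z^2)" by (simp add: power_mult_distrib)
 also have "(real (l j)*(real l0*4^Suc (Suc j)))^(2*d) = z^2"
 proof -
  have "real (l j)*(real l0*4^Suc (Suc j)) = (real l0*4^Suc j)^2" unfolding l_def by (simp add: power2_eq_square)
  then show ?thesis unfolding z_def by (metis power_mult mult.commute)
 qed
 finally show ?case using z0 unfolding l_def by simp
qed

lemma per_tower_good:
 assumes "per d (nn 0) good" "!!j. j < J ==> nn j = l j*nn (Suc j)" "!!j. j <= J ==> 0 < nn j" "2 <= d" "!!j. 2*h < l j" "j <= J"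
 shows "per d (nn j) (tower_good d h l good j)"
 using assms(6)
proof (induction j)
 case (Suc j)
 interpret lv: level d "l j" "nn (Suc j)" h "%_. 0" "tower_good d h l good j"
  by unfold_locales (use assms Suc in \<open>auto simp: per_def\<close>)
 show ?case using lv.per_goodB by simp
qed (use assms in simp)

text \<open>A bad box contains two separated bad boxes of the level below; unfolding this down to
  the cells yields the tree.\<close>

lemma tower_bad_leafset:
 assumes "per d (nn 0) good" "!!j. j < J ==> nn j = l j*nn (Suc j)" "!!j. j <= J ==> 0 < nn j" "2 <= d" "!!j. 2*h < l j" "j <= J"
  and "~ tower_good d h l good j B"
 shows "\<exists>Q\<in>leafsets d h l j B. \<forall>c\<in>Q. ~ good c"
 using assms(6,7)
proof (induction j arbitrary: B)
 case (Suc j)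
 interpret lv: level d "l j" "nn (Suc j)" h "%_. 0" "tower_good d h l good j"
  by unfold_locales (use assms(1-5) Suc.prems per_tower_good[OF assms(1-5), of j] in \<open>auto simp: per_def\<close>)
 have "~ lv.goodB B" using Suc.prems by simp
 then obtain x y k where xy: "x \<in> torus d (l j)" "y \<in> torus d (l j)" "k < d" "int h <= \<bar>x k - y k\<bar>"
  and b: "~ tower_good d h l good j (sub (l j) B x)" "~ tower_good d h l good j (sub (l j) B y)"
  unfolding lv.goodB_def by (auto simp: not_less)
 obtain Q1 Q2 where Q: "Q1 \<in> leafsets d h l j (sub (l j) B x)" "\<forall>c\<in>Q1. ~ good c"
  "Q2 \<in> leafsets d h l j (sub (l j) B y)" "\<forall>c\<in>Q2. ~ good c"
  using Suc.IH[OF _ b(1)] Suc.IH[OF _ b(2)] Suc.prems(1) by fastforce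
 have "(x, y) \<in> {(x, y). x \<in> torus d (l j) & y \<in> torus d (l j) & (\<exists>k<d. int h <= \<bar>x k - y k\<bar>)}" using xy by blast
 moreover have "Q1 \<union> Q2 \<in> (%(Q1, Q2). Q1 \<union> Q2) ` (leafsets d h l j (sub (l j) B x) \<times> leafsets d h l j (sub (l j) B y))"
  using Q by (intro image_eqI[of _ _ "(Q1, Q2)"]) auto
 ultimately have "Q1 \<union> Q2 \<in> leafsets d h l (Suc j) B" unfolding leafsets.simps by (intro UN_I[of "(x, y)"]) auto
 then show ?case using Q by blast
qed simp

lemma (in torus_walk) cd_ge: assumes "0 <= D" "D <= \<bar>a - b\<bar>" "\<bar>a - b\<bar> <= int N - D" shows "D <= cd a b"
proof (cases "D = 0")
 case True
 then show ?thesis using cd_nonneg by simp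
next
 case False
 have main: "D <= cd a b" if "D <= a - b" "a - b <= int N - D" for a b
 proof -
  have "(a - b) mod int N = a - b" using that False assms(1) by (intro mod_pos_pos_trivial) auto
  moreover have "(b - a) mod int N = int N - (a - b)"
  proof -
   have "(b - a) mod int N = (int N - (a - b)) mod int N" by (metis minus_diff_eq mod_add_self1 diff_minus_eq_add add.commute uminus_add_conv_diff)
   also have "... = int N - (a - b)" using that False assms(1) by (intro mod_pos_pos_trivial) auto
   finally show ?thesis .
  qed
  ultimately show ?thesis using that by (simp add: cd_def)
 qed
 show ?thesis using main[of a b] main[of b a] assms cd_commute[of a b] by (cases "b <= a") auto
qed

section \<open>Cells of the torus and the probability of a bad top box\<close>

definition tsize :: "nat => nat => nat => nat => nat" where "tsize l0 m J j = m*(\<Prod>i\<in>{j..<J}. l0*4^i)"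

text \<open>\<open>N\<close> need not be a multiple of the number of cells, so N/n0 is only between
  \<open>side\<close> and 2 * \<open>side\<close>. \<open>gap\<close> keeps the regions of separated
  cells apart, \<open>sepc\<close> sums the Green functions between them, and \<open>Yl\<close> lets
  the failure probability per cell beat the number of witnesses.\<close>

locale torus_cells = torus_run +
 fixes h l0 J m :: nat
 assumes m2: "2 <= m" and h0: "0 < h" and l16: "16 <= l0" and l32: "32*d*h <= l0"
  and sizeN: "side*tsize l0 m J 0 <= N" "N <= 2 * side*tsize l0 m J 0"
  and gap: "2*Rr + 2 <= (h - 1) * side"
  and sepc: "real (2*Rr + 1)^d*CX d*(2/sqrt (real ((h - 1) * side - 2*Rr - 1)) + 2^J*real tmix/real N^d) <= 1"
  and Yl: "(4*real l0)^(2*d) <= exp (real \<sigma>)"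
begin

definition l :: "nat => nat" where "l j = l0*4^j"
definition nn :: "nat => nat" where "nn j = tsize l0 m J j"
definition r0 :: nat where "r0 = (h - 1) * side - 2*Rr - 1"
definition Lb :: "nat => nat" where "Lb j = (\<Prod>i<j. l i)"
abbreviation "n0 \<equiv> nn 0"

text \<open>a N / n0 rounded up: the first integer of the a-th of n0 equal intervals. Hence
  \<open>ctr\<close> is the lower corner of a cell rather than its centre.\<close>

definition ctr0 :: "int => int" where "ctr0 a = (a*int N + int n0 - 1) div int n0"
definition ctr :: "pt => pt" where "ctr c = (\<lambda>i\<in>{..<d}. ctr0 (c i) mod int N)"
text \<open>A cube of side \<sigma>^3 at the corner, small enough to lie inside the cell; the middle
  third of the walk has to visit it.\<close>

definition Cset :: "pt => pt set" where "Cset c = (%t. \<lambda>i\<in>{..<d}. (ctr0 (c i) + t i) mod int N) ` torus d (\<sigma>^3)"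

definition good :: "pt list => pt => bool" where "good p c \<longleftrightarrow> ~ bad (ctr c) (Cset c) p"

lemma l_pos: "0 < l j" and l_ge: "l0 <= l j" using l16 by (auto simp: l_def)

lemma lh: "4*h <= l j" "2*h < l j"
proof -
 have "4*h <= 32*d*h" using d3 by (intro mult_right_mono) auto
 then show "4*h <= l j" using l32 l_ge[of j] by linarith
 then show "2*h < l j" using h0 by linarith
qed

lemma nn_pos: "0 < nn j" unfolding nn_def tsize_def using m2 l16 by (auto intro!: prod_pos)

lemma nn_step: "j < J ==> nn j = l j*nn (Suc j)" unfolding nn_def tsize_def l_def by (subst prod.atLeast_Suc_lessThan) auto

lemma nn_J: "nn J = m" by (simp add: nn_def tsize_def)

lemma n0_eq: "n0 = Lb j*nn j" if "j <= J" using that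
proof (induction j)
 case (Suc j)
 then show ?case using nn_step[of j] by (simp add: Lb_def)
qed (simp add: Lb_def)

lemma Lb_ge: "16^j <= Lb j"
proof -
 have "(\<Prod>i<j. 16) <= (\<Prod>i<j. l i)" using l_ge l16 by (intro prod_mono) (auto intro: order_trans)
 then show ?thesis by (simp add: Lb_def)
qed

lemma side_pos: "0 < side" unfolding side_def using sigma_ge by simp

lemma n0_le: "n0 <= N" using sizeN(1) side_pos unfolding nn_def by (metis le_trans mult.commute mult_le_mono2 mult_1_right Suc_leI One_nat_def)

lemma ctr0_bounds: "a*int N <= int n0*ctr0 a" "int n0*ctr0 a < a*int N + int n0"
proof -
 define x where "x = a*int N + int n0 - 1"
 have n: "0 < int n0" using nn_pos[of 0] by simp
 have "int n0*(x div int n0) + x mod int n0 = x" by simp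
 moreover have "0 <= x mod int n0" "x mod int n0 < int n0" using n by simp_all
 ultimately show "a*int N <= int n0*ctr0 a" "int n0*ctr0 a < a*int N + int n0" unfolding ctr0_def x_def[symmetric] unfolding x_def by linarith+
qed

lemma ctr0_per: "ctr0 (a + int n0*b) = ctr0 a + int N*b"
proof -
 have n: "int n0 ~= 0" using nn_pos[of 0] by simp
 have "(a + int n0*b)*int N + int n0 - 1 = (a*int N + int n0 - 1) + int n0*(b*int N)" by (simp add: algebra_simps)
 then have "((a + int n0*b)*int N + int n0 - 1) div int n0 = (a*int N + int n0 - 1) div int n0 + b*int N"
  using n by (metis div_mult_self2 add.commute)
 then show ?thesis unfolding ctr0_def by (simp add: mult.commute)
qed

lemma ctr0_mod: assumes "a mod int n0 = b mod int n0" shows "(ctr0 a + t) mod int N = (ctr0 b + t) mod int N"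
proof -
 obtain z where "a = b + int n0*z" using assms by (metis mod_eqE)
 then have "ctr0 a + t = ctr0 b + t + int N*z" using ctr0_per[of b z] by simp
 then show ?thesis by (simp only: mod_mult_self2)
qed

lemma ctr_T: "ctr c \<in> T" unfolding torus_def ctr_def using N3 by auto

lemma good_per: "per d n0 (good p)"
proof -
 have "good p c = good p c'" if eq: "\<forall>i<d. c i mod int n0 = c' i mod int n0" for c c'
 proof -
  have e: "(ctr0 (c i) + t) mod int N = (ctr0 (c' i) + t) mod int N" if "i < d" for i t using ctr0_mod eq that by blast
  have "ctr c = ctr c'" unfolding ctr_def using e[of _ 0] by (intro restrict_ext) simp
  moreover have "Cset c = Cset c'" unfolding Cset_def using e by (intro image_cong refl restrict_ext) simp
  ultimately show ?thesis by (simp add: good_def)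
 qed
 then show ?thesis unfolding per_def by blast
qed

lemma sigma3_lt_N: "\<sigma>^3 < side" "\<sigma>^3 <= Rr" "side < N"
proof -
 have s: "1 < \<sigma>" using sigma_ge by simp
 show "\<sigma>^3 < side" unfolding side_def using s by (intro power_strict_increasing) auto
 show "\<sigma>^3 <= Rr" unfolding Rr_def using s by (intro power_increasing) auto
 have "side < \<sigma>^(3*d + 8)" unfolding side_def using s by (intro power_strict_increasing) auto
 then show "side < N" using Nbig by linarith
qed

lemma Cset_reg: "Cset c \<subseteq> reg (ctr c)"
proof
 fix x assume "x \<in> Cset c"
 then obtain t where t: "t \<in> torus d (\<sigma>^3)" and x: "x = (\<lambda>i\<in>{..<d}. (ctr0 (c i) + t i) mod int N)" unfolding Cset_def by blast
 have "x \<in> T" unfolding x torus_def using N3 by auto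
 moreover have "cd (ctr c i) (x i) <= int Rr" if "i < d" for i
 proof -
  have "cd (ctr c i) (x i) = cd (ctr0 (c i)) (ctr0 (c i) + t i)" using that by (simp add: x ctr_def)
  also have "... <= \<bar>- t i\<bar>" by (rule cd_le_abs) simp
  also have "... <= int Rr" using torusD[OF t that] of_nat_mono[OF sigma3_lt_N(2), where ?'a = int] by linarith
  finally show ?thesis .
 qed
 ultimately show "x \<in> reg (ctr c)" unfolding reg_def ball_def by blast
qed

lemma card_Cset: "card (Cset c) = (\<sigma>^3)^d"
proof -
 have "inj_on (%t. \<lambda>i\<in>{..<d}. (ctr0 (c i) + t i) mod int N) (torus d (\<sigma>^3))"
 proof (rule inj_onI)
  fix s t assume s: "s \<in> torus d (\<sigma>^3)" and t: "t \<in> torus d (\<sigma>^3)"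
   and eq: "(\<lambda>i\<in>{..<d}. (ctr0 (c i) + s i) mod int N) = (\<lambda>i\<in>{..<d}. (ctr0 (c i) + t i) mod int N)"
  show "s = t"
  proof (rule PiE_ext[OF s[unfolded torus_def] t[unfolded torus_def]])
   fix i assume i: "i \<in> {..<d}"
   have "(ctr0 (c i) + s i) mod int N = (ctr0 (c i) + t i) mod int N" using fun_cong[OF eq, of i] i by simp
   then have "s i mod int N = t i mod int N" by (metis add_diff_cancel_left' mod_diff_left_eq)
   moreover have "0 <= s i" "s i < int N" "0 <= t i" "t i < int N"
    using torusD[OF s, of i] torusD[OF t, of i] i[unfolded lessThan_iff] of_nat_mono[OF less_imp_le[OF less_trans[OF sigma3_lt_N(1,3)]], where ?'a = int] by (auto intro: less_le_trans)
   ultimately show "s i = t i" by simp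
  qed
 qed
 then show ?thesis unfolding Cset_def by (simp add: card_image card_torus)
qed

lemma r0_pos: "1 <= r0" using gap by (simp add: r0_def)

text \<open>Boxes that differ by \<open>h\<close> contain cells whose indices differ by more than (h
  - 1) * \<open>Lb j\<close>; the extra 1 makes up for the rounding in \<open>ctr0\<close>. Since m
  >= 2 the indices differ by at most half of \<open>n0\<close>, so the way around the torus is long
  as well. After subtracting both regions, \<open>Lb j\<close> >= 16^j leaves the distance 16^j *
  \<open>r0\<close>.\<close>

lemma far_centres: assumes j: "Suc j <= J" and k: "k < d"
  and lo: "int ((h - 1)*Lb j + 1) <= \<bar>a k - b k\<bar>" and hi: "\<bar>a k - b k\<bar> <= int (Lb (Suc j))"
  and y: "y \<in> reg (ctr a)" and z: "z \<in> reg (ctr b)"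
 shows "z ~: ball y (16^j*r0)"
proof -
 define D where "D = int ((h - 1)*Lb j * side)"
 define \<Delta> where "\<Delta> = \<bar>a k - b k\<bar>"
 have n: "0 < int n0" using nn_pos[of 0] by simp
 have "1 <= (\<Prod>i\<in>{Suc j..<J}. l0*4^i)" using l16 by (intro prod_ge_1) auto
 then have "2 <= nn (Suc j)" unfolding nn_def tsize_def using m2 by (metis mult_le_mono mult_1_right)
 then have "Lb (Suc j)*2 <= n0" unfolding n0_eq[OF j] by (intro mult_left_mono) auto
 then have n0L: "2*int (Lb (Suc j)) <= int n0" by linarith
 have "4*(h - 1) <= l j" using lh(1)[of j] by simp
 then have "Lb j*(4*(h - 1)) <= Lb j*l j" by (rule mult_left_mono) simp
 then have "4*((h - 1)*Lb j) <= Lb (Suc j)" by (simp add: Lb_def ac_simps)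
 moreover have "Lb (Suc j) <= n0" using n0L by linarith
 ultimately have "4*((h - 1)*Lb j) <= n0" by linarith
 then have "4*((h - 1)*Lb j) * side <= n0 * side" by (rule mult_right_mono) simp
 also have "... <= N" using sizeN(1) by (simp add: nn_def mult.commute)
 finally have "4*((h - 1)*Lb j * side) <= N" by (simp only: ac_simps)
 then have DN: "4*D <= int N" unfolding D_def by linarith
 have diff: "D <= ctr0 s - ctr0 t & ctr0 s - ctr0 t <= int N - D" if st: "s - t = \<Delta>" for s t
 proof
  have NS: "int side*int n0 <= int N" using sizeN(1) by (metis nn_def of_nat_le_iff of_nat_mult)
  have "(s - t)*int N - int n0 < int n0*(ctr0 s - ctr0 t)" using ctr0_bounds[of s] ctr0_bounds[of t] by (simp add: algebra_simps)
  moreover have "\<Delta>*(int side*int n0) <= \<Delta>*int N" using NS by (intro mult_left_mono) (auto simp: \<Delta>_def)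
  ultimately have "int n0*(\<Delta>*int side - 1) < int n0*(ctr0 s - ctr0 t)" unfolding st by (simp add: algebra_simps)
  then have "\<Delta>*int side - 1 < ctr0 s - ctr0 t" using n by (simp only: mult_less_cancel_left_pos)
  moreover have "int ((h - 1)*Lb j + 1)*int side <= \<Delta>*int side" using lo unfolding \<Delta>_def by (rule mult_right_mono) simp
  moreover have "int ((h - 1)*Lb j + 1)*int side = D + int side" unfolding D_def by (simp only: of_nat_mult of_nat_add of_nat_1 distrib_right mult_1)
  moreover have "1 <= int side" using side_pos by simp
  ultimately show "D <= ctr0 s - ctr0 t" by linarith
  have "int n0*(ctr0 s - ctr0 t) < (s - t)*int N + int n0" using ctr0_bounds[of s] ctr0_bounds[of t] by (simp add: algebra_simps)
  moreover have "2*\<Delta>*int N <= int n0*int N" using hi n0L unfolding \<Delta>_def by (intro mult_right_mono) auto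
  ultimately have "int n0*(2*(ctr0 s - ctr0 t)) < int n0*(int N + 2)" unfolding st by (simp add: algebra_simps)
  then have "2*(ctr0 s - ctr0 t) < int N + 2" using n by (simp only: mult_less_cancel_left_pos)
  then show "ctr0 s - ctr0 t <= int N - D" using DN of_nat_mono[OF N3, where ?'a = int] by simp
 qed
 have D0: "0 <= D" by (simp add: D_def)
 have "D <= \<bar>ctr0 (a k) - ctr0 (b k)\<bar> & \<bar>ctr0 (a k) - ctr0 (b k)\<bar> <= int N - D"
 proof (cases "b k <= a k")
  case True
  then show ?thesis using diff[of "a k" "b k"] D0 by (simp add: \<Delta>_def)
 next
  case False
  then show ?thesis using diff[of "b k" "a k"] D0 by (simp add: \<Delta>_def)
 qed
 then have cdD: "D <= cd (ctr0 (a k)) (ctr0 (b k))" by (intro cd_ge D0) auto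
 have "cd (ctr0 (a k)) (y k) <= int Rr" "cd (ctr0 (b k)) (z k) <= int Rr" using y z k by (auto simp: reg_def ball_def ctr_def)
 moreover have "cd (ctr0 (a k)) (ctr0 (b k)) <= cd (ctr0 (a k)) (y k) + cd (y k) (ctr0 (b k))" by (rule cd_triangle)
 moreover have "cd (y k) (ctr0 (b k)) <= cd (y k) (z k) + cd (z k) (ctr0 (b k))" by (rule cd_triangle)
 ultimately have "D - 2*int Rr <= cd (y k) (z k)" using cdD cd_commute[of "z k" "ctr0 (b k)"] by linarith
 moreover have "int (16^j*r0) < D - 2*int Rr"
 proof -
  have e: "r0 + 1 + 2*Rr = (h - 1) * side" using gap by (simp add: r0_def)
  have L1: "1 <= Lb j" using Lb_ge[of j] le_trans[OF one_le_power[of "16::nat" j]] by simp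
  have "16^j*r0 <= Lb j*r0" using Lb_ge[of j] by (rule mult_right_mono) simp
  then have "16^j*r0 < Lb j*(r0 + 1)" unfolding distrib_left using L1 by linarith
  moreover have "1*(2*Rr) <= Lb j*(2*Rr)" using L1 by (rule mult_right_mono) simp
  then have "Lb j*(r0 + 1) + 2*Rr <= Lb j*(r0 + 1 + 2*Rr)" by (simp only: distrib_left mult_1)
  ultimately have "16^j*r0 + 2*Rr < Lb j*((h - 1) * side)" unfolding e by linarith
  then have "int (16^j*r0 + 2*Rr) < int (Lb j*((h - 1) * side))" by (simp only: of_nat_less_iff)
  then show ?thesis unfolding D_def by (simp add: ac_simps)
 qed
 ultimately show ?thesis using k unfolding ball_def by (auto simp: not_le intro!: exI[of _ k])
qed

abbreviation "RD \<equiv> real (2*Rr + 1)^d"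
definition wgt :: "nat => real" where "wgt j = RD*(CX d*(1/sqrt (real (16^j*r0)) + real tmix/real N^d))"

lemma CX_nonneg: "0 <= CX d" unfolding CX_def using CU_gt0 by simp

lemma far_greenS: assumes "Suc j <= J" "k < d"
  "int ((h - 1)*Lb j + 1) <= \<bar>a k - b k\<bar>" "\<bar>a k - b k\<bar> <= int (Lb (Suc j))" "y \<in> reg (ctr a)"
 shows "greenS tmix y (reg (ctr b)) <= wgt j"
proof -
 have yT: "y \<in> T" using assms(5) ball_subset unfolding reg_def by blast
 have "greenS tmix y (reg (ctr b)) <= (\<Sum>z\<in>reg (ctr b). CX d*(1/sqrt (real (16^j*r0)) + real tmix/real N^d))" unfolding greenS_def
 proof (rule sum_mono)
  fix z assume z: "z \<in> reg (ctr b)"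
  have zT: "z \<in> T" using z ball_subset unfolding reg_def by blast
  show "green tmix y z <= CX d*(1/sqrt (real (16^j*r0)) + real tmix/real N^d)"
   by (rule green_far_le[OF yT zT far_centres[OF assms z]]) (use r0_pos in simp)
 qed
 also have "... = real (card (reg (ctr b)))*(CX d*(1/sqrt (real (16^j*r0)) + real tmix/real N^d))" by simp
 also have "... <= wgt j" unfolding wgt_def
 proof (rule mult_right_mono)
  show "real (card (reg (ctr b))) <= RD"
   using of_nat_mono[OF card_ball_le[of "ctr b" Rr], where ?'a = real] unfolding reg_def by simp
 qed (use CX_nonneg in auto)
 finally show ?thesis .
qed

text \<open>Seen from one leaf, the sibling subtree split off at level i has 2^i leaves, each
  contributing at most \<open>wgt i\<close>.\<close>

lemma leafset_sep: "j <= J ==> Q \<in> leafsets d h l j B ==> card Q = 2^j & disjoint_family_on (%q. reg (ctr q)) Q \<and>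
  (\<forall>q\<in>Q. \<forall>y\<in>reg (ctr q). (\<Sum>i\<in>Q - {q}. greenS tmix y (reg (ctr i))) <= (\<Sum>i<j. 2^i*wgt i))"
proof (induction j arbitrary: B Q)
 case 0
 then show ?case by (simp add: disjoint_family_on_def)
next
 case (Suc j)
 obtain x y Q1 Q2 k where xy: "x \<in> torus d (l j)" "y \<in> torus d (l j)" "k < d" "int h <= \<bar>x k - y k\<bar>"
  "Q1 \<in> leafsets d h l j (sub (l j) B x)" "Q2 \<in> leafsets d h l j (sub (l j) B y)" "Q = Q1 \<union> Q2"
  using leafsets_SucE[OF Suc.prems(2)] by metis
 have IH1: "card Q1 = 2^j" "disjoint_family_on (%q. reg (ctr q)) Q1"
  "!!q y. q \<in> Q1 ==> y \<in> reg (ctr q) ==> (\<Sum>i\<in>Q1 - {q}. greenS tmix y (reg (ctr i))) <= (\<Sum>i<j. 2^i*wgt i)"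
  using Suc.IH[OF _ xy(5)] Suc.prems(1) by auto
 have IH2: "card Q2 = 2^j" "disjoint_family_on (%q. reg (ctr q)) Q2"
  "!!q y. q \<in> Q2 ==> y \<in> reg (ctr q) ==> (\<Sum>i\<in>Q2 - {q}. greenS tmix y (reg (ctr i))) <= (\<Sum>i<j. 2^i*wgt i)"
  using Suc.IH[OF _ xy(6)] Suc.prems(1) by auto
 have fin: "finite Q1" "finite Q2" using leafsets_nonempty_finite xy(5,6) by blast+
 have far: "int ((h - 1)*Lb j + 1) <= \<bar>a k - b k\<bar> & \<bar>a k - b k\<bar> <= int (Lb (Suc j))" if a: "a \<in> Q1" and b: "b \<in> Q2" for a b
 proof -
  define L where "L = int (Lb j)"
  have L0: "0 < L" unfolding L_def Lb_def using l_pos by (simp add: prod_pos)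
  have ra: "L * sub (l j) B x k <= a k" "a k < L*(sub (l j) B x k + 1)" using leafsets_range[OF xy(5) a xy(3)] by (auto simp: L_def Lb_def)
  have rb: "L * sub (l j) B y k <= b k" "b k < L*(sub (l j) B y k + 1)" using leafsets_range[OF xy(6) b xy(3)] by (auto simp: L_def Lb_def)
  have xk: "0 <= x k" "x k + 1 <= int (l j)" "0 <= y k" "y k + 1 <= int (l j)" using torusD[OF xy(1,3)] torusD[OF xy(2,3)] by auto
  have sx: "sub (l j) B x k - sub (l j) B y k = x k - y k" by (simp add: sub_def)
  have LS: "int (Lb (Suc j)) = L*int (l j)" by (simp add: L_def Lb_def)
  have hL: "int ((h - 1)*Lb j + 1) = L*(int h - 1) + 1" using h0 by (simp add: L_def of_nat_diff mult.commute)
  have lohi: "L*(int h - 1) + 1 <= a' - b' & a' - b' <= L*int (l j)"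
   if "int h <= s - t" "s - t + 1 <= int (l j)" "L * s <= a'" "a' < L*(s + 1)" "L*t <= b'" "b' < L*(t + 1)" for s t a' b'
  proof
   have "L*int h <= L*(s - t)" using that(1) L0 by (intro mult_left_mono) auto
   then show "L*(int h - 1) + 1 <= a' - b'" using that by (simp add: algebra_simps)
   have "L*(s - t + 1) <= L*int (l j)" using that(2) L0 by (intro mult_left_mono) auto
   then show "a' - b' <= L*int (l j)" using that by (simp add: algebra_simps)
  qed
  show ?thesis
  proof (cases "y k <= x k")
   case True
   then have "L*(int h - 1) + 1 <= a k - b k & a k - b k <= L*int (l j)"
    using xy(4) xk sx ra rb by (intro lohi[of "sub (l j) B x k" "sub (l j) B y k"]) auto
   moreover have "0 <= L*(int h - 1)" using L0 h0 by simp
   ultimately show ?thesis unfolding hL LS by simp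
  next
   case False
   then have "L*(int h - 1) + 1 <= b k - a k & b k - a k <= L*int (l j)"
    using xy(4) xk sx ra rb by (intro lohi[of "sub (l j) B y k" "sub (l j) B x k"]) auto
   moreover have "0 <= L*(int h - 1)" using L0 h0 by simp
   ultimately show ?thesis unfolding hL LS by simp
  qed
 qed
 have far': "int ((h - 1)*Lb j + 1) <= \<bar>b k - a k\<bar>" "\<bar>b k - a k\<bar> <= int (Lb (Suc j))" if "a \<in> Q1" "b \<in> Q2" for a b
  using far[OF that] by (simp_all add: abs_minus_commute)
 have "a ~= b" if "a \<in> Q1" "b \<in> Q2" for a b
 proof
  assume ab: "a = b"
  have "int ((h - 1)*Lb j + 1) <= \<bar>a k - b k\<bar>" using far[OF that] by blast
  moreover have "\<bar>a k - b k\<bar> = 0" unfolding ab by simp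
  ultimately show False by linarith
 qed
 then have disj: "Q1 \<inter> Q2 = {}" by blast
 have r1: "reg (ctr a) \<inter> reg (ctr b) = {}" if "a \<in> Q1" "b \<in> Q2" for a b
 proof -
  have "z ~: reg (ctr b)" if z: "z \<in> reg (ctr a)" for z
  proof
   assume zb: "z \<in> reg (ctr b)"
   have "z ~: ball z (16^j*r0)" using far[OF \<open>a \<in> Q1\<close> \<open>b \<in> Q2\<close>] by (intro far_centres[OF Suc.prems(1) xy(3) _ _ z zb]) auto
   moreover have "z \<in> T" using z ball_subset unfolding reg_def by blast
   ultimately show False by simp
  qed
  then show ?thesis by blast
 qed
 have "card Q = 2^Suc j" unfolding xy(7) using card_Un_disjoint[OF fin disj] IH1 IH2 by simp
 moreover have "disjoint_family_on (%q. reg (ctr q)) Q" using IH1(2) IH2(2) r1 unfolding xy(7) disjoint_family_on_def by blast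
 moreover have "(\<Sum>i\<in>Q - {q}. greenS tmix z (reg (ctr i))) <= (\<Sum>i<Suc j. 2^i*wgt i)"
  if q: "q \<in> Q" and z: "z \<in> reg (ctr q)" for q z
 proof (cases "q \<in> Q1")
  case True
  have "Q - {q} = (Q1 - {q}) \<union> Q2" using True disj xy(7) by blast
  then have "(\<Sum>i\<in>Q - {q}. greenS tmix z (reg (ctr i))) = (\<Sum>i\<in>Q1 - {q}. greenS tmix z (reg (ctr i))) + (\<Sum>i\<in>Q2. greenS tmix z (reg (ctr i)))"
   using fin disj by (simp only:) (intro sum.union_disjoint, auto)
  also have "(\<Sum>i\<in>Q2. greenS tmix z (reg (ctr i))) <= (\<Sum>i\<in>Q2. wgt j)"
   using far[OF True] z by (intro sum_mono far_greenS[OF Suc.prems(1) xy(3), of q]) auto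
  also have "(\<Sum>i\<in>Q1 - {q}. greenS tmix z (reg (ctr i))) <= (\<Sum>i<j. 2^i*wgt i)" by (rule IH1(3)[OF True z])
  finally show ?thesis using IH2(1) by simp
 next
  case False
  then have q2: "q \<in> Q2" using q xy(7) by blast
  have "Q - {q} = (Q2 - {q}) \<union> Q1" using q2 disj xy(7) by blast
  then have "(\<Sum>i\<in>Q - {q}. greenS tmix z (reg (ctr i))) = (\<Sum>i\<in>Q2 - {q}. greenS tmix z (reg (ctr i))) + (\<Sum>i\<in>Q1. greenS tmix z (reg (ctr i)))"
   using fin disj by (simp only:) (intro sum.union_disjoint, auto)
  also have "(\<Sum>i\<in>Q1. greenS tmix z (reg (ctr i))) <= (\<Sum>i\<in>Q1. wgt j)"
   using far' q2 z by (intro sum_mono far_greenS[OF Suc.prems(1) xy(3), of q]) auto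
  also have "(\<Sum>i\<in>Q2 - {q}. greenS tmix z (reg (ctr i))) <= (\<Sum>i<j. 2^i*wgt i)" by (rule IH2(3)[OF q2 z])
  finally show ?thesis using IH1(1) by simp
 qed
 ultimately show ?case by blast
qed

text \<open>Distances of order 16^i give a Green function decay 4^(-i), which beats the 2^i leaves;
  the equidistributed part sums to 2^J * tmix / N^d.\<close>

lemma sum_wgt: "(\<Sum>i<J. 2^i*wgt i) <= 1"
proof -
 define K where "K = RD*CX d"
 define s where "s = 1/sqrt (real r0)"
 define q where "q = real tmix/real N^d"
 have K0: "0 <= K" unfolding K_def using CX_nonneg by simp
 have s0: "0 <= s" "0 <= q" by (simp_all add: s_def q_def)
 have "2^i*wgt i = K*(s*(1/2)^i + q*2^i)" for i
 proof -
  have "sqrt ((16::real)^i) = sqrt ((4^i)^2)" by (simp add: power_mult[symmetric] mult.commute[of i] power_mult)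
  then have "sqrt (real (16^i*r0)) = 4^i * sqrt (real r0)" by (simp add: real_sqrt_mult)
  then have "wgt i = K*(s/4^i + q)" unfolding wgt_def K_def s_def q_def by simp
  moreover have "(2::real)^i*(s/4^i) = s*(1/2)^i"
  proof -
   have "(4::real)^i = 2^i*2^i" by (simp add: power_mult_distrib[symmetric])
   then show ?thesis by (simp add: power_one_over)
  qed
  moreover have "2^i*(K*(s/4^i + q)) = K*(2^i*(s/4^i) + q*2^i)" by (simp add: algebra_simps)
  ultimately show ?thesis by (simp only:)
 qed
 then have "(\<Sum>i<J. 2^i*wgt i) = (\<Sum>i<J. K*(s*(1/2)^i + q*2^i))" by simp
 also have "... = K*(s*(\<Sum>i<J. (1/2)^i) + q*(\<Sum>i<J. 2^i))"
  unfolding sum_distrib_left[of s] sum_distrib_left[of q] sum.distrib[symmetric] by (rule sum_distrib_left[symmetric])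
 also have "... <= K*(s*2 + q*2^J)"
 proof (intro mult_left_mono add_mono K0 s0)
  have "(\<Sum>i<J. (1/2 :: real)^i) = 2 - 2*(1/2)^J" by (induction J) (simp_all add: field_simps)
  also have "... <= 2" by simp
  finally show "(\<Sum>i<J. (1/2 :: real)^i) <= 2" .
  have "(\<Sum>i<J. (2 :: real)^i) = 2^J - 1" by (induction J) simp_all
  then show "(\<Sum>i<J. (2 :: real)^i) <= 2^J" by simp
 qed
 also have "... = RD*CX d*(2/sqrt (real ((h - 1) * side - 2*Rr - 1)) + 2^J*real tmix/real N^d)"
  unfolding K_def s_def q_def r0_def by simp
 finally show ?thesis using sepc by linarith
qed

text \<open>Union bound over boxes and witnesses: at most exp \<sigma> to the power 2^J of them per
  box, each of probability at most exp (- 2 \<sigma>) to the power 2^J.\<close>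

lemma top_bad_prob:
 "avgT n (%p. of_bool (\<exists>B\<in>torus d m. ~ tower_good d h l (good p) J B)) <= real m^d*exp (- (real \<sigma>*2^J))"
proof -
 have sepQ: "sep Q (%q. reg (ctr q))" if "Q \<in> leafsets d h l J B" for Q B
  unfolding sep_def using leafset_sep[OF order.refl that] leafsets_nonempty_finite[OF that] sum_wgt
  unfolding reg_def by (meson ball_subset order_trans)
 have "avgT n (%p. of_bool (\<exists>B\<in>torus d m. ~ tower_good d h l (good p) J B))
  <= avgT n (%p. \<Sum>B\<in>torus d m. \<Sum>Q\<in>leafsets d h l J B. of_bool (\<forall>c\<in>Q. bad (ctr c) (Cset c) p))"
 proof (rule avgT_mono)
  fix x p
  show "(of_bool (\<exists>B\<in>torus d m. ~ tower_good d h l (good p) J B) :: real)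
   <= (\<Sum>B\<in>torus d m. \<Sum>Q\<in>leafsets d h l J B. of_bool (\<forall>c\<in>Q. bad (ctr c) (Cset c) p))"
  proof (cases "\<exists>B\<in>torus d m. ~ tower_good d h l (good p) J B")
   case True
   then obtain B where B: "B \<in> torus d m" "~ tower_good d h l (good p) J B" by blast
   have "2 <= d" using d3 by simp
   then obtain Q where Q: "Q \<in> leafsets d h l J B" "\<forall>c\<in>Q. ~ good p c"
    using tower_bad_leafset[OF good_per nn_step nn_pos _ lh(2) order.refl B(2)] by blast
   have "(1::real) = of_bool (\<forall>c\<in>Q. bad (ctr c) (Cset c) p)" using Q(2) by (simp add: good_def)
   also have "... <= (\<Sum>Q\<in>leafsets d h l J B. of_bool (\<forall>c\<in>Q. bad (ctr c) (Cset c) p))"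
    by (rule member_le_sum[OF Q(1)]) (simp_all add: finite_leafsets)
   also have "... <= (\<Sum>B\<in>torus d m. \<Sum>Q\<in>leafsets d h l J B. of_bool (\<forall>c\<in>Q. bad (ctr c) (Cset c) p))"
    by (rule member_le_sum[OF B(1)]) (simp_all add: finite_torus sum_nonneg)
   finally show ?thesis using True by simp
  next
   case False
   then show ?thesis by (simp add: sum_nonneg)
  qed
 qed
 also have "... = (\<Sum>B\<in>torus d m. \<Sum>Q\<in>leafsets d h l J B. avgT n (%p. of_bool (\<forall>c\<in>Q. bad (ctr c) (Cset c) p)))"
  by (simp only: avgT_sum)
 also have "... <= (\<Sum>B\<in>torus d m. \<Sum>Q\<in>leafsets d h l J B. exp (- (2*real \<sigma>))^(2^J))"
 proof (intro sum_mono)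
  fix B Q assume Q: "Q \<in> leafsets d h l J B"
  have "card Q = 2^J" using leafset_sep[OF order.refl Q] by blast
  then show "avgT n (%p. of_bool (\<forall>c\<in>Q. bad (ctr c) (Cset c) p)) <= exp (- (2*real \<sigma>))^(2^J)"
   using bad_joint[OF sepQ[OF Q], of Cset] Cset_reg card_Cset by simp
 qed
 also have "... = (\<Sum>B\<in>torus d m. real (card (leafsets d h l J B))*exp (- (2*real \<sigma>))^(2^J))" by simp
 also have "... <= (\<Sum>B\<in>torus d m. exp (real \<sigma>)^(2^J)*exp (- (2*real \<sigma>))^(2^J))"
 proof (intro sum_mono mult_right_mono)
  fix B
  define z where "z = (real l0*4^Suc J)^(2*d)"
  have "1*1 <= real l0*4^Suc J" using l16 by (intro mult_mono one_le_power) auto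
  then have "1 <= real l0*4^Suc J" by simp
  then have z1: "1 <= z" unfolding z_def by (rule one_le_power)
  have "l = (%i. l0*4^i)" by (simp add: fun_eq_iff l_def)
  then have "real (card (leafsets d h l J B))*z <= ((4*real l0)^(2*d))^(2^J)" using card_leafsets[of l0 d h J B] l16 unfolding z_def by simp
  also have "... <= exp (real \<sigma>)^(2^J)" by (intro power_mono Yl) simp
  finally have "real (card (leafsets d h l J B))*z <= exp (real \<sigma>)^(2^J)" .
  moreover have "real (card (leafsets d h l J B))*1 <= real (card (leafsets d h l J B))*z" using z1 by (intro mult_left_mono) auto
  ultimately show "real (card (leafsets d h l J B)) <= exp (real \<sigma>)^(2^J)" by linarith
 qed simp
 also have "... = real m^d*(exp (real \<sigma>)^(2^J)*exp (- (2*real \<sigma>))^(2^J))" by (simp add: card_torus)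
 also have "exp (real \<sigma>)^(2^J)*exp (- (2*real \<sigma>))^(2^J) = exp (- (real \<sigma>*2^J))"
  unfolding power_mult_distrib[symmetric] exp_add[symmetric] exp_of_nat_mult[symmetric] by (simp add: mult.commute)
 finally show ?thesis .
qed

end

lemma prod_one_minus_ge:
 fixes x :: "nat => real"
 assumes "!!i. i < J ==> 0 <= x i & x i <= 1"
 shows "1 - (\<Sum>i<J. x i) <= (\<Prod>i<J. 1 - x i)"
 using assms
proof (induction J)
 case (Suc J)
 have p: "(\<Prod>i<J. 1 - x i) <= 1" using Suc.prems by (intro prod_le_1) auto
 have "x J*(\<Prod>i<J. 1 - x i) <= x J*1" using Suc.prems p by (intro mult_left_mono) auto
 then show ?case using Suc by (simp add: algebra_simps)
qed simp

section \<open>Geometry of the cells and the fraction of cells lost\<close>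

context torus_cells begin

definition incell :: "pt => pt => bool" where "incell c y \<longleftrightarrow> (\<forall>i<d. (y i*int n0) div int N = c i mod int n0)"

lemma cell_arith: assumes "(y*int n0) div int N = a mod int n0" shows "cd (ctr0 a) y <= 2*int side"
proof -
 define q where "q = a mod int n0"
 have n: "0 < int n0" "0 < int N" using nn_pos[of 0] Npos by auto
 have "int N*q + (y*int n0) mod int N = y*int n0" using assms unfolding q_def by (metis mult_div_mod_eq)
 then have y: "q*int N <= y*int n0" "y*int n0 < q*int N + int N" using pos_mod_bound[OF n(2), of "y*int n0"] pos_mod_sign[OF n(2), of "y*int n0"]
  unfolding mult.commute[of q] by linarith+
 have NS: "int N <= 2*int side*int n0" using sizeN(2) by (metis nn_def of_nat_le_iff of_nat_mult of_nat_numeral)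
 have nN: "int n0 <= int N" using n0_le by simp
 have "(ctr0 q - y)*int n0 <= int N" "(y - ctr0 q)*int n0 <= int N" using ctr0_bounds[of q] y nN by (simp_all add: algebra_simps)
 then have "\<bar>ctr0 q - y\<bar>*int n0 <= int N" by (cases "0 <= ctr0 q - y") (simp_all add: abs_if)
 then have "\<bar>ctr0 q - y\<bar>*int n0 <= 2*int side*int n0" using NS by linarith
 then have "\<bar>ctr0 q - y\<bar> <= 2*int side" using n by simp
 moreover have "cd (ctr0 a) y <= \<bar>ctr0 q - y\<bar>"
 proof (rule cd_le_abs)
  have "ctr0 a mod int N = ctr0 q mod int N" using ctr0_mod[of a q 0] by (simp add: q_def)
  then show "(ctr0 q - y) mod int N = (ctr0 a - y) mod int N" by (metis mod_diff_left_eq)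
 qed
 ultimately show ?thesis by linarith
qed

lemma incell_ball: "y \<in> T ==> incell c y ==> y \<in> ball (ctr c) (2 * side)" unfolding incell_def ball_def by (auto simp: ctr_def cell_arith)

lemma ctr_next: "k < d ==> ctr (c(k := c k + 1)) \<in> ball (ctr c) (3 * side)"
proof -
 assume k: "k < d"
 have n: "0 < int n0" using nn_pos[of 0] by simp
 have "cd (ctr0 (c i)) (ctr0 ((c(k := c k + 1)) i)) <= int (3 * side)" for i
 proof (cases "i = k")
  case True
  have NS: "int N <= 2*int side*int n0" using sizeN(2) by (metis nn_def of_nat_le_iff of_nat_mult of_nat_numeral)
  have nN: "int n0 <= int N" using n0_le by simp
  have "int n0*(ctr0 (c k + 1) - ctr0 (c k)) <= int N + int n0" "- int n0 <= int n0*(ctr0 (c k + 1) - ctr0 (c k))"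
   using ctr0_bounds[of "c k"] ctr0_bounds[of "c k + 1"] nN by (simp_all add: algebra_simps)
  then have "int n0*(ctr0 (c k + 1) - ctr0 (c k)) <= int n0*(2*int side + 1)"
   "int n0 * - 1 <= int n0*(ctr0 (c k + 1) - ctr0 (c k))" using NS by (simp_all add: algebra_simps)
  then have "ctr0 (c k + 1) - ctr0 (c k) <= 2*int side + 1" "- 1 <= ctr0 (c k + 1) - ctr0 (c k)" using n by (simp_all only: mult_le_cancel_left_pos)
  then have "\<bar>ctr0 (c k) - ctr0 (c k + 1)\<bar> <= 3*int side" using side_pos by (simp add: abs_if)
  moreover have "cd (ctr0 (c k)) (ctr0 (c k + 1)) <= \<bar>ctr0 (c k) - ctr0 (c k + 1)\<bar>" by (rule cd_le_abs) simp
  ultimately show ?thesis using True by simp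
 qed simp
 then show ?thesis using ctr_T unfolding ball_def by (auto simp: ctr_def)
qed

lemma incell_next_ball: "k < d ==> y \<in> T ==> incell (c(k := c k + 1)) y ==> y \<in> ball (ctr c) (8 * side)"
proof -
 assume a: "k < d" "y \<in> T" "incell (c(k := c k + 1)) y"
 have "y \<in> ball (ctr c) (3 * side + 2 * side)" by (rule ball_trans[OF ctr_next[OF a(1)] incell_ball[OF a(2,3)]])
 moreover have "ball (ctr c) (3 * side + 2 * side) \<subseteq> ball (ctr c) (8 * side)" by (rule ball_mono) simp
 ultimately show ?thesis by blast
qed

lemma incell_ball8: "y \<in> T ==> incell c y ==> y \<in> ball (ctr c) (8 * side)" using incell_ball ball_mono[of "2 * side" "8 * side"] by auto

lemma Cset_incell: "y \<in> Cset c ==> incell c y"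
proof -
 assume "y \<in> Cset c"
 then obtain t where t: "t \<in> torus d (\<sigma>^3)" and y: "y = (\<lambda>i\<in>{..<d}. (ctr0 (c i) + t i) mod int N)" unfolding Cset_def by blast
 have n: "0 < int n0" "0 < int N" using nn_pos[of 0] Npos by auto
 show ?thesis unfolding incell_def
 proof (intro allI impI)
  fix i assume i: "i < d"
  define a where "a = c i mod int n0"
  have a: "0 <= a" "a + 1 <= int n0" using n unfolding a_def by (simp_all add: Suc_leI add1_zle_eq)
  have ti: "0 <= t i" "t i + 1 <= int side" using torusD[OF t i] of_nat_mono[OF less_imp_le[OF sigma3_lt_N(1)], where ?'a = int] by linarith+
  define s where "s = ctr0 a + t i"
  have lo: "a*int N <= int n0 * s" unfolding s_def distrib_left using ctr0_bounds(1)[of a] mult_nonneg_nonneg[of "int n0" "t i"] ti by linarith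
  have "int n0*(t i + 1) <= int n0*int side" using ti n by (intro mult_left_mono) auto
  also have "... <= int N" using sizeN(1) by (metis mult.commute nn_def of_nat_le_iff of_nat_mult)
  finally have hi: "int n0 * s < (a + 1)*int N" unfolding s_def using ctr0_bounds(2)[of a] by (simp add: algebra_simps)
  have "0 <= int n0 * s" using lo a n by (meson mult_nonneg_nonneg order_trans less_imp_le)
  then have s0: "0 <= s" using n by (simp add: zero_le_mult_iff)
  have "(a + 1)*int N <= int n0*int N" using a n by (intro mult_right_mono) auto
  then have "int n0 * s < int n0*int N" using hi by linarith
  then have sN: "s < int N" using n by simp
  have "y i = (ctr0 (c i) + t i) mod int N" using i by (simp add: y)
  also have "... = s mod int N" unfolding s_def by (rule ctr0_mod) (simp add: a_def)
  also have "... = s" using s0 sN by simp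
  finally have ys: "y i = s" .
  have "(s*int n0) div int N = a"
  proof (rule int_div_pos_eq[where r = "s*int n0 - int N*a"])
  qed (use lo hi in \<open>auto simp: algebra_simps\<close>)
  then show "(y i*int n0) div int N = c i mod int n0" using ys by (simp add: a_def)
 qed
qed

lemma ctr_incell: "incell c (ctr c)"
proof (rule Cset_incell)
 have "0 < \<sigma>^3" using sigma_ge by simp
 then have "(\<lambda>i\<in>{..<d}. 0) \<in> torus d (\<sigma>^3)" unfolding torus_def by auto
 then show "ctr c \<in> Cset c" unfolding Cset_def ctr_def by (intro image_eqI[of _ _ "\<lambda>i\<in>{..<d}. 0"]) auto
qed

lemma incell_unique: assumes "c \<in> torus d n0" "c' \<in> torus d n0" "incell c y" "incell c' y" shows "c = c'"
proof (rule PiE_ext[OF assms(1)[unfolded torus_def] assms(2)[unfolded torus_def]])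
 fix i assume "i \<in> {..<d}"
 then show "c i = c' i" using assms torusD[OF assms(1), of i] torusD[OF assms(2), of i] unfolding incell_def by fastforce
qed

lemma incell_exists: assumes "y \<in> T"
 obtains c where "c \<in> torus d n0" "incell c y"
proof
 define c where "c = (\<lambda>i\<in>{..<d}. (y i*int n0) div int N)"
 have n: "0 < int n0" "0 < int N" using nn_pos[of 0] Npos by auto
 have r: "0 <= (y i*int n0) div int N & (y i*int n0) div int N < int n0" if "i < d" for i
 proof
  have "0 <= y i" "y i < int N" using torusD[OF assms that] by auto
  then show "0 <= (y i*int n0) div int N" using n by (simp add: pos_imp_zdiv_nonneg_iff)
  have "y i*int n0 < int n0*int N" using \<open>y i < int N\<close> n by (simp add: mult.commute)
  moreover have "(y i*int n0) div int N*int N <= y i*int n0"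
   using pos_mod_sign[OF n(2), of "y i*int n0"] div_mult_mod_eq[of "y i*int n0" "int N"] by linarith
  ultimately have "(y i*int n0) div int N*int N < int n0*int N" by linarith
  then show "(y i*int n0) div int N < int n0" using n by simp
 qed
 then show "c \<in> torus d n0" unfolding torus_def c_def by auto
 show "incell c y" unfolding incell_def c_def using r by auto
qed

lemma card_near_cells: assumes "x \<in> T" shows "card {c \<in> torus d n0. x \<in> reg (ctr c)} <= (2*Rr + 1)^d"
proof -
 have "inj_on ctr (torus d n0)" by (rule inj_onI) (metis ctr_incell incell_unique)
 then have "inj_on ctr {c \<in> torus d n0. x \<in> reg (ctr c)}" by (rule inj_on_subset) auto
 then have "card {c \<in> torus d n0. x \<in> reg (ctr c)} = card (ctr ` {c \<in> torus d n0. x \<in> reg (ctr c)})" by (simp add: card_image)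
 also have "... <= card (ball x Rr)" using ball_commute[OF ctr_T] unfolding reg_def by (intro card_mono) auto
 also have "... <= (2*Rr + 1)^d" by (rule card_ball_le)
 finally show ?thesis .
qed

lemma Lb_J: "n0 = Lb J*m" using n0_eq[of J] nn_J by simp

text \<open>Bound for the fraction of cells lost on all levels: d times the sum of h / l(j), with
  the geometric factor 4/3 rounded up to 2.\<close>

definition eta :: real where "eta = 2*real d*real h/real l0"

lemma sum_h_l: "(\<Sum>i<J. real h/real (l i)) <= 4/3*(real h/real l0)"
proof -
 have "(\<Sum>i<J. real h/real (l i)) = real h/real l0*(\<Sum>i<J. (1/4)^i)" unfolding l_def sum_distrib_left by (simp add: power_one_over)
 also have "(\<Sum>i<J. (1/4 :: real)^i) = 4/3 - 4/3*(1/4)^J" by (induction J) simp_all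
 also have "real h/real l0*(4/3 - 4/3*(1/4)^J) <= real h/real l0*(4/3)" by (intro mult_left_mono) auto
 finally show ?thesis by simp
qed

lemma tower_inst: assumes f: "per d n0 f" "!!c. f c = 0 | f c = 1" shows "tower d h l nn f (good p) J"
proof
 have "(\<Sum>i<J. 8*real d*real h/real (l i)) = 8*real d*(\<Sum>i<J. real h/real (l i))" by (simp add: sum_distrib_left mult.assoc)
 also have "... <= 8*real d*(4/3*(real h/real l0))" by (intro mult_left_mono sum_h_l) auto
 also have "... = (32*real d*real h/real l0)/3" by simp
 also have "32*real d*real h/real l0 <= 1" using of_nat_mono[OF l32, where ?'a = real] l16 by (simp add: divide_le_eq)
 finally show "(\<Sum>i<J. 8*real d*real h/real (l i)) <= 1/2" by simp
qed (use f d3 h0 lh nn_step nn_pos good_per in auto)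

lemma MM_ge: "(1 - eta)*real (Lb J)^d <= real ((\<Prod>i<J. l i - h)^d)"
proof -
 define s where "s = (\<Sum>i<J. real h/real (l i))"
 have hl: "real h/real (l i) <= 1" for i using lh(2)[of i] l_pos[of i] by (simp add: divide_le_eq)
 have s0: "0 <= s" unfolding s_def by (intro sum_nonneg) auto
 have e: "(1 - real h/real (l i))*real (l i) = real (l i - h)" for i using lh(2)[of i] l_pos[of i] by (simp add: of_nat_diff left_diff_distrib)
 have P: "(\<Prod>i<J. 1 - real h/real (l i))*real (Lb J) = real (\<Prod>i<J. l i - h)"
  unfolding Lb_def of_nat_prod prod.distrib[symmetric] by (simp add: e)
 have le1: "1 - s <= (\<Prod>i<J. 1 - real h/real (l i))" unfolding s_def by (rule prod_one_minus_ge) (use hl in auto)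
 have "real d * s <= real d*(4/3*(real h/real l0))" unfolding s_def by (intro mult_left_mono sum_h_l) auto
 also have "... <= real d*(2*(real h/real l0))" by (intro mult_left_mono mult_right_mono) auto
 finally have sl: "real d * s <= eta" by (simp add: eta_def mult.assoc mult.left_commute)
 have e1: "eta <= 1" using of_nat_mono[OF l32, where ?'a = real] l16 unfolding eta_def by (simp add: divide_le_eq)
 have "1 * s <= real d * s" using d3 s0 by (intro mult_right_mono) auto
 then have s1: "s <= 1" using sl e1 by linarith
 have "1 - eta <= 1 + real d*(- s)" using sl by simp
 also have "... <= (1 + (- s))^d" by (rule Bernoulli_inequality) (use s1 in simp)
 also have "... <= (\<Prod>i<J. 1 - real h/real (l i))^d" using le1 s1 by (intro power_mono) auto
 finally have "(1 - eta)*real (Lb J)^d <= (\<Prod>i<J. 1 - real h/real (l i))^d*real (Lb J)^d" by (rule mult_right_mono) simp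
 also have "... = real ((\<Prod>i<J. l i - h)^d)" unfolding power_mult_distrib[symmetric] P by simp
 finally show ?thesis .
qed

text \<open>A connection that leaves the ball of radius K passes through K shells around its first
  point.\<close>

lemma conn_card: assumes c: "conn S a b" and fin: "finite S" and ST: "S \<subseteq> T" and far: "b ~: ball a K" shows "K <= card S"
proof -
 have aT: "a \<in> T" using conn_mem[OF c] ST by blast
 have "\<exists>y\<in>S. y ~: ball a k & y \<in> ball a (Suc k)" if k: "k < K" for k
 proof -
  have "b ~: ball a k" using far ball_mono[of k K a] k by auto
  then obtain w y where w: "conn (S \<inter> ball a k) a w" "adj w y" "y \<in> S" "y ~: ball a k"
   using conn_exit[OF c, of "ball a k"] aT by (metis ball_self)
  have "w \<in> ball a k" using conn_mem[OF w(1)] by blast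
  then have "y \<in> ball a (Suc k)" using adj_ball[OF w(2)] w(3) ST by blast
  then show ?thesis using w by blast
 qed
 then obtain y where y: "!!k. k < K ==> y k \<in> S & y k ~: ball a k & y k \<in> ball a (Suc k)" by metis
 have "inj_on y {..<K}"
 proof (rule linorder_inj_onI')
  fix i j assume ij: "i \<in> {..<K}" "j \<in> {..<K}" "i < j"
  then have "y i \<in> ball a j" using y[of i] ball_mono[of "Suc i" j a] by auto
  then show "y i ~= y j" using y[of j] ij by auto
 qed
 then have "K = card (y ` {..<K})" by (simp add: card_image)
 also have "... <= card S" using y by (intro card_mono fin) auto
 finally show ?thesis .
qed

lemma all_top_good: assumes "\<forall>B\<in>torus d m. tower_good d h l (good p) J B" shows "tower_good d h l (good p) J B"
proof -
 define B' where "B' = (\<lambda>i\<in>{..<d}. B i mod int m)"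
 have "2 <= d" using d3 by simp
 have "per d (nn J) (tower_good d h l (good p) J)" by (rule per_tower_good[OF good_per nn_step nn_pos \<open>2 \<le> d\<close> lh(2) order.refl])
 moreover have "B i mod int (nn J) = B' i mod int (nn J)" if "i < d" for i using that by (simp add: B'_def nn_J)
 ultimately have "tower_good d h l (good p) J B = tower_good d h l (good p) J B'" by (rule perD)
 moreover have "B' \<in> torus d m" unfolding torus_def B'_def using m2 by auto
 ultimately show ?thesis using assms by simp
qed

section \<open>Deterministic consequences when all top boxes are good\<close>

context
 fixes p x
 assumes p: "p \<in> walks n x" and xT: "x \<in> T" and top: "\<forall>B\<in>torus d m. tower_good d h l (good p) J B"
  and n0big: "2*(2*\<sigma>^(3*d) + 1) <= n0"
begin

text \<open>The tower applied to the zero function: the whole surviving mass is \<beta>, which is at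
  most the number of good cells.\<close>

lemma card_good: "(1 - eta)*real n0^d <= real (card {c \<in> torus d n0. good p c})"
proof -
 have pf: "per d n0 (%_. 0 :: real)" by (simp add: per_def)
 interpret tw: tower d h l nn "%_. 0" "good p" J by (rule tower_inst[OF pf]) simp
 obtain \<alpha> \<beta> :: real where ab: "\<alpha> <= (\<Sum>c\<in>torus d n0. 0)" "\<beta> <= (\<Sum>c\<in>torus d n0. of_bool (good p c)*(1 - 0))"
  "\<alpha> + \<beta> = real (tw.MM J)*real (nn J)^d"
  using tw.tower_isoperimetry[OF all_top_good[OF top]] by metis
 have "(1 - eta)*real n0^d = (1 - eta)*real (Lb J)^d*real m^d" unfolding Lb_J by (simp add: power_mult_distrib)
 also have "... <= real (tw.MM J)*real m^d" using MM_ge unfolding tw.MM_def by (intro mult_right_mono) auto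
 also have "... = \<alpha> + \<beta>" using ab(3) nn_J by simp
 also have "... <= (\<Sum>c\<in>torus d n0. of_bool (good p c))" using ab(1,2) by simp
 also have "... = real (card {c \<in> torus d n0. good p c})"
  using finite_torus[of d n0] by (simp add: of_bool_def sum.If_cases Int_def conj_commute)
 finally show ?thesis .
qed

lemma eta_half: "eta <= 1/16" using of_nat_mono[OF l32, where ?'a = real] l16 unfolding eta_def by (simp add: divide_le_eq)

lemma len: "length p = Suc n" and n1_le: "n1 <= n" using walksD[OF p] by (auto simp: n1_def)

lemma past_sub: "past p \<subseteq> set p" "past (rev p) \<subseteq> set p"
 unfolding past_def using set_take_subset[of _ p] set_take_subset[of _ "rev p"] by auto

lemma past_rev: "past (rev p) = set (drop n1 p)"
proof -
 have "length p - Suc (n - n1) = n1" using len n1_le by simp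
 then show ?thesis unfolding past_def take_rev by simp
qed

lemma past_cover: "set p = past p \<union> past (rev p)"
proof -
 have "set (drop (Suc (n - n1)) p) \<subseteq> set (drop n1 p)" by (rule set_drop_subset_set_drop) (simp add: n1_def)
 moreover have "set p = set (take (Suc (n - n1)) p) \<union> set (drop (Suc (n - n1)) p)" by (metis append_take_drop_id set_append)
 moreover have "set (drop n1 p) \<subseteq> set p" by (rule set_drop_subset)
 ultimately show ?thesis unfolding past_rev unfolding past_def by blast
qed

lemma middle_past: "middle p \<subseteq> past p" "middle p \<subseteq> past (rev p)"
proof -
 show "middle p \<subseteq> past p" unfolding middle_def past_def by (rule set_drop_subset)
 have "middle p = set (take (Suc (n - n1) - n1) (drop n1 p))" unfolding middle_def by (simp add: drop_take)
 then show "middle p \<subseteq> past (rev p)" unfolding past_rev by (simp add: set_take_subset)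
qed

lemma pT: "set p \<subseteq> T" using walks_set[OF p xT] .

lemma past_conn: "a \<in> past p ==> b \<in> past p ==> conn (past p) a b" "a \<in> past (rev p) ==> b \<in> past (rev p) ==> conn (past (rev p)) a b"
proof -
 have s: "successively adj p" by (rule walks_successively[OF p])
 have s1: "successively adj (take (Suc (n - n1)) p)" "successively adj (drop n1 p)" using s by (metis append_take_drop_id successively_append_iff)+
 show "conn (past p) a b" if "a \<in> past p" "b \<in> past p"
  using conn_trans[OF conn_sym[OF conn_list[OF s1(1) order.refl]] conn_list[OF s1(1) order.refl]] that unfolding past_def by blast
 show "conn (past (rev p)) a b" if "a \<in> past (rev p)" "b \<in> past (rev p)"
  using conn_trans[OF conn_sym[OF conn_list[OF s1(2) order.refl]] conn_list[OF s1(2) order.refl]] that unfolding past_rev by blast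
qed

lemma good_visit: "good p c ==> \<exists>y. y \<in> middle p & y \<in> Cset c" unfolding good_def bad_def by blast

lemma visits_inj: "(!!c. good p c ==> y c \<in> Cset c) ==> inj_on y {c \<in> torus d n0. good p c}"
 using incell_unique Cset_incell by (intro inj_onI) (metis (mono_tags, lifting) mem_Collect_eq)

text \<open>Each good cell has its own point visited in the middle third, and these are too many for
  a single ball of radius \<sigma>^(3 d).\<close>

lemma far_visits: "\<exists>a b. a \<in> middle p & b \<in> middle p & b ~: ball a (\<sigma>^(3*d))"
proof (rule ccontr)
 define K where "K = \<sigma>^(3*d)"
 assume "~ ?thesis"
 then have all: "!!a b. a \<in> middle p ==> b \<in> middle p ==> b \<in> ball a K" unfolding K_def by blast
 define G where "G = {c \<in> torus d n0. good p c}"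
 obtain y where y: "!!c. good p c ==> y c \<in> middle p & y c \<in> Cset c" using good_visit by metis
 have n1': "1 <= n0" using n0big by simp
 have "0 < (1 - eta)*real n0^d" using eta_half n1' by simp
 then have "0 < card G" using card_good unfolding G_def by linarith
 then obtain c0 where c0: "c0 \<in> G" by (metis card_gt_0_iff ex_in_conv)
 have inj: "inj_on y G" unfolding G_def by (rule visits_inj) (use y in blast)
 have "y ` G \<subseteq> ball (y c0) K" using all y c0 unfolding G_def by blast
 then have "card G <= card (ball (y c0) K)" using card_image[OF inj] card_mono[OF finite_ball] by metis
 also have "... <= (2*K + 1)^d" by (rule card_ball_le)
 finally have G1: "real (card G) <= real (2*K + 1)^d" by (metis of_nat_le_iff of_nat_power)
 have "2*(2*K + 1) <= n0" using n0big unfolding K_def .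
 then have "real (2*(2*K + 1))^d <= real n0^d" by (intro power_mono) linarith+
 then have "2^d*real (2*K + 1)^d <= real n0^d" unfolding power_mult_distrib[symmetric] by simp
 moreover have "(2::real)^1 <= 2^d" using d3 by (intro power_increasing) auto
 then have "2*real (2*K + 1)^d <= 2^d*real (2*K + 1)^d" by (intro mult_right_mono) auto
 ultimately have "2*real (2*K + 1)^d <= real n0^d" by linarith
 moreover have "(1 - 1/16)*real n0^d <= (1 - eta)*real n0^d" using eta_half by (intro mult_right_mono) auto
 moreover have "0 < real n0^d" using n1' by simp
 moreover have "(1 - eta)*real n0^d <= real (card G)" using card_good unfolding G_def .
 moreover have False if "2*X <= P" "(1 - 1/16)*P <= Z" "0 < P" "Z <= g" "g <= X" for X P Z g :: real using that by argo
 ultimately show False using G1 by blast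
qed

text \<open>A connected set containing two points that far apart is large. This supplies the size
  condition built into \<open>badf\<close>.\<close>

lemma card_pasts: "(\<sigma>^3)^d <= card (past p)" "(\<sigma>^3)^d <= card (past (rev p))"
proof -
 obtain a b where ab: "a \<in> middle p" "b \<in> middle p" "b ~: ball a (\<sigma>^(3*d))" using far_visits by blast
 have e: "(\<sigma>^3)^d = \<sigma>^(3*d)" by (simp add: power_mult)
 show "(\<sigma>^3)^d <= card (past p)" unfolding e
  using ab middle_past past_sub pT by (intro conn_card[OF past_conn(1) _ _ ab(3)] finite_subset[OF past_sub(1)]) auto
 show "(\<sigma>^3)^d <= card (past (rev p))" unfolding e
  using ab middle_past past_sub pT by (intro conn_card[OF past_conn(2) _ _ ab(3)] finite_subset[OF past_sub(2)]) auto
qed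

text \<open>Every point is joined to one visit \<open>y\<close> of the middle third: points of the
  first two thirds because the forward walk is not bad, the others because the reversed walk is not
  bad.\<close>

lemma good_conn: assumes g: "good p c" and ab: "a \<in> set p \<inter> ball (ctr c) (8 * side)" "b \<in> set p \<inter> ball (ctr c) (8 * side)"
 shows "conn (set p \<inter> reg (ctr c)) a b"
proof -
 obtain y where y: "y \<in> middle p" "y \<in> Cset c" using good_visit[OF g] by blast
 have y8: "y \<in> ball (ctr c) (8 * side)" using incell_ball8[OF _ Cset_incell[OF y(2)]] y(1) middle_past past_sub pT by blast
 have nb: "~ badf (ctr c) p" "~ badf (ctr c) (rev p)" using g unfolding good_def bad_def by blast+
 have c: "conn (set p \<inter> reg (ctr c)) a y" if a: "a \<in> set p" "a \<in> ball (ctr c) (8 * side)" for a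
 proof (cases "a \<in> past p")
  case True
  then show ?thesis using nb(1) card_pasts(1) y(1) middle_past(1) y8 a(2) unfolding badf_def by blast
 next
  case False
  then have "a \<in> past (rev p)" using past_cover a(1) by blast
  then have "conn (set (rev p) \<inter> reg (ctr c)) a y" using nb(2) card_pasts(2) y(1) middle_past(2) y8 a(2) unfolding badf_def by blast
  then show ?thesis by simp
 qed
 show ?thesis using conn_trans[OF c conn_sym[OF c]] ab by blast
qed

context
 fixes A :: "pt set"
 assumes A: "A \<subseteq> set p"
begin

text \<open>A good cell with visited points on both sides of A has value 0; such cells are recovered
  through \<open>near\<close>, since their region contains a boundary edge.\<close>

definition cf :: "pt => real" where "cf c = of_bool (good p c & (\<forall>y\<in>set p. incell c y --> y \<in> A))"

abbreviation "bd \<equiv> edge_boundary d N (set p) A"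

lemma per_cf: "per d n0 cf"
proof -
 have "cf c = cf c'" if eq: "\<forall>i<d. c i mod int n0 = c' i mod int n0" for c c'
 proof -
  have "good p c = good p c'" using perD[OF good_per, of c c'] eq by blast
  moreover have "incell c y = incell c' y" for y unfolding incell_def using eq by simp
  ultimately show ?thesis unfolding cf_def by simp
 qed
 then show ?thesis unfolding per_def by blast
qed

lemma finite_bd: "finite bd"
proof (rule finite_subset)
 show "bd \<subseteq> Pow (set p)" unfolding edge_boundary_def using A by auto
qed simp

lemma boundary_edge:
 assumes g: "good p c" and a: "a \<in> A" "a \<in> ball (ctr c) (8 * side)" and b: "b \<in> set p - A" "b \<in> ball (ctr c) (8 * side)"
 shows "\<exists>e\<in>bd. e \<subseteq> reg (ctr c)"
proof -
 have "conn (set p \<inter> reg (ctr c)) a b" by (rule good_conn[OF g]) (use a b A in auto)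
 then obtain w y where w: "conn (set p \<inter> reg (ctr c) \<inter> A) a w" "adj w y" "y \<in> set p \<inter> reg (ctr c)" "y ~: A"
  using conn_exit[of "set p \<inter> reg (ctr c)" a b A] a(1) b(1) by blast
 have "w \<in> set p \<inter> reg (ctr c) \<inter> A" using conn_mem[OF w(1)] by blast
 then have "{w, y} \<in> bd & {w, y} \<subseteq> reg (ctr c)" unfolding edge_boundary_def using w by (auto simp: adj_def)
 then show ?thesis by blast
qed

definition near :: "pt set" where "near = {c \<in> torus d n0. \<exists>e\<in>bd. e \<subseteq> reg (ctr c)}"

lemma card_near: "real (card near) <= RD*real (card bd)"
proof -
 have "near = (\<Union>e\<in>bd. {c \<in> torus d n0. e \<subseteq> reg (ctr c)})" unfolding near_def by blast
 then have "card near <= (\<Sum>e\<in>bd. card {c \<in> torus d n0. e \<subseteq> reg (ctr c)})" by (simp only: card_UN_le[OF finite_bd])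
 also have "... <= (\<Sum>e\<in>bd. (2*Rr + 1)^d)"
 proof (rule sum_mono)
  fix e assume "e \<in> bd"
  then obtain w y where e: "e = {w, y}" "w \<in> A" unfolding edge_boundary_def by blast
  have "w \<in> T" using e(2) A pT by blast
  have "card {c \<in> torus d n0. e \<subseteq> reg (ctr c)} <= card {c \<in> torus d n0. w \<in> reg (ctr c)}"
   using finite_torus[of d n0] e by (intro card_mono) auto
  also have "... <= (2*Rr + 1)^d" by (rule card_near_cells[OF \<open>w \<in> T\<close>])
  finally show "card {c \<in> torus d n0. e \<subseteq> reg (ctr c)} <= (2*Rr + 1)^d" .
 qed
 finally have "card near <= card bd*(2*Rr + 1)^d" by simp
 then have "real (card near) <= real (card bd*(2*Rr + 1)^d)" by (simp only: of_nat_le_iff)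
 then show ?thesis by (simp add: mult.commute)
qed

text \<open>If \<open>cf\<close> changes between adjacent good cells, the ball of radius 8 *
  \<open>side\<close> around one corner contains visited points inside and outside A; they are
  connected in the region, and the connection crosses the boundary of A there.\<close>

lemma etv_le: "etv d n0 cf (good p) <= real d*(RD*real (card bd))"
proof -
 have "etv d n0 cf (good p) <= (\<Sum>k<d. \<Sum>c\<in>torus d n0. of_bool (c \<in> near))" unfolding etv_def
 proof (intro sum_mono)
  fix k c assume k: "k \<in> {..<d}" and c: "c \<in> torus d n0"
  show "(if good p c & good p (c(k := c k + 1)) then \<bar>cf c - cf (c(k := c k + 1))\<bar> else 0) <= of_bool (c \<in> near)"
  proof (cases "good p c & good p (c(k := c k + 1)) & cf c ~= cf (c(k := c k + 1))")
   case True
   define c' where "c' = c(k := c k + 1)"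
   have g: "good p c" "good p c'" and ne: "cf c ~= cf c'" using True by (auto simp: c'_def)
   obtain v v' where v: "v \<in> middle p" "v \<in> Cset c" "v' \<in> middle p" "v' \<in> Cset c'" using good_visit g by meson
   have vp: "v \<in> set p" "v' \<in> set p" using v middle_past past_sub by blast+
   have iv: "incell c v" "incell c' v'" using v Cset_incell by blast+
   have b8: "y \<in> ball (ctr c) (8 * side)" if "y \<in> set p" "incell c y | incell c' y" for y
    using incell_ball8[of y c] incell_next_ball[of k y c] that k pT unfolding c'_def by blast
   have "\<exists>a b. a \<in> A & a \<in> ball (ctr c) (8 * side) & b \<in> set p - A & b \<in> ball (ctr c) (8 * side)"
   proof (cases "\<forall>y\<in>set p. incell c y --> y \<in> A")
    case all: True
    then have "~ (\<forall>y\<in>set p. incell c' y --> y \<in> A)" using ne g unfolding cf_def by auto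
    then show ?thesis using all b8 vp(1) iv(1) by blast
   next
    case nall: False
    then have "cf c = 0" unfolding cf_def by auto
    then have "cf c' ~= 0" using ne by simp
    then have "\<forall>y\<in>set p. incell c' y --> y \<in> A" by (simp add: cf_def)
    then show ?thesis using nall b8 vp(2) iv(2) by blast
   qed
   then obtain a b where "a \<in> A" "a \<in> ball (ctr c) (8 * side)" "b \<in> set p - A" "b \<in> ball (ctr c) (8 * side)" by blast
   then have "c \<in> near" unfolding near_def using c boundary_edge[OF g(1)] by blast
   moreover have "\<bar>cf c - cf c'\<bar> <= 1" unfolding cf_def by auto
   ultimately show ?thesis unfolding c'_def by simp
  qed auto
 qed
 also have "... = real d*real (card near)"
 proof -
  have "torus d n0 \<inter> near = near" unfolding near_def by blast
  then have "(\<Sum>c\<in>torus d n0. of_bool (c \<in> near)) = real (card near)" using finite_torus[of d n0] by (simp add: of_bool_def sum.If_cases)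
  then show ?thesis by simp
 qed
 also have "... <= real d*(RD*real (card bd))" by (intro mult_left_mono card_near) simp
 finally show ?thesis .
qed

lemma cell_cover: assumes S: "S \<subseteq> T"
 shows "real (card S) <= real (5 * side)^d*real (card {c \<in> torus d n0. \<exists>y\<in>S. incell c y})"
proof -
 define F where "F = {c \<in> torus d n0. \<exists>y\<in>S. incell c y}"
 have fF: "finite F" unfolding F_def using finite_torus by simp
 have "S \<subseteq> (\<Union>c\<in>F. ball (ctr c) (2 * side))"
 proof
  fix y assume y: "y \<in> S"
  then have yT: "y \<in> T" using S by blast
  obtain c where "c \<in> torus d n0" "incell c y" using incell_exists[OF yT] by blast
  then show "y \<in> (\<Union>c\<in>F. ball (ctr c) (2 * side))" using y incell_ball[OF yT] unfolding F_def by blast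
 qed
 then have "card S <= card (\<Union>c\<in>F. ball (ctr c) (2 * side))" using fF by (intro card_mono) auto
 also have "... <= (\<Sum>c\<in>F. card (ball (ctr c) (2 * side)))" by (rule card_UN_le[OF fF])
 also have "... <= (\<Sum>c\<in>F. (5 * side)^d)"
 proof (rule sum_mono)
  fix c
  have "card (ball (ctr c) (2 * side)) <= (2*(2 * side) + 1)^d" by (rule card_ball_le)
  also have "... <= (5 * side)^d" using side_pos by (intro power_mono) auto
  finally show "card (ball (ctr c) (2 * side)) <= (5 * side)^d" .
 qed
 finally have "card S <= card F*(5 * side)^d" by simp
 then have "real (card S) <= real (card F*(5 * side)^d)" by (simp only: of_nat_le_iff)
 then show ?thesis unfolding F_def[symmetric] by (simp add: mult.commute)
qed

text \<open>A cell meeting A has \<open>cf\<close> equal to 1, or is bad, or is mixed and then near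
  the boundary. The two terms \<open>eta\<close> in the bound of |A| stand for the bad cells and for
  the mass lost in the tower. A cell meeting the rest of the range has \<open>cf\<close> different
  from 1, so no boundary term appears there.\<close>

lemma isoperimetry_scale:
 obtains \<alpha> \<beta> M :: real where "0 <= \<alpha>" "0 <= \<beta>" "\<alpha> <= real (card A)" "(1 - eta)*real (Lb J)^d <= M"
  "real (card A) <= real (5 * side)^d*(\<alpha> + 2*eta*real n0^d + RD*real (card bd))"
  "real (card (set p - A)) <= real (5 * side)^d*(\<beta> + eta*real n0^d)"
  "(1 - eta)*real n0^d <= real (card (set p))"
  "!!r. 0 < r ==> r <= m ==> 2*\<alpha> <= real r^d*M ==> \<alpha> <= 20*real r*real (Lb J)*(real d*(RD*real (card bd)))"
  "\<alpha>*\<beta> <= 10*real n0^(d + 1)*(real d*(RD*real (card bd)))"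
proof -
 have cf01: "cf c = 0 | cf c = 1" for c unfolding cf_def of_bool_def by argo
 interpret tw: tower d h l nn cf "good p" J by (rule tower_inst[OF per_cf cf01])
 define V where "V = real d*(RD*real (card bd))"
 have V: "tw.V <= V" unfolding tw.V_def V_def by (rule etv_le)
 define C where "C = torus d n0"
 have fC: "finite C" and cC: "real (card C) = real n0^d" unfolding C_def by (simp_all add: finite_torus card_torus)
 define G F1 where "G = {c \<in> C. good p c}" and "F1 = {c \<in> C. cf c = 1}"
 have fG: "finite G" "finite F1" using fC by (auto simp: G_def F1_def)
 have FG: "F1 \<subseteq> G" unfolding F1_def G_def cf_def by auto
 have "(\<Sum>c\<in>C. cf c) = (\<Sum>c\<in>C. if cf c = 1 then 1 else 0)" 
 proof (intro sum.cong refl)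
  fix c show "cf c = (if cf c = 1 then 1 else 0)" using cf01[of c] by auto
 qed
 then have sumf: "(\<Sum>c\<in>torus d n0. cf c) = real (card F1)" using fC unfolding F1_def C_def[symmetric] by (simp add: sum.If_cases Int_def)
 have "(\<Sum>c\<in>C. of_bool (good p c)*(1 - cf c)) = (\<Sum>c\<in>C. (if good p c then 1 else 0) - cf c)"
 proof (intro sum.cong refl)
  fix c show "of_bool (good p c)*(1 - cf c) = (if good p c then 1 else 0) - cf c" by (cases "good p c") (simp_all add: cf_def)
 qed
 also have "... = real (card G) - (\<Sum>c\<in>C. cf c)" using fC unfolding sum_subtractf G_def by (simp add: sum.If_cases Int_def)
 finally have sumg: "(\<Sum>c\<in>torus d n0. of_bool (good p c)*(1 - cf c)) = real (card G) - real (card F1)" using sumf unfolding C_def by simp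
 obtain \<alpha> \<beta> :: real where ab: "0 <= \<alpha>" "0 <= \<beta>" "\<alpha> <= real (card F1)" "\<beta> <= real (card G) - real (card F1)"
  "\<alpha> + \<beta> = real (tw.MM J)*real (nn J)^d"
  "!!r. 0 < r ==> r <= nn J ==> 2*\<alpha> <= real r^d*real (tw.MM J) ==> \<alpha> <= 20*real r*real (tw.LL J)*tw.V"
  "\<alpha>*\<beta> <= 10*real (tw.MM J)*real (nn J)^(d + 1)*real (tw.LL J)*tw.V"
  by (rule tw.tower_isoperimetry[OF all_top_good[OF top], unfolded sumf sumg]) (rule that; assumption)
 have LL: "tw.LL J = Lb J" unfolding tw.LL_def Lb_def ..
 have MMb: "(1 - eta)*real (Lb J)^d <= real (tw.MM J)" using MM_ge unfolding tw.MM_def .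
 have "(1 - eta)*real n0^d = (1 - eta)*real (Lb J)^d*real m^d" unfolding Lb_J by (simp add: power_mult_distrib)
 also have "... <= real (tw.MM J)*real m^d" using MMb by (rule mult_right_mono) simp
 finally have tot: "(1 - eta)*real n0^d <= \<alpha> + \<beta>" using ab(5) nn_J by simp
 have GC: "real (card G) <= real n0^d" unfolding cC[symmetric] G_def using fC by (intro of_nat_mono card_mono) auto
 have Gge: "(1 - eta)*real n0^d <= real (card G)" using card_good unfolding G_def C_def .
 obtain y where y: "!!c. good p c ==> y c \<in> middle p & y c \<in> Cset c" using good_visit by metis
 have inj: "inj_on y G" unfolding G_def C_def by (rule visits_inj) (use y in blast)
 have yp: "y c \<in> set p" if "good p c" for c using y[OF that] middle_past past_sub by blast
 have "y ` F1 \<subseteq> A"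
 proof
  fix z assume "z \<in> y ` F1"
  then obtain c where c: "c \<in> F1" "z = y c" by blast
  have g: "good p c" and all: "\<forall>y\<in>set p. incell c y --> y \<in> A" using c(1) unfolding F1_def cf_def by auto
  show "z \<in> A" using all yp[OF g] Cset_incell[of "y c" c] y[OF g] c(2) by blast
 qed
 moreover have "card (y ` F1) = card F1" by (rule card_image[OF inj_on_subset[OF inj FG]])
 ultimately have F1A: "card F1 <= card A" using finite_subset[OF A] card_mono[of A "y ` F1"] by simp
 have "y ` G \<subseteq> set p" using yp unfolding G_def by blast
 then have "card G <= card (set p)" using card_image[OF inj] card_mono[of "set p" "y ` G"] by simp
 then have Ip: "(1 - eta)*real n0^d <= real (card (set p))" using Gge by linarith
 have K0: "0 <= real (5 * side)^d" by simp
 have "{c \<in> C. \<exists>y\<in>A. incell c y} \<subseteq> F1 \<union> (C - G) \<union> near"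
 proof
  fix c assume "c \<in> {c \<in> C. \<exists>y\<in>A. incell c y}"
  then obtain z where z: "c \<in> C" "z \<in> A" "incell c z" by blast
  show "c \<in> F1 \<union> (C - G) \<union> near"
  proof (cases "good p c & cf c ~= 1")
   case True
   then obtain b where b: "b \<in> set p" "incell c b" "b ~: A" unfolding cf_def by auto
   have "\<exists>e\<in>bd. e \<subseteq> reg (ctr c)" using True z b A pT incell_ball8 by (intro boundary_edge[of c z b]) blast+
   then show ?thesis using z unfolding near_def C_def by blast
  next
   case False
   then show ?thesis using z unfolding F1_def G_def by blast
  qed
 qed
 moreover have fn: "finite near" unfolding near_def using finite_torus by simp
 ultimately have "card {c \<in> C. \<exists>y\<in>A. incell c y} <= card (F1 \<union> (C - G) \<union> near)" using fC fG by (intro card_mono) auto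
 also have "... <= card F1 + card (C - G) + card near" by (meson add_le_mono1 card_Un_le order_trans)
 finally have "real (card {c \<in> C. \<exists>y\<in>A. incell c y}) <= real (card F1) + real (card (C - G)) + real (card near)" by linarith
 moreover have "real (card (C - G)) = real n0^d - real (card G)"
 proof -
  have "G \<subseteq> C" by (auto simp: G_def)
  then have "card (C - G) = card C - card G" "card G <= card C" using fC fG by (simp_all add: card_Diff_subset card_mono)
  then show ?thesis using cC by simp
 qed
 moreover have "real (card F1) <= eta*real n0^d + \<alpha>" using ab(4) tot GC unfolding left_diff_distrib by linarith
 ultimately have "real (card {c \<in> C. \<exists>y\<in>A. incell c y}) <= \<alpha> + 2*eta*real n0^d + RD*real (card bd)"
  using Gge card_near unfolding left_diff_distrib by linarith
 then have "real (5 * side)^d*real (card {c \<in> C. \<exists>y\<in>A. incell c y}) <= real (5 * side)^d*(\<alpha> + 2*eta*real n0^d + RD*real (card bd))"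
  using K0 by (rule mult_left_mono)
 moreover have "A \<subseteq> T" using A pT by blast
 ultimately have cardA: "real (card A) <= real (5 * side)^d*(\<alpha> + 2*eta*real n0^d + RD*real (card bd))" using cell_cover[of A] unfolding C_def by linarith
 have "{c \<in> C. \<exists>y\<in>set p - A. incell c y} \<subseteq> C - F1" unfolding F1_def cf_def by auto
 then have "card {c \<in> C. \<exists>y\<in>set p - A. incell c y} <= card (C - F1)" using fC by (intro card_mono) auto
 also have "card (C - F1) = card C - card F1" using fG(2) by (intro card_Diff_subset) (auto simp: F1_def)
 finally have "real (card {c \<in> C. \<exists>y\<in>set p - A. incell c y}) <= real (card C - card F1)" by simp
 also have "... = real n0^d - real (card F1)"
 proof -
  have "card F1 <= card C" using fC by (intro card_mono) (auto simp: F1_def)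
  then show ?thesis using cC by simp
 qed
 also have "... <= \<beta> + eta*real n0^d" using ab(3) tot unfolding left_diff_distrib by linarith
 finally have "real (5 * side)^d*real (card {c \<in> C. \<exists>y\<in>set p - A. incell c y}) <= real (5 * side)^d*(\<beta> + eta*real n0^d)"
  using K0 by (rule mult_left_mono)
 moreover have "set p - A \<subseteq> T" using pT by blast
 ultimately have cardB: "real (card (set p - A)) <= real (5 * side)^d*(\<beta> + eta*real n0^d)" using cell_cover[of "set p - A"] unfolding C_def by linarith
 have window: "\<alpha> <= 20*real r*real (Lb J)*V" if "0 < r" "r <= m" "2*\<alpha> <= real r^d*real (tw.MM J)" for r
 proof -
  have "\<alpha> <= 20*real r*real (Lb J)*tw.V" using ab(6)[of r] that nn_J LL by simp
  also have "... <= 20*real r*real (Lb J)*V" by (intro mult_left_mono V) simp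
  finally show ?thesis .
 qed
 have "\<alpha>*\<beta> <= 10*real (tw.MM J)*real m^(d + 1)*real (Lb J)*tw.V" using ab(7) nn_J LL by simp
 also have "... <= 10*real (Lb J)^d*real m^(d + 1)*real (Lb J)*V"
  using of_nat_mono[OF tw.MM_le[of J], where ?'a = real] V tw.V0 unfolding LL by (intro mult_mono) auto
 also have "... = 10*real n0^(d + 1)*V" unfolding Lb_J by (simp add: power_mult_distrib)
 finally have prod: "\<alpha>*\<beta> <= 10*real n0^(d + 1)*V" .
 have aA: "\<alpha> <= real (card A)" using ab(3) F1A by linarith
 show thesis by (rule that[OF ab(1,2) aA MMb cardA cardB Ip window[unfolded V_def] prod[unfolded V_def]])
qed

end

end

end

section \<open>Small and large sets at a fixed scale\<close>

context torus_cells begin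

context
 fixes p x A
 assumes p: "p \<in> walks n x" and xT: "x \<in> T" and top: "\<forall>B\<in>torus d m. tower_good d h l (good p) J B"
  and n0big: "2*(2*\<sigma>^(3*d) + 1) <= n0" and A: "A \<subseteq> set p"
  and H1: "8*real (5 * side)^d*eta*real n0^d <= real (card A)" and A0: "0 < card A"
begin

text \<open>t is the side of a cube with |A| points. The windows have side r about 4 t / L in top
  boxes, so that \<alpha> fills at most half of one, while r L <= 5 t keeps the loss linear in t.
  The hypothesis \<open>H1\<close> makes the lost cells a minor part of A.\<close>

lemma small_sets: assumes t: "0 < t" "t^d = real (card A)" and Lt: "real (Lb J) <= t" and n0: "5*t <= real n0"
 shows "real (card A) <= 200*real d*real (5 * side)^d*RD*t*real (card (edge_boundary d N (set p) A))"
proof -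
 define a b K0 K where "a = real (card A)" and "b = real (card (edge_boundary d N (set p) A))"
  and "K0 = real (5 * side)^d" and "K = RD"
 obtain \<alpha> \<beta> M :: real where S: "0 <= \<alpha>" "\<alpha> <= a" "(1 - eta)*real (Lb J)^d <= M"
  "a <= K0*(\<alpha> + 2*eta*real n0^d + K*b)"
  "!!r. 0 < r ==> r <= m ==> 2*\<alpha> <= real r^d*M ==> \<alpha> <= 20*real r*real (Lb J)*(real d*(K*b))"
  by (rule isoperimetry_scale[OF p xT top n0big A, folded a_def b_def K0_def K_def]) (rule that; assumption)
 have a1: "1 <= a" using A0 by (simp add: a_def)
 have t1: "1 <= t" using t a1 unfolding a_def[symmetric] by (metis linorder_not_le power_less_one_iff less_imp_le not_less_iff_gr_or_eq power_0 zero_less_iff_neq_zero d3 not_numeral_le_zero)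
 have K0: "0 < K0" "0 < K" using side_pos by (simp_all add: K0_def K_def)
 have b0: "0 <= b" by (simp add: b_def)
 have H: "K0*(2*eta*real n0^d) <= a/4" using H1 unfolding a_def K0_def by simp
 have d1: "1 <= real d" using d3 by simp
 have tb: "0 <= K0*(K*b)" using K0 b0 by simp
 show ?thesis
 proof (cases "a/4 <= K0*(K*b)")
  case True
  then have "a <= 4*(1*1)*(K0*(K*b))" by simp
  also have "... <= 200*(real d*t)*(K0*(K*b))" using d1 t1 tb by (intro mult_right_mono mult_mono) auto
  finally show ?thesis unfolding a_def b_def K0_def K_def by (simp add: ac_simps)
 next
  case False
  then have al: "a/2 <= K0*\<alpha>" using S(4) H by (simp add: distrib_left)
  define L where "L = real (Lb J)"
  have L0: "0 < L" unfolding L_def Lb_def using l_pos by (simp add: prod_pos)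
  define r where "r = nat \<lceil>4*t/L\<rceil>"
  have r: "4*t/L <= real r" "real r <= 4*t/L + 1" unfolding r_def using L0 t(1) by (auto simp: of_nat_nat)
  have rL: "4*t <= real r*L" "real r*L <= 5*t" using r L0 Lt unfolding L_def[symmetric] by (simp_all add: field_simps)
  have r0: "0 < r" using rL t(1) L0 by (metis gr0I mult_zero_left of_nat_0 not_le mult_pos_pos zero_less_numeral)
  have "real r*L <= real m*L" using rL(2) n0 unfolding Lb_J L_def by (simp add: mult.commute)
  then have rm: "r <= m" using L0 by simp
  have "2*\<alpha> <= 2*t^d" using S(2) t(2) unfolding a_def by simp
  also have "... <= (4*t)^d/2"
  proof -
   have "(4::real)^1 <= 4^d" using d3 by (intro power_increasing) auto
   then have "4*t^d <= 4^d*t^d" using t(1) by (intro mult_right_mono) auto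
   then show ?thesis by (simp add: power_mult_distrib)
  qed
  also have "... <= (real r*L)^d/2" using rL t(1) by (intro divide_right_mono power_mono) auto
  also have "... = real r^d*(1/2*L^d)" by (simp add: power_mult_distrib)
  also have "... <= real r^d*M"
  proof (rule mult_left_mono)
   have "1/2*L^d <= (1 - eta)*L^d" using eta_half[OF p xT top n0big] L0 by (intro mult_right_mono) auto
   then show "1/2*L^d <= M" using S(3) unfolding L_def by linarith
  qed simp
  finally have "\<alpha> <= 20*real r*L*(real d*(K*b))" using S(5)[OF r0 rm] unfolding L_def by simp
  also have "... = 20*(real r*L)*(real d*(K*b))" by simp
  also have "... <= 20*(5*t)*(real d*(K*b))" using rL(2) K0 b0 by (intro mult_right_mono mult_left_mono) auto
  finally have "K0*\<alpha> <= K0*(100*t*(real d*(K*b)))" using K0 by simp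
  then have "a <= 2*(K0*(100*t*(real d*(K*b))))" using al by linarith
  then show ?thesis unfolding a_def b_def K0_def K_def by (simp add: ac_simps)
 qed
qed

text \<open>Both masses have a definite share: \<alpha> is at least |A| / (2 K0), and the complement
  forces \<beta> >= (1 - \<mu>) q / (4 K0). The product bound then gives the claim.\<close>

lemma large_sets: assumes mu: "real (card A) <= \<mu>*real (card (set p))" "0 < \<mu>" "\<mu> < 1" and eta: "4*real (5 * side)^d*eta <= 1 - \<mu>"
 shows "(1 - \<mu>)*real (card A) <= 80*real d*(real (5 * side)^d)^2*RD*real n0*real (card (edge_boundary d N (set p) A))"
proof -
 define a b K0 K q where "a = real (card A)" and "b = real (card (edge_boundary d N (set p) A))"
  and "K0 = real (5 * side)^d" and "K = RD" and "q = real n0^d"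
 obtain \<alpha> \<beta> :: real where S: "0 <= \<alpha>" "0 <= \<beta>"
  "a <= K0*(\<alpha> + 2*eta*q + K*b)" "real (card (set p - A)) <= K0*(\<beta> + eta*q)"
  "(1 - eta)*q <= real (card (set p))" "\<alpha>*\<beta> <= 10*real n0^(d + 1)*(real d*(K*b))"
  by (rule isoperimetry_scale[OF p xT top n0big A, folded a_def b_def K0_def K_def q_def]) (rule that; assumption)
 have n1: "1 <= real n0" using nn_pos[of 0] by simp
 have q0: "0 < q" unfolding q_def using n1 by (intro zero_less_power) linarith
 have "1 <= real (5 * side)" using side_pos by simp
 then have K0: "1 <= K0" "0 < K" unfolding K0_def K_def by (rule one_le_power) simp
 have b0: "0 <= b" by (simp add: b_def)
 have d1: "1 <= real d" using d3 by simp
 have H: "K0*(2*eta*q) <= a/4" using H1 unfolding a_def K0_def q_def by simp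
 have a0: "0 <= a" by (simp add: a_def)
 show ?thesis
 proof (cases "a/4 <= K0*(K*b)")
  case True
  have "(1 - \<mu>)*a <= 1*a" using mu a0 by (intro mult_right_mono) auto
  also have "... <= 4*(1*1*1)*(K0*(K*b))" using True by simp
  also have "... <= 80*(real d*K0*real n0)*(K0*(K*b))" using d1 K0 n1 b0 by (intro mult_right_mono mult_mono) auto
  finally show ?thesis unfolding a_def b_def K0_def K_def by (simp add: ac_simps power2_eq_square)
 next
  case False
  then have al: "a/2 <= K0*\<alpha>" using S(3) H by (simp add: distrib_left)
  have "card (set p - A) = card (set p) - card A" "card A <= card (set p)" using A by (simp_all add: card_Diff_subset finite_subset card_mono)
  then have "real (card (set p - A)) = real (card (set p)) - a" by (simp add: a_def)
  moreover have "(1 - \<mu>)*(1/2*q) <= (1 - \<mu>)*real (card (set p))"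
  proof (rule mult_left_mono)
   have "1/2*q <= (1 - eta)*q" using eta_half[OF p xT top n0big] q0 by (intro mult_right_mono) auto
   then show "1/2*q <= real (card (set p))" using S(5) by linarith
  qed (use mu in simp)
  ultimately have "(1 - \<mu>)*(1/2*q) <= real (card (set p - A))" using mu(1) unfolding a_def left_diff_distrib by linarith
  moreover have "K0*eta*q <= (1 - \<mu>)/4*q" using eta q0 unfolding K0_def by (intro mult_right_mono) auto
  ultimately have "(1 - \<mu>)*(1/2*q) <= K0*\<beta> + (1 - \<mu>)/4*q" using S(4) unfolding distrib_left by (simp only: mult.assoc)
  moreover have "(1 - \<mu>)*(1/2*q) = 2*((1 - \<mu>)*q/4)" "(1 - \<mu>)/4*q = (1 - \<mu>)*q/4" by simp_all
  ultimately have be: "(1 - \<mu>)*q/4 <= K0*\<beta>" by linarith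
  have "(a/2)*((1 - \<mu>)*q/4) <= (K0*\<alpha>)*(K0*\<beta>)" using al be a0 mu q0 S(1) K0 by (intro mult_mono) auto
  also have "... = K0^2*(\<alpha>*\<beta>)" by (simp add: power2_eq_square)
  also have "... <= K0^2*(10*real n0^(d + 1)*(real d*(K*b)))" using S(6) by (rule mult_left_mono) simp
  also have "... = q*(10*K0^2*real n0*(real d*(K*b)))" unfolding q_def by simp
  finally have "q*((1 - \<mu>)*a/8) <= q*(10*K0^2*real n0*(real d*(K*b)))" by (simp add: ac_simps)
  then have "(1 - \<mu>)*a/8 <= 10*K0^2*real n0*(real d*(K*b))" using q0 by simp
  then show ?thesis unfolding a_def b_def K0_def K_def by (simp add: ac_simps)
 qed
qed

end

end

section \<open>Choice of the parameters\<close>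

definition pD :: "nat => nat" where "pD d = 2*d*(3*d + 8)"
text \<open>\<open>pD\<close> bounds the exponent of \<sigma> in the geometric losses. With \<sigma>
  = (N^d / |A|)^(1/pE) this loss is (N^d / |A|)^(1/(2 d^2)), which stays within the power 1/d^2
  granted by the theorem.\<close>

definition pE :: "nat => nat" where "pE d = 2*d^2*pD d"
text \<open>The first factor is \<open>h\<close>. The second makes the fraction \<open>eta\<close>
  of lost cells smaller than |A| / N^d by a further factor of order \<sigma>.\<close>

definition pl0 :: "nat => nat => nat" where "pl0 d s = s^(pD d + 2) * s^(pE d + 1)"
text \<open>Just enough levels; the constant 4 pays for the union bounds over boxes and
  scales.\<close>

definition pJ :: "nat => nat => nat" where "pJ N s = (LEAST J. 4*(ln (real N))^2 <= real s*2^J)"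
definition pL :: "nat => nat => nat => nat" where "pL d N s = (\<Prod>i<pJ N s. pl0 d s*4^i)"
definition pm :: "nat => nat => nat => nat" where "pm d N s = N div (s^(3*d + 4)*pL d N s)"

definition good_sigma :: "nat => real => real => nat => bool" where
 "good_sigma d v \<mu> s \<longleftrightarrow> ok_sigma d v s & real (17 * s^(3*d + 4))^(2*d)*real (4*d + 3)*exp (- real s) <= 1 \<and>
   4*CX d <= real s & (4*real (pl0 d s))^(2*d) <= exp (real s) \<and>
   8*real d*5^d <= (1 - \<mu>)*real s & 10*2^(2*d*pD d) <= s & 200*d*15^d <= s"

text \<open>exp (\<open>ww N\<close>) bounds 2^J and, if there is at least one level, also the scale
  itself.\<close>

definition ww :: "nat => real" where "ww N = ln (8*(ln (real N))^2)"

definition good_N :: "nat => real => nat => bool" where "good_N d v N \<longleftrightarrow> 1 <= ln (real N) & 2*real (CL d) <= v * real N \<and>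
   8*real (pD d + pE d + 6)*(ww N)^2 <= ln (real N) & (4*CX d*real (CL d))^4 <= real N \<and>
   4^pD d <= N & real (d + 1) <= 3*ln (real N)"

lemma pJ_props: assumes s: "1 <= s" and N: "1 <= ln (real N)" shows "4*(ln (real N))^2 <= real s*2^pJ N s" "2^pJ N s <= exp (ww N)" "1 <= ww N"
  and "0 < pJ N s ==> real s <= exp (ww N)"
proof -
 define q where "q = (ln (real N))^2"
 have q1: "1 <= q" unfolding q_def using N by (rule one_le_power)
 have ew: "exp (ww N) = 8*q" unfolding ww_def q_def using q1 N by (subst exp_ln) auto
 have "exp 1 <= exp (ww N)" unfolding ew using exp_le q1 by linarith
 then show "1 <= ww N" by simp
 obtain J where "4*q < 2^J" using real_arch_pow[of 2 "4*q"] by auto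
 then have "4*q <= 1*2^J" by simp
 also have "... <= real s*2^J" using s by (intro mult_right_mono) auto
 finally have ex: "\<exists>J. 4*q <= real s*2^J" by blast
 show "4*(ln (real N))^2 <= real s*2^pJ N s" unfolding pJ_def by (rule LeastI_ex) (use ex q_def in simp)
 have prev: "real s*2^j < 4*q" if "pJ N s = Suc j" for j
 proof -
  have "j < pJ N s" using that by simp
  from not_less_Least[OF this[unfolded pJ_def]] show ?thesis by (simp add: q_def)
 qed
 show "2^pJ N s <= exp (ww N)"
 proof (cases "pJ N s")
  case 0
  then show ?thesis using ew q1 by simp
 next
  case (Suc j)
  have "1*2^j <= real s*2^j" using s by (intro mult_right_mono) auto
  then show ?thesis using prev[OF Suc] unfolding Suc power_Suc ew by linarith
 qed
 assume "0 < pJ N s"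
 then obtain j where j: "pJ N s = Suc j" by (cases "pJ N s") auto
 have "real s*1 <= real s*2^j" by (intro mult_left_mono) auto
 then show "real s <= exp (ww N)" using prev[OF j] ew q1 by simp
qed

text \<open>There are O(ww) levels with ratios exp (O(ww)), so a top box has side exp (O(ww^2)),
  which is below any fixed power of \<open>N\<close> for large \<open>N\<close>; N^(1/4) is
  enough.\<close>

lemma pL_le: assumes s: "1 <= s" and N: "good_N d v N"
 shows "real (pL d N s) <= exp (ln (real N)/4)" "0 < pJ N s ==> real s^pE d <= exp (ln (real N)/4)"
proof -
 define w where "w = ww N"
 define J where "J = pJ N s"
 have ln1: "1 <= ln (real N)" and big: "8*real (pD d + pE d + 6)*w^2 <= ln (real N)" using N by (auto simp: good_N_def w_def)
 note P = pJ_props[OF s ln1, folded w_def J_def]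
 have ww: "w <= w^2" using P(3) by (simp add: power2_eq_square)
 define c where "c = exp (w*real (pD d + pE d + 5))"
 have pl: "pl0 d s = s^(pD d + pE d + 3)" unfolding pl0_def power_add[symmetric] by (rule arg_cong[of _ _ "%k. s^k"]) simp
 have "real (pL d N s) <= (\<Prod>i<J. c)" unfolding pL_def J_def[symmetric] of_nat_prod
 proof (rule prod_mono, intro conjI)
  fix i assume i: "i \<in> {..<J}"
  then have sw: "real s <= exp w" using P(4) by simp
  have "(2::real)^i <= exp w" using i by (intro order_trans[OF _ P(2)] power_increasing) auto
  then have "((2::real)^i)^2 <= (exp w)^2" by (intro power_mono) auto
  then have "(4::real)^i <= exp w^2" by (simp add: power_mult[symmetric] mult.commute[of i] power_mult)
  moreover have "real s^(pD d + pE d + 3) <= exp w^(pD d + pE d + 3)" using sw by (intro power_mono) auto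
  ultimately have "real s^(pD d + pE d + 3)*4^i <= exp w^(pD d + pE d + 3)*exp w^2" by (intro mult_mono) auto
  also have "... = c" unfolding c_def power_add[symmetric] by (simp add: exp_of_nat_mult[symmetric] mult.commute add.commute)
  finally show "real (pl0 d s*4^i) <= c" unfolding pl by simp
 qed simp
 also have "... = exp (real J*(w*real (pD d + pE d + 5)))" by (simp add: c_def exp_of_nat_mult[symmetric])
 also have "... <= exp (ln (real N)/4)"
 proof -
  have "exp (real J*ln 2) = 2^J" by (simp add: exp_of_nat_mult)
  then have "real J*ln 2 <= w" using P(2) by (metis exp_le_cancel_iff)
  moreover have "real J*(1/2) <= real J*ln 2" using ln2_ge_two_thirds by (intro mult_left_mono) auto
  ultimately have "real J <= 2*w" by linarith
  then have "real J*(w*real (pD d + pE d + 5)) <= (2*w)*(w*real (pD d + pE d + 5))" using P(3) by (intro mult_right_mono) auto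
  also have "... = 2*real (pD d + pE d + 5)*w^2" by (simp add: power2_eq_square)
  also have "... <= 2*real (pD d + pE d + 6)*w^2" by (intro mult_right_mono) auto
  also have "... = (8*real (pD d + pE d + 6)*w^2)/4" by simp
  also have "... <= ln (real N)/4" using big by (rule divide_right_mono) simp
  finally show ?thesis by (simp only: exp_le_cancel_iff)
 qed
 finally show "real (pL d N s) <= exp (ln (real N)/4)" .
 assume "0 < pJ N s"
 then have "real s^pE d <= exp w^pE d" using P(4) unfolding J_def by (intro power_mono) auto
 also have "... = exp (real (pE d)*w)" by (simp add: exp_of_nat_mult)
 also have "... <= exp (ln (real N)/4)"
 proof -
  have "real (pE d)*w <= real (pD d + pE d + 6)*w^2" using ww P(3) by (intro mult_mono) auto
  also have "... = (8*real (pD d + pE d + 6)*w^2)/8" by simp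
  also have "... <= ln (real N)/8" using big by (rule divide_right_mono) simp
  also have "... <= ln (real N)/4" using ln1 by simp
  finally show ?thesis by simp
 qed
 finally show "real s^pE d <= exp (ln (real N)/4)" .
qed

text \<open>The comparisons with \<open>N\<close> are organised around X = N^(1/4), which bounds the
  side of a cell, the side of a top box in cells, 2^J and the constant \<open>Y\<close>; the region
  bound \<kappa> is at most X^2.\<close>

lemma (in torus_walk) cells_inst: assumes v: "0 < v" and s: "good_sigma d v \<mu> s" and gN: "good_N d v N" and sN: "s^pD d <= N"
  and n: "12*real (4*d + 3) * v * real N^d + 3 <= real n"
 shows "torus_cells d N v s n (s^(pD d + 2)) (pl0 d s) (pJ N s) (pm d N s)" and "2*(2 * s^(3*d) + 1) <= tsize (pl0 d s) (pm d N s) (pJ N s) 0"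
proof -
 define h l0 J m where "h = s^(pD d + 2)" and "l0 = pl0 d s" and "J = pJ N s" and "m = pm d N s"
 define X where "X = exp (ln (real N)/4)"
 have Nr: "0 < real N" using Npos by simp
 have X4: "X^4 = real N" unfolding X_def using Nr by (simp add: exp_of_nat_mult[symmetric])
 have sok: "ok_sigma d v s" using s by (simp add: good_sigma_def)
 have sb: "200*d*15^d <= s" using s by (simp add: good_sigma_def)
 have "200*d*1 <= 200*d*15^d" by (intro mult_left_mono) auto
 then have s200: "200*d <= s" using sb by linarith
 then have s1: "1 <= s" and s600: "600 <= s" using d3 by linarith+
 have "9*d <= 3*d*d" using d3 by (intro mult_right_mono) auto
 moreover have "pD d = 2*(3*d*d) + 16*d" by (simp add: pD_def algebra_simps)
 ultimately have D1: "12*d + 16 <= pD d" "6*d + 8 <= pD d" using d3 by linarith+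
 have "real tmix = 2*real (CL d)*real N^2" by (simp add: tmix_def)
 also have "... <= v * real N*real N^2" using gN unfolding good_N_def by (intro mult_right_mono) auto
 also have "... = v * real N^3" by (simp add: power3_eq_cube power2_eq_square)
 also have "... <= v * real N^d" using v d3 Npos by (intro mult_left_mono power_increasing) auto
 finally have vN: "real tmix <= v * real N^d" .
 have sNp: "s^k <= N" if "k <= pD d" for k using power_increasing[OF that s1] sN by linarith
 interpret sc: torus_scale d N v s by unfold_locales (use v sok vN sNp[of "3*d + 8"] D1 in auto)
 interpret ru: torus_run d N v s n by unfold_locales (use n s in \<open>auto simp: good_sigma_def\<close>)
 define L where "L = pL d N s"
 have l0s: "l0 = h * s^(pE d + 1)" unfolding l0_def h_def pl0_def ..
 have h1: "1 <= h" unfolding h_def using s1 by simp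
 have "32*d*h <= s*h" using s200 by (intro mult_right_mono) auto
 also have "... <= s^(pE d + 1)*h" using s1 by (intro mult_right_mono self_le_power) auto
 finally have l0h: "32*d*h <= l0" unfolding l0s by (simp add: mult.commute)
 have "32*1*1 <= 32*d*h" using d3 h1 by (intro mult_mono) auto
 then have l0_16: "16 <= l0" using l0h by linarith
 have L1: "1 <= L" unfolding L_def pL_def l0_def[symmetric] using l0_16 by (intro prod_ge_1) auto
 have LX: "real L <= X" unfolding L_def X_def by (rule pL_le[OF s1 gN])
 have sd: "sc.side = s^(3*d + 4)" "sc.Rr = s^(3*d + 7)" by (simp_all add: sc.side_def sc.Rr_def)
 have "s^(4*(3*d + 4)) <= N" by (rule sNp) (use D1 in simp)
 then have "real (s^(4*(3*d + 4))) <= real N" by (simp only: of_nat_le_iff)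
 then have "real sc.side^4 <= X^4" unfolding sd X4 by (simp add: power_mult[symmetric] mult.commute)
 then have sX: "real sc.side <= X" using power_le_imp_le_base[of "real sc.side" 3 X] by (simp add: X_def)
 have "(600::nat) <= N" using s600 sNp[of 1] D1 by simp
 then have "2^4 <= X^4" unfolding X4 by simp
 then have X2: "2 <= X" using power_le_imp_le_base[of 2 3 X] by (simp add: X_def)
 have "2*(real sc.side*real L) <= X*(X*X)" using sX LX X2 by (intro mult_mono) auto
 also have "... <= X^4"
 proof -
  have "X^3 <= X^4" using X2 by (intro power_increasing) auto
  then show ?thesis by (simp add: power3_eq_cube)
 qed
 finally have "real (2*(sc.side*L)) <= real N" unfolding X4 by simp
 then have two: "2*(sc.side*L) <= N" by (simp only: of_nat_le_iff)
 have sL0: "0 < sc.side*L" using s1 L1 by (simp add: sd)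
 have m_eq: "m = N div (sc.side*L)" unfolding m_def pm_def L_def sd ..
 have m2: "2 <= m" unfolding m_eq using two sL0 by (simp add: less_eq_div_iff_mult_less_eq)
 have ts: "tsize l0 m J 0 = m*L" unfolding tsize_def L_def pL_def l0_def J_def by (simp add: lessThan_atLeast0)
 have mN: "m*(sc.side*L) <= N" unfolding m_eq by simp
 have "N < (m + 1)*(sc.side*L)" unfolding m_eq using sL0 dividend_less_div_times[OF sL0, of N] by (simp add: algebra_simps)
 also have "... <= (2*m)*(sc.side*L)" using m2 by (intro mult_right_mono) auto
 finally have Nm: "N <= 2*(m*(sc.side*L))" by simp
 have e: "sc.Rr = s^3 * sc.side" unfolding sd by (simp add: power_add[symmetric] add.commute)
 have sd4: "600 <= sc.side" unfolding sd using s600 s1 self_le_power[of s "3*d + 4"] by simp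
 have "600 * s^3 <= s * s^3" using s600 by (rule mult_right_mono) simp
 also have "... = s^4" by (simp add: power_numeral_reduce)
 also have "... <= h" unfolding h_def using D1 s1 by (intro power_increasing) auto
 finally have hs: "600 * s^3 <= h" .
 have "1 <= s^3" using s1 by simp
 then have "2 * s^3 + 2 + h div 2 <= h - 1" using hs by linarith
 then have "(2 * s^3 + 2 + h div 2) * sc.side <= (h - 1) * sc.side" by (rule mult_right_mono) simp
 moreover have "(h div 2)*600 <= (h div 2) * sc.side" using sd4 by (rule mult_left_mono) simp
 moreover have "h + 1 <= 2 * sc.side + (h div 2)*600" using sd4 by linarith
 ultimately have gap0: "h + 2 * sc.Rr + 1 <= (h - 1) * sc.side" unfolding e distrib_right by linarith
 define \<kappa> where "\<kappa> = real s^(d*(3*d + 8))"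
 have \<kappa>: "real (2 * sc.Rr + 1)^d <= \<kappa>"
 proof -
  have "1 <= sc.Rr" unfolding sd using s1 by simp
  then have "2 * sc.Rr + 1 <= 3 * sc.Rr" by linarith
  also have "... <= s * sc.Rr" using s600 by (intro mult_right_mono) auto
  finally have "2 * sc.Rr + 1 <= s * sc.Rr" .
  also have "... = s^(3*d + 8)" unfolding sd power_Suc[symmetric] by (rule arg_cong[of _ _ "%k. s^k"]) simp
  finally have "(2 * sc.Rr + 1)^d <= (s^(3*d + 8))^d" by (intro power_mono) auto
  also have "... = s^(d*(3*d + 8))" by (simp add: power_mult[symmetric] mult.commute)
  finally show ?thesis unfolding \<kappa>_def by (metis of_nat_le_iff of_nat_power)
 qed
 have k0: "0 < \<kappa>" unfolding \<kappa>_def using s1 by simp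
 have CX0: "0 <= CX d" unfolding CX_def using CU_gt0 by simp
 define r0 where "r0 = (h - 1) * sc.side - 2 * sc.Rr - 1"
 have r0h: "h <= r0" unfolding r0_def using gap0 by linarith
 \<comment> \<open>\<open>h\<close> is a square because \<open>green_far_le\<close> decays like an
   inverse square root: sqrt h is s times the bound \<kappa> for the size of a region.\<close>
 have "h = (s^(d*(3*d + 8) + 1))^2" unfolding h_def pD_def power_mult[symmetric] by (simp add: algebra_simps)
 then have "real h = (\<kappa>*real s)^2" unfolding \<kappa>_def by (simp add: mult.commute)
 then have hsq: "sqrt (real h) = \<kappa>*real s" using k0 by simp
 have "0 < sqrt (real h)" "sqrt (real h) <= sqrt (real (r0))"
  using of_nat_mono[OF r0h, where ?'a = real] h1 by (auto simp del: of_nat_diff)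
 then have "2/sqrt (real (r0)) <= 2/sqrt (real h)" by (intro divide_left_mono mult_pos_pos) linarith+
 then have "\<kappa>*CX d*(2/sqrt (real (r0))) <= \<kappa>*CX d*(2/(\<kappa>*real s))"
  unfolding hsq using k0 CX0 by (intro mult_left_mono) auto
 also have "... = (4*CX d/real s)/2" using k0 by simp
 also have "... <= 1/2" using s s1 unfolding good_sigma_def by (intro divide_right_mono) (auto simp: divide_le_eq)
 finally have first: "\<kappa>*CX d*(2/sqrt (real (r0))) <= 1/2" .
 define Y where "Y = 4*CX d*real (CL d)"
 have Y0: "0 <= Y" unfolding Y_def using CX0 by simp
 have "\<kappa>^2 = real (s^pD d)" unfolding \<kappa>_def pD_def by (simp add: power_mult[symmetric] ac_simps)
 also have "... <= (X^2)^2" using sN by (simp add: X4 power_mult[symmetric])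
 finally have kX: "\<kappa> <= X^2" by (rule power2_le_imp_le) simp
 have ln1: "1 <= ln (real N)" and big: "8*real (pD d + pE d + 6)*(ww N)^2 <= ln (real N)" using gN by (auto simp: good_N_def)
 have w1: "1 <= ww N" by (rule pJ_props(3)[OF s1 ln1])
 have "ww N*1 <= ww N*ww N" using w1 by (intro mult_left_mono) auto
 moreover have "4*(ww N)^2 <= 8*real (pD d + pE d + 6)*(ww N)^2" by (intro mult_right_mono) auto
 ultimately have "4*ww N <= ln (real N)" using big by (simp add: power2_eq_square)
 then have "exp (ww N) <= X" unfolding X_def by simp
 then have JX: "2^J <= X" using pJ_props(2)[OF s1 ln1] unfolding J_def by linarith
 have "Y^4 <= X^4" using gN unfolding X4 Y_def good_N_def by simp
 then have YX: "Y <= X" using power_le_imp_le_base[of Y 3 X] by (simp add: X_def)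
 have "real N^3 <= real N^d" using d3 Npos by (intro power_increasing) auto
 then have "real tmix/real N^d <= real tmix/real N^3" using Nr by (intro divide_left_mono) auto
 also have "... = 2*real (CL d)/real N" using Nr by (simp add: tmix_def power3_eq_cube power2_eq_square)
 finally have "real tmix/real N^d <= 2*real (CL d)/real N" .
 then have "\<kappa>*CX d*2^J*(real tmix/real N^d) <= \<kappa>*CX d*2^J*(2*real (CL d)/real N)" using k0 CX0 by (intro mult_left_mono) auto
 also have "... = (\<kappa>*(Y*2^J))/real N/2" unfolding Y_def by simp
 also have "... <= (X^2*(X*X))/real N/2" using kX YX JX k0 Y0 Nr by (intro divide_right_mono mult_mono) (auto simp: X_def)
 also have "X^2*(X*X) = real N" unfolding X4[symmetric] by (simp add: power_numeral_reduce)
 finally have second: "\<kappa>*CX d*(2^J*real tmix/real N^d) <= 1/2" using Nr by simp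
 have "real (2 * sc.Rr + 1)^d*CX d*(2/sqrt (real (r0)) + 2^J*real tmix/real N^d)
  <= \<kappa>*CX d*(2/sqrt (real (r0)) + 2^J*real tmix/real N^d)"
  using \<kappa> CX0 by (intro mult_right_mono) auto
 then have sepc: "real (2 * sc.Rr + 1)^d*CX d*(2/sqrt (real (r0)) + 2^J*real tmix/real N^d) <= 1" using first second unfolding distrib_left[of "\<kappa>*CX d"] by linarith
 show "torus_cells d N v s n h l0 J m" by unfold_locales
   (use m2 h1 l0_16 l0h mN Nm gap0 sepc[unfolded r0_def] s in \<open>auto simp: ts good_sigma_def l0_def[symmetric] ac_simps\<close>)
 have "s^(3*d + 4) * s^(3*d + 4) <= N" using sNp[of "6*d + 8"] D1 by (simp add: power_add[symmetric])
 moreover have "2*(m*(sc.side*L)) = sc.side*(2*(m*L))" by simp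
 ultimately have "sc.side * s^(3*d + 4) <= sc.side*(2*(m*L))" using Nm unfolding sd by linarith
 then have "s^(3*d + 4) <= 2*(m*L)" using s1 by (simp add: sd)
 moreover have "12 * s^(3*d) <= s^(3*d + 4)"
 proof -
  have "12 <= s^4" using s600 self_le_power[of s 4] s1 by simp
  then have "12 * s^(3*d) <= s^4 * s^(3*d)" by (rule mult_right_mono) simp
  then show ?thesis by (simp add: power_add[symmetric] add.commute)
 qed
 moreover have "1 <= s^(3*d)" using s1 by simp
 ultimately have "6 * s^(3*d) <= m*L" "1 <= s^(3*d)" by simp_all
 moreover have "2*(2 * s^(3*d) + 1) = 4 * s^(3*d) + 2" by simp
 ultimately show "2*(2 * s^(3*d) + 1) <= tsize l0 m J 0" unfolding ts by linarith
qed

context torus_walk begin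

text \<open>Stated for every scale separately, since the scale will depend on the set A, which is
  chosen after the walk.\<close>

definition tbad :: "nat => nat => pt list => bool" where
 "tbad n s p \<longleftrightarrow> (\<exists>B\<in>torus d (pm d N s). ~ tower_good d (s^(pD d + 2)) (torus_cells.l (pl0 d s))
   (torus_cells.good d N s n (pl0 d s) (pJ N s) (pm d N s) p) (pJ N s) B)"

context
 fixes v \<mu> :: real and s0 n :: nat
 assumes v: "0 < v" and mu: "0 < \<mu>" "\<mu> < 1" and gs: "!!s. s0 <= s ==> good_sigma d v \<mu> s" and gN: "good_N d v N"
  and s0N: "s0^pD d <= N" and n: "12*real (4*d + 3) * v * real N^d + 3 <= real n"
begin

text \<open>At most \<open>N\<close> scales are admissible and each has at most N^d top boxes; exp
  (- 4 (ln N)^2) absorbs this factor N^(d + 1).\<close>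

lemma tbad_prob: "avgT n (%p. of_bool (\<exists>s\<ge>s0. s^pD d <= N & tbad n s p)) <= exp (- (ln (real N))\<^sup>2)"
proof -
 have ln1: "1 <= ln (real N)" and lnd: "real (d + 1) <= 3*ln (real N)" using gN by (auto simp: good_N_def)
 have D0: "0 < pD d" using d3 by (simp add: pD_def)
 define S where "S = {s. s0 <= s & s^pD d <= N}"
 have s1: "1 <= s" if "s0 <= s" for s
 proof -
  have "200*d*15^d <= s" "0 < 200*d*15^d" using gs[OF that] d3 by (auto simp: good_sigma_def)
  then show ?thesis by linarith
 qed
 have SN: "S \<subseteq> {1..N}"
 proof
  fix s assume s: "s \<in> S"
  then have "1 <= s" using s1 by (simp add: S_def)
  then have "s <= s^pD d" using D0 by (intro self_le_power) auto
  then show "s \<in> {1..N}" using s \<open>1 \<le> s\<close> by (simp add: S_def)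
 qed
 have fS: "finite S" and cS: "card S <= N" using finite_subset[OF SN] card_mono[OF _ SN] by auto
 have "avgT n (%p. of_bool (\<exists>s\<ge>s0. s^pD d <= N & tbad n s p)) <= avgT n (%p. \<Sum>s\<in>S. of_bool (tbad n s p))"
 proof (rule avgT_mono)
  fix p
  show "(of_bool (\<exists>s\<ge>s0. s^pD d <= N & tbad n s p) :: real) <= (\<Sum>s\<in>S. of_bool (tbad n s p))"
  proof (cases "\<exists>s\<ge>s0. s^pD d <= N & tbad n s p")
   case True
   then obtain s where s: "s \<in> S" "tbad n s p" by (auto simp: S_def)
   have "of_bool (tbad n s p) <= (\<Sum>s\<in>S. of_bool (tbad n s p) :: real)" by (rule member_le_sum[OF s(1)]) (auto simp: fS)
   then show ?thesis using True s(2) by simp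
  next
   case False
   show ?thesis unfolding of_bool_def if_not_P[OF False] by (simp add: sum_nonneg)
  qed
 qed
 also have "... = (\<Sum>s\<in>S. avgT n (%p. of_bool (tbad n s p)))" by (rule avgT_sum)
 also have "... <= (\<Sum>s\<in>S. real N^d*exp (- (4*(ln (real N))^2)))"
 proof (rule sum_mono)
  fix s assume "s \<in> S"
  then have s: "s0 <= s" "s^pD d <= N" by (auto simp: S_def)
  interpret tc: torus_cells d N v s n "s^(pD d + 2)" "pl0 d s" "pJ N s" "pm d N s" by (rule cells_inst[OF v gs[OF s(1)] gN s(2) n])
  have "avgT n (%p. of_bool (tbad n s p)) <= real (pm d N s)^d*exp (- (real s*2^pJ N s))" unfolding tbad_def by (rule tc.top_bad_prob)
  also have "... <= real N^d*exp (- (4*(ln (real N))^2))"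
   using pJ_props(1)[OF s1[OF s(1)] ln1] by (intro mult_mono power_mono) (auto simp: pm_def)
  finally show "avgT n (%p. of_bool (tbad n s p)) <= real N^d*exp (- (4*(ln (real N))^2))" .
 qed
 also have "... = real (card S)*(real N^d*exp (- (4*(ln (real N))^2)))" by simp
 also have "... <= real N*(real N^d*exp (- (4*(ln (real N))^2)))" using cS by (intro mult_right_mono) auto
 also have "... = exp (real (d + 1)*ln (real N) - 4*(ln (real N))^2)"
 proof -
  have "exp (real (d + 1)*ln (real N)) = real N^(d + 1)" using Npos by (simp only: exp_of_nat_mult exp_ln of_nat_0_less_iff)
  then show ?thesis by (simp add: exp_diff exp_minus divide_inverse)
 qed
 also have "... <= exp (- (ln (real N))\<^sup>2)"
 proof -
  have "real (d + 1)*ln (real N) <= 3*ln (real N)*ln (real N)" using lnd ln1 by (intro mult_right_mono) auto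
  then show ?thesis by (simp add: power2_eq_square)
 qed
 finally show ?thesis .
qed

text \<open>The scale is \<tau> = (N^d / |A|)^(1/pE) rounded up, but at least \<open>s0\<close>. At
  s = \<open>s0\<close> the set A has positive density, and \<open>large_sets\<close> applies with
  constants depending on \<open>s0\<close>. Otherwise s <= 2 \<tau>, and \<open>small_sets\<close>
  applies with t = |A|^(1/d) = N / \<tau>^k.\<close>

lemma tbad_imp: assumes p: "p \<in> walks n x" and xT: "x \<in> T" and tops: "!!s. s0 <= s ==> s^pD d <= N ==> ~ tbad n s p"
  and A: "A \<subseteq> set p" and cA: "real (card A) <= \<mu>*real (card (set p))"
 shows "min (1/2^pD d) ((1 - \<mu>)/real s0^(2*pD d + 2*d*pD d))*real (card A) powr (1 - 1/real d + 1/(real d)^2)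
  *real N powr (- (1/real d)) <= real (card (edge_boundary d N (set p) A))"
proof (cases "card A = 0")
 case False
 define \<gamma> where "\<gamma> = min (1/2^pD d) ((1 - \<mu>)/real s0^(2*pD d + 2*d*pD d))"
 define a b where "a = real (card A)" and "b = real (card (edge_boundary d N (set p) A))"
 define \<tau> where "\<tau> = (real N^d/a) powr (1/real (pE d))"
 define s where "s = max s0 (nat \<lceil>\<tau>\<rceil>)"
 define k where "k = 2*d*pD d"
 define t where "t = real N/\<tau>^k"
 have d0: "0 < real d" using d3 by simp
 have D0: "0 < pD d" using d3 by (simp add: pD_def)
 have "1*(3*d + 8) <= (2*d*(2*d))*(3*d + 8)" using d3 by (intro mult_right_mono) auto
 also have "... = k" by (simp add: k_def pD_def)
 finally have kd: "3*d + 8 <= k" by simp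
 have Ek: "pE d = k*d" by (simp add: k_def pE_def power2_eq_square)
 have k0: "0 < k" using d3 D0 by (simp add: k_def)
 have a1: "1 <= a" using False by (simp add: a_def)
 have Nr: "1 <= real N" using Npos by simp
 have "card A <= card T" using A walks_set[OF p xT] by (intro card_mono) auto
 then have aN: "a <= real N^d" unfolding a_def card_torus by (metis of_nat_le_iff of_nat_power)
 have r1: "1 <= real N^d/a" using aN a1 by (simp add: le_divide_eq)
 have \<tau>1: "1 <= \<tau>" unfolding \<tau>_def using r1 by (simp add: ge_one_powr_ge_zero)
 have \<tau>E: "\<tau>^pE d = real N^d/a"
 proof -
  have "\<tau>^pE d = \<tau> powr real (pE d)" using \<tau>1 by (simp add: powr_realpow)
  also have "... = (real N^d/a) powr 1" unfolding \<tau>_def powr_powr using k0 d3 by (simp add: Ek)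
  finally show ?thesis using r1 a1 by simp
 qed
 have "t^d = real N^d/\<tau>^pE d" unfolding t_def Ek by (simp add: power_divide power_mult)
 then have td: "t^d = a" unfolding \<tau>E using a1 Nr by simp
 have t0: "0 < t" unfolding t_def using \<tau>1 Nr by simp
 have t1: "1 <= t"
 proof (rule ccontr)
  assume "~ 1 <= t"
  then have "t^d < 1" using t0 d3 by (simp add: power_less_one_iff)
  then show False using td a1 by simp
 qed
 have s\<tau>: "\<tau> <= real s" 
 proof -
  have "\<tau> <= real (nat \<lceil>\<tau>\<rceil>)" by linarith
  also have "... <= real s" unfolding s_def by simp
  finally show ?thesis .
 qed
 have s2\<tau>: "real s <= 2*\<tau>" if "s ~= s0"
 proof -
  have "s = nat \<lceil>\<tau>\<rceil>" using that unfolding s_def by linarith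
  then have "real s <= \<tau> + 1" using \<tau>1 by linarith
  then show ?thesis using \<tau>1 by linarith
 qed
 have ss0: "s0 <= s" by (simp add: s_def)
 have g: "good_sigma d v \<mu> s" by (rule gs[OF ss0])
 have sb: "200*d*15^d <= s" "10*2^k <= s" "8*real d*5^d <= (1 - \<mu>)*real s" using g by (auto simp: good_sigma_def k_def)
 have "0 < 200*d*15^d" using d3 by simp
 then have s1: "1 <= s" using sb(1) by linarith
 \<comment> \<open>\<tau> is at most N^(d/pE), and pE = 2 d^2 pD leaves room; the factor 2 from
   rounding is absorbed by 4^pD <= N.\<close>
 have sN: "s^pD d <= N"
 proof (cases "s = s0")
  case ne: False
  have "(real s^pD d)^(2*d^2) = real s^pE d" by (simp add: pE_def power_mult[symmetric] mult.commute)
  also have "... <= (2*\<tau>)^pE d" using s2\<tau>[OF ne] by (intro power_mono) auto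
  also have "... = (4^pD d)^d\<^sup>2*(real N^d/a)"
  proof -
   have "(2::real)^pE d = (2^2)^(pD d*d^2)" unfolding power_mult[symmetric] by (simp add: pE_def ac_simps)
   then show ?thesis unfolding power_mult_distrib \<tau>E by (simp add: power_mult)
  qed
  also have "... <= real N^d\<^sup>2*real N^d"
  proof (intro mult_mono power_mono)
   have "real (4^pD d) <= real N" using gN unfolding good_N_def by (simp only: of_nat_le_iff)
   then show "(4::real)^pD d <= real N" by simp
   show "real N^d/a <= real N^d" using a1 Nr by (simp add: divide_le_eq mult_le_cancel_left1)
  qed (use a1 in auto)
  also have "... <= real N^(2*d^2)" unfolding power_add[symmetric] using Nr d3 by (intro power_increasing) (auto simp: power2_eq_square)
  finally have "real s^pD d <= real N" using power_mono_iff[of "real s^pD d" "real N" "2*d^2"] d3 by simp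
  then show ?thesis by (metis of_nat_le_iff of_nat_power)
 qed (use s0N in simp)
 interpret tc: torus_cells d N v s n "s^(pD d + 2)" "pl0 d s" "pJ N s" "pm d N s" by (rule cells_inst[OF v g gN sN n])
 have top: "\<forall>B\<in>torus d (pm d N s). tower_good d (s^(pD d + 2)) tc.l (tc.good p) (pJ N s) B"
  using tops[OF ss0 sN] unfolding tbad_def by blast
 have n0big: "2*(2 * s^(3*d) + 1) <= tc.n0" unfolding tc.nn_def by (rule cells_inst[OF v g gN sN n])
 define K0 K where "K0 = real (5*tc.side)^d" and "K = real (2*tc.Rr + 1)^d"
 have sd: "tc.side = s^(3*d + 4)" "tc.Rr = s^(3*d + 7)" by (simp_all add: tc.side_def tc.Rr_def)
 have "1 <= real (5*tc.side)" "1 <= real (2*tc.Rr + 1)" using tc.side_pos by simp_all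
 then have K1: "1 <= K0" "1 <= K" unfolding K0_def K_def by (auto intro: one_le_power simp del: of_nat_mult of_nat_add)
 have b0: "0 <= b" by (simp add: b_def)
 have "real (2*tc.Rr + 1) <= 3*real s^(3*d + 7)" unfolding sd using s1 by simp
 then have "K <= (3*real s^(3*d + 7))^d" unfolding K_def by (intro power_mono) auto
 then have "K0*K <= (5*real s^(3*d + 4))^d*(3*real s^(3*d + 7))^d" using K1 by (intro mult_mono) (auto simp: K0_def sd)
 also have "... = 15^d*real s^(d*(6*d + 11))"
 proof -
  have "(5*real s^(3*d + 4))*(3*real s^(3*d + 7)) = 15*real s^(6*d + 11)" by (simp add: power_add[symmetric])
  then show ?thesis unfolding power_mult_distrib[symmetric] by (simp add: power_mult_distrib power_mult[symmetric] mult.commute)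
 qed
 finally have "200*real d*(K0*K) <= 200*real d*(15^d*real s^(d*(6*d + 11)))" by (intro mult_left_mono) auto
 also have "... = real (200*d*15^d)*real s^(d*(6*d + 11))" by simp
 also have "... <= real s*real s^(d*(6*d + 11))" using sb(1) by (intro mult_right_mono) (auto simp only: of_nat_le_iff, simp)
 also have "... <= real s^pD d" unfolding power_Suc[symmetric] pD_def using s1 d3 by (intro power_increasing) (auto simp: algebra_simps)
 finally have KK: "200*real d*(K0*K) <= real s^pD d" .
 have n0N: "real N <= 2*real s^(3*d + 4)*real tc.n0" "real s^(3*d + 4)*real tc.n0 <= real N"
 proof -
  have "real N <= real (2 * s^(3*d + 4)*tc.n0)" "real (s^(3*d + 4)*tc.n0) <= real N" using tc.sizeN unfolding tc.nn_def sd of_nat_le_iff by blast+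
  then show "real N <= 2*real s^(3*d + 4)*real tc.n0" "real s^(3*d + 4)*real tc.n0 <= real N"
   by (simp_all only: of_nat_mult of_nat_power of_nat_numeral)
 qed
 have "real (pl0 d s) = real (s^(pD d + 2))*real s^(pE d + 1)" by (simp only: pl0_def of_nat_mult of_nat_power)
 moreover have "real (s^(pD d + 2)) ~= 0" using s1 by simp
 ultimately have eta: "tc.eta = 2*real d/real s^(pE d + 1)" unfolding tc.eta_def by (simp only:) simp
 have eta0: "0 <= tc.eta" unfolding eta by simp
 have "8*real (5*tc.side)^d*tc.eta*real tc.n0^d = 8*5^d*(real s^(3*d + 4)*real tc.n0)^d*tc.eta" unfolding sd by (simp add: power_mult_distrib)
 also have "... <= 8*5^d*real N^d*tc.eta" by (rule mult_right_mono[OF mult_left_mono[OF power_mono[OF n0N(2)]] eta0]) simp_all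
 also have "... = (16*real d*5^d/real s)*(real N^d/real s^pE d)" unfolding eta using s1 by simp
 also have "... <= 1*a"
 proof (rule mult_mono)
  have "(5::nat)^d <= 15^d" by (rule power_mono) auto
  then have "16*d*5^d <= 200*d*15^d" by (intro mult_mono) auto
  then have "16*d*5^d <= s" using sb(1) by linarith
  then have "real (16*d*5^d) <= real s" by (simp only: of_nat_le_iff)
  then show "16*real d*5^d/real s <= 1" using s1 by (simp add: divide_le_eq)
  have "\<tau>^pE d <= real s^pE d" using s\<tau> \<tau>1 by (intro power_mono) auto
  then have "real N^d <= a*real s^pE d" unfolding \<tau>E using a1 by (simp add: divide_le_eq mult.commute)
  then show "real N^d/real s^pE d <= a" using s1 by (simp add: divide_le_eq)
 qed auto
 finally have H1: "8*real (5*tc.side)^d*tc.eta*real tc.n0^d <= real (card A)" by (simp add: a_def)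
 have cA0: "0 < card A" using False by simp
 \<comment> \<open>Enough for the claim: a/t = a^(1 - 1/d), and \<tau>^pD = (N^d / a)^(1/(2 d^2))
   does not exceed (N^d / a)^(1/d^2).\<close>
 have main: "\<gamma>*(a/t)*(1/\<tau>^pD d) <= b"
 proof (cases "s = s0")
  case True
  have "4*real (5*tc.side)^d*tc.eta = 8*real d*5^d*(real s^(d*(3*d + 4))/real s^(pE d + 1))"
   unfolding sd eta by (simp add: power_mult_distrib power_mult[symmetric] mult.commute)
  also have "... <= 8*real d*5^d*(real s^pE d/real s^(pE d + 1))"
  proof (intro mult_left_mono divide_right_mono power_increasing)
   have "3*d + 4 <= k" using kd by linarith
   then show "d*(3*d + 4) <= pE d" unfolding Ek by (simp add: mult.commute)
  qed (use s1 in auto)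
  also have "... = 8*real d*5^d/real s" using s1 by simp
  also have "... <= 1 - \<mu>" using sb(3) s1 by (simp add: divide_le_eq)
  finally have "4*real (5*tc.side)^d*tc.eta <= 1 - \<mu>" .
  from tc.large_sets[OF p xT top n0big A H1 cA0 cA mu this]
  have "(1 - \<mu>)*a <= 80*real d*K0^2*K*real tc.n0*b" unfolding a_def b_def K0_def K_def .
  also have "... <= (real s^pD d)^2*real N*b"
  proof (intro mult_right_mono mult_mono b0)
   have "real d*1 <= real d*real d" using d3 by (intro mult_left_mono) auto
   then have "80*real d <= (200*real d)^2" by (simp add: power2_eq_square)
   moreover have "K*1 <= K*K" using K1 by (intro mult_left_mono) auto
   ultimately have "(80*real d)*(K0^2*K) <= (200*real d)^2*(K0^2*K^2)"
    using K1 by (intro mult_mono) (auto simp: power2_eq_square)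
   then have "80*real d*K0^2*K <= (200*real d*(K0*K))^2" by (simp add: power_mult_distrib mult.assoc)
   also have "... <= (real s^pD d)^2" using KK K1 by (intro power_mono) auto
   finally show "80*real d*K0^2*K <= (real s^pD d)^2" .
   show "real tc.n0 <= real N" using tc.n0_le by simp
  qed (use K1 in auto)
  also have "... <= (real s^pD d)^2*(t*real s^k)*b"
  proof (intro mult_right_mono mult_left_mono b0)
   have "\<tau>^k <= real s^k" using s\<tau> \<tau>1 by (intro power_mono) auto
   then have "t*\<tau>^k <= t*real s^k" using t0 by (intro mult_left_mono) auto
   then show "real N <= t*real s^k" using \<tau>1 unfolding t_def by simp
  qed simp
  also have "... = t*(real s^(2*pD d + k)*b)" by (simp add: power_add power_mult[symmetric] mult.commute)
  finally have "(1 - \<mu>)*a/t <= real s^(2*pD d + k)*b" using t0 by (simp add: divide_le_eq mult.commute)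
  moreover have "0 < real s^(2*pD d + k)" using s1 by simp
  ultimately have "(1 - \<mu>)*a/t/real s^(2*pD d + k) <= b" by (simp only: pos_divide_le_eq mult.commute)
  then have B: "(1 - \<mu>)/real s0^(2*pD d + k)*(a/t) <= b" unfolding True by (simp add: ac_simps)
  have "\<gamma>*(a/t)*(1/\<tau>^pD d) <= \<gamma>*(a/t)*1"
   unfolding \<gamma>_def using mu \<tau>1 a1 t0 by (intro mult_left_mono mult_nonneg_nonneg) auto
  also have "... <= (1 - \<mu>)/real s0^(2*pD d + k)*(a/t)"
   unfolding \<gamma>_def k_def using a1 t0 by (simp only: mult_1_right) (intro mult_right_mono, auto)
  finally show ?thesis using B by linarith
 next
  case ne: False
  \<comment> \<open>Without levels a top box is a cell and \<open>Lb\<close> is 1. With levels, s^pE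
    and \<open>Lb\<close> are at most N^(1/4), so A is so dense that t exceeds the side of a top
    box.\<close>
  have Lt: "real (tc.Lb (pJ N s)) <= t"
  proof (cases "pJ N s = 0")
   case True
   then show ?thesis using t1 by (simp add: tc.Lb_def)
  next
   case J: False
   define X where "X = exp (ln (real N)/4)"
   have X4: "X^4 = real N" unfolding X_def using Nr by (simp add: exp_of_nat_mult[symmetric])
   have X1: "1 <= X" unfolding X_def using Nr by simp
   have LX: "real (tc.Lb (pJ N s)) <= X" "real s^pE d <= X" using pL_le[OF s1 gN] J unfolding X_def tc.Lb_def pL_def tc.l_def by simp_all
   have "real (tc.Lb (pJ N s))^d*real s^pE d <= X^d*X" using LX X1 by (intro mult_mono power_mono) auto
   also have "... <= X^(4*d)" unfolding power_Suc2[symmetric] using X1 d3 by (intro power_increasing) auto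
   also have "... = real N^d" unfolding power_mult X4 ..
   also have "... = t^d*\<tau>^pE d" unfolding td \<tau>E using a1 by simp
   also have "... <= t^d*real s^pE d" using s\<tau> \<tau>1 t0 by (intro mult_left_mono power_mono) auto
   finally have "real (tc.Lb (pJ N s))^d <= t^d" using s1 by simp
   then show ?thesis using power_mono_iff[of "real (tc.Lb (pJ N s))" t d] t0 d3 by simp
  qed
  have st: "(real s/2)^k <= \<tau>^k" using s2\<tau>[OF ne] by (intro power_mono) auto
  have "t*(real s/2)^k <= t*\<tau>^k" using t0 by (intro mult_left_mono st) auto
  also have "... = real N" unfolding t_def using \<tau>1 by simp
  also note n0N(1)
  finally have "t*real s^k <= 2^k*(2*real s^(3*d + 4)*real tc.n0)" by (simp add: power_divide divide_le_eq mult.commute)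
  moreover have "real (10*2^k)*real s^(3*d + 4) <= real s^k"
  proof -
   have "real (10*2^k)*real s^(3*d + 4) <= real s*real s^(3*d + 4)"
    using sb(2) by (intro mult_right_mono) (auto simp only: of_nat_le_iff, simp)
   also have "... <= real s^k"
   proof -
    have "Suc (3*d + 4) <= k" using kd by linarith
    then show ?thesis unfolding power_Suc[symmetric] using s1 by (intro power_increasing) auto
   qed
   finally show ?thesis .
  qed
  then have "t*(real (10*2^k)*real s^(3*d + 4)) <= t*real s^k" using t0 by (intro mult_left_mono) auto
  ultimately have "t*(real (10*2^k)*real s^(3*d + 4)) <= 2^k*(2*real s^(3*d + 4)*real tc.n0)" by linarith
  moreover have "t*(real (10*2^k)*real s^(3*d + 4)) = (2*2^k*real s^(3*d + 4))*(5*t)" by simp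
  moreover have "2^k*(2*real s^(3*d + 4)*real tc.n0) = (2*2^k*real s^(3*d + 4))*real tc.n0" by simp
  ultimately have "(2*2^k*real s^(3*d + 4))*(5*t) <= (2*2^k*real s^(3*d + 4))*real tc.n0" by (simp only:)
  then have tn0: "5*t <= real tc.n0" using s1 by (simp add: mult_le_cancel_left_pos)
  from tc.small_sets[OF p xT top n0big A H1 cA0 t0 td[unfolded a_def] Lt tn0]
  have "a <= (200*real d*(K0*K))*t*b" unfolding a_def b_def K0_def K_def by (simp add: ac_simps)
  also have "... <= (2*\<tau>)^pD d*t*b"
  proof (intro mult_right_mono b0)
   have "real s^pD d <= (2*\<tau>)^pD d" using s2\<tau>[OF ne] by (intro power_mono) auto
   then show "200*real d*(K0*K) <= (2*\<tau>)^pD d" using KK by linarith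
  qed (use t0 in simp)
  finally have "a/t <= (2^pD d*\<tau>^pD d)*b" using t0 by (simp add: divide_le_eq power_mult_distrib ac_simps)
  moreover have "0 < 2^pD d*\<tau>^pD d" using \<tau>1 by simp
  ultimately have "a/t/(2^pD d*\<tau>^pD d) <= b" by (simp only: pos_divide_le_eq mult.commute)
  then have "(1/2^pD d)*(a/t)*(1/\<tau>^pD d) <= b" by (simp add: ac_simps)
  moreover have "\<gamma>*(a/t)*(1/\<tau>^pD d) <= (1/2^pD d)*(a/t)*(1/\<tau>^pD d)"
   unfolding \<gamma>_def using a1 t0 \<tau>1 by (intro mult_right_mono) auto
  ultimately show ?thesis by linarith
 qed
 have "a powr (1/real d) = (t powr real d) powr (1/real d)" unfolding td[symmetric] using t0 by (simp add: powr_realpow)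
 then have ta: "t = a powr (1/real d)" using t0 d0 by (simp add: powr_powr)
 have P1: "a powr (1 - 1/real d + 1/(real d)^2) = a/t*a powr (1/(real d)^2)" unfolding ta using a1 by (simp add: powr_add powr_diff)
 have "(real N^d) powr (- (1/(real d)^2)) = real N powr (real d*(- (1/(real d)^2)))"
  using Nr by (simp add: powr_realpow[symmetric] powr_powr)
 also have "real d*(- (1/(real d)^2)) = - (1/real d)" using d0 by (simp add: power2_eq_square)
 finally have P2: "real N powr (- (1/real d)) = (real N^d) powr (- (1/(real d)^2))" ..
 have P3: "a powr (1/(real d)^2)*(real N^d) powr (- (1/(real d)^2)) = (real N^d/a) powr (- (1/(real d)^2))"
  using a1 Nr unfolding powr_minus by (subst powr_divide) (simp_all add: divide_inverse)
 have "1/(2*(real d)^2) <= 1/(real d)^2" using d0 by (intro divide_left_mono mult_pos_pos) auto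
 then have P4: "(real N^d/a) powr (- (1/(real d)^2)) <= (real N^d/a) powr (- (1/(2*(real d)^2)))"
  using r1 by (intro powr_mono) linarith+
 have "\<tau>^pD d = \<tau> powr real (pD d)" using \<tau>1 by (simp add: powr_realpow)
 also have "... = (real N^d/a) powr (1/(2*(real d)^2))" 
 proof -
  have "real (pE d) = 2*(real d)^2*real (pD d)" by (simp add: pE_def)
  then have "1/real (pE d)*real (pD d) = 1/(2*(real d)^2)" using D0 by simp
  then show ?thesis unfolding \<tau>_def powr_powr by (simp only:)
 qed
 finally have P5: "(real N^d/a) powr (- (1/(2*(real d)^2))) = 1/\<tau>^pD d" unfolding powr_minus by (simp only: inverse_eq_divide)
 have "a powr (1 - 1/real d + 1/(real d)^2)*real N powr (- (1/real d)) <= (a/t)*(1/\<tau>^pD d)" unfolding P1 P2 mult.assoc P3 using P4 unfolding P5 by (rule mult_left_mono) (use a1 t0 in simp)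
 moreover have "0 <= \<gamma>" unfolding \<gamma>_def using mu by simp
 ultimately have "\<gamma>*(a powr (1 - 1/real d + 1/(real d)^2)*real N powr (- (1/real d))) <= \<gamma>*((a/t)*(1/\<tau>^pD d))"
  by (rule mult_left_mono)
 also have "... <= b" using main by (simp only: mult.assoc)
 finally show ?thesis unfolding \<gamma>_def a_def b_def by (simp only: mult.assoc)
qed simp

end

end

lemma eventually_good_sigma: assumes d: "3 <= d" and v: "0 < v" and mu: "\<mu> < 1"
 shows "\<forall>\<^sub>F s in sequentially. good_sigma d v \<mu> s"
proof -
 have E1: "\<forall>\<^sub>F s in sequentially. real (17 * s^(3*d + 4))^(2*d)*real (4*d + 3)*exp (- real s) <= 1"
  using eventually_poly_exp[of 1 1 "17^(2*d)*real (4*d + 3)" "(3*d + 4)*(2*d)"]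
  by (simp add: power_mult_distrib power_mult[symmetric] ac_simps)
 have E2: "\<forall>\<^sub>F s in sequentially. (4*real (pl0 d s))^(2*d) <= exp (real s)"
 proof (rule eventually_mono[OF eventually_poly_exp[of 1 1 "4^(2*d)" "(pD d + 2 + (pE d + 1))*(2*d)"]])
  fix s assume elim: "4^(2*d)*real s^((pD d + 2 + (pE d + 1))*(2*d))*exp (- 1*real s) <= 1"
  have "(4*real (pl0 d s))^(2*d) = 4^(2*d)*real s^((pD d + 2 + (pE d + 1))*(2*d))"
   unfolding pl0_def power_add[symmetric] by (simp only: of_nat_power power_mult_distrib power_mult)
  then have "(4*real (pl0 d s))^(2*d)*exp (- real s) <= 1" using elim by simp
  then show "(4*real (pl0 d s))^(2*d) <= exp (real s)" by (simp add: exp_minus divide_simps)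
 qed simp_all
 have lin: "\<forall>\<^sub>F s in sequentially. C <= real s" for C using eventually_linear_ge[of 1 C] by simp
 have nat: "\<forall>\<^sub>F s in sequentially. C <= s" for C :: nat by (rule eventually_ge_at_top)
 show ?thesis unfolding good_sigma_def eventually_conj_iff
  using eventually_ok_sigma[OF d v] E1 E2 lin[of "4*CX d"] nat eventually_linear_ge[of "1 - \<mu>"] mu by simp
qed

lemma eventually_good_N: assumes v: "0 < v" shows "\<forall>\<^sub>F N in sequentially. good_N d v N"
proof -
 have lin: "\<forall>\<^sub>F N in sequentially. C <= real N" for C using eventually_linear_ge[of 1 C] by simp
 have nat: "\<forall>\<^sub>F N in sequentially. C <= N" for C :: nat by (rule eventually_ge_at_top)
 have lnt: "filterlim (%N. ln (real N)) at_top sequentially" by real_asymp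
 have ln: "\<forall>\<^sub>F N in sequentially. C <= ln (real N)" for C using lnt unfolding filterlim_at_top by blast
 have lnd: "\<forall>\<^sub>F N in sequentially. real (d + 1) <= 3*ln (real N)" using ln[of "real (d + 1)/3"] by eventually_elim simp
 have "((%x. (ln (8*(ln x)^2))^2/ln x) \<longlongrightarrow> (0::real)) at_top" by real_asymp
 then have "((%N. (ww N)^2/ln (real N)) \<longlonglongrightarrow> 0)" unfolding ww_def
  by (rule filterlim_compose[OF _ filterlim_real_sequentially])
 then have "((%N. 8*real (pD d + pE d + 6)*((ww N)^2/ln (real N))) \<longlonglongrightarrow> 8*real (pD d + pE d + 6)*0)"
  by (intro tendsto_intros)
 then have "\<forall>\<^sub>F N in sequentially. 8*real (pD d + pE d + 6)*((ww N)^2/ln (real N)) < 1" by (rule order_tendstoD(2)) simp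
 then have W: "\<forall>\<^sub>F N in sequentially. 8*real (pD d + pE d + 6)*(ww N)^2 <= ln (real N)"
  using ln[of 1] by eventually_elim (simp add: divide_less_eq)
 show ?thesis unfolding good_N_def eventually_conj_iff using ln[of 1] eventually_linear_ge[OF v] W lin nat lnd by blast
qed

definition isop :: "nat => nat => real => real => pt set => bool" where "isop d N \<mu> \<gamma> I \<longleftrightarrow> (\<forall>A. A \<subseteq> I --> real (card A) <= \<mu>*real (card I) \<longrightarrow>
  \<gamma>*real (card A) powr (1 - 1/real d + 1/(real d)^2)*real N powr (- (1/real d)) <= real (card (edge_boundary d N I A)))"

theorem walk_isoperimetry:
 fixes d :: nat and u \<mu> :: real
 assumes d: "3 <= d" and u: "0 < u" and mu: "0 < \<mu>" "\<mu> < 1"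
 shows "\<exists>\<gamma>>0. \<forall>\<^sub>F N in sequentially. torus_walk d N \<and>
  torus_walk.avgT d N (nat \<lfloor>u*real N^d\<rfloor>) (%p. of_bool (~ isop d N \<mu> \<gamma> (set p)))
  <= exp (- (ln (real N))\<^sup>2)"
proof -
 \<comment> \<open>Half of u N^d serves the stages; the other half absorbs the floor and the summand
   3 in the time condition.\<close>
 define v where "v = u/(24*real (4*d + 3))"
 have v: "0 < v" unfolding v_def using u by simp
 have nv: "12*real (4*d + 3) * v = u/2" unfolding v_def by (simp add: field_simps)
 obtain s1 where "!!s. s1 <= s ==> good_sigma d v \<mu> s" using eventually_good_sigma[OF d v mu(2)] unfolding eventually_sequentially by blast
 then have s1: "!!s. max 1 s1 <= s ==> good_sigma d v \<mu> s" by simp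
 define s0 where "s0 = max 1 s1"
 define \<gamma> where "\<gamma> = min (1/2^pD d) ((1 - \<mu>)/real s0^(2*pD d + 2*d*pD d))"
 have "0 < real s0" unfolding s0_def by simp
 then have "0 < \<gamma>" unfolding \<gamma>_def using mu by simp
 moreover have "\<forall>\<^sub>F N in sequentially. torus_walk d N \<and>
  torus_walk.avgT d N (nat \<lfloor>u*real N^d\<rfloor>) (%p. of_bool (~ isop d N \<mu> \<gamma> (set p)))
  <= exp (- (ln (real N))\<^sup>2)"
  using eventually_good_N[OF v, of d] eventually_ge_at_top[of 3] eventually_ge_at_top[of "s0^pD d"] eventually_linear_ge[OF u, of 8]
 proof eventually_elim
  case (elim N)
  interpret torus_walk d N by unfold_locales (use d elim in auto)
  define n where "n = nat \<lfloor>u*real N^d\<rfloor>"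
  have "real N^1 <= real N^d" using d elim by (intro power_increasing) auto
  then have "u*real N <= u*real N^d" using u by (intro mult_left_mono) auto
  then have "8 <= u*real N^d" using elim by linarith
  then have n: "12*real (4*d + 3) * v * real N^d + 3 <= real n" unfolding nv n_def by linarith
  have "avgT n (%p. of_bool (~ isop d N \<mu> \<gamma> (set p)))
   <= avgT n (%p. of_bool (\<exists>s\<ge>s0. s^pD d <= N & tbad n s p))"
  proof (rule avgT_mono)
   have ob: "(P ==> Q) ==> of_bool P <= (of_bool Q :: real)" for P Q by (cases P) auto
   fix x p assume x: "x \<in> T" "p \<in> walks n x"
   have "\<exists>s\<ge>s0. s^pD d <= N & tbad n s p" if A: "A \<subseteq> set p" "real (card A) <= \<mu>*real (card (set p))"
    "~ \<gamma>*real (card A) powr (1 - 1/real d + 1/(real d)^2)*real N powr (- (1/real d)) <= real (card (edge_boundary d N (set p) A))" for A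
   proof (rule ccontr)
    assume "~ ?thesis"
    then have "!!s. s0 <= s ==> s^pD d <= N ==> ~ tbad n s p" by blast
    from tbad_imp[OF v mu s1[folded s0_def] elim(1,3) n x(2,1) this A(1,2)] A(3) show False unfolding \<gamma>_def by blast
   qed
   then show "(of_bool (~ isop d N \<mu> \<gamma> (set p)) :: real)
    <= of_bool (\<exists>s\<ge>s0. s^pD d <= N & tbad n s p)" unfolding isop_def by (intro ob) blast
  qed
  also have "... <= exp (- (ln (real N))\<^sup>2)" by (rule tbad_prob[OF v mu s1[folded s0_def] elim(1,3) n])
  finally show ?case using torus_walk_axioms unfolding n_def by blast
 qed
 ultimately show ?thesis by blast
qed

section \<open>From finite averages to the probability space of the walk\<close>

context torus_walk begin

definition wpath :: "pt => (nat => pt) => nat => pt" where "wpath x w k = torus_proj d N (%i. x i + (\<Sum>j<k. w j i))"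

lemma wpath_Suc: "st (wpath x w k) (w k) = wpath x w (Suc k)"
 unfolding st_def wpath_def torus_proj_def by (intro restrict_ext) (simp add: mod_simps add.assoc)

text \<open>Unfolds the nested averages into one sum over step sequences, the form in which cylinder
  sets of the product space appear.\<close>

lemma E_eq_sum: assumes "x \<in> T"
 shows "E n x f = (\<Sum>w\<in>PiE {..<n} (%_. unit_steps d). f (map (wpath x w) [0..<Suc n]))/(2*real d)^n"
proof (induction n arbitrary: f)
 case 0
 have "wpath x w 0 = x" for w unfolding wpath_def torus_proj_def
  by (rule PiE_ext[of _ "{..<d}" "%_. {0..<int N}"]) (use assms in \<open>auto simp: torus_def PiE_iff\<close>)
 then show ?case by simp
next
 case (Suc n)
 define U where "U = unit_steps d"
 have "E (Suc n) x f = (\<Sum>w\<in>PiE {..<n} (%_. U). (\<Sum>e\<in>U. f (map (wpath x w) [0..<Suc n] @ [st (wpath x w n) e]))/(2*real d))/(2*real d)^n"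
  unfolding E_snoc Suc avg_def U_def by simp
 also have "... = (\<Sum>w\<in>PiE {..<n} (%_. U). \<Sum>e\<in>U. f (map (wpath x w) [0..<Suc n] @ [st (wpath x w n) e]))/(2*real d)^Suc n"
  by (simp add: sum_divide_distrib[symmetric])
 also have "(\<Sum>w\<in>PiE {..<n} (%_. U). \<Sum>e\<in>U. f (map (wpath x w) [0..<Suc n] @ [st (wpath x w n) e]))
   = (\<Sum>w\<in>PiE {..<n} (%_. U). \<Sum>e\<in>U. f (map (wpath x (w(n := e))) [0..<Suc (Suc n)]))"
 proof (intro sum.cong refl arg_cong[of _ _ f])
  fix w e
  have e: "wpath x (w(n := e)) k = wpath x w k" if "k <= n" for k
  proof -
   have "(\<Sum>j<k. (w(n := e)) j i) = (\<Sum>j<k. w j i)" for i using that by (intro sum.cong) auto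
   then show ?thesis unfolding wpath_def by simp
  qed
  have "st (wpath x w n) e = wpath x (w(n := e)) (Suc n)" using wpath_Suc[of x "w(n := e)" n] e[of n] by simp
  moreover have "map (wpath x (w(n := e))) [0..<Suc n] = map (wpath x w) [0..<Suc n]" using e by (intro map_cong) auto
  ultimately show "map (wpath x w) [0..<Suc n] @ [st (wpath x w n) e] = map (wpath x (w(n := e))) [0..<Suc (Suc n)]" by simp
 qed
 also have "... = (\<Sum>w\<in>PiE {..<Suc n} (%_. U). f (map (wpath x w) [0..<Suc (Suc n)]))"
  using sum_PiE_split[of n "Suc n" "%_. U" "%w. f (map (wpath x w) [0..<Suc (Suc n)])"]
  by (simp add: U_def lessThan_Suc)
 finally show ?case unfolding U_def .
qed

lemma space_srw: "space (srw_space d N) = UNIV" by (simp add: srw_space_def space_pair_measure space_PiM)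

text \<open>The coordinates are embedded into the reals to use Borel measurability of sums; the
  floor brings them back to the integers.\<close>

lemma srw_measurable: "{\<omega>. srw d N \<omega> k = y} \<in> sets (srw_space d N)" if "y \<in> T"
proof -
 define M where "M = srw_space d N"
 define s where "s i \<omega> = real_of_int (fst \<omega> i) + (\<Sum>j<k. real_of_int (snd \<omega> j i))" for i and \<omega> :: "(nat => int) \<times> (nat => nat => int)"
 have f: "(%\<omega>. real_of_int (fst \<omega> i)) \<in> borel_measurable M" for i
  unfolding M_def srw_space_def by (rule measurable_compose[OF measurable_fst]) simp
 have g: "(%\<omega>. real_of_int (snd \<omega> j i)) \<in> borel_measurable M" for i j unfolding M_def srw_space_def
  by (rule measurable_compose[OF measurable_compose[OF measurable_snd measurable_component_singleton[of j]]]) simp_all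
 have m: "s i \<in> borel_measurable M" for i unfolding s_def using f g by measurable
 have "{\<omega> \<in> space M. \<lfloor>s i \<omega>\<rfloor> mod int N = y i} \<in> sets M" for i
  using measurable_compose[OF m measurable_real_floor, of i] by measurable
 then have "{\<omega> \<in> space M. \<forall>i\<in>{..<d}. \<lfloor>s i \<omega>\<rfloor> mod int N = y i} \<in> sets M" by (intro sets.sets_Collect_finite_All) auto
 moreover have "(\<forall>i\<in>{..<d}. \<lfloor>s i \<omega>\<rfloor> mod int N = y i) \<longleftrightarrow> srw d N \<omega> k = y" for \<omega>
 proof -
  have fl: "\<lfloor>s i \<omega>\<rfloor> = fst \<omega> i + (\<Sum>j<k. snd \<omega> j i)" for i
  proof -
   have "s i \<omega> = real_of_int (fst \<omega> i + (\<Sum>j<k. snd \<omega> j i))" by (simp add: s_def)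
   then show ?thesis by (simp only: floor_of_int)
  qed
  show ?thesis unfolding fl srw_def torus_proj_def
  proof
   assume a: "\<forall>i\<in>{..<d}. (fst \<omega> i + (\<Sum>j<k. snd \<omega> j i)) mod int N = y i"
   show "(\<lambda>i\<in>{..<d}. (fst \<omega> i + (\<Sum>k<k. snd \<omega> k i)) mod int N) = y"
    by (rule PiE_ext[of _ "{..<d}" "%_. {0..<int N}"]) (use a that Npos in \<open>auto simp: torus_def PiE_iff\<close>)
  qed auto
 qed
 ultimately show ?thesis unfolding M_def space_srw by simp
qed

lemma srw_T: "srw d N \<omega> k \<in> T" unfolding srw_def torus_proj_def torus_def using Npos by auto

lemma prob_srw: "prob_space (srw_space d N)" unfolding srw_space_def by (intro prob_space_pair prob_space_PiM prob_space_measure_pmf)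

text \<open>The range takes only finitely many values, and each value is attained on an
  event.\<close>

lemma event_measurable: "{\<omega>. Q (srw d N \<omega> ` {..n})} \<in> sets (srw_space d N)"
proof -
 define M where "M = srw_space d N"
 have sp: "space M = UNIV" unfolding M_def by (rule space_srw)
 have e: "{\<omega> \<in> space M. srw d N \<omega> k = y} \<in> sets M" if "y \<in> T" for k y
  using srw_measurable[OF that] by (simp add: M_def space_srw)
 have "{\<omega> \<in> space M. srw d N \<omega> ` {..n} = S} \<in> sets M" if S: "S \<subseteq> T" for S
 proof -
  have fS: "finite S" by (rule finite_subset[OF S finite_torus])
  have "{\<omega> \<in> space M. (\<forall>k\<in>{..n}. \<exists>y\<in>S. srw d N \<omega> k = y) & (\<forall>y\<in>S. \<exists>k\<in>{..n}. srw d N \<omega> k = y)} \<in> sets M"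
   using S fS by (intro sets.sets_Collect_conj sets.sets_Collect_finite_All sets.sets_Collect_finite_Ex e) auto
  moreover have "srw d N \<omega> ` {..n} = S \<longleftrightarrow> (\<forall>k\<in>{..n}. \<exists>y\<in>S. srw d N \<omega> k = y) & (\<forall>y\<in>S. \<exists>k\<in>{..n}. srw d N \<omega> k = y)" for \<omega>
   unfolding set_eq_subset image_subset_iff subset_eq[of S] image_iff by (simp add: eq_commute)
  ultimately show ?thesis by simp
 qed
 then have "(\<Union>S\<in>{S \<in> Pow T. Q S}. {\<omega> \<in> space M. srw d N \<omega> ` {..n} = S}) \<in> sets M"
  by (intro sets.finite_UN) (auto simp: finite_torus)
 moreover have "(\<Union>S\<in>{S \<in> Pow T. Q S}. {\<omega> \<in> space M. srw d N \<omega> ` {..n} = S}) = {\<omega>. Q (srw d N \<omega> ` {..n})}"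
  using srw_T by (auto simp: sp)
 ultimately show ?thesis by (simp add: M_def)
qed

lemma cylinder: assumes x: "x \<in> T" and w: "!!i. i < n ==> w i \<in> unit_steps d"
 shows "{x} \<times> {\<xi>. \<forall>i\<in>{..<n}. \<xi> i \<in> {w i}} \<in> sets (srw_space d N)"
  and "measure (srw_space d N) ({x} \<times> {\<xi>. \<forall>i\<in>{..<n}. \<xi> i \<in> {w i}}) = 1/(real N^d*(2*real d)^n)"
proof -
 define p1 where "p1 = measure_pmf (pmf_of_set T)"
 define p2 where "p2 = (%n::nat. measure_pmf (pmf_of_set (unit_steps d)))"
 interpret P2: product_prob_space p2 UNIV unfolding p2_def by unfold_locales
 have M: "srw_space d N = p1 \<Otimes>\<^sub>M PiM UNIV p2" by (simp add: srw_space_def p1_def p2_def)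
 have C: "{\<xi>. \<forall>i\<in>{..<n}. \<xi> i \<in> {w i}} = {\<xi> \<in> space (PiM UNIV p2). \<forall>i\<in>{..<n}. \<xi> i \<in> {w i}}" by (simp add: space_PiM p2_def)
 have Cs: "{\<xi>. \<forall>i\<in>{..<n}. \<xi> i \<in> {w i}} \<in> sets (PiM UNIV p2)" unfolding C
  by (intro sets.sets_Collect_finite_All sets_Collect_single) (auto simp: p2_def)
 have x1: "{x} \<in> sets p1" by (simp add: p1_def)
 show "{x} \<times> {\<xi>. \<forall>i\<in>{..<n}. \<xi> i \<in> {w i}} \<in> sets (srw_space d N)" unfolding M using x1 Cs by simp
 have "0 < card (unit_steps d)" using dpos by simp
 then have une: "unit_steps d ~= {}" unfolding card_gt_0_iff by blast
 have Tne: "T ~= {}" using x by blast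
 have "{\<xi>. \<forall>i\<in>{..<n}. \<xi> i \<in> {w i}} = prod_emb UNIV p2 {..<n} (PiE {..<n} (%i. {w i}))"
  unfolding C prod_emb_def by (auto simp: space_PiM Pi_iff)
 then have "measure (PiM UNIV p2) {\<xi>. \<forall>i\<in>{..<n}. \<xi> i \<in> {w i}} = (\<Prod>i<n. measure (p2 i) {w i})" by (simp only:) (rule P2.measure_PiM_emb, auto simp: p2_def)
 also have "... = (\<Prod>i<n. 1/(2*real d))"
 proof (intro prod.cong refl)
  fix i assume "i \<in> {..<n}"
  then show "measure (p2 i) {w i} = 1/(2*real d)"
   unfolding p2_def measure_pmf_single using w[of i] by (subst pmf_of_set[OF une finite_unit_steps]) simp
 qed
 finally have m2: "measure (PiM UNIV p2) {\<xi>. \<forall>i\<in>{..<n}. \<xi> i \<in> {w i}} = 1/(2*real d)^n" by (simp add: power_one_over)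
 have m1: "measure p1 {x} = 1/real N^d" unfolding p1_def measure_pmf_single using x by (subst pmf_of_set[OF Tne finite_torus]) (simp add: card_torus)
 have sf: "sigma_finite_measure (PiM UNIV p2)" by unfold_locales
 show "measure (srw_space d N) ({x} \<times> {\<xi>. \<forall>i\<in>{..<n}. \<xi> i \<in> {w i}}) = 1/(real N^d*(2*real d)^n)"
  unfolding M measure_def sigma_finite_measure.emeasure_pair_measure_Times[OF sf x1 Cs] enn2real_mult
  unfolding measure_def[symmetric] m1 m2 by simp
qed

text \<open>The cylinders over the pairs of start and steps in \<open>Z\<close> are disjoint,
  equally likely and contained in the event.\<close>

lemma srw_prob_ge: "avgT n (%p. of_bool (Q (set p))) <= measure (srw_space d N) {\<omega>. Q (srw d N \<omega> ` {..n})}"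
proof -
 interpret prob_space "srw_space d N" by (rule prob_srw)
 define W where "W = PiE {..<n} (%_. unit_steps d)"
 define Z where "Z = {(x, w). (x, w) \<in> T \<times> W & Q (set (map (wpath x w) [0..<Suc n]))}"
 define cyl where "cyl = (%(x, w). {x :: pt} \<times> {\<xi>. \<forall>i\<in>{..<n}. \<xi> i \<in> {w i :: pt}})"
 have fW: "finite W" unfolding W_def by (intro finite_PiE) auto
 have fZ: "finite Z" 
 proof (rule finite_subset)
  show "Z \<subseteq> T \<times> W" unfolding Z_def by blast
  show "finite (T \<times> W)" by (intro finite_cartesian_product finite_torus fW)
 qed
 have cs: "cyl z \<in> events & prob (cyl z) = 1/(real N^d*(2*real d)^n)" if "z \<in> Z" for z
 proof -
  define x w where "x = fst z" and "w = snd z"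
  have z: "z = (x, w)" by (simp add: x_def w_def)
  have "x \<in> T" "w \<in> W" using that unfolding z Z_def by auto
  moreover have "w i \<in> unit_steps d" if "i < n" for i using \<open>w \<in> W\<close> that unfolding W_def by auto
  ultimately show ?thesis unfolding z cyl_def prod.case using cylinder[of x n w] by blast
 qed
 have dj: "disjoint_family_on cyl Z"
 proof (unfold disjoint_family_on_def, intro ballI impI)
  fix a b assume ab: "a \<in> Z" "b \<in> Z" "a ~= b"
  define x w y w' where "x = fst a" "w = snd a" "y = fst b" "w' = snd b"
  then have e: "a = (x, w)" "b = (y, w')" by simp_all
  have W: "w \<in> W" "w' \<in> W" using ab e by (auto simp: Z_def)
  have "w = w'" if "\<forall>i<n. w i = w' i" by (rule PiE_ext[OF W[unfolded W_def]]) (use that in auto)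
  then have "x ~= y | (\<exists>i<n. w i ~= w' i)" using ab e by blast
  then show "cyl a \<inter> cyl b = {}" unfolding e cyl_def by fastforce
 qed
 have "avgT n (%p. of_bool (Q (set p))) = (\<Sum>x\<in>T. \<Sum>w\<in>W. of_bool (Q (set (map (wpath x w) [0..<Suc n]))))/(2*real d)^n/real N^d"
  unfolding avgT_def W_def sum_divide_distrib[symmetric] by (simp add: E_eq_sum sum_divide_distrib)
 also have "(\<Sum>x\<in>T. \<Sum>w\<in>W. of_bool (Q (set (map (wpath x w) [0..<Suc n])))) = real (card Z)"
 proof -
  have "(\<Sum>x\<in>T. \<Sum>w\<in>W. of_bool (Q (set (map (wpath x w) [0..<Suc n])))) = (\<Sum>z\<in>T \<times> W. of_bool (z \<in> Z) :: real)"
   unfolding sum.cartesian_product by (intro sum.cong refl) (auto simp: Z_def)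
  also have "... = real (card Z)"
  proof -
   have "(T \<times> W) \<inter> Z = Z" by (auto simp: Z_def)
   then show ?thesis using fW finite_torus[of d N] by (simp add: of_bool_def sum.If_cases)
  qed
  finally show ?thesis .
 qed
 also have "real (card Z)/(2*real d)^n/real N^d = (\<Sum>z\<in>Z. prob (cyl z))" using cs by (simp add: mult.commute)
 also have "... = prob (\<Union>z\<in>Z. cyl z)" using cs by (intro finite_measure_finite_Union[symmetric] fZ dj) auto
 also have "... <= prob {\<omega>. Q (srw d N \<omega> ` {..n})}"
 proof (rule finite_measure_mono[OF _ event_measurable])
  show "(\<Union>z\<in>Z. cyl z) \<subseteq> {\<omega>. Q (srw d N \<omega> ` {..n})}"
  proof
   fix \<omega> assume "\<omega> \<in> (\<Union>z\<in>Z. cyl z)"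
   then obtain x w where z: "(x, w) \<in> Z" "\<omega> \<in> cyl (x, w)" by auto
   have "srw d N \<omega> k = wpath x w k" if "k <= n" for k
   proof -
    have "fst \<omega> = x" "!!j. j < k ==> snd \<omega> j = w j" using z(2) that by (auto simp: cyl_def)
    then show ?thesis unfolding srw_def wpath_def by simp
   qed
   then have "srw d N \<omega> ` {..n} = wpath x w ` {..n}" by (intro image_cong) auto
   also have "... = set (map (wpath x w) [0..<Suc n])" by (simp add: atLeast0_atMost_Suc atLeast0LessThan lessThan_Suc_atMost del: upt_Suc)
   finally show "\<omega> \<in> {\<omega>. Q (srw d N \<omega> ` {..n})}" using z(1) by (simp add: Z_def)
  qed
 qed
 finally show ?thesis .
qed

lemma avgT_compl: "avgT n (%p. of_bool (P p)) = 1 - avgT n (%p. of_bool (~ P p))"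
proof -
 have "avgT n (%p. \<Sum>b\<in>{True, False}. of_bool (P p = b)) = avgT n (%p. 1)" by (intro arg_cong[of _ _ "avgT n"] ext) auto
 moreover have "avgT n (%p. 1) = 1"
 proof -
  show ?thesis unfolding avgT_def using Npos by (simp add: card_torus)
 qed
 ultimately show ?thesis unfolding avgT_sum by simp
qed

end

theorem theorem1p2:
  fixes d :: nat and u \<mu> :: real
  assumes "d \<ge> 3" and "u > 0" and "0 < \<mu>" and "\<mu> < 1"
  shows "\<exists>\<gamma> C :: real. \<gamma> > 0 \<and>
    (\<forall>N :: nat. N \<ge> 1 \<longrightarrow>
      measure (srw_space d N)
        {\<omega> \<in> space (srw_space d N).
          \<forall>A. A \<subseteq> srw_range d N u \<omega> \<longrightarrow>
              real (card A) \<le> \<mu> * real (card (srw_range d N u \<omega>)) \<longrightarrow>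
              real (card (edge_boundary d N (srw_range d N u \<omega>) A))
                \<ge> \<gamma> * real (card A) powr (1 - 1 / real d + 1 / (real d)\<^sup>2)
                    * real N powr (- (1 / real d))}
      \<ge> 1 - C * exp (- (ln (real N))\<^sup>2))"
proof -
 obtain \<gamma> N0 where \<gamma>: "0 < \<gamma>" and N0: "!!N. N0 <= N ==> torus_walk d N \<and>
  torus_walk.avgT d N (nat \<lfloor>u*real N^d\<rfloor>) (%p. of_bool (~ isop d N \<mu> \<gamma> (set p))) <= exp (- (ln (real N))\<^sup>2)"
  using walk_isoperimetry[OF assms] unfolding eventually_sequentially by blast
 \<comment> \<open>The sum makes the right-hand side nonpositive for the finitely many
   \<open>N\<close> below \<open>N0\<close>.\<close>
 define C where "C = 1 + (\<Sum>N<N0. exp ((ln (real N))^2))"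
 have C1: "1 <= C" unfolding C_def by (simp add: sum_nonneg)
 have "1 - C*exp (- (ln (real N))\<^sup>2) <= measure (srw_space d N) {\<omega> \<in> space (srw_space d N). isop d N \<mu> \<gamma> (srw_range d N u \<omega>)}" for N
 proof (cases "N0 <= N")
  case True
  interpret torus_walk d N using N0[OF True] by blast
  define n where "n = nat \<lfloor>u*real N^d\<rfloor>"
  have "1 - C*exp (- (ln (real N))\<^sup>2) <= 1 - 1*exp (- (ln (real N))\<^sup>2)" using C1 by (intro diff_left_mono mult_right_mono) auto
  also have "... <= 1 - avgT n (%p. of_bool (~ isop d N \<mu> \<gamma> (set p)))" using N0[OF True] unfolding n_def by simp
  also have "... = avgT n (%p. of_bool (isop d N \<mu> \<gamma> (set p)))" by (rule avgT_compl[symmetric])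
  also have "... <= measure (srw_space d N) {\<omega>. isop d N \<mu> \<gamma> (srw d N \<omega> ` {..n})}" by (rule srw_prob_ge)
  finally show ?thesis unfolding n_def srw_range_def space_srw by simp
 next
  case False
  then have "exp ((ln (real N))^2) <= (\<Sum>N<N0. exp ((ln (real N))^2))" by (intro member_le_sum) auto
  then have "exp ((ln (real N))^2)*exp (- (ln (real N))\<^sup>2) <= C*exp (- (ln (real N))\<^sup>2)" unfolding C_def by (intro mult_right_mono) auto
  then have "1 <= C*exp (- (ln (real N))\<^sup>2)" by (simp add: exp_add[symmetric])
  then have "1 - C*exp (- (ln (real N))\<^sup>2) <= 0" by simp
  then show ?thesis using measure_nonneg order_trans by blast
 qed
 then show ?thesis using \<gamma> unfolding isop_def by blast
qed

end
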